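(* For every integer $k \geq 2$ and every real $\alpha > 0$ there exists $\eta = \eta(\alpha,k) > 0$ such that the following holds for all sufficiently large $n$ (depending on $k$ and $\alpha$), all $p \in (0,1]$, and all $\beta \leq \eta n p/\log^3 n$. Let $G$ be a $(p,\beta)$-sparse graph with $n$ vertices and minimum degree at least $(1/k+\alpha)np$. Then the vertex set of $G$ can be covered by $k-1$ cycles.
   Context: Graphs are finite and simple; $\log$ is the natural logarithm. For (not necessarily disjoint) $X, Y \subseteq V(G)$, $e_G(X,Y)$ denotes the number of ordered pairs $(x,y) \in X\times Y$ such that $xy$ is an edge of $G$ (so $e_G(X,X)$ is twice the number of edges inside $X$). A graph $G$ is $(p,\beta)$-sparse if for all subsets $X,Y \subseteq V(G)$ we have $e_G(X,Y) \leq p|X||Y| + \beta\sqrt{|X||Y|}$. The vertex set of $G$ is covered by $k-1$ cycles if there are cycles $C_1,\dots,C_{k-1}$ (of length at least 3, subgraphs of $G$, not required to be disjoint or distinct) such that every vertex of $G$ lies on at least one $C_i$. *)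

theory Defs
  imports Complex_Main "Graph_Theory.Graph_Theory"
begin

text \<open>
  A finite simple graph is a \<^const>\<open>pair_graph\<close>: a finite, loopfree digraph whose set of
  arcs, a relation on the vertices, is symmetric. An edge \<open>xy\<close> is thus represented by the two arcs
  \<open>(x, y)\<close> and \<open>(y, x)\<close>, and the degree of a vertex is its out-degree.
\<close>

definition edge_pairs :: "'a pair_pre_digraph \<Rightarrow> 'a set \<Rightarrow> 'a set \<Rightarrow> nat" where
  "edge_pairs G X Y = card {(x, y). x \<in> X \<and> y \<in> Y \<and> (x, y) \<in> parcs G}"

definition sparse_graph :: "real \<Rightarrow> real \<Rightarrow> 'a pair_pre_digraph \<Rightarrow> bool" where
  "sparse_graph p \<beta> G \<longleftrightarrow>
    (\<forall>X Y. X \<subseteq> pverts G \<and> Y \<subseteq> pverts G \<longrightarrow>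
      real (edge_pairs G X Y)
        \<le> p * real (card X) * real (card Y) + \<beta> * sqrt (real (card X) * real (card Y)))"

text \<open>Only meaningful for finite graphs with at least one vertex.\<close>

definition min_degree :: "'a pair_pre_digraph \<Rightarrow> nat" where
  "min_degree G = Min ((\<lambda>v. out_degree (with_proj G) v) ` pverts G)"

text \<open>
  The length bound is needed because \<^const>\<open>pre_digraph.cycle\<close> also admits the closed walk
  \<open>x, y, x\<close> along a single edge. A cycle is given by its list of arcs, so its vertices are the
  tails of these arcs.
\<close>

definition graph_cycle :: "'a pair_pre_digraph \<Rightarrow> ('a \<times> 'a) awalk \<Rightarrow> bool" where
  "graph_cycle G c \<longleftrightarrow> pre_digraph.cycle (with_proj G) c \<and> 3 \<le> length c"

definition cycle_verts :: "('a \<times> 'a) awalk \<Rightarrow> 'a set" where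
  "cycle_verts c = fst ` set c"

definition covered_by_cycles :: "'a pair_pre_digraph \<Rightarrow> nat \<Rightarrow> bool" where
  "covered_by_cycles G m \<longleftrightarrow>
    (\<exists>C. (\<forall>i\<in>{1..m}. graph_cycle G (C i)) \<and>
         (\<forall>v\<in>pverts G. \<exists>i\<in>{1..m}. v \<in> cycle_verts (C i)))"

end

theory Submission
 imports Defs "HOL-Probability.Probability" "HOL-Real_Asymp.Real_Asymp" "HOL-Combinatorics.Combinatorics"
begin

text \<open>
 Cutting the graph repeatedly along sparse cuts yields fewer than \<open>k\<close> parts without sparse cuts in which almost all
 vertices keep degree at least \<open>(1/k + \<alpha>/2) n p\<close>. If \<open>j \<ge> 1\<close> is least with \<open>card P \<le> (j + 1) (1/k + \<alpha>/8) n\<close>, then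
 the part \<open>P\<close> can be covered by \<open>j\<close> cycles, and these numbers add up to at most \<open>k - 1\<close> because
 \<open>card P > j n / k\<close>. In each part a small random reserve connects any \<open>O(n / log n)\<close> prescribed pairs of vertices by
 disjoint short paths.

 For \<open>j = 1\<close> almost all degrees exceed half of the density, so random blocks are joined by perfect matchings; this
 gives few paths that cover everything outside the reserve. Switching gadgets placed in the reserves allow the final
 matching to induce any permutation, which they turn into one Hamilton cycle.

 For \<open>j \<ge> 2\<close> there is a weighting of the edges whose degrees lie between \<open>b / j\<close> and \<open>b\<close>. Sampling each vertex for
 each cycle with probability proportional to its weighted degree, and grouping into \<open>O(log n)\<close> random classes,
 makes all pairs of classes almost regular. Almost perfect matchings between consecutive classes form few paths, which
 the reserve closes to a cycle. Two disjoint reserves are used, so that the vertices of each one are covered by the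
 cycles that use the other.
\<close>


section \<open>Sparse relations and expansion\<close>

text \<open>Sparseness bounds edge counts only from above, so every lower bound comes from degrees
  or from the absence of sparse cuts. The powers of \<open>L = ln n\<close> form a budget. Sets of
  density about \<open>1 / L^2\<close> must still see degrees well above \<beta>, which
  \<open>\<beta> <= n p / L^3\<close> grants with a factor \<open>L\<close> to spare; this spare
  factor absorbs all constants, so \<eta> = 1 works. The density \<open>1 / L^2\<close> arises
  twice: a reserve contains order \<open>L\<close> layers for each of order \<open>L\<close> rounds,
  and in the Hamiltonian case each of \<open>r\<close> gadgets asks for order \<open>L\<close>
  connections while a reserve supplies order \<open>n / L\<close> of them, whence \<open>r\<close>
  and the block sizes have order \<open>n / L^2\<close>. Concentration in such sets costs a factor
  \<open>L^4\<close>; since sparseness itself implies that \<open>n p\<close> has order at least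
  \<open>L^6\<close>, an exponent of order \<open>L^2\<close> remains, which beats a union bound
  over polynomially many events. The sets that link large neighbourhoods have constant density
  instead, because they must serve exponentially many sets at once.\<close>

abbreviation deg :: "('a \<times> 'a) set => 'a => real" where
 "deg E v \<equiv> real (card (E `` {v}))"

abbreviation deg_in :: "('a \<times> 'a) set => 'a => 'a set => real" where
 "deg_in E v S \<equiv> real (card (E `` {v} \<inter> S))"

abbreviation rcard :: "'a set => real" where
 "rcard S \<equiv> real (card S)"

definition ecount :: "('a \<times> 'a) set => 'a set => 'a set => real" where
 "ecount E X Y = (\<Sum>x\<in>X. deg_in E x Y)"

definition sparse_rel :: "real => real => 'a set => ('a \<times> 'a) set => bool" where
 "sparse_rel p \<beta> V E \<longleftrightarrow> (\<forall>X\<subseteq>V. \<forall>Y\<subseteq>V.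
   ecount E X Y <= p * card X * card Y + \<beta> * sqrt (rcard X * rcard Y))"

lemma sparse_relD:
 "sparse_rel p \<beta> V E ==> X \<subseteq> V ==> Y \<subseteq> V ==>
   ecount E X Y <= p * card X * card Y + \<beta> * sqrt (rcard X * rcard Y)"
 by (auto simp: sparse_rel_def)

lemma ecount_ge:
 assumes "!!x. x \<in> X ==> d <= deg_in E x Y"
 shows "d * card X <= ecount E X Y"
 using sum_bounded_below[of X d "\<lambda>x. deg_in E x Y"] assms
 by (simp add: ecount_def mult.commute)

lemma ecount_sigma:
 assumes "finite X" "finite Y"
 shows "ecount E X Y = card {(x, y). x \<in> X \<and> y \<in> Y \<and> (x, y) \<in> E}"
proof -
 have "{(x, y). x \<in> X \<and> y \<in> Y \<and> (x, y) \<in> E} = Sigma X (\<lambda>x. E `` {x} \<inter> Y)" by auto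
 moreover have "card (Sigma X (\<lambda>x. E `` {x} \<inter> Y)) = (\<Sum>x\<in>X. card (E `` {x} \<inter> Y))"
  using assms by (intro card_SigmaI) auto
 ultimately show ?thesis by (simp add: ecount_def)
qed

lemma ecount_sym:
 assumes "finite X" "finite Y" "sym E"
 shows "ecount E X Y = ecount E Y X"
proof -
 have "bij_betw prod.swap {(x, y). x \<in> X \<and> y \<in> Y \<and> (x, y) \<in> E} {(x, y). x \<in> Y \<and> y \<in> X \<and> (x, y) \<in> E}"
  by (rule bij_betwI[of _ _ _ prod.swap]) (auto dest: symD[OF assms(3)])
 then show ?thesis using ecount_sigma[OF assms(1,2), of E] ecount_sigma[OF assms(2,1), of E]
  by (simp add: bij_betw_same_card)
qed

lemma ecount_union_right:
 assumes "finite Y" "finite Z" "Y \<inter> Z = {}"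
 shows "ecount E X (Y \<union> Z) = ecount E X Y + ecount E X Z"
proof -
 have "card (E `` {x} \<inter> (Y \<union> Z)) = card (E `` {x} \<inter> Y) + card (E `` {x} \<inter> Z)" for x
  using assms by (subst card_Un_disjoint[symmetric]) (auto intro!: arg_cong[where f=card])
 then show ?thesis by (simp add: ecount_def sum.distrib)
qed

lemma ecount_union_left:
 assumes "finite X" "finite Y" "X \<inter> Y = {}"
 shows "ecount E (X \<union> Y) Z = ecount E X Z + ecount E Y Z"
 unfolding ecount_def using assms by (intro sum.union_disjoint) auto

lemma ecount_nonneg: "0 <= ecount E X Y"
 by (simp add: ecount_def sum_nonneg)

text \<open>If the term \<open>p * card X * card Y\<close> accounts for less than
  \<open>d - t\<close> per vertex of \<open>X\<close>, the square-root term has to supply the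
  remaining \<open>t\<close>, and squaring turns this into growth by the factor
  \<open>(t / \<beta>)^2\<close>. So either \<open>Y\<close> is as large as in a random-like graph
  or \<open>X\<close> expands. All expansion below is an instance, with \<open>t\<close> a fixed
  fraction of \<open>d\<close>.\<close>

lemma sparse_expand:
 assumes sp: "sparse_rel p \<beta> V E" and XV: "X \<subseteq> V" and YV: "Y \<subseteq> V" and fin: "finite V"
  and pos: "0 < p" "0 < \<beta>" "0 <= t"
  and deg: "!!x. x \<in> X ==> d <= deg_in E x Y"
 shows "(d - t) / p <= card Y \<or> (t / \<beta>)\<^sup>2 * card X <= card Y"
proof (rule disjCI, rule ccontr)
 assume 1: "\<not> (t / \<beta>)\<^sup>2 * card X <= card Y" and 2: "\<not> (d - t) / p <= card Y"
 let ?x = "rcard X" and ?y = "rcard Y"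
 from 2 have "?y < (d - t) / p" by linarith
 then have py: "p * ?y < d - t" using pos by (simp add: field_simps)
 have x0: "?x > 0" using 1 by (cases "card X = 0") auto
 have "d * ?x <= p * ?x * ?y + \<beta> * sqrt (?x * ?y)"
  using ecount_ge[of X d E Y, OF deg] sparse_relD[OF sp XV YV] by linarith
 then have "(d - p * ?y) * ?x <= \<beta> * sqrt (?x * ?y)" by (simp add: algebra_simps)
 moreover have "t * ?x <= (d - p * ?y) * ?x" using py x0 by simp
 ultimately have "t * ?x <= \<beta> * sqrt (?x * ?y)" by linarith
 then have "(t * ?x)\<^sup>2 <= (\<beta> * sqrt (?x * ?y))\<^sup>2"
  using pos x0 by (intro power_mono) auto
 then have "?x * (t\<^sup>2 * ?x) <= ?x * (\<beta>\<^sup>2 * ?y)"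
  by (simp add: power_mult_distrib power2_eq_square algebra_simps)
 then have "t\<^sup>2 * ?x <= \<beta>\<^sup>2 * ?y" using x0 by simp
 then have "(t / \<beta>)\<^sup>2 * ?x <= ?y" using pos by (simp add: field_simps power_divide)
 with 1 show False by simp
qed

section \<open>Random colourings\<close>

text \<open>Hoeffding's inequality and a union bound over \<open>K\<close>. The range
  \<open>b k v\<close> may be 0 for vertices that do not matter for \<open>k\<close>, so the
  variance bound \<open>s k\<close> scales with the set concerned instead of with
  \<open>V\<close>.\<close>

lemma sampling:
 fixes P :: "'v => 'c pmf" and f :: "'k => 'v => 'c => real"
 assumes fin: "finite V" "finite K"
  and bnd: "!!k v c. k \<in> K ==> v \<in> V ==> c \<in> set_pmf (P v) ==> 0 <= f k v c \<and> f k v c <= b k v"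
  and tau: "!!k. k \<in> K ==> 0 < \<tau> k" and s: "!!k. k \<in> K ==> 0 < s k \<and> (\<Sum>v\<in>V. (b k v)\<^sup>2) <= s k"
  and small: "(\<Sum>k\<in>K. 2 * exp (- 2 * (\<tau> k)\<^sup>2 / s k)) < 1"
 shows "\<exists>\<phi>. (\<forall>v\<in>V. \<phi> v \<in> set_pmf (P v)) \<and>
  (\<forall>k\<in>K. \<bar>(\<Sum>v\<in>V. f k v (\<phi> v)) - (\<Sum>v\<in>V. measure_pmf.expectation (P v) (f k v))\<bar> < \<tau> k)"
proof -
 define M where "M = Pi_pmf V undefined P"
 define Bad where "Bad k = {\<omega>. \<tau> k <= \<bar>(\<Sum>v\<in>V. f k v (\<omega> v)) - (\<Sum>v\<in>V. measure_pmf.expectation (P v) (f k v))\<bar>}" for k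
 have comp: "map_pmf (\<lambda>\<omega>. \<omega> v) M = P v" if "v \<in> V" for v
  unfolding M_def using fin that by (simp add: Pi_pmf_component)
 have exp: "measure_pmf.expectation M (\<lambda>\<omega>. g (\<omega> v)) = measure_pmf.expectation (P v) g" if "v \<in> V" for v and g :: "'c => real"
  unfolding comp[OF that, symmetric] by simp
 have inset: "\<omega> v \<in> set_pmf (P v)" if "\<omega> \<in> set_pmf M" "v \<in> V" for \<omega> v
  using comp[OF that(2), symmetric] that by auto
 have prob: "measure_pmf.prob M (Bad k) <= 2 * exp (- 2 * (\<tau> k)\<^sup>2 / s k)" if k: "k \<in> K" for k
 \<comment> \<open>Hoeffding's bound is applied with a positive sum of squared ranges. If the sum is
   0, all relevant values are 0 and the bad event is null.\<close>
 proof (cases "(\<Sum>v\<in>V. (b k v)\<^sup>2) > 0")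
  case True
  interpret H: Hoeffding_ineq "measure_pmf M" V "\<lambda>v \<omega>. f k v (\<omega> v)" "\<lambda>_. 0" "b k"
   "\<Sum>v\<in>V. measure_pmf.expectation M (\<lambda>\<omega>. f k v (\<omega> v))"
  proof (unfold_locales)
   show "finite V" by fact
   have "prob_space.indep_vars (measure_pmf M) (\<lambda>_. count_space UNIV) (\<lambda>x f. f x) V"
    unfolding M_def by (rule indep_vars_Pi_pmf) fact
   then show "prob_space.indep_vars (measure_pmf M) (\<lambda>_. borel) (\<lambda>v \<omega>. f k v (\<omega> v)) V"
    by (rule prob_space.indep_vars_compose2[OF measure_pmf.prob_space_axioms]) simp
   show "AE \<omega> in measure_pmf M. f k v (\<omega> v) \<in> {0..b k v}" if "v \<in> V" for v
    using bnd[OF k that] inset that by (auto simp: AE_measure_pmf_iff)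
  qed simp
  have "measure_pmf.prob M (Bad k) <= 2 * exp (- 2 * (\<tau> k)\<^sup>2 / (\<Sum>v\<in>V. (b k v)\<^sup>2))"
   using H.Hoeffding_ineq_abs_ge[of "\<tau> k"] True tau[OF k] by (simp add: Bad_def exp)
  also have "... <= 2 * exp (- 2 * (\<tau> k)\<^sup>2 / s k)"
   using True s[OF k] by (auto intro!: divide_left_mono mult_pos_pos)
  finally show ?thesis .
 next
  case False
  then have "(\<Sum>v\<in>V. (b k v)\<^sup>2) = 0" using sum_nonneg[of V "\<lambda>v. (b k v)\<^sup>2"] by force
  then have b0: "b k v = 0" if "v \<in> V" for v using that fin by (simp add: sum_nonneg_eq_0_iff)
  then have f0: "f k v c = 0" if "v \<in> V" "c \<in> set_pmf (P v)" for v c using bnd[OF k that] that by force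
  have e0: "measure_pmf.expectation (P v) (f k v) = 0" if "v \<in> V" for v
   using f0[OF that] by (intro integral_eq_zero_AE) (auto simp: AE_measure_pmf_iff)
  have "\<omega> \<notin> Bad k" if "\<omega> \<in> set_pmf M" for \<omega>
  proof -
   have "(\<Sum>v\<in>V. f k v (\<omega> v)) = 0" "(\<Sum>v\<in>V. measure_pmf.expectation (P v) (f k v)) = 0"
    using f0 e0 inset[OF that] by (auto intro!: sum.neutral)
   then show ?thesis using tau[OF k] by (simp add: Bad_def)
  qed
  then have "AE \<omega> in M. \<omega> \<notin> Bad k" by (simp add: AE_measure_pmf_iff)
  then have "measure_pmf.prob M (Bad k) = 0"
   by (subst measure_pmf.prob_eq_0) auto
  then show ?thesis by simp
 qed
 have "measure_pmf.prob M (\<Union>k\<in>K. Bad k) <= (\<Sum>k\<in>K. measure_pmf.prob M (Bad k))"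
  using fin by (intro measure_pmf.finite_measure_subadditive_finite) auto
 also have "... <= (\<Sum>k\<in>K. 2 * exp (- 2 * (\<tau> k)\<^sup>2 / s k))" by (intro sum_mono prob)
 finally have lt: "measure_pmf.prob M (\<Union>k\<in>K. Bad k) < 1" using small by simp
 have "\<exists>\<omega>\<in>set_pmf M. \<omega> \<notin> (\<Union>k\<in>K. Bad k)"
 proof (rule ccontr)
  assume "\<not> ?thesis"
  then have "measure_pmf.prob M (\<Union>k\<in>K. Bad k) = 1"
   by (subst measure_pmf.prob_eq_1) (auto simp: AE_measure_pmf_iff)
  with lt show False by simp
 qed
 then obtain \<omega> where "\<omega> \<in> set_pmf M" "\<omega> \<notin> (\<Union>k\<in>K. Bad k)" by blast
 then have w: "\<omega> \<in> set_pmf M" "!!k. k \<in> K ==> \<omega> \<notin> Bad k" by blast+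
 show ?thesis
 proof (intro exI conjI ballI)
  show "\<omega> v \<in> set_pmf (P v)" if "v \<in> V" for v using inset w(1) that by blast
  show "\<bar>(\<Sum>v\<in>V. f k v (\<omega> v)) - (\<Sum>v\<in>V. measure_pmf.expectation (P v) (f k v))\<bar> < \<tau> k" if "k \<in> K" for k
   using w(2)[OF that] unfolding Bad_def mem_Collect_eq not_le .
 qed
qed

text \<open>Vertices outside \<open>S k\<close> have range 0. With \<tau> k a fraction of
  \<open>card (S k)\<close>, the failure probability is therefore exponentially small in
  \<open>card (S k)\<close>, which is what neighbourhoods of size about \<open>n p\<close>
  require.\<close>

lemma sampling_card:
 fixes P :: "'v => 'c pmf" and s \<tau> :: "'k => real"
 assumes fin: "finite V" "finite K"
  and S: "!!k. k \<in> K ==> S k \<subseteq> V"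
  and tau: "!!k. k \<in> K ==> 0 < \<tau> k" and s: "!!k. k \<in> K ==> 0 < s k \<and> card (S k) <= s k"
  and small: "(\<Sum>k\<in>K. 2 * exp (- 2 * (\<tau> k)\<^sup>2 / s k)) < 1"
 shows "\<exists>\<phi>. (\<forall>v\<in>V. \<phi> v \<in> set_pmf (P v)) \<and>
  (\<forall>k\<in>K. \<bar>card {v \<in> S k. \<phi> v \<in> C k} - (\<Sum>v\<in>S k. measure_pmf.prob (P v) (C k))\<bar> < \<tau> k)"
proof -
 define f :: "'k => 'v => 'c => real" where "f k v c = of_bool (v \<in> S k) * indicator (C k) c" for k v c
 have main: "\<exists>\<phi>. (\<forall>v\<in>V. \<phi> v \<in> set_pmf (P v)) \<and>
  (\<forall>k\<in>K. \<bar>(\<Sum>v\<in>V. f k v (\<phi> v)) - (\<Sum>v\<in>V. measure_pmf.expectation (P v) (f k v))\<bar> < \<tau> k)"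
 proof (rule sampling[where f = f and b = "\<lambda>k v. of_bool (v \<in> S k)" and s = s])
  fix k assume k: "k \<in> K"
  have "(\<Sum>v\<in>V. (of_bool (v \<in> S k) :: real)\<^sup>2) = (\<Sum>v\<in>V. of_bool (v \<in> S k))"
   by (intro sum.cong) auto
  also have "... = card (S k)" using S[OF k] fin
   by (simp add: Int_absorb1 sum.If_cases of_bool_def)
  finally show "0 < s k \<and> (\<Sum>v\<in>V. (of_bool (v \<in> S k) :: real)\<^sup>2) <= s k" using s[OF k] by simp
 next
  fix k v c assume "k \<in> K" "v \<in> V" "c \<in> set_pmf (P v)"
  then show "0 <= f k v c \<and> f k v c <= of_bool (v \<in> S k)" by (simp add: f_def indicator_def)
 next
  show "finite V" "finite K" by (rule fin)+
  show "0 < \<tau> k" if "k \<in> K" for k using tau that .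
  show "(\<Sum>k\<in>K. 2 * exp (- 2 * (\<tau> k)\<^sup>2 / s k)) < 1" by (rule small)
 qed
 have e1: "(\<Sum>v\<in>V. f k v (\<phi> v)) = card {v \<in> S k. \<phi> v \<in> C k}" if "k \<in> K" for k \<phi>
 proof -
  have fS: "finite (S k)" using S[OF that] fin finite_subset by auto
  have "(\<Sum>v\<in>V. f k v (\<phi> v)) = (\<Sum>v\<in>S k. indicator (C k) (\<phi> v))"
   unfolding f_def using S[OF that] fin by (intro sum.mono_neutral_cong_right) auto
  also have "... = card {v \<in> S k. \<phi> v \<in> C k}"
   using fS by (simp add: indicator_def sum.If_cases Int_def)
  finally show ?thesis .
 qed
 have e2: "(\<Sum>v\<in>V. measure_pmf.expectation (P v) (f k v)) = (\<Sum>v\<in>S k. measure_pmf.prob (P v) (C k))" if "k \<in> K" for k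
 proof -
  have "measure_pmf.expectation (P v) (f k v) = (if v \<in> S k then measure_pmf.prob (P v) (C k) else 0)" for v
  proof -
   have "f k v = (if v \<in> S k then indicator (C k) else (\<lambda>_. 0))" by (auto simp: f_def fun_eq_iff)
   then show ?thesis by simp
  qed
  then show ?thesis using S[OF that] fin by (simp add: sum.If_cases Int_absorb1)
 qed
 from main obtain \<phi> where \<phi>: "\<forall>v\<in>V. \<phi> v \<in> set_pmf (P v)"
  "!!k. k \<in> K ==> \<bar>(\<Sum>v\<in>V. f k v (\<phi> v)) - (\<Sum>v\<in>V. measure_pmf.expectation (P v) (f k v))\<bar> < \<tau> k" by blast
 show ?thesis
 proof (intro exI conjI ballI)
  show "\<phi> v \<in> set_pmf (P v)" if "v \<in> V" for v using \<phi>(1) that by blast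
  show "\<bar>card {v \<in> S k. \<phi> v \<in> C k} - (\<Sum>v\<in>S k. measure_pmf.prob (P v) (C k))\<bar> < \<tau> k" if "k \<in> K" for k
   using \<phi>(2)[OF that] unfolding e1[OF that] e2[OF that] .
 qed
qed

text \<open>The value \<open>None\<close> receives the mass missing to 1; in random colourings it
  stands for the vertices that get no colour.\<close>

lemma ex_pmf_option:
 fixes w :: "'c => real"
 assumes "finite C" "!!c. c \<in> C ==> 0 <= w c" "sum w C <= 1"
 shows "\<exists>p. (\<forall>D\<subseteq>C. measure_pmf.prob p (Some ` D) = sum w D) \<and> set_pmf p \<subseteq> insert None (Some ` C)"
proof -
 define g where "g x = (case x of None => 1 - sum w C | Some c => if c \<in> C then w c else 0)" for x
 have g0: "g x \<ge> 0" for x using assms by (auto simp: g_def split: option.split)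
 have out: "g x = 0" if "x \<notin> insert None (Some ` C)" for x using that by (auto simp: g_def split: option.splits)
 have sum1: "(\<Sum>x\<in>insert None (Some ` C). g x) = 1"
  using assms(1) by (simp add: sum.reindex g_def image_iff cong: sum.cong)
 have "(\<integral>\<^sup>+ x. ennreal (g x) \<partial>count_space UNIV) = (\<integral>\<^sup>+ x. ennreal (g x) \<partial>count_space (insert None (Some ` C)))"
  using out by (subst nn_integral_count_space_indicator[of "insert None (Some ` C)"])
    (auto intro!: nn_integral_cong simp: indicator_def)
 also have "... = 1" using assms(1) g0 sum1
  by (subst nn_integral_count_space_finite) (simp_all only: finite_insert finite_imageI sum_ennreal ennreal_1)
 finally have i1: "(\<integral>\<^sup>+ x. ennreal (g x) \<partial>count_space UNIV) = 1" .
 have pm: "pmf (embed_pmf g) x = g x" for x by (rule pmf_embed_pmf[OF g0 i1])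
 have "measure_pmf.prob (embed_pmf g) (Some ` D) = sum w D" if "D \<subseteq> C" for D
  using that finite_subset[OF that assms(1)]
  by (subst measure_measure_pmf_finite) (auto simp: pm sum.reindex g_def intro!: sum.cong)
 moreover have "set_pmf (embed_pmf g) \<subseteq> insert None (Some ` C)"
  using out by (force simp: set_pmf_eq pm)
 ultimately show ?thesis by blast
qed

section \<open>Matchings\<close>

text \<open>The Halmos-Vaughan induction for Hall's theorem. If some proper nonempty
  \<open>S\<close> has no surplus of neighbours, match \<open>S\<close>, and match the rest into
  what \<open>S\<close> cannot reach; otherwise every such set has a surplus of one, so any single
  pair may be matched and removed.\<close>

lemma hall:
 assumes "finite X" "!!x. x \<in> X ==> finite (N x)" "!!S. S \<subseteq> X ==> card S <= card (\<Union>(N ` S))"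
 shows "\<exists>f. inj_on f X \<and> (\<forall>x\<in>X. f x \<in> N x)"
 using assms
proof (induction "card X" arbitrary: X N rule: less_induct)
 case less
 note finX = less.prems(1) and finN = less.prems(2) and H = less.prems(3)
 have finU: "finite (\<Union>(N ` S))" if "S \<subseteq> X" for S
  using that finX finN by (auto intro: finite_subset)
 show ?case
 proof (cases "X = {}")
  case True then show ?thesis by auto
 next
  case False
  show ?thesis
  proof (cases "\<exists>S. S \<subset> X \<and> S \<noteq> {} \<and> card (\<Union>(N ` S)) <= card S")
   case True
   then obtain S where S: "S \<subset> X" "S \<noteq> {}" "card (\<Union>(N ` S)) <= card S" by blast
   have finS: "finite S" using S finX finite_subset by blast
   have "\<exists>f. inj_on f S \<and> (\<forall>x\<in>S. f x \<in> N x)"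
    using S finX finN by (intro less.hyps H psubset_card_mono finS) auto
   then obtain f where f: "inj_on f S" "!!x. x \<in> S ==> f x \<in> N x" by blast
   define N' where "N' z = N z - \<Union>(N ` S)" for z
   have "\<exists>g. inj_on g (X - S) \<and> (\<forall>x\<in>X - S. g x \<in> N' x)"
   proof (rule less.hyps)
    show "card (X - S) < card X" using S finX by (intro psubset_card_mono) auto
    show "finite (X - S)" using finX by simp
    show "finite (N' x)" if "x \<in> X - S" for x using that finN by (simp add: N'_def)
    fix T assume T: "T \<subseteq> X - S"
    have finT: "finite T" using T finX finite_subset by blast
    have "card S + card T = card (S \<union> T)" using T finS finT by (subst card_Un_disjoint) auto
    also have "... <= card (\<Union>(N ` (S \<union> T)))" using T S by (intro H) auto
    also have "\<Union>(N ` (S \<union> T)) = \<Union>(N ` S) \<union> \<Union>(N' ` T)" by (auto simp: N'_def)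
    also have "card ... <= card (\<Union>(N ` S)) + card (\<Union>(N' ` T))" by (rule card_Un_le)
    finally show "card T <= card (\<Union>(N' ` T))" using S(3) by linarith
   qed
   then obtain g where g: "inj_on g (X - S)" "!!x. x \<in> X - S ==> g x \<in> N' x" by blast
   define h where "h x = (if x \<in> S then f x else g x)" for x
   have "inj_on h X"
   proof (rule inj_onI)
    fix x y assume xy: "x \<in> X" "y \<in> X" "h x = h y"
    have no: False if "a \<in> S" "b \<in> X - S" "f a = g b" for a b
     using f(2)[OF that(1)] g(2)[OF that(2)] that by (auto simp: N'_def)
    show "x = y" using xy no[of x y] no[of y x] f(1) g(1)
     by (auto simp: h_def inj_on_def split: if_splits)
   qed
   moreover have "h x \<in> N x" if "x \<in> X" for x
    using f(2)[of x] g(2)[of x] that by (auto simp: h_def N'_def)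
   ultimately show ?thesis by blast
  next
   case notight: False
   from False obtain x where x: "x \<in> X" by blast
   have "card {x} <= card (\<Union>(N ` {x}))" using x by (intro H) auto
   then obtain y where y: "y \<in> N x" by fastforce
   define N' where "N' z = N z - {y}" for z
   have "\<exists>g. inj_on g (X - {x}) \<and> (\<forall>x\<in>X - {x}. g x \<in> N' x)"
   proof (rule less.hyps)
    show "card (X - {x}) < card X" using x finX by (intro psubset_card_mono) auto
    show "finite (X - {x})" using finX by simp
    show "finite (N' z)" if "z \<in> X - {x}" for z using that finN by (simp add: N'_def)
    fix T assume T: "T \<subseteq> X - {x}"
    show "card T <= card (\<Union>(N' ` T))"
    proof (cases "T = {}")
     case False
     then have "card T < card (\<Union>(N ` T))" using notight T x by (metis Diff_insert_absorb Diff_subset insert_Diff insert_absorb not_le psubsetI subset_Diff_insert subset_trans insertI1)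
     moreover have "\<Union>(N ` T) \<subseteq> insert y (\<Union>(N' ` T))" by (auto simp: N'_def)
     then have "card (\<Union>(N ` T)) <= card (insert y (\<Union>(N' ` T)))"
      using finU[of T] T by (intro card_mono) (auto simp: N'_def)
     moreover have "card (insert y (\<Union>(N' ` T))) <= Suc (card (\<Union>(N' ` T)))"
      by (rule card_insert_le_m1) auto
     ultimately show ?thesis by linarith
    qed simp
   qed
   then obtain g where g: "inj_on g (X - {x})" "!!z. z \<in> X - {x} ==> g z \<in> N' z" by blast
   have "inj_on (g(x := y)) X"
    using g by (force simp: inj_on_def N'_def)
   moreover have "(g(x := y)) z \<in> N z" if "z \<in> X" for z using g(2)[of z] that y by (auto simp: N'_def)
   ultimately show ?thesis by blast
  qed
 qed
qed

text \<open>Add \<open>d\<close> dummy partners available to all of \<open>X\<close>, apply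
  \<open>hall\<close>, and discard the at most \<open>d\<close> elements matched to dummies.\<close>

lemma hall_deficiency:
 fixes N :: "'a => 'b set"
 assumes fin: "finite X" "!!x. x \<in> X ==> finite (N x)"
  and H: "!!S. S \<subseteq> X ==> card S <= card (\<Union>(N ` S)) + d"
 shows "\<exists>M f. M \<subseteq> X \<and> card X <= card M + d \<and> inj_on f M \<and> (\<forall>x\<in>M. f x \<in> N x)"
proof -
 define N' :: "'a => ('b + nat) set" where "N' x = Inl ` N x \<union> Inr ` {..<d}" for x
 have "\<exists>f. inj_on f X \<and> (\<forall>x\<in>X. f x \<in> N' x)"
 proof (rule hall)
  fix S assume S: "S \<subseteq> X"
  show "card S <= card (\<Union>(N' ` S))"
  proof (cases "S = {}")
   case False
   then have "\<Union>(N' ` S) = Inl ` (\<Union>(N ` S)) \<union> Inr ` {..<d}" by (auto simp: N'_def)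
   moreover have "finite (\<Union>(N ` S))" using S fin by (auto intro: finite_subset)
   ultimately have "card (\<Union>(N' ` S)) = card (\<Union>(N ` S)) + d"
    by (simp, subst card_Un_disjoint) (auto simp: card_image)
   then show ?thesis using H[OF S] by simp
  qed simp
 qed (use fin in \<open>auto simp: N'_def\<close>)
 then obtain f where f: "inj_on f X" "!!x. x \<in> X ==> f x \<in> N' x" by blast
 define M where "M = {x \<in> X. f x \<in> range Inl}"
 have "card (X - M) = card (f ` (X - M))" using f(1) by (intro card_image[symmetric]) (auto simp: inj_on_def)
 also have "... <= card (Inr ` {..<d} :: ('b + nat) set)"
  using f(2) by (intro card_mono) (fastforce simp: M_def N'_def)+
 also have "... = d" by (simp add: card_image)
 finally have "card X <= card M + d"
  using card_Diff_subset[of M X] fin card_mono[of X M] finite_subset[of M X] by (auto simp: M_def)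
 moreover have "inj_on (\<lambda>x. projl (f x)) M"
 proof (rule inj_onI)
  fix x y assume a: "x \<in> M" "y \<in> M" "projl (f x) = projl (f y)"
  then have "f x = f y" by (auto simp: M_def)
  then show "x = y" using f(1) a by (auto simp: M_def inj_on_def)
 qed
 moreover have "projl (f x) \<in> N x" if "x \<in> M" for x using f(2)[of x] that by (auto simp: M_def N'_def)
 moreover have "M \<subseteq> X" by (auto simp: M_def)
 ultimately show ?thesis by blast
qed

text \<open>The weak degree bound alone gives a Hall violator \<open>S\<close> at least
  \<open>c N / 2\<close> neighbours, so \<open>S\<close> has more than twice as many elements as
  \<open>B\<close>. Hence \<open>S - B\<close> is more than half of \<open>S\<close>, and its
  degrees above \<open>N p / 2\<close> push the neighbourhood beyond \<open>N / 2\<close>. The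
  expansion alternative of \<open>sparse_expand\<close> is impossible both times, because its factor
  is at least 4.\<close>

lemma sparse_matching_aux:
 fixes p \<beta> a c :: real
 assumes sp: "sparse_rel p \<beta> V E" and XV: "X \<subseteq> V" and YV: "Y \<subseteq> V" and fin: "finite V"
  and cX: "card X = N"
  and pos: "0 < p" "0 < \<beta>" "0 < a" "0 < c"
  and deg: "!!x. x \<in> X ==> c * p * N <= card (E `` {x} \<inter> Y)"
  and deg2: "!!x. x \<in> X - B ==> (1/2 + a) * p * N <= card (E `` {x} \<inter> Y)"
  and B: "B \<subseteq> X" "card B <= c / 4 * N"
  and \<beta>: "4 * \<beta> <= c * p * N" "4 * \<beta> <= a * p * N"
  and S: "S \<subseteq> X" "card (E `` S \<inter> Y) < card S"
 shows "N < 2 * card (E `` S \<inter> Y)"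
proof -
 have finX: "finite X" "finite Y" using finite_subset[OF XV fin] finite_subset[OF YV fin] by auto
 have finS: "finite S" "finite B" using S B finX finite_subset by auto
 define N1 where "N1 = E `` S \<inter> Y"
 have N1V: "N1 \<subseteq> V" "finite N1" using YV finX by (auto simp: N1_def)
 have S0: "card S > 0" using S by simp
 have restr: "E `` {x} \<inter> N1 = E `` {x} \<inter> Y" if "x \<in> S" for x using that by (auto simp: N1_def)
 have big: "4 <= (t / \<beta>)\<^sup>2" if "2 * \<beta> <= t" for t :: real
 proof -
  have "2 <= t / \<beta>" using that pos by (simp add: field_simps)
  then have "2\<^sup>2 <= (t / \<beta>)\<^sup>2" by (intro power_mono) auto
  then show ?thesis by simp
 qed
 have "(c * p * N - c * p * N / 2) / p <= card N1 \<or> ((c * p * N / 2) / \<beta>)\<^sup>2 * card S <= card N1"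
  using S XV N1V fin pos deg restr by (intro sparse_expand[OF sp]) auto
 moreover have "\<not> ((c * p * N / 2) / \<beta>)\<^sup>2 * card S <= card N1"
 proof
  assume "((c * p * N / 2) / \<beta>)\<^sup>2 * card S <= card N1"
  moreover have "4 * card S <= ((c * p * N / 2) / \<beta>)\<^sup>2 * card S"
   using big[of "c * p * N / 2"] \<beta> S0 by simp
  ultimately show False using S(2) S0 unfolding N1_def[symmetric] by linarith
 qed
 ultimately have "c * N / 2 <= card N1" using pos by (simp add: field_simps)
 then have "2 * rcard B < card S" using B S(2) unfolding N1_def[symmetric] by linarith
 moreover have "card S <= card (S - B) + card B" using finS
  by (metis card_Un_le le_trans card_mono Un_Diff_cancel2 Un_upper1 finite_Diff finite_Un)
 ultimately have SB: "rcard S < 2 * card (S - B)" by linarith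
 have "((1/2 + a) * p * N - a * p * N / 2) / p <= card N1 \<or> ((a * p * N / 2) / \<beta>)\<^sup>2 * card (S - B) <= card N1"
  using S XV N1V fin pos deg2 restr by (intro sparse_expand[OF sp]) auto
 moreover have "\<not> ((a * p * N / 2) / \<beta>)\<^sup>2 * card (S - B) <= card N1"
 proof
  assume "((a * p * N / 2) / \<beta>)\<^sup>2 * card (S - B) <= card N1"
  moreover have "4 * rcard (S - B) <= ((a * p * N / 2) / \<beta>)\<^sup>2 * card (S - B)"
   using big[of "a * p * N / 2"] \<beta> by (intro mult_right_mono) auto
  ultimately show False using S(2) SB unfolding N1_def[symmetric] by linarith
 qed
 moreover have "((1/2 + a) * p * N - a * p * N / 2) / p = N / 2 + a * N / 2" using pos by (simp add: field_simps)
 moreover have "N > 0" using cX S S0 finX card_mono[of X S] by simp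
 then have "a * N / 2 > 0" using pos by simp
 ultimately show ?thesis unfolding N1_def[symmetric] by linarith
qed

text \<open>If \<open>S\<close> violates Hall's condition, so do the non-neighbours of
  \<open>S\<close> in \<open>Y\<close>, on the other side. By \<open>sparse_matching_aux\<close>
  both neighbourhoods exceed \<open>N / 2\<close>; but the second is smaller than the set of
  non-neighbours, which has fewer than \<open>N / 2\<close> elements.\<close>

lemma sparse_matching:
 fixes p \<beta> a c :: real
 assumes sp: "sparse_rel p \<beta> V E" and symE: "sym E" and XV: "X \<subseteq> V" and YV: "Y \<subseteq> V" and fin: "finite V"
  and cX: "card X = N" "card Y = N"
  and pos: "0 < p" "0 < \<beta>" "0 < a" "0 < c"
  and deg: "!!x. x \<in> X ==> c * p * N <= card (E `` {x} \<inter> Y)" "!!y. y \<in> Y ==> c * p * N <= card (E `` {y} \<inter> X)"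
  and deg2: "!!x. x \<in> X - B ==> (1/2 + a) * p * N <= card (E `` {x} \<inter> Y)"
   "!!y. y \<in> Y - C ==> (1/2 + a) * p * N <= card (E `` {y} \<inter> X)"
  and B: "B \<subseteq> X" "card B <= c / 4 * N" and C: "C \<subseteq> Y" "card C <= c / 4 * N"
  and \<beta>: "4 * \<beta> <= c * p * N" "4 * \<beta> <= a * p * N"
 shows "\<exists>f. bij_betw f X Y \<and> (\<forall>x\<in>X. (x, f x) \<in> E)"
proof -
 have finX: "finite X" "finite Y" using finite_subset[OF XV fin] finite_subset[OF YV fin] by auto
 have "\<exists>f. inj_on f X \<and> (\<forall>x\<in>X. f x \<in> E `` {x} \<inter> Y)"
 proof (rule hall)
  fix S assume S: "S \<subseteq> X"
  have eq: "\<Union> ((\<lambda>x. E `` {x} \<inter> Y) ` S) = E `` S \<inter> Y" by auto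
  show "card S <= card (\<Union> ((\<lambda>x. E `` {x} \<inter> Y) ` S))"
  proof (rule ccontr)
   assume "\<not> ?thesis"
   then have lt: "card (E `` S \<inter> Y) < card S" unfolding eq by simp
   have 1: "N < 2 * card (E `` S \<inter> Y)"
    using sparse_matching_aux[OF sp XV YV fin cX(1) pos deg(1) deg2(1) B \<beta> S lt] by simp
   define T where "T = Y - E `` S"
   have cT: "card T + card (E `` S \<inter> Y) = N"
    using cX finX unfolding T_def by (metis Int_commute card_Diff_subset_Int card_mono finite_Int inf_le1 le_add_diff_inverse2)
   have sub: "E `` T \<inter> X \<subseteq> X - S" using symD[OF symE] by (auto simp: T_def)
   have "card (E `` T \<inter> X) <= N - card S"
    using card_mono[OF _ sub] finX S cX card_Diff_subset[of S X] finite_subset[OF S] by simp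
   moreover have "card S <= N" using S cX finX card_mono by blast
   ultimately have lt2: "card (E `` T \<inter> X) < card T" using lt cT by linarith
   have "N < 2 * card (E `` T \<inter> X)"
    using sparse_matching_aux[OF sp YV XV fin cX(2) pos deg(2) deg2(2) C \<beta> _ lt2] by (auto simp: T_def)
   then show False using 1 lt2 cT by linarith
  qed
 qed (use finX in auto)
 then obtain f where f: "inj_on f X" "!!x. x \<in> X ==> f x \<in> E `` {x} \<inter> Y" by blast
 have "f ` X = Y" using f cX finX by (intro card_subset_eq) (auto simp: card_image)
 then show ?thesis using f by (auto simp: bij_betw_def)
qed

section \<open>Partition into robustly connected parts\<close>

text \<open>A set of ordered pairs: with \<open>E\<close> symmetric every crossing edge counts
  twice, hence the factor 2 in the cut bound of \<open>decomposition\<close>.\<close>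

definition cutset :: "('a \<times> 'a) set => ('a => nat) => ('a \<times> 'a) set" where
 "cutset E \<phi> = {(u, w) \<in> E. \<phi> u \<noteq> \<phi> w}"

lemma cutset_upd:
 assumes fin: "finite E" and "sym E" "irrefl E"
 shows "card (cutset E (\<phi>(v := b))) =
  card {(u, w) \<in> E. u \<noteq> v \<and> w \<noteq> v \<and> \<phi> u \<noteq> \<phi> w} + 2 * card {w \<in> E `` {v}. \<phi> w \<noteq> b}"
proof -
 let ?K = "{(u, w) \<in> E. u \<noteq> v \<and> w \<noteq> v \<and> \<phi> u \<noteq> \<phi> w}" and ?D = "{w \<in> E `` {v}. \<phi> w \<noteq> b}"
 have no: "(v, v) \<notin> E" using assms by (auto simp: irrefl_def)
 have "cutset E (\<phi>(v := b)) = ?K \<union> (Pair v ` ?D \<union> (\<lambda>w. (w, v)) ` ?D)"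
  using no symD[OF assms(2)] by (auto simp: cutset_def split: if_splits)
 moreover have finD: "finite ?D" using finite_Image[OF fin, of "{v}"] by (rule rev_finite_subset) auto
 moreover have "finite ?K" using fin by (rule rev_finite_subset) auto
 moreover have "card (Pair v ` ?D \<union> (\<lambda>w. (w, v)) ` ?D) = card ?D + card ?D"
  using finD no by (subst card_Un_disjoint) (auto simp: card_image inj_on_def)
 ultimately show ?thesis by (simp, subst card_Un_disjoint) auto
qed

text \<open>Among the labellings with large parts and few crossing edges take one with the most
  parts, and among these one with the fewest crossing edges. Sparseness makes its parts larger than
  \<open>n / k\<close>, because few edges leave a part while the inner degrees average at most about
  \<open>p * card P\<close>; this bounds the number of parts. Maximality of their number forbids
  sparse cuts, and minimality of the crossing edges leaves each vertex at least a
  \<open>1 / k\<close> fraction of its degree in its own part. The \<open>if\<close> admits the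
  single part for \<open>k = 1\<close>.\<close>

lemma decomposition:
 fixes k :: nat and \<alpha> \<xi> \<theta> p B :: real
 assumes fin: "finite V" and n: "card V = n" "2 * k <= n" and EV: "E \<subseteq> V \<times> V" and symE: "sym E" and irr: "irrefl E"
  and sp: "sparse_rel p B V E" and k: "k \<ge> 1" and pos: "0 < p" "0 < \<alpha>" "0 < \<xi>" "0 < \<theta>"
  and \<theta>: "\<theta> <= 1 / (2 * real k)" and \<xi>: "8 * \<xi> * k <= \<alpha> * \<theta>" and B: "0 <= B" "B <= \<alpha> / 4 * n * p"
  and deg: "!!v. v \<in> V ==> (1 / k + \<alpha>) * n * p <= card (E `` {v})"
 shows "\<exists>q \<phi>. 1 <= q \<and> q < k + (if k = 1 then 1 else 0) \<and> (\<forall>v\<in>V. \<phi> v < q) \<and> (\<forall>a<q. \<exists>P. P = {v \<in> V. \<phi> v = a} \<and>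
   (1 / k + \<alpha> / 2) * n <= card P \<and>
   (\<forall>v\<in>P. (1 / k + \<alpha>) * n * p <= k * card (E `` {v} \<inter> P)) \<and>
   \<alpha> * card {v \<in> P. card (E `` {v} \<inter> P) < (1 / k + \<alpha> / 2) * n * p} <= 4 * \<xi> * k * n \<and>
   (\<forall>S\<subseteq>P. \<theta> * n <= card S --> \<theta> * n <= card (P - S) --> \<xi> * n\<^sup>2 * p <= ecount E S (P - S)))"
proof -
 have n0: "0 < real n" using n k by linarith
 have finE: "finite E" using fin by (intro finite_subset[OF EV]) simp
 define part where "part \<phi> a = {v \<in> V. \<phi> v = a}" for \<phi> :: "'a => nat" and a
 have finP: "finite (part \<phi> a)" for \<phi> a using fin by (simp add: part_def)
 \<comment> \<open>Each additional part may cost \<open>2 * \<xi> * n^2 * p\<close> ordered crossing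
   pairs. The size requirement is weak; \<open>size\<close> improves it to
   \<open>(1 / k + \<alpha> / 2) * n\<close>.\<close>
 define adm where "adm q \<phi> \<longleftrightarrow> (\<forall>v\<in>V. \<phi> v < q) \<and> (\<forall>a<q. \<theta> * n <= card (part \<phi> a)) \<and>
  rcard (cutset E \<phi>) <= 2 * \<xi> * (real q - 1) * n\<^sup>2 * p" for q \<phi>
 have size: "(1 / k + \<alpha> / 2) * n <= card (part \<phi> a)" if "adm q \<phi>" "q <= k" "a < q" for q \<phi> a
 proof -
  let ?P = "part \<phi> a"
  have PV: "?P \<subseteq> V" by (auto simp: part_def)
  have big: "\<theta> * n <= card ?P" using that by (auto simp: adm_def)
  then have P0: "0 < rcard ?P" using pos n0 mult_pos_pos[of \<theta> "real n"] by linarith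
  have "(1 / k + \<alpha>) * n * p * card ?P <= ecount E ?P V"
   using deg PV EV by (intro ecount_ge) (auto simp: part_def Int_absorb2 Image_subset)
  also have "... = ecount E ?P ?P + ecount E ?P (V - ?P)"
   using ecount_union_right[of ?P "V - ?P" E ?P] finP fin PV by (simp add: Un_absorb1)
  also have "ecount E ?P ?P <= p * card ?P * card ?P + B * card ?P"
   using sparse_relD[OF sp PV PV] by (simp add: real_sqrt_mult)
  also have "ecount E ?P (V - ?P) <= card (cutset E \<phi>)"
   using finP fin finE by (subst ecount_sigma) (auto simp: cutset_def part_def intro!: card_mono finite_subset[OF _ finE])
  also have "... <= 2 * \<xi> * (real q - 1) * n\<^sup>2 * p" using that by (simp add: adm_def)
  also have "... <= 2 * \<xi> * k * n\<^sup>2 * p" using that pos by (intro mult_right_mono mult_left_mono) auto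
  also have "... <= (\<alpha> / 4 * n * p) * card ?P"
  proof -
   have "2 * \<xi> * k * n\<^sup>2 * p = (8 * \<xi> * k) * (n * p * n / 4)" by (simp add: power2_eq_square)
   also have "... <= (\<alpha> * \<theta>) * (n * p * n / 4)" using \<xi> pos n0 by (intro mult_right_mono) auto
   also have "... = (\<alpha> / 4 * n * p) * (\<theta> * n)" by simp
   also have "... <= (\<alpha> / 4 * n * p) * card ?P" using big pos n0 by (intro mult_left_mono) auto
   finally show ?thesis .
  qed
  finally have "(1 / k + \<alpha>) * n * p * card ?P <= p * card ?P * card ?P + B * card ?P + (\<alpha> / 4 * n * p) * card ?P"
   by simp
  then have "((1 / k + \<alpha>) * n * p) * card ?P <= (p * card ?P + B + \<alpha> / 4 * n * p) * card ?P"
   by (simp add: algebra_simps)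
  then have "(1 / k + \<alpha>) * n * p <= p * card ?P + B + \<alpha> / 4 * n * p" using P0 by simp
  then have "p * ((1 / k + \<alpha> / 2) * n) <= p * card ?P" using B by (simp add: algebra_simps)
  then show ?thesis using pos by simp
 qed
 have sumP: "(\<Sum>a<q. card (part \<phi> a)) = n" if "adm q \<phi>" for q \<phi>
 proof -
  have V: "V = (\<Union>a\<in>{..<q}. part \<phi> a)" using that by (auto simp: adm_def part_def)
  have "card (\<Union>a\<in>{..<q}. part \<phi> a) = (\<Sum>a<q. card (part \<phi> a))"
   using finP by (intro card_UN_disjoint) (auto simp: part_def)
  then have "card V = (\<Sum>a<q. card (part \<phi> a))" using V by simp
  then show ?thesis using n by simp
 qed
 have qk: "q < k + (if k = 1 then 1 else 0)" if "adm q \<phi>" "q <= k" for q \<phi>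
 proof (rule ccontr)
  assume "\<not> ?thesis"
  then have "q = k" using that by (auto split: if_splits)
  then have "k * ((1 / k + \<alpha> / 2) * n) <= (\<Sum>a<k. rcard (part \<phi> a))"
   using size[OF that(1)] sum_bounded_below[of "{..<k}" "(1 / k + \<alpha> / 2) * n" "\<lambda>a. rcard (part \<phi> a)"] by simp
  also have "... = n" using sumP[OF that(1)] \<open>q = k\<close> by (metis of_nat_sum)
  finally have "(k * (1 / k + \<alpha> / 2)) * n <= 1 * real n" by (simp only: mult.assoc mult_1)
  then have "k * (1 / k + \<alpha> / 2) <= 1" by (rule mult_right_le_imp_le[OF _ n0])
  moreover have "k * (1 / k + \<alpha> / 2) = 1 + k * \<alpha> / 2" using k by (simp add: field_simps)
  moreover have "k * \<alpha> / 2 > 0" using k pos by simp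
  ultimately show False by linarith
 qed
 have adm1: "adm 1 (\<lambda>_. 0)"
 proof -
  have "1 / (2 * real k) <= 1" using k by (simp add: field_simps)
  then have "\<theta> * n <= 1 * real n" using \<theta> n0 by (intro mult_right_mono) linarith+
  then show ?thesis by (simp add: adm_def part_def cutset_def n)
 qed
 define Q where "Q = {q. 1 <= q \<and> q <= k \<and> (\<exists>\<phi>. adm q \<phi>)}"
 have finQ: "finite Q" by (rule finite_subset[of _ "{..k}"]) (auto simp: Q_def)
 have Q1: "1 \<in> Q" using adm1 k by (auto simp: Q_def)
 define q where "q = Max Q"
 have qQ: "q \<in> Q" using finQ Q1 unfolding q_def by (intro Max_in) auto
 then obtain \<phi>0 where \<phi>0: "adm q \<phi>0" and q: "1 <= q" "q <= k" by (auto simp: Q_def)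
 obtain \<phi> where \<phi>: "adm q \<phi>" and mn: "!!\<psi>. adm q \<psi> ==> card (cutset E \<phi>) <= card (cutset E \<psi>)"
  using ex_has_least_nat[of "adm q" \<phi>0 "\<lambda>\<phi>. card (cutset E \<phi>)"] \<phi>0 by blast
 have step: "q + 1 <= k ==> \<not> adm (q + 1) \<psi>" for \<psi>
  using Max_ge[OF finQ, of "q + 1"] unfolding q_def[symmetric] by (auto simp: Q_def)
 \<comment> \<open>Moving \<open>v\<close> to part \<open>b\<close> changes the cut by twice the
   difference of the two degrees of \<open>v\<close>. The move stays admissible, since the part of
   \<open>v\<close>, larger than \<open>n / k\<close>, can spare a vertex; so minimality of the cut
   decides.\<close>
 have own: "card (E `` {v} \<inter> part \<phi> b) <= card (E `` {v} \<inter> part \<phi> (\<phi> v))" if v: "v \<in> V" and b: "b < q" for v b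
 proof (cases "b = \<phi> v")
  case False
  let ?\<psi> = "\<phi>(v := b)"
  have p1: "card (part \<phi> (\<phi> v)) <= card (part ?\<psi> (\<phi> v)) + 1"
  proof -
   have "part \<phi> (\<phi> v) \<subseteq> insert v (part ?\<psi> (\<phi> v))" by (auto simp: part_def)
   then have "card (part \<phi> (\<phi> v)) <= card (insert v (part ?\<psi> (\<phi> v)))" using finP by (intro card_mono) auto
   also have "... <= card (part ?\<psi> (\<phi> v)) + 1" using finP by (simp add: card_insert_if)
   finally show ?thesis .
  qed
  have big1: "\<theta> * n + 1 <= (1 / k + \<alpha> / 2) * n"
  proof -
   have "\<theta> * n <= 1 / (2 * k) * n" using \<theta> n0 by (intro mult_right_mono) auto
   moreover have "1 <= 1 / (2 * k) * n" using n k by (simp add: field_simps)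
   moreover have "(1 / k + \<alpha> / 2) * n = 1 / (2 * k) * n + 1 / (2 * k) * n + \<alpha> / 2 * n"
    using k by (simp add: field_simps)
   moreover have "\<alpha> / 2 * n > 0" using pos n0 by simp
   ultimately show ?thesis by linarith
  qed
  have "cutset E ?\<psi> = cutset E ?\<psi>" ..
  show ?thesis
  proof (rule ccontr)
   assume lt: "\<not> ?thesis"
   have "E `` {v} = (E `` {v} \<inter> part \<phi> a) \<union> {w \<in> E `` {v}. \<phi> w \<noteq> a}" for a
    using EV by (auto simp: part_def)
   moreover have fE: "finite (E `` {v})" using finE by (rule finite_Image)
   ultimately have spl: "card (E `` {v}) = card (E `` {v} \<inter> part \<phi> a) + card {w \<in> E `` {v}. \<phi> w \<noteq> a}" for a
    by (subst card_Un_disjoint[symmetric]) (auto simp: part_def intro: rev_finite_subset[OF fE])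
   have "card (cutset E ?\<psi>) + 2 * card {w \<in> E `` {v}. \<phi> w \<noteq> \<phi> v} = card (cutset E \<phi>) + 2 * card {w \<in> E `` {v}. \<phi> w \<noteq> b}"
    using cutset_upd[OF finE symE irr, of \<phi> v b] cutset_upd[OF finE symE irr, of \<phi> v "\<phi> v"] by simp
   then have less: "card (cutset E ?\<psi>) < card (cutset E \<phi>)"
    using lt spl[of b] spl[of "\<phi> v"] by linarith
   have "adm q ?\<psi>" unfolding adm_def
   proof (intro conjI allI impI ballI)
    show "?\<psi> w < q" if "w \<in> V" for w using that \<phi> b by (auto simp: adm_def)
    show "\<theta> * n <= card (part ?\<psi> a)" if "a < q" for a
    proof (cases "a = \<phi> v")
     case True
     have "(1 / k + \<alpha> / 2) * n <= card (part \<phi> (\<phi> v))" using size[OF \<phi> q(2) that] True by simp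
     moreover have "rcard (part \<phi> (\<phi> v)) <= card (part ?\<psi> (\<phi> v)) + 1" using p1 by linarith
     ultimately show ?thesis unfolding True using big1 by linarith
    next
     case False
     then have "part \<phi> a \<subseteq> part ?\<psi> a" by (auto simp: part_def)
     then have "card (part \<phi> a) <= card (part ?\<psi> a)" using finP by (intro card_mono)
     moreover have "\<theta> * n <= card (part \<phi> a)" using \<phi> that by (simp add: adm_def)
     ultimately show ?thesis by linarith
    qed
    show "rcard (cutset E ?\<psi>) <= 2 * \<xi> * (real q - 1) * n\<^sup>2 * p"
     using \<phi> less by (simp add: adm_def)
   qed
   then show False using mn less by fastforce
  qed
 qed simp
 have main: "(1 / k + \<alpha> / 2) * n <= card P \<and>
   (\<forall>v\<in>P. (1 / k + \<alpha>) * n * p <= k * card (E `` {v} \<inter> P)) \<and>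
   \<alpha> * card {v \<in> P. card (E `` {v} \<inter> P) < (1 / k + \<alpha> / 2) * n * p} <= 4 * \<xi> * k * n \<and>
   (\<forall>S\<subseteq>P. \<theta> * n <= card S --> \<theta> * n <= card (P - S) --> \<xi> * n\<^sup>2 * p <= ecount E S (P - S))"
  if a: "a < q" and P: "P = part \<phi> a" for a P
 proof (intro conjI ballI allI impI)
  show "(1 / k + \<alpha> / 2) * n <= card P" unfolding P using size[OF \<phi> q(2) a] .
  show "(1 / k + \<alpha>) * n * p <= k * card (E `` {v} \<inter> P)" if v: "v \<in> P" for v
  proof -
   have vV: "v \<in> V" "\<phi> v = a" using v P by (auto simp: part_def)
   have "E `` {v} \<subseteq> (\<Union>b<q. E `` {v} \<inter> part \<phi> b)" using EV \<phi> by (auto simp: adm_def part_def)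
   then have "card (E `` {v}) <= card (\<Union>b<q. E `` {v} \<inter> part \<phi> b)" using finP by (intro card_mono) auto
   also have "... <= (\<Sum>b<q. card (E `` {v} \<inter> part \<phi> b))" by (intro card_UN_le) auto
   also have "... <= (\<Sum>b<q. card (E `` {v} \<inter> P))" using own[OF vV(1)] vV P by (intro sum_mono) auto
   also have "... <= k * card (E `` {v} \<inter> P)" using q by simp
   finally have "deg E v <= k * card (E `` {v} \<inter> P)" by (metis of_nat_le_iff of_nat_mult)
   then show ?thesis using deg[OF vV(1)] by linarith
  qed
  show "\<alpha> * card {v \<in> P. card (E `` {v} \<inter> P) < (1 / k + \<alpha> / 2) * n * p} <= 4 * \<xi> * k * n"
  proof -
   let ?X = "{v \<in> P. card (E `` {v} \<inter> P) < (1 / k + \<alpha> / 2) * n * p}"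
   have fX: "finite ?X" using finP P by simp
   have PV: "P \<subseteq> V" using P by (auto simp: part_def)
   have "\<alpha> / 2 * n * p * card ?X <= ecount E ?X (V - P)"
   proof (rule ecount_ge)
    fix v assume v: "v \<in> ?X"
    have "E `` {v} = (E `` {v} \<inter> P) \<union> (E `` {v} \<inter> (V - P))" using EV by auto
    then have "card (E `` {v}) <= card (E `` {v} \<inter> P) + card (E `` {v} \<inter> (V - P))" by (metis card_Un_le)
    moreover have "(1 / k + \<alpha>) * n * p <= card (E `` {v})" using deg v PV by blast
    moreover have "(1 / k + \<alpha>) * n * p = (1 / k + \<alpha> / 2) * n * p + \<alpha> / 2 * n * p" by (simp add: algebra_simps)
    ultimately show "\<alpha> / 2 * n * p <= card (E `` {v} \<inter> (V - P))" using v by auto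
   qed
   also have "... <= card (cutset E \<phi>)"
    using fX fin finE P by (subst ecount_sigma) (auto simp: cutset_def part_def intro!: card_mono finite_subset[OF _ finE])
   also have "... <= 2 * \<xi> * (real q - 1) * n\<^sup>2 * p" using \<phi> by (simp add: adm_def)
   also have "... <= 2 * \<xi> * k * n\<^sup>2 * p" using q pos by (intro mult_right_mono mult_left_mono) auto
   finally have "(n * p) * (\<alpha> * card ?X) <= (n * p) * (4 * \<xi> * k * n)" by (simp add: power2_eq_square algebra_simps)
   then show ?thesis using n0 pos by simp
  qed
  show "\<xi> * n\<^sup>2 * p <= ecount E S (P - S)" if S: "S \<subseteq> P" "\<theta> * n <= card S" "\<theta> * n <= card (P - S)" for S
  proof (rule ccontr)
   assume lt: "\<not> ?thesis"
   have fS: "finite S" "finite (P - S)" using finite_subset[OF S(1)] finP P by auto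
   have PV: "P \<subseteq> V" using P by (auto simp: part_def)
   \<comment> \<open>A sparse cut gives \<open>S\<close> the new label \<open>q\<close>; the result
     would be admissible with \<open>q + 1\<close> parts.\<close>
   let ?\<psi> = "\<lambda>v. if v \<in> S then q else \<phi> v"
   have "adm (q + 1) ?\<psi>" unfolding adm_def
   proof (intro conjI allI impI ballI)
    show "?\<psi> w < q + 1" if "w \<in> V" for w using that \<phi> by (auto simp: adm_def less_Suc_eq)
    have lab: "\<phi> v < q" if "v \<in> V" for v using \<phi> that by (auto simp: adm_def)
    show "\<theta> * n <= card (part ?\<psi> b)" if "b < q + 1" for b
    proof -
     consider "b = q" | "b = a" "b \<noteq> q" | "b < q" "b \<noteq> a" using \<open>b < q + 1\<close> by linarith
     then show ?thesis
     proof cases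
      case 1
      then have "part ?\<psi> b = S" using lab S PV by (force simp: part_def)
      then show ?thesis using S by simp
     next
      case 2
      then have "part ?\<psi> b = P - S" using S by (auto simp: P part_def)
      then show ?thesis using S by simp
     next
      case 3
      then have "part ?\<psi> b = part \<phi> b" using S by (auto simp: P part_def)
      then show ?thesis using \<phi> 3 by (simp add: adm_def)
     qed
    qed
    let ?D = "{(x, y). x \<in> S \<and> y \<in> P - S \<and> (x, y) \<in> E}" and ?D' = "{(x, y). x \<in> P - S \<and> y \<in> S \<and> (x, y) \<in> E}"
    have "cutset E ?\<psi> \<subseteq> cutset E \<phi> \<union> (?D \<union> ?D')"
     using EV S(1) by (auto simp: cutset_def P part_def split: if_splits)
    moreover have "finite (cutset E \<phi> \<union> (?D \<union> ?D'))" using finE by (rule rev_finite_subset) (auto simp: cutset_def)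
    ultimately have "card (cutset E ?\<psi>) <= card (cutset E \<phi> \<union> (?D \<union> ?D'))" by (intro card_mono)
    also have "... <= card (cutset E \<phi>) + (card ?D + card ?D')" by (meson add_mono card_Un_le le_refl le_trans)
    finally have "rcard (cutset E ?\<psi>) <= card (cutset E \<phi>) + (ecount E S (P - S) + ecount E (P - S) S)"
     using ecount_sigma[OF fS, of E] ecount_sigma[OF fS(2,1), of E] by linarith
    also have "... = card (cutset E \<phi>) + 2 * ecount E S (P - S)" using ecount_sym[OF fS symE] by simp
    also have "... <= 2 * \<xi> * (real q - 1) * n\<^sup>2 * p + 2 * (\<xi> * n\<^sup>2 * p)"
     using lt \<phi> by (auto simp: adm_def)
    also have "... = 2 * \<xi> * (real (q + 1) - 1) * n\<^sup>2 * p" by (simp add: algebra_simps)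
    finally show "rcard (cutset E ?\<psi>) <= 2 * \<xi> * (real (q + 1) - 1) * n\<^sup>2 * p" .
   qed
   note ad = this
   \<comment> \<open>By \<open>qk\<close> the value \<open>q = k\<close> can occur only for
     \<open>k = 1\<close>, and then the single part would have more than \<open>n\<close>
     vertices.\<close>
   have "q + 1 <= k \<or> k = 1 \<and> q = 1" using qk[OF \<phi> q(2)] q by (auto split: if_splits)
   moreover have "\<not> (k = 1 \<and> q = 1)"
   proof
    assume "k = 1 \<and> q = 1"
    then have "(1 + \<alpha> / 2) * n <= card (part \<phi> a)" using size[OF \<phi> q(2) a] by simp
    moreover have "card (part \<phi> a) <= n" using n fin by (auto simp: part_def intro!: card_mono)
    moreover have "(1 + \<alpha> / 2) * n > n" using pos n0 by simp
    ultimately show False by linarith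
   qed
   ultimately show False using step ad by blast
  qed
 qed
 have "\<exists>P. P = {v \<in> V. \<phi> v = a} \<and>
   (1 / k + \<alpha> / 2) * n <= card P \<and>
   (\<forall>v\<in>P. (1 / k + \<alpha>) * n * p <= k * card (E `` {v} \<inter> P)) \<and>
   \<alpha> * card {v \<in> P. card (E `` {v} \<inter> P) < (1 / k + \<alpha> / 2) * n * p} <= 4 * \<xi> * k * n \<and>
   (\<forall>S\<subseteq>P. \<theta> * n <= card S --> \<theta> * n <= card (P - S) --> \<xi> * n\<^sup>2 * p <= ecount E S (P - S))"
  if "a < q" for a using main[OF that] unfolding part_def by blast
 then show ?thesis using q qk[OF \<phi> q(2)] \<phi> by (intro exI[of _ q] exI[of _ \<phi>]) (auto simp: adm_def)
qed

section \<open>Connecting prescribed pairs through layered reserves\<close>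

abbreviation chain :: "('a \<times> 'a) set => 'a list => bool" where
 "chain E \<equiv> successively (\<lambda>u v. (u, v) \<in> E)"

lemma chain_rev: "sym E ==> chain E xs ==> chain E (rev xs)"
 by (subst successively_rev) (auto intro: successively_mono dest: symD)

section \<open>Growing neighbourhoods layer by layer\<close>

text \<open>Only the newest layer is kept, so the paths of \<open>reach_path\<close> take exactly
  one vertex from each of \<open>L 0\<close>, ..., \<open>L (s - 1)\<close>; this limits how much of
  a layer a family of such paths can block. \<open>Z\<close> is the set of vertices already in
  use.\<close>

fun reach :: "('a \<times> 'a) set => (nat => 'a set) => 'a set => 'a set => nat => 'a set" where
 "reach E L Z X 0 = X"
| "reach E L Z X (Suc s) = E `` reach E L Z X s \<inter> L s - Z"

lemma reach_union: "reach E L Z (X \<union> Y) s = reach E L Z X s \<union> reach E L Z Y s"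
 by (induction s) auto

lemma reach_empty: "reach E L Z {} s = {}"
 by (induction s) auto

lemma reach_path:
 assumes "v \<in> reach E L Z {x} s" "s > 0"
 shows "\<exists>zs. length zs = s \<and> last zs = v \<and> chain E (x # zs) \<and> (\<forall>i<s. zs ! i \<in> L i - Z)"
 using assms
proof (induction s arbitrary: v)
 case (Suc s)
 from Suc.prems obtain u where u: "u \<in> reach E L Z {x} s" "(u, v) \<in> E" "v \<in> L s - Z" by auto
 show ?case
 proof (cases "s = 0")
  case True
  then show ?thesis using u by (intro exI[of _ "[v]"]) auto
 next
  case False
  then obtain zs where zs: "length zs = s" "last zs = u" "chain E (x # zs)" "\<forall>i<s. zs ! i \<in> L i - Z"
   using Suc.IH[OF u(1)] by auto
  have ne: "zs \<noteq> []" using False zs by auto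
  have "chain E ((x # zs) @ [v])"
   using zs(2,3) u(2) ne by (subst successively_append_iff) auto
  moreover have "\<forall>i<Suc s. (zs @ [v]) ! i \<in> L i - Z" using zs(1,4) u(3) by (auto simp: nth_append less_Suc_eq)
  ultimately show ?thesis using zs(1) by (intro exI[of _ "zs @ [v]"]) auto
 qed
qed simp

text \<open>A halving argument. In each layer the lower bound for the reached set quadruples, even
  after the deletion of \<open>Z\<close>, unless saturation is attained. Of two halves of the
  sources, one keeps at least half of the reached set. From at most \<open>2 ^ \<sigma>\<close>
  sources, \<sigma> halvings leave a single one, while the bound has doubled in every layer. The
  condition \<open>q <= 16 * card X\<close> makes the blocked vertices harmless against growth by
  the factor 25.\<close>

lemma reach_good:
 fixes p \<beta> \<delta> :: real
 assumes sp: "sparse_rel p \<beta> V E" and fin: "finite V" and EV: "E \<subseteq> V \<times> V" and pos: "0 < p" "0 < \<beta>" "0 < \<delta>"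
  and LV: "!!s. s < \<sigma> ==> L s \<subseteq> V"
  and deg: "!!v s. v \<in> V ==> s < \<sigma> ==> \<delta> <= card (E `` {v} \<inter> L s)"
  and Z: "!!s. s < \<sigma> ==> card (Z \<inter> L s) <= q"
  and q: "q <= \<delta> / (4 * p)" and \<beta>: "10 * \<beta> <= \<delta>"
  and X: "X \<subseteq> V" "X \<noteq> {}" "card X <= 2 ^ \<sigma>" "q <= 16 * card X"
 shows "\<exists>x\<in>X. min (\<delta> / (8 * p)) (2 ^ \<sigma>) <= card (reach E L Z {x} \<sigma>)"
proof -
 define \<tau> where "\<tau> = \<delta> / (8 * p)"
 have tau: "\<tau> > 0" using pos by (simp add: \<tau>_def)
 have q2: "q <= 2 * \<tau>" using q pos by (simp add: \<tau>_def field_simps)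
 have finX: "finite X" using X fin finite_subset by auto
 define w where "w = card X"
 have w: "w \<ge> 1" using X finX by (simp add: w_def Suc_le_eq card_gt_0_iff)
 have claim: "\<exists>X'\<subseteq>X. X' \<noteq> {} \<and> card X' <= 2 ^ (\<sigma> - s) \<and> min \<tau> (2 ^ s * w) <= card (reach E L Z X' s)" if "s <= \<sigma>" for s
  using that
 proof (induction s)
  case 0
  then show ?case using X by (intro exI[of _ X]) (auto simp: w_def)
 next
  case (Suc s)
  then obtain X' where X': "X' \<subseteq> X" "X' \<noteq> {}" "card X' <= 2 ^ (\<sigma> - s)" "min \<tau> (2 ^ s * w) <= card (reach E L Z X' s)" by auto
  have s: "s < \<sigma>" using Suc by simp
  define Y where "Y = reach E L Z X' s"
  have YV: "Y \<subseteq> V" using X'(1) X(1) LV[of "s - 1"] s by (cases s) (auto simp: Y_def)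
  define Y1 where "Y1 = E `` Y \<inter> L s"
  have Y1V: "Y1 \<subseteq> V" using LV[OF s] by (auto simp: Y1_def)
  have finY: "finite Y1" using Y1V fin finite_subset by auto
  have "(\<delta> - \<delta> / 2) / p <= card Y1 \<or> (\<delta> / 2 / \<beta>)\<^sup>2 * card Y <= card Y1"
  proof (rule sparse_expand[OF sp YV Y1V fin])
   fix x assume x: "x \<in> Y"
   then have "E `` {x} \<inter> Y1 = E `` {x} \<inter> L s" by (auto simp: Y1_def)
   then show "\<delta> <= card (E `` {x} \<inter> Y1)" using deg[of x s] x YV s by auto
  qed (use pos in auto)
  \<comment> \<open>The factor is \<open>5^2\<close>: half of \<delta> serves as \<open>t\<close> in
    \<open>sparse_expand\<close>, and \<open>10 * \<beta> <= \<delta>\<close>.\<close>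
  moreover have "25 * rcard Y <= (\<delta> / 2 / \<beta>)\<^sup>2 * card Y"
  proof (rule mult_right_mono)
   have "5 <= \<delta> / 2 / \<beta>" using \<beta> pos by (simp add: field_simps)
   then have "5\<^sup>2 <= (\<delta> / 2 / \<beta>)\<^sup>2" by (intro power_mono) auto
   then show "25 <= (\<delta> / 2 / \<beta>)\<^sup>2" by simp
  qed simp
  moreover have "(\<delta> - \<delta> / 2) / p = 4 * \<tau>" by (simp add: \<tau>_def)
  ultimately have exp: "4 * \<tau> <= card Y1 \<or> 25 * rcard Y <= card Y1" by linarith
  have "card Y1 <= card (Y1 - Z) + card (Z \<inter> L s)"
  proof -
   have "Y1 \<subseteq> (Y1 - Z) \<union> (Z \<inter> L s)" by (auto simp: Y1_def)
   moreover have "finite (Z \<inter> L s)" using LV[OF s] fin finite_subset by blast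
   ultimately have "card Y1 <= card ((Y1 - Z) \<union> (Z \<inter> L s))" using finY by (intro card_mono) auto
   also have "... <= card (Y1 - Z) + card (Z \<inter> L s)" by (rule card_Un_le)
   finally show ?thesis .
  qed
  then have r1: "rcard Y1 <= card (Y1 - Z) + q" using Z[OF s] by linarith
  have w2: "real w <= 2 ^ s * real w" using w by (simp add: mult_le_cancel_right2)
  have q16: "q <= 16 * real w" using X(4) unfolding w_def by linarith
  have target: "min (2 * \<tau>) (4 * (2 ^ s * w)) <= card (Y1 - Z)"
  proof -
   from X'(4) consider "\<tau> <= card Y" | "2 ^ s * real w <= card Y" unfolding Y_def by fastforce
   then show ?thesis
   proof cases
    case 1
    then show ?thesis using exp r1 q2 tau by (auto simp: min_le_iff_disj)
   next
    case 2
    show ?thesis using exp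
    proof
     assume "4 * \<tau> <= card Y1" then show ?thesis using r1 q2 by (auto simp: min_le_iff_disj)
    next
     assume "25 * rcard Y <= card Y1"
     then have "25 * (2 ^ s * real w) - 16 * w <= card (Y1 - Z)" using 2 r1 q16 by linarith
     then have "4 * (2 ^ s * real w) <= card (Y1 - Z)" using w2 by simp
     then show ?thesis by (simp add: min_le_iff_disj)
    qed
   qed
  qed
  have rS: "reach E L Z X' (Suc s) = Y1 - Z" by (simp add: Y1_def Y_def)
  have half: "\<exists>X''\<subseteq>X. X'' \<noteq> {} \<and> card X'' <= 2 ^ (\<sigma> - Suc s) \<and> min \<tau> (2 ^ Suc s * w) <= card (reach E L Z X'' (Suc s))"
  proof (cases "card X' <= 2 ^ (\<sigma> - Suc s)")
   case True
   have "min \<tau> (2 ^ Suc s * w) <= min (2 * \<tau>) (4 * (2 ^ s * real w))" using tau by (auto simp: min_def)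
   then show ?thesis using X' True target rS by (intro exI[of _ X']) auto
  next
   case False
   then obtain A where A: "A \<subseteq> X'" "card A = 2 ^ (\<sigma> - Suc s)"
    by (metis nat_le_linear obtain_subset_with_card_n)
   have finX': "finite X'" using X' finX finite_subset by blast
   have "card (X' - A) = card X' - card A" using A finX' by (meson card_Diff_subset finite_subset)
   moreover have "2 ^ (\<sigma> - s) = 2 * (2::nat) ^ (\<sigma> - Suc s)" using s by (metis Suc_diff_Suc power_Suc)
   ultimately have B: "card (X' - A) <= 2 ^ (\<sigma> - Suc s)" using X'(3) A by simp
   have "Y1 - Z = reach E L Z A (Suc s) \<union> reach E L Z (X' - A) (Suc s)"
    unfolding rS[symmetric] using A(1) by (subst reach_union[symmetric]) (simp add: Un_absorb1)
   then have "card (Y1 - Z) <= card (reach E L Z A (Suc s)) + card (reach E L Z (X' - A) (Suc s))"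
    by (metis card_Un_le)
   then have "min \<tau> (2 ^ Suc s * w) <= card (reach E L Z A (Suc s)) \<or> min \<tau> (2 ^ Suc s * w) <= card (reach E L Z (X' - A) (Suc s))"
    using target by (auto simp: min_def split: if_splits)
   moreover have pm: "min \<tau> (2 ^ Suc s * w) > 0" using tau w by simp
   have "C \<noteq> {}" if "min \<tau> (2 ^ Suc s * w) <= card (reach E L Z C (Suc s))" for C
   proof
    assume "C = {}"
    then have "card (reach E L Z C (Suc s)) = 0" by (simp only: reach_empty card.empty)
    with that pm show False by linarith
   qed
   moreover have "A \<subseteq> X" "X' - A \<subseteq> X" "card A <= 2 ^ (\<sigma> - Suc s)" using A X'(1) by auto
   ultimately show ?thesis using B by blast
  qed
  then show ?case .
 qed
 from claim[of \<sigma>] obtain X' where X': "X' \<subseteq> X" "X' \<noteq> {}" "card X' <= 1" "min \<tau> (2 ^ \<sigma> * w) <= card (reach E L Z X' \<sigma>)" by auto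
 then have "card X' = 1" using finX finite_subset by (metis One_nat_def card_gt_0_iff Suc_leI le_antisym)
 then obtain x where x: "X' = {x}" by (auto simp: card_1_singleton_iff)
 have "(2::real) ^ \<sigma> <= 2 ^ \<sigma> * w" using w by simp
 then have "min \<tau> (2 ^ \<sigma>) <= min \<tau> (2 ^ \<sigma> * w)" by (intro min.mono) auto
 then have "min \<tau> (2 ^ \<sigma>) <= card (reach E L Z {x} \<sigma>)" using X'(4) unfolding x by linarith
 then show ?thesis using X'(1) x unfolding \<tau>_def by blast
qed

text \<open>Only the inner vertices \<open>zs\<close> are listed. The endpoints may be arbitrary
  vertices, also shared by several pairs. As \<open>zs\<close> is nonempty, a connection is never a
  single edge.\<close>

definition conn :: "('a \<times> 'a) set => 'a set => 'a => 'a => 'a list => bool" where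
 "conn E R x y zs \<longleftrightarrow> zs \<noteq> [] \<and> distinct zs \<and> set zs \<subseteq> R \<and> chain E (x # zs @ [y])"

definition disj_lists :: "'i set => ('i => 'a list) => bool" where
 "disj_lists I P \<longleftrightarrow> (\<forall>i\<in>I. \<forall>j\<in>I. i \<noteq> j --> set (P i) \<inter> set (P j) = {})"

lemma card_preimage_le:
 assumes "finite I" "!!v. card {i \<in> I. x i = v} <= m" "finite B"
 shows "card {i \<in> I. x i \<in> B} <= m * card B"
proof -
 have "{i \<in> I. x i \<in> B} = (\<Union>v\<in>B. {i \<in> I. x i = v})" by auto
 also have "card ... <= (\<Sum>v\<in>B. card {i \<in> I. x i = v})" using assms by (intro card_UN_le)
 also have "... <= (\<Sum>v\<in>B. m)" using assms by (intro sum_mono) auto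
 finally show ?thesis by (simp add: mult.commute)
qed

section \<open>Disjoint connections in rounds\<close>

text \<open>Two tasks are separated here: layers inside \<open>W\<close> enlarge a single vertex to
  a set of size \<tau>0, and \<open>link\<close> joins two such sets through \<open>Q\<close> while
  up to \<open>zq\<close> vertices of \<open>Q\<close> are blocked. Only the second task consumes
  \<open>Q\<close>, at most \<open>K\<close> vertices per connection.\<close>

locale layered =
 fixes V :: "'a set" and E :: "('a \<times> 'a) set" and p \<beta> :: real and \<sigma> :: nat and W Q :: "'a set" and K zq :: nat and \<tau>0 :: real
 assumes sp: "sparse_rel p \<beta> V E" and fin: "finite V" and EV: "E \<subseteq> V \<times> V" and symE: "sym E"
  and pos: "0 < p" "0 < \<beta>" "0 < \<sigma>" and WV: "W \<subseteq> V" and WQ: "W \<inter> Q = {}"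
  and link: "!!A B Z. A \<subseteq> W ==> B \<subseteq> W ==> \<tau>0 <= card A ==> \<tau>0 <= card B ==> card (Z \<inter> Q) <= zq ==>
    \<exists>a\<in>A. \<exists>b\<in>B. \<exists>zs. conn E (Q - Z) a b zs \<and> length zs <= K"
begin

text \<open>Take a largest family of disjoint connections with at most one vertex in every layer and
  at most \<open>K\<close> in \<open>Q\<close>. If more than half of the pairs were left,
  \<open>reach_good\<close> would let fewer than \<open>card I / 16\<close> endpoints on either side
  fail to grow; each serves at most 3 pairs, so fewer than \<open>3/16 + 3/16 < 1/2\<close> of the
  pairs are spoiled and another pair could be connected. The index \<open>b\<close> separates the
  layers grown from \<open>x i\<close> from those grown from \<open>y i\<close>.\<close>

lemma round:
 fixes L :: "bool => nat => 'a set" and I :: "'i set" and \<delta> :: real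
 assumes LV: "!!b s. s < \<sigma> ==> L b s \<subseteq> W"
  and Ldisj: "!!b s b' s'. s < \<sigma> ==> s' < \<sigma> ==> (b, s) \<noteq> (b', s') ==> L b s \<inter> L b' s' = {}"
  and deg: "!!v b s. v \<in> V ==> s < \<sigma> ==> \<delta> <= card (E `` {v} \<inter> L b s)"
  and \<delta>: "0 < \<delta>" "10 * \<beta> <= \<delta>" "\<tau>0 <= \<delta> / (8 * p)" "\<tau>0 <= 2 ^ \<sigma>"
  and I: "finite I" "card I <= \<delta> / (4 * p)" "card I <= 2 ^ \<sigma>"
  and xy: "!!i. i \<in> I ==> x i \<in> V" "!!i. i \<in> I ==> y i \<in> V"
  and mult: "!!v. card {i \<in> I. x i = v} <= 3" "!!v. card {i \<in> I. y i = v} <= 3"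
  and Z0: "Z0 \<subseteq> Q" "card Z0 + K * card I <= zq"
 shows "\<exists>J P. J \<subseteq> I \<and> 2 * card (I - J) <= card I \<and> disj_lists J P \<and>
  (\<forall>i\<in>J. conn E ((\<Union>b. \<Union>s<\<sigma>. L b s) \<union> Q - Z0) (x i) (y i) (P i) \<and> card (set (P i) \<inter> Q) <= K \<and> length (P i) <= 2 * \<sigma> + K)"
proof -
 define R where "R = (\<Union>b. \<Union>s<\<sigma>. L b s) \<union> Q - Z0"
 define ok where "ok J P \<longleftrightarrow> J \<subseteq> I \<and> disj_lists J P \<and>
  (\<forall>i\<in>J. conn E R (x i) (y i) (P i) \<and> card (set (P i) \<inter> Q) <= K \<and> length (P i) <= 2 * \<sigma> + K \<and> (\<forall>b. \<forall>s<\<sigma>. card (set (P i) \<inter> L b s) <= 1))" for J P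
 have "ok {} (\<lambda>_. [])" by (simp add: ok_def disj_lists_def)
 moreover have "\<forall>J. (\<exists>P. ok J P) --> card J < Suc (card I)"
  using I(1) by (auto simp: ok_def less_Suc_eq_le intro: card_mono)
 ultimately obtain J where J: "\<exists>P. ok J P" and Jmax: "!!J'. \<exists>P. ok J' P ==> card J' <= card J"
  using ex_has_greatest_nat[of "\<lambda>J. \<exists>P. ok J P" "{}" card "Suc (card I)"] by blast
 then obtain P where P: "ok J P" by blast
 have JI: "J \<subseteq> I" "finite J" using P I(1) finite_subset by (auto simp: ok_def)
 have "2 * card (I - J) <= card I"
 proof (rule ccontr)
  assume many: "\<not> ?thesis"
  define Z where "Z = (\<Union>i\<in>J. set (P i))"
  define q where "q = card I"
  have cJ: "card J <= q" using JI I(1) by (simp add: q_def card_mono)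
  have ZL: "card (Z \<inter> L b s) <= q" if "s < \<sigma>" for b s
  proof -
   have "Z \<inter> L b s = (\<Union>i\<in>J. set (P i) \<inter> L b s)" by (auto simp: Z_def)
   also have "card ... <= (\<Sum>i\<in>J. card (set (P i) \<inter> L b s))" using JI by (intro card_UN_le)
   also have "... <= (\<Sum>i\<in>J. 1)" using P that by (intro sum_mono) (auto simp: ok_def)
   finally show ?thesis using cJ by simp
  qed
  have ZQ: "card ((Z0 \<union> Z) \<inter> Q) <= zq"
  proof -
   have "(Z0 \<union> Z) \<inter> Q = Z0 \<union> (\<Union>i\<in>J. set (P i) \<inter> Q)" using Z0 by (auto simp: Z_def)
   also have "card ... <= card Z0 + card (\<Union>i\<in>J. set (P i) \<inter> Q)" by (rule card_Un_le)
   also have "card (\<Union>i\<in>J. set (P i) \<inter> Q) <= (\<Sum>i\<in>J. card (set (P i) \<inter> Q))" using JI by (intro card_UN_le)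
   also have "... <= (\<Sum>i\<in>J. K)" using P by (intro sum_mono) (auto simp: ok_def)
   also have "... <= K * card I" using cJ by (simp add: q_def)
   finally show ?thesis using Z0 by linarith
  qed
  have "I \<noteq> {}" using many by auto
  then have q0: "q > 0" using I(1) by (simp add: q_def card_gt_0_iff)
  have LV': "L b s \<subseteq> V" if "s < \<sigma>" for b s using LV[OF that] WV by blast
  define t where "t = min (\<delta> / (8 * p)) (2 ^ \<sigma>)"
  have bad: "16 * card {v \<in> f ` I. card (reach E (L b) Z {v} \<sigma>) < t} < q" if f: "!!i. i \<in> I ==> f i \<in> V" for f b
  proof (rule ccontr)
   let ?X = "{v \<in> f ` I. card (reach E (L b) Z {v} \<sigma>) < t}"
   assume a: "\<not> 16 * card ?X < q"
   have "card ?X <= card (f ` I)" using I(1) by (intro card_mono) auto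
   also have "... <= card I" using I(1) by (rule card_image_le)
   finally have le: "card ?X <= 2 ^ \<sigma>" using I(3) by linarith
   have "?X \<noteq> {}" using a q0 by force
   moreover have "real q <= \<delta> / (4 * p)" using I(2) q_def by simp
   moreover have "?X \<subseteq> V" using f by auto
   moreover have "q <= 16 * card ?X" using a by linarith
   ultimately have "\<exists>v\<in>?X. min (\<delta> / (8 * p)) (2 ^ \<sigma>) <= card (reach E (L b) Z {v} \<sigma>)"
    using le by (intro reach_good[where q = q and \<delta> = \<delta> and V = V and \<beta> = \<beta>] sp fin EV pos \<delta> LV' deg) (auto simp: ZL)
   then obtain v where "v \<in> ?X" "t <= card (reach E (L b) Z {v} \<sigma>)" unfolding t_def by blast
   then show False unfolding mem_Collect_eq by linarith
  qed
  let ?Bx = "{v \<in> x ` I. card (reach E (L True) Z {v} \<sigma>) < t}"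
  let ?By = "{v \<in> y ` I. card (reach E (L False) Z {v} \<sigma>) < t}"
  have fB: "finite ?Bx" "finite ?By" using I(1) by auto
  have "\<exists>i\<in>I - J. x i \<notin> ?Bx \<and> y i \<notin> ?By"
  proof (rule ccontr)
   assume "\<not> ?thesis"
   then have "I - J \<subseteq> {i \<in> I. x i \<in> ?Bx} \<union> {i \<in> I. y i \<in> ?By}" by blast
   then have "card (I - J) <= card ({i \<in> I. x i \<in> ?Bx} \<union> {i \<in> I. y i \<in> ?By})" using I(1) by (intro card_mono) auto
   also have "... <= card {i \<in> I. x i \<in> ?Bx} + card {i \<in> I. y i \<in> ?By}" by (rule card_Un_le)
   also have "... <= 3 * card ?Bx + 3 * card ?By"
    using card_preimage_le[OF I(1) mult(1) fB(1)] card_preimage_le[OF I(1) mult(2) fB(2)] by linarith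
   moreover have "16 * card ?Bx < q" "16 * card ?By < q" using bad[of x True] bad[of y False] xy by blast+
   ultimately show False using many unfolding q_def by linarith
  qed
  then obtain i where i: "i \<in> I" "i \<notin> J" "x i \<notin> ?Bx" "y i \<notin> ?By" by blast
  define A where "A = reach E (L True) Z {x i} \<sigma>"
  define B where "B = reach E (L False) Z {y i} \<sigma>"
  have cA: "t <= card A" "t <= card B" using i by (auto simp: A_def B_def)
  obtain \<sigma>' where \<sigma>': "\<sigma> = Suc \<sigma>'" using pos by (cases \<sigma>) auto
  have "A \<subseteq> W" "B \<subseteq> W" using LV[of \<sigma>'] by (auto simp: A_def B_def \<sigma>')
  moreover have "\<tau>0 <= card A" "\<tau>0 <= card B" using cA \<delta> by (auto simp: t_def)
  ultimately obtain a b zs where ab: "a \<in> A" "b \<in> B" and zs: "conn E (Q - (Z0 \<union> Z)) a b zs" "length zs <= K"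
   using link[OF _ _ _ _ ZQ] by blast
  obtain us where us: "length us = \<sigma>" "last us = a" "chain E (x i # us)" "\<forall>s<\<sigma>. us ! s \<in> L True s - Z"
   using reach_path[of a E "L True" Z "x i" \<sigma>] ab pos by (auto simp: A_def)
  obtain ws where ws: "length ws = \<sigma>" "last ws = b" "chain E (y i # ws)" "\<forall>s<\<sigma>. ws ! s \<in> L False s - Z"
   using reach_path[of b E "L False" Z "y i" \<sigma>] ab pos by (auto simp: B_def)
  \<comment> \<open>\<open>us\<close> leads from \<open>x i\<close> to \<open>a\<close> and
    \<open>zs\<close> from \<open>a\<close> to \<open>b\<close>; \<open>ws\<close> was grown from
    \<open>y i\<close>, so it is traversed backwards.\<close>
  define P1 where "P1 = us @ zs @ rev ws"
  have neu: "us \<noteq> []" "ws \<noteq> []" "zs \<noteq> []" using us ws pos zs by (auto simp: conn_def)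
  have setu: "set us = (\<lambda>s. us ! s) ` {..<\<sigma>}" "set ws = (\<lambda>s. ws ! s) ` {..<\<sigma>}"
   using us(1) ws(1) by (auto simp: set_conv_nth)
  have zQ: "set zs \<subseteq> Q - (Z0 \<union> Z)" using zs by (simp add: conn_def)
  have notQ: "L b s \<inter> Q = {}" if "s < \<sigma>" for b s using LV[OF that] WQ by blast
  have uL: "\<exists>s<\<sigma>. v \<in> L True s \<and> v \<notin> Z" if "v \<in> set us" for v using that us(1,4) by (auto simp: in_set_conv_nth)
  have wL: "\<exists>s<\<sigma>. v \<in> L False s \<and> v \<notin> Z" if "v \<in> set ws" for v using that ws(1,4) by (auto simp: in_set_conv_nth)
  have dist: "distinct P1"
  proof -
   have "us ! i \<noteq> us ! j" if "i < \<sigma>" "j < \<sigma>" "i \<noteq> j" for i j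
   proof -
    have "L True i \<inter> L True j = {}" using Ldisj[of i j True True] that by simp
    moreover have "us ! i \<in> L True i" "us ! j \<in> L True j" using us(4) that by auto
    ultimately show ?thesis by auto
   qed
   then have "distinct us" using us(1) by (simp add: distinct_conv_nth)
   moreover have "ws ! i \<noteq> ws ! j" if "i < \<sigma>" "j < \<sigma>" "i \<noteq> j" for i j
   proof -
    have "L False i \<inter> L False j = {}" using Ldisj[of i j False False] that by simp
    moreover have "ws ! i \<in> L False i" "ws ! j \<in> L False j" using ws(4) that by auto
    ultimately show ?thesis by auto
   qed
   then have "distinct ws" using ws(1) by (simp add: distinct_conv_nth)
   moreover have "set us \<inter> set ws = {}"
   proof (rule ccontr)
    assume "\<not> ?thesis"
    then obtain v where "v \<in> set us" "v \<in> set ws" by blast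
    then obtain i j where "i < \<sigma>" "j < \<sigma>" "v \<in> L True i" "v \<in> L False j" using uL wL by blast
    moreover have "L True i \<inter> L False j = {}" using Ldisj[of i j True False] calculation by simp
    ultimately show False by blast
   qed
   moreover have "set us \<inter> set zs = {}" using uL zQ notQ by blast
   moreover have "set ws \<inter> set zs = {}" using wL zQ notQ by blast
   ultimately show ?thesis using zs by (auto simp: P1_def conn_def)
  qed
  have ch: "chain E (x i # P1 @ [y i])"
  proof -
   have c1: "chain E (a # zs @ [b])" using zs by (simp add: conn_def)
   have "chain E (rev (y i # ws))" by (rule chain_rev[OF symE ws(3)])
   then have c2: "chain E (rev ws @ [y i])" by simp
   have h: "hd (rev ws @ [y i]) = b" using ws(2) neu by (simp add: hd_rev)
   have "chain E (zs @ (rev ws @ [y i]))"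
    using c1 c2 neu h by (auto simp: successively_append_iff successively_Cons)
   moreover have "(last (x i # us), hd (zs @ (rev ws @ [y i]))) \<in> E"
    using c1 us(2) neu by (auto simp: successively_Cons)
   ultimately have "chain E ((x i # us) @ (zs @ (rev ws @ [y i])))" using us(3) by (subst successively_append_iff) simp
   then show ?thesis by (simp add: P1_def)
  qed
  have setP: "set P1 = set us \<union> set zs \<union> set ws" by (auto simp: P1_def)
  have sub: "set P1 \<subseteq> R - Z"
  proof
   fix v assume "v \<in> set P1"
   then consider "v \<in> set us" | "v \<in> set zs" | "v \<in> set ws" unfolding setP by blast
   then show "v \<in> R - Z"
   proof cases
    case 1
    then obtain s where "s < \<sigma>" "v \<in> L True s" "v \<notin> Z" using uL by blast
    then show ?thesis using notQ[of s True] Z0(1) unfolding R_def by blast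
   next
    case 2 then show ?thesis using zQ unfolding R_def by blast
   next
    case 3
    then obtain s where "s < \<sigma>" "v \<in> L False s" "v \<notin> Z" using wL by blast
    then show ?thesis using notQ[of s False] Z0(1) unfolding R_def by blast
   qed
  qed
  have cQ: "card (set P1 \<inter> Q) <= K"
  proof -
   have "set P1 \<inter> Q \<subseteq> set zs" using uL wL notQ unfolding setP by blast
   then have "card (set P1 \<inter> Q) <= card (set zs)" by (intro card_mono) auto
   also have "... <= K" using zs(2) card_length[of zs] by linarith
   finally show ?thesis .
  qed
  have cL: "card (set P1 \<inter> L c s) <= 1" if s: "s < \<sigma>" for c s
  proof -
   have "set P1 \<inter> L c s \<subseteq> {if c then us ! s else ws ! s}"
   proof
    fix v assume v: "v \<in> set P1 \<inter> L c s"
    then have "v \<notin> set zs" using zQ notQ[OF s] by blast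
    then consider s' where "s' < \<sigma>" "v = us ! s'" | s' where "s' < \<sigma>" "v = ws ! s'" using v unfolding setP setu by blast
    then show "v \<in> {if c then us ! s else ws ! s}"
    proof cases
     case 1 then show ?thesis using v us(4) Ldisj[OF s 1(1), of c True] by (cases "c \<and> s = s'") auto
    next
     case 2 then show ?thesis using v ws(4) Ldisj[OF s 2(1), of c False] by (cases "\<not> c \<and> s = s'") auto
    qed
   qed
   then have "card (set P1 \<inter> L c s) <= card {if c then us ! s else ws ! s}" by (intro card_mono) auto
   then show ?thesis by simp
  qed
  have "ok (insert i J) (P(i := P1))"
   unfolding ok_def
  proof (intro conjI ballI allI impI)
   show "insert i J \<subseteq> I" using i JI by auto
   have "set (P j) \<inter> set P1 = {}" if "j \<in> J" for j using sub that by (auto simp: Z_def)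
   then show "disj_lists (insert i J) (P(i := P1))"
    using P i(2) unfolding ok_def disj_lists_def by (auto simp: Int_commute)
  next
   fix j assume j: "j \<in> insert i J"
   have Pj: "conn E R (x j) (y j) (P j) \<and> card (set (P j) \<inter> Q) <= K \<and> length (P j) <= 2 * \<sigma> + K \<and> (\<forall>b. \<forall>s<\<sigma>. card (set (P j) \<inter> L b s) <= 1)" if "j \<noteq> i"
    using P j that by (auto simp: ok_def)
   show "conn E R (x j) (y j) ((P(i := P1)) j)"
    using Pj dist ch sub neu by (cases "j = i") (auto simp: conn_def P1_def)
   show "card (set ((P(i := P1)) j) \<inter> Q) <= K" using Pj cQ by (cases "j = i") auto
   show "length ((P(i := P1)) j) <= 2 * \<sigma> + K" using Pj us(1) ws(1) zs(2) by (cases "j = i") (auto simp: P1_def)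
   show "card (set ((P(i := P1)) j) \<inter> L b s) <= 1" if "s < \<sigma>" for b s using Pj cL that by (cases "j = i") auto
  qed
  then have "card (insert i J) <= card J" using Jmax by blast
  then show False using i JI by simp
 qed
 then show ?thesis using P JI unfolding ok_def R_def by blast
qed

text \<open>Each call of \<open>round\<close> uses fresh layers and leaves at most half of the
  pairs, so at most \<open>q0 / 2 ^ r\<close> pairs are open in round \<open>r\<close> and its
  layers may be correspondingly thin. \<open>Q\<close> is shared by all rounds; with
  \<open>K\<close> vertices charged per connection, the budget \<open>2 * K * card I\<close> covers
  the current round and all later ones.\<close>

lemma connect_all:
 fixes L :: "nat => bool => nat => 'a set" and \<delta> :: "nat => real" and q0 :: real
 assumes LV: "!!r b s. r < rn ==> s < \<sigma> ==> L r b s \<subseteq> W"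
  and Ldisj: "!!r b s r' b' s'. r < rn ==> r' < rn ==> s < \<sigma> ==> s' < \<sigma> ==> (r, b, s) \<noteq> (r', b', s') ==> L r b s \<inter> L r' b' s' = {}"
  and deg: "!!r v b s. r < rn ==> v \<in> V ==> s < \<sigma> ==> \<delta> r <= card (E `` {v} \<inter> L r b s)"
  and \<delta>: "!!r. r < rn ==> 0 < \<delta> r \<and> 10 * \<beta> <= \<delta> r \<and> \<tau>0 <= \<delta> r / (8 * p) \<and> q0 / 2 ^ r <= \<delta> r / (4 * p)" and s0: "\<tau>0 <= 2 ^ \<sigma>"
  and q0: "q0 <= 2 ^ \<sigma>" "q0 < 2 ^ rn"
  and r: "r <= rn"
  and I: "finite I" "card I <= q0 / 2 ^ r"
  and xy: "!!i. i \<in> I ==> x i \<in> V" "!!i. i \<in> I ==> y i \<in> V"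
  and mult: "!!v. card {i \<in> I. x i = v} <= 3" "!!v. card {i \<in> I. y i = v} <= 3"
  and Z0: "Z0 \<subseteq> Q" "card Z0 + 2 * K * card I <= zq"
 shows "\<exists>P. disj_lists I P \<and>
  (\<forall>i\<in>I. conn E ((\<Union>r'\<in>{r..<rn}. \<Union>b. \<Union>s<\<sigma>. L r' b s) \<union> Q - Z0) (x i) (y i) (P i) \<and> length (P i) <= 2 * \<sigma> + K)"
 using r I xy mult Z0
proof (induction "rn - r" arbitrary: r I Z0)
 case 0
 \<comment> \<open>After the last round \<open>q0 < 2 ^ rn\<close> leaves less than one open
   pair.\<close>
 then have "rcard I < 1" using q0(2) proof -
  have "q0 / 2 ^ r < 1" using q0(2) 0 by simp
  then show ?thesis using 0(4) by linarith
 qed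
 then have "I = {}" using 0 by simp
 then show ?case by (simp add: disj_lists_def)
next
 case (Suc m)
 then have r: "r < rn" by simp
 have "q0 / 2 ^ r <= 2 ^ \<sigma>"
 proof (cases "q0 \<ge> 0")
  case True
  then have "q0 / 2 ^ r <= q0 / 1" by (intro divide_left_mono) auto
  then show ?thesis using q0 by simp
 next
  case False
  then have "q0 / 2 ^ r <= 0" by (simp add: field_simps)
  then show ?thesis by (rule order_trans) simp
 qed
 then have "rcard I <= 2 ^ \<sigma>" using Suc.prems(3) by linarith
 then have Is: "card I <= 2 ^ \<sigma>" by (metis of_nat_le_iff of_nat_numeral of_nat_power)
 have "\<exists>J P. J \<subseteq> I \<and> 2 * card (I - J) <= card I \<and> disj_lists J P \<and>
  (\<forall>i\<in>J. conn E ((\<Union>b. \<Union>s<\<sigma>. L r b s) \<union> Q - Z0) (x i) (y i) (P i) \<and> card (set (P i) \<inter> Q) <= K \<and> length (P i) <= 2 * \<sigma> + K)"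
 proof (rule round[where \<delta> = "\<delta> r"])
  show "rcard I <= \<delta> r / (4 * p)" using \<delta>[OF r] Suc.prems(3) by linarith
  show "card Z0 + K * card I <= zq" using Suc.prems(9) by simp
 qed (use LV[OF r] Ldisj[OF r r] deg[OF r] \<delta>[OF r] s0 Is Suc.prems in auto)
 then obtain J P where J: "J \<subseteq> I" "2 * card (I - J) <= card I" "disj_lists J P"
  and P: "!!i. i \<in> J ==> conn E ((\<Union>b. \<Union>s<\<sigma>. L r b s) \<union> Q - Z0) (x i) (y i) (P i) \<and> card (set (P i) \<inter> Q) <= K \<and> length (P i) <= 2 * \<sigma> + K"
  by blast
 have finJ: "finite J" using J Suc.prems finite_subset by blast
 \<comment> \<open>Only the used vertices of \<open>Q\<close> have to be remembered, because later
   rounds work in other layers.\<close>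
 define Z1 where "Z1 = Z0 \<union> (\<Union>i\<in>J. set (P i) \<inter> Q)"
 have cIJ: "card I = card J + card (I - J)"
  using J finJ Suc.prems(2) by (metis card_Diff_subset card_mono le_add_diff_inverse)
 have "card Z1 <= card Z0 + K * card J"
 proof -
  have "card Z1 <= card Z0 + card (\<Union>i\<in>J. set (P i) \<inter> Q)" unfolding Z1_def by (rule card_Un_le)
  also have "card (\<Union>i\<in>J. set (P i) \<inter> Q) <= (\<Sum>i\<in>J. card (set (P i) \<inter> Q))" using finJ by (intro card_UN_le)
  also have "... <= (\<Sum>i\<in>J. K)" using P by (intro sum_mono) auto
  finally show ?thesis by (simp add: mult.commute)
 qed
 moreover have "K * card J + 2 * K * card (I - J) <= 2 * K * card I"
 proof -
  have "card J + 2 * card (I - J) <= 2 * card I" using J(2) cIJ by linarith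
  then have "K * (card J + 2 * card (I - J)) <= K * (2 * card I)" by (rule mult_le_mono2)
  then show ?thesis by (simp add: algebra_simps)
 qed
 ultimately have Z1: "card Z1 + 2 * K * card (I - J) <= zq" using Suc.prems(9) by linarith
 have "\<exists>P'. disj_lists (I - J) P' \<and>
  (\<forall>i\<in>I - J. conn E ((\<Union>r'\<in>{Suc r..<rn}. \<Union>b. \<Union>s<\<sigma>. L r' b s) \<union> Q - Z1) (x i) (y i) (P' i) \<and> length (P' i) <= 2 * \<sigma> + K)"
 proof (rule Suc.hyps(1))
  show "m = rn - Suc r" "Suc r <= rn" using Suc.hyps(2) by auto
  show "finite (I - J)" using Suc.prems by simp
  have "rcard (I - J) <= rcard I / 2" using J(2) by linarith
  also have "... <= q0 / 2 ^ r / 2" by (rule divide_right_mono[OF Suc.prems(3)]) simp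
  finally show "rcard (I - J) <= q0 / 2 ^ Suc r" by (simp add: mult.commute)
  have "card {i \<in> I - J. f i = v} <= card {i \<in> I. f i = v}" for f :: "_ => 'a" and v
   using Suc.prems(2) by (intro card_mono) auto
  then show "card {i \<in> I - J. x i = v} <= 3" "card {i \<in> I - J. y i = v} <= 3" for v
   using Suc.prems(6,7) le_trans by blast+
  show "Z1 \<subseteq> Q" using Suc.prems(8) by (auto simp: Z1_def)
  show "card Z1 + 2 * K * card (I - J) <= zq" by (rule Z1)
 qed (use Suc.prems in auto)
 then obtain P' where P': "disj_lists (I - J) P'"
  "!!i. i \<in> I - J ==> conn E ((\<Union>r'\<in>{Suc r..<rn}. \<Union>b. \<Union>s<\<sigma>. L r' b s) \<union> Q - Z1) (x i) (y i) (P' i) \<and> length (P' i) <= 2 * \<sigma> + K"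
  by blast
 define P2 where "P2 i = (if i \<in> J then P i else P' i)" for i
 have cross: "set (P i) \<inter> set (P' j) = {}" if "i \<in> J" "j \<in> I - J" for i j
 proof (rule ccontr)
  assume "\<not> ?thesis"
  then obtain v where v: "v \<in> set (P i)" "v \<in> set (P' j)" by blast
  have 1: "v \<in> (\<Union>b. \<Union>s<\<sigma>. L r b s) \<union> Q" using P[OF that(1)] v(1) unfolding conn_def by blast
  have 2: "v \<in> (\<Union>r'\<in>{Suc r..<rn}. \<Union>b. \<Union>s<\<sigma>. L r' b s) \<union> Q - Z1" using P'(2)[OF that(2)] v(2) unfolding conn_def by blast
  show False
  proof (cases "v \<in> Q")
   case True then show False using 2 v that by (auto simp: Z1_def)
  next
   case False
   then obtain b s r' b' s' where "s < \<sigma>" "v \<in> L r b s" "r' \<in> {Suc r..<rn}" "s' < \<sigma>" "v \<in> L r' b' s'" using 1 2 by blast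
   then show False using Ldisj[of r r' s s' b b'] r by auto
  qed
 qed
 have "disj_lists I P2" unfolding disj_lists_def
 proof (intro ballI impI)
  fix i j assume ij: "i \<in> I" "j \<in> I" "i \<noteq> j"
  show "set (P2 i) \<inter> set (P2 j) = {}"
   using ij J(3) P'(1) cross[of i j] cross[of j i] by (auto simp: P2_def disj_lists_def)
 qed
 moreover have "conn E ((\<Union>r'\<in>{r..<rn}. \<Union>b. \<Union>s<\<sigma>. L r' b s) \<union> Q - Z0) (x i) (y i) (P2 i) \<and> length (P2 i) <= 2 * \<sigma> + K" if "i \<in> I" for i
 proof (cases "i \<in> J")
  case True
  have "(\<Union>b. \<Union>s<\<sigma>. L r b s) \<union> Q - Z0 \<subseteq> (\<Union>r'\<in>{r..<rn}. \<Union>b. \<Union>s<\<sigma>. L r' b s) \<union> Q - Z0"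
  proof -
   have "r \<in> {r..<rn}" using r by simp
   then show ?thesis by blast
  qed
  then have "set (P i) \<subseteq> (\<Union>r'\<in>{r..<rn}. \<Union>b. \<Union>s<\<sigma>. L r' b s) \<union> Q - Z0"
   using P[OF True] unfolding conn_def by (meson subset_trans)
  then show ?thesis using P[OF True] True unfolding P2_def conn_def by simp
 next
  case False
  have "(\<Union>r'\<in>{Suc r..<rn}. \<Union>b. \<Union>s<\<sigma>. L r' b s) \<union> Q - Z1 \<subseteq> (\<Union>r'\<in>{r..<rn}. \<Union>b. \<Union>s<\<sigma>. L r' b s) \<union> Q - Z0"
  proof -
   have "{Suc r..<rn} \<subseteq> {r..<rn}" by auto
   moreover have "Z0 \<subseteq> Z1" by (auto simp: Z1_def)
   ultimately show ?thesis by blast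
  qed
  moreover have P'i: "conn E ((\<Union>r'\<in>{Suc r..<rn}. \<Union>b. \<Union>s<\<sigma>. L r' b s) \<union> Q - Z1) (x i) (y i) (P' i) \<and> length (P' i) <= 2 * \<sigma> + K"
   using P'(2)[of i] False that by simp
  ultimately have "set (P' i) \<subseteq> (\<Union>r'\<in>{r..<rn}. \<Union>b. \<Union>s<\<sigma>. L r' b s) \<union> Q - Z0"
   unfolding conn_def by (meson subset_trans)
  then show ?thesis using P'i False unfolding P2_def conn_def by simp
 qed
 ultimately show ?case by blast
qed

end

section \<open>Random sets meeting all large boundaries and common neighbourhoods\<close>

lemma random_subset:
 fixes eps :: real and s \<tau> :: "'k => real"
 assumes fin: "finite V" "finite K" and S: "!!k. k \<in> K ==> S k \<subseteq> V" and eps: "0 <= eps" "eps <= 1"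
  and tau: "!!k. k \<in> K ==> 0 < \<tau> k" and s: "!!k. k \<in> K ==> 0 < s k \<and> card (S k) <= s k"
  and small: "(\<Sum>k\<in>K. 2 * exp (- 2 * (\<tau> k)\<^sup>2 / s k)) < 1"
 shows "\<exists>Q\<subseteq>V. \<forall>k\<in>K. \<bar>card (S k \<inter> Q) - eps * card (S k)\<bar> < \<tau> k"
proof -
 obtain \<phi> where \<phi>: "!!k. k \<in> K ==> \<bar>card {v \<in> S k. \<phi> v \<in> {True}} - (\<Sum>v\<in>S k. measure_pmf.prob (bernoulli_pmf eps) {True})\<bar> < \<tau> k"
  using sampling_card[OF fin S tau s small, where P = "\<lambda>_. bernoulli_pmf eps" and C = "\<lambda>_. {True}"] by blast
 have pr: "measure_pmf.prob (bernoulli_pmf eps) {True} = eps"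
  using eps by (simp add: measure_pmf_single)
 show ?thesis
 proof (intro exI conjI ballI)
  show "{v \<in> V. \<phi> v} \<subseteq> V" by auto
  fix k assume k: "k \<in> K"
  have "{v \<in> S k. \<phi> v \<in> {True}} = S k \<inter> {v \<in> V. \<phi> v}" using S[OF k] by auto
  then show "\<bar>card (S k \<inter> {v \<in> V. \<phi> v}) - eps * card (S k)\<bar> < \<tau> k"
   using \<phi>[OF k] by (simp add: pr mult.commute)
 qed
qed

text \<open>The situation inside one part. \<open>n\<close> remains the order of the whole graph, so
  \<open>V\<close> may be smaller, and the sparseness parameter is fixed at its largest value. The
  bound on \<open>n * p\<close> supplies concentration in neighbourhoods; the last clause says that
  cuts between linear-sized sets are dense.\<close>

definition good_graph :: "nat => real => real => real => 'a set => ('a \<times> 'a) set => bool" where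
 "good_graph n c \<xi> p V E \<longleftrightarrow> finite V \<and> E \<subseteq> V \<times> V \<and> sym E \<and> irrefl E \<and> 0 < p \<and> card V <= n \<and>
   c * ln (real n) ^ 6 <= real n * p \<and> sparse_rel p (real n * p / ln (real n) ^ 3) V E \<and>
   (\<forall>v\<in>V. c * real n * p <= deg E v) \<and>
   (\<forall>S\<subseteq>V. c / 8 * real n <= rcard S --> c / 8 * real n <= rcard (V - S) --> \<xi> * (real n)\<^sup>2 * p <= ecount E S (V - S))"

lemma good_graphD:
 assumes "good_graph n c \<xi> p V E"
 shows "finite V" "E \<subseteq> V \<times> V" "sym E" "irrefl E" "0 < p" "card V <= n" "c * ln (real n) ^ 6 <= real n * p"
  "sparse_rel p (real n * p / ln (real n) ^ 3) V E" "!!v. v \<in> V ==> c * real n * p <= deg E v"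
  "!!S. S \<subseteq> V ==> c / 8 * real n <= rcard S ==> c / 8 * real n <= rcard (V - S) ==> \<xi> * (real n)\<^sup>2 * p <= ecount E S (V - S)"
 using assms unfolding good_graph_def by auto

definition inner_bd :: "('a \<times> 'a) set => real => 'a set => 'a set" where
 "inner_bd E d D = {v \<in> D. d <= rcard (E `` {v} - D)}"

text \<open>What a linking set must meet when a search has used vertices of \<open>W\<close> only:
  the vertices from which the neighbourhood of \<open>A\<close> can be enlarged, and the common
  neighbours of \<open>A\<close> and \<open>B\<close>, where a connection closes. The number of
  these sets is at most exponential in \<open>card W\<close>, so a random set can meet all large
  ones once \<open>card W\<close> is a small fraction of \<open>n\<close>.\<close>

definition hit_family :: "('a \<times> 'a) set => real => 'a set => 'a set set" where
 "hit_family E d W = (\<lambda>A. inner_bd E d (E `` A)) ` Pow W \<union> (\<lambda>(A, B). E `` A \<inter> E `` B) ` (Pow W \<times> Pow W)"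

lemma card_hit_family:
 assumes "finite W"
 shows "finite (hit_family E d W)" "card (hit_family E d W) <= 2 * 4 ^ card W"
proof -
 show "finite (hit_family E d W)" using assms by (simp add: hit_family_def)
 have "card (hit_family E d W) <= card ((\<lambda>A. inner_bd E d (E `` A)) ` Pow W) + card ((\<lambda>(A, B). E `` A \<inter> E `` B) ` (Pow W \<times> Pow W))"
  unfolding hit_family_def by (rule card_Un_le)
 also have "... <= card (Pow W) + card (Pow W \<times> Pow W)" using assms by (intro add_mono card_image_le) auto
 also have "... = 2 ^ card W + 4 ^ card W"
  using assms by (simp add: card_Pow card_cartesian_product power_mult_distrib[symmetric])
 also have "... <= 2 * 4 ^ card W" by (simp add: power_mono)
 finally show "card (hit_family E d W) <= 2 * 4 ^ card W" .
qed

text \<open>A random set of density \<open>eps\<close> fails on a set of size \<phi> n with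
  probability exponentially small in \<open>n\<close>, which outweighs the
  \<open>2 * 4 ^ card W\<close> members of the family. The sets in \<N> may be much smaller, but
  there are at most \<open>n + 1\<close> of them, and size of order \<open>ln n ^ 6\<close> is
  enough for these.\<close>

lemma hit_step:
 fixes eps \<phi> c :: real
 assumes "0 < eps" "eps <= 1" "0 < \<phi>" "0 < c"
 shows "\<exists>(\<omega> :: real) (h :: real). 0 < \<omega> \<and> 0 < h \<and> (\<forall>\<^sub>F n in sequentially. \<forall>(V :: 'a set) W \<F> \<N>.
  finite V \<and> card V <= n \<and> W \<subseteq> V \<and> card W <= \<omega> * real n \<and> \<F> \<subseteq> Pow V \<and> card \<F> <= 2 * 4 ^ card W \<and>
  \<N> \<subseteq> Pow V \<and> card \<N> <= n + 1 \<and> (\<forall>S\<in>\<N>. c * ln n ^ 6 <= card S) -->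
  (\<exists>Q\<subseteq>V - W. (\<forall>F\<in>\<F>. \<phi> * real n <= card F --> h * real n <= card (F \<inter> Q)) \<and> (\<forall>S\<in>\<N>. card (S \<inter> Q) <= 2 * eps * card S)))"
proof -
 \<comment> \<open>The first bound leaves at least half of a set of size \<phi> n outside
   \<open>W\<close>. The second makes \<open>4 ^ card W\<close> at most \<open>exp (a * n)\<close>,
   which uses up half of the exponent \<open>2 * a * n\<close> obtained from Hoeffding's
   inequality.\<close>
 define \<omega> where "\<omega> = min (\<phi> / 2) (eps\<^sup>2 * \<phi>\<^sup>2 / 32)"
 define h where "h = eps * \<phi> / 4"
 define a where "a = eps\<^sup>2 * \<phi>\<^sup>2 / 16"
 have pos: "\<omega> > 0" "h > 0" "a > 0" using assms by (auto simp: \<omega>_def h_def a_def)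
 have ev1: "\<forall>\<^sub>F n :: nat in sequentially. 4 * exp (- a * n) < 1 / 4" using pos by real_asymp
 have ev2: "\<forall>\<^sub>F n :: nat in sequentially. (n + 1) * (2 * exp (- 2 * eps\<^sup>2 * (c * ln n ^ 6))) < 1 / 4" using assms by real_asymp
 have ev3: "\<forall>\<^sub>F n :: nat in sequentially. 0 < c * ln n ^ 6" using assms by real_asymp
 have main: "\<exists>Q\<subseteq>V - W. (\<forall>F\<in>\<F>. \<phi> * real n <= card F --> h * real n <= card (F \<inter> Q)) \<and> (\<forall>S\<in>\<N>. card (S \<inter> Q) <= 2 * eps * card S)"
  if n: "4 * exp (- a * n) < 1 / 4" "(n + 1) * (2 * exp (- 2 * eps\<^sup>2 * (c * ln n ^ 6))) < 1 / 4" "0 < c * ln n ^ 6" "n > 0"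
   and A: "finite V" "card V <= n" "W \<subseteq> V" "card W <= \<omega> * real n" "\<F> \<subseteq> Pow V" "card \<F> <= 2 * 4 ^ card W"
    "\<N> \<subseteq> Pow V" "card \<N> <= n + 1" "\<forall>S\<in>\<N>. c * ln n ^ 6 <= card S"
  for n and V W :: "'a set" and \<F> \<N>
 proof -
  define F' where "F' = {F \<in> \<F>. \<phi> * real n <= card F}"
  define K where "K = Inl ` F' \<union> Inr ` \<N>"
  define S :: "'a set + 'a set => 'a set" where "S k = (case k of Inl F => F - W | Inr N => N - W)" for k
  define \<tau> where "\<tau> k = (case k of Inl F => eps * \<phi> * real n / 4 | Inr (N :: 'a set) => eps * card N)" for k :: "'a set + 'a set"
  define s where "s k = (case k of Inl F => real n | Inr (N :: 'a set) => rcard N)" for k :: "'a set + 'a set"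
  have finFN: "finite \<F>" "finite \<N>" using A finite_subset[of _ "Pow V"] by auto
  then have finK: "finite K" by (simp add: K_def F'_def)
  have NN: "0 < rcard N" if "N \<in> \<N>" for N using n(3) A(9) that by (meson less_le_trans)
  have finV: "finite F" if "F \<in> \<F> \<or> F \<in> \<N>" for F using that A finite_subset[of F V] by auto
  have "\<exists>Q\<subseteq>V - W. \<forall>k\<in>K. \<bar>card (S k \<inter> Q) - eps * card (S k)\<bar> < \<tau> k"
  proof (rule random_subset[where s = s])
   show "finite (V - W)" "finite K" "0 <= eps" "eps <= 1" using A finK assms by auto
   show "S k \<subseteq> V - W" if k: "k \<in> K" for k
   proof (cases k)
    case (Inl F)
    then have "F \<in> \<F>" using k by (auto simp: K_def F'_def)
    then have "F \<subseteq> V" using A(5) by blast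
    then show ?thesis using Inl by (auto simp: S_def)
   next
    case (Inr N)
    then have "N \<in> \<N>" using k by (auto simp: K_def)
    then have "N \<subseteq> V" using A(7) by blast
    then show ?thesis using Inr by (auto simp: S_def)
   qed
   show "0 < \<tau> k" if "k \<in> K" for k using that assms n NN by (auto simp: K_def F'_def \<tau>_def)
   show "0 < s k \<and> card (S k) <= s k" if k: "k \<in> K" for k
   proof (cases k)
    case (Inl F)
    then have "F \<in> \<F>" using k by (auto simp: K_def F'_def)
    then have "F \<subseteq> V" using A(5) by blast
    then have "card (F - W) <= card V" using A by (intro card_mono) auto
    then show ?thesis using Inl n A by (simp add: s_def S_def)
   next
    case (Inr N)
    then have N: "N \<in> \<N>" using k by (auto simp: K_def)
    then have "card (N - W) <= card N" using finV by (intro card_mono) auto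
    then show ?thesis using Inr NN[OF N] by (simp add: s_def S_def)
   qed
   have "(\<Sum>k\<in>Inl ` F'. 2 * exp (- 2 * (\<tau> k)\<^sup>2 / s k)) = card F' * (2 * exp (- 2 * a * n))"
   proof -
    have e: "2 * (eps * \<phi> * real n / 4)\<^sup>2 / real n = 2 * a * n"
     using n by (simp add: a_def power2_eq_square field_simps)
    have "(\<Sum>k\<in>Inl ` F'. 2 * exp (- 2 * (\<tau> k)\<^sup>2 / s k)) = (\<Sum>k\<in>F'. 2 * exp (- (2 * (eps * \<phi> * real n / 4)\<^sup>2 / real n)))"
     by (subst sum.reindex) (auto simp: \<tau>_def s_def)
    then show ?thesis unfolding e by simp
   qed
   also have "... <= (2 * exp (a * n)) * (2 * exp (- 2 * a * n))"
   proof (rule mult_right_mono)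
    have "rcard F' <= rcard \<F>" using finFN by (auto simp: F'_def intro: card_mono)
    also have "... <= real (2 * 4 ^ card W)" using A by (simp only: of_nat_le_iff)
    also have "... = 2 * exp (ln 4 * card W)" by (simp add: exp_of_nat2_mult)
    also have "ln 4 * card W <= 2 * (eps\<^sup>2 * \<phi>\<^sup>2 / 32 * n)"
    proof (rule mult_mono)
     have "ln (4::real) = 2 * ln 2" using ln_realpow[of 2 2] by simp
     also have "... <= 2 * 1" using ln_2_less_1 by simp
     finally show "ln (4::real) <= 2" by simp
     have "\<omega> * real n <= eps\<^sup>2 * \<phi>\<^sup>2 / 32 * n" by (intro mult_right_mono) (auto simp: \<omega>_def)
     then show "card W <= eps\<^sup>2 * \<phi>\<^sup>2 / 32 * n" using A by linarith
    qed auto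
    also have "2 * (eps\<^sup>2 * \<phi>\<^sup>2 / 32 * n) = a * n" by (simp add: a_def)
    finally show "rcard F' <= 2 * exp (a * n)" by simp
   qed simp
   also have "... = 4 * exp (- a * n)" by (simp add: exp_add[symmetric])
   finally have s1: "(\<Sum>k\<in>Inl ` F'. 2 * exp (- 2 * (\<tau> k)\<^sup>2 / s k)) < 1 / 4" using n(1) by linarith
   have "(\<Sum>k\<in>Inr ` \<N>. 2 * exp (- 2 * (\<tau> k)\<^sup>2 / s k)) = (\<Sum>N\<in>\<N>. 2 * exp (- 2 * eps\<^sup>2 * card N))"
    using NN by (subst sum.reindex) (auto simp: \<tau>_def s_def power2_eq_square intro!: sum.cong)
   also have "... <= (\<Sum>N\<in>\<N>. 2 * exp (- 2 * eps\<^sup>2 * (c * ln n ^ 6)))"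
    using A(9) by (intro sum_mono) (auto intro!: mult_left_mono)
   also have "... <= (n + 1) * (2 * exp (- 2 * eps\<^sup>2 * (c * ln n ^ 6)))"
    using A(8) by (simp only: sum_constant, intro mult_right_mono) auto
   finally have s2: "(\<Sum>k\<in>Inr ` \<N>. 2 * exp (- 2 * (\<tau> k)\<^sup>2 / s k)) < 1 / 4" using n(2) unfolding of_nat_add of_nat_1 by linarith
   have "(\<Sum>k\<in>K. 2 * exp (- 2 * (\<tau> k)\<^sup>2 / s k)) = (\<Sum>k\<in>Inl ` F'. 2 * exp (- 2 * (\<tau> k)\<^sup>2 / s k)) + (\<Sum>k\<in>Inr ` \<N>. 2 * exp (- 2 * (\<tau> k)\<^sup>2 / s k))"
    unfolding K_def using finFN by (intro sum.union_disjoint) (auto simp: F'_def)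
   then show "(\<Sum>k\<in>K. 2 * exp (- 2 * (\<tau> k)\<^sup>2 / s k)) < 1" using s1 s2 by linarith
  qed
  then obtain Q where Q: "Q \<subseteq> V - W" "!!k. k \<in> K ==> \<bar>card (S k \<inter> Q) - eps * card (S k)\<bar> < \<tau> k" by blast
  have QW: "(T - W) \<inter> Q = T \<inter> Q" for T using Q by auto
  have "h * real n <= card (F \<inter> Q)" if F: "F \<in> \<F>" "\<phi> * real n <= card F" for F
  proof -
   have "Inl F \<in> K" using F by (auto simp: K_def F'_def)
   from Q(2)[OF this, unfolded S_def \<tau>_def sum.case QW abs_less_iff]
   have 1: "eps * card (F - W) - eps * \<phi> * real n / 4 < card (F \<inter> Q)" by linarith
   have finW: "finite W" using A finite_subset by blast
   have "card F <= card ((F - W) \<union> W)" using finV[of F] F finW by (intro card_mono) auto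
   then have "card F <= card (F - W) + card W" using card_Un_le[of "F - W" W] by linarith
   moreover have "\<omega> * real n <= \<phi> / 2 * real n" by (intro mult_right_mono) (auto simp: \<omega>_def)
   ultimately have "\<phi> * real n / 2 <= card (F - W)" using F A by linarith
   then have "eps * (\<phi> * real n / 2) <= eps * card (F - W)" using assms by (intro mult_left_mono) auto
   then show ?thesis using 1 by (simp add: h_def)
  qed
  moreover have "card (N \<inter> Q) <= 2 * eps * card N" if N: "N \<in> \<N>" for N
  proof -
   have "Inr N \<in> K" using N by (auto simp: K_def)
   from Q(2)[OF this, unfolded S_def \<tau>_def sum.case QW abs_less_iff]
   have 1: "card (N \<inter> Q) < eps * card (N - W) + eps * card N" by linarith
   have "card (N - W) <= card N" using finV[of N] N by (intro card_mono) auto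
   then have "eps * card (N - W) <= eps * card N" using assms by (intro mult_left_mono) auto
   then show ?thesis using 1 by simp
  qed
  ultimately show ?thesis using Q(1) by blast
 qed
 have "\<forall>\<^sub>F n in sequentially. \<forall>(V :: 'a set) W \<F> \<N>.
  finite V \<and> card V <= n \<and> W \<subseteq> V \<and> card W <= \<omega> * real n \<and> \<F> \<subseteq> Pow V \<and> card \<F> <= 2 * 4 ^ card W \<and>
  \<N> \<subseteq> Pow V \<and> card \<N> <= n + 1 \<and> (\<forall>S\<in>\<N>. c * ln n ^ 6 <= card S) -->
  (\<exists>Q\<subseteq>V - W. (\<forall>F\<in>\<F>. \<phi> * real n <= card F --> h * real n <= card (F \<inter> Q)) \<and> (\<forall>S\<in>\<N>. card (S \<inter> Q) <= 2 * eps * card S))"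
  using ev1 ev2 ev3 eventually_gt_at_top[of 0]
 proof eventually_elim
  case (elim n)
  show ?case by (intro allI impI, elim conjE, rule main[OF elim])
 qed
 then show ?thesis using pos by (intro exI[of _ \<omega>] exI[of _ h]) simp
qed

text \<open>\<open>Q i\<close> has to meet the family generated by \<open>W\<close> and all earlier
  \<open>Q j\<close>, so each set must be small compared with what the later ones tolerate. The
  induction therefore adds a new initial set, whose density \<open>eps1\<close> is chosen below the
  constant \<open>\<omega>1\<close> of the remaining \<open>K\<close> sets; those are found over
  \<open>W \<union> Q0\<close>.\<close>

lemma hit_sequence:
 fixes \<phi> c \<xi> eps :: real
 assumes "0 < \<phi>" "0 < c" "0 < eps"
 shows "\<exists>(\<omega> :: real) (h :: real). 0 < \<omega> \<and> 0 < h \<and> (\<forall>\<^sub>F n in sequentially. \<forall>(V :: 'a set) E p W. good_graph n c \<xi> p V E \<and> V \<noteq> {} \<and> W \<subseteq> V \<and> card W <= \<omega> * real n -->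
  (\<exists>Q :: nat => 'a set. (\<forall>i<K. Q i \<subseteq> V - W) \<and> (\<forall>i<K. \<forall>j<K. i \<noteq> j --> Q i \<inter> Q j = {}) \<and>
   card (\<Union>i<K. Q i) <= eps * real n \<and> (\<forall>v\<in>V. card (E `` {v} \<inter> (\<Union>i<K. Q i)) <= eps * card (E `` {v})) \<and>
   (\<forall>i<K. \<forall>F\<in>hit_family E (\<xi> / 2 * n * p) (W \<union> (\<Union>j<i. Q j)). \<phi> * real n <= card F --> h * real n <= card (F \<inter> Q i))))"
 using assms(3)
proof (induction K arbitrary: eps)
 case 0
 show ?case using 0 by (intro exI[of _ 1] conjI always_eventually) auto
next
 case (Suc K)
 obtain \<omega>1 h1 where w1: "\<omega>1 > 0" "h1 > 0" and IH: "\<forall>\<^sub>F n in sequentially. \<forall>(V :: 'a set) E p W. good_graph n c \<xi> p V E \<and> V \<noteq> {} \<and> W \<subseteq> V \<and> card W <= \<omega>1 * real n -->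
  (\<exists>Q :: nat => 'a set. (\<forall>i<K. Q i \<subseteq> V - W) \<and> (\<forall>i<K. \<forall>j<K. i \<noteq> j --> Q i \<inter> Q j = {}) \<and>
   card (\<Union>i<K. Q i) <= eps / 2 * real n \<and> (\<forall>v\<in>V. card (E `` {v} \<inter> (\<Union>i<K. Q i)) <= eps / 2 * card (E `` {v})) \<and>
   (\<forall>i<K. \<forall>F\<in>hit_family E (\<xi> / 2 * n * p) (W \<union> (\<Union>j<i. Q j)). \<phi> * real n <= card F --> h1 * real n <= card (F \<inter> Q i)))"
  using Suc.IH[of "eps / 2"] Suc.prems by auto
 define eps1 where "eps1 = min 1 (min (eps / 4) (\<omega>1 / 4))"
 have e1: "0 < eps1" "eps1 <= 1" "2 * eps1 <= eps / 2" "2 * eps1 <= \<omega>1 / 2" using Suc.prems w1 by (auto simp: eps1_def)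
 have "c * c > 0" using assms by simp
 from hit_step[OF e1(1,2) assms(1) this, where ?'a = 'a]
 obtain \<omega>2 h2 where w2: "\<omega>2 > 0" "h2 > 0" and st: "\<forall>\<^sub>F n in sequentially. \<forall>(V :: 'a set) W \<F> \<N>.
  finite V \<and> card V <= n \<and> W \<subseteq> V \<and> card W <= \<omega>2 * real n \<and> \<F> \<subseteq> Pow V \<and> card \<F> <= 2 * 4 ^ card W \<and>
  \<N> \<subseteq> Pow V \<and> card \<N> <= n + 1 \<and> (\<forall>S\<in>\<N>. c * c * ln n ^ 6 <= card S) -->
  (\<exists>Q\<subseteq>V - W. (\<forall>F\<in>\<F>. \<phi> * real n <= card F --> h2 * real n <= card (F \<inter> Q)) \<and> (\<forall>S\<in>\<N>. card (S \<inter> Q) <= 2 * eps1 * card S))"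
  by blast
 define \<omega> where "\<omega> = min \<omega>2 (\<omega>1 / 2)"
 define h where "h = min h1 h2"
 have "\<forall>\<^sub>F n in sequentially. \<forall>(V :: 'a set) E p W. good_graph n c \<xi> p V E \<and> V \<noteq> {} \<and> W \<subseteq> V \<and> card W <= \<omega> * real n -->
  (\<exists>Q :: nat => 'a set. (\<forall>i<Suc K. Q i \<subseteq> V - W) \<and> (\<forall>i<Suc K. \<forall>j<Suc K. i \<noteq> j --> Q i \<inter> Q j = {}) \<and>
   card (\<Union>i<Suc K. Q i) <= eps * real n \<and> (\<forall>v\<in>V. card (E `` {v} \<inter> (\<Union>i<Suc K. Q i)) <= eps * card (E `` {v})) \<and>
   (\<forall>i<Suc K. \<forall>F\<in>hit_family E (\<xi> / 2 * n * p) (W \<union> (\<Union>j<i. Q j)). \<phi> * real n <= card F --> h * real n <= card (F \<inter> Q i)))"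
  using IH st
 proof eventually_elim
  case (elim n)
  show ?case
  proof (intro allI impI, elim conjE)
   fix V :: "'a set" and E p W
   assume G: "good_graph n c \<xi> p V E" and ne: "V \<noteq> {}" and W: "W \<subseteq> V" "card W <= \<omega> * real n"
   note g = good_graphD[OF G]
   let ?d = "\<xi> / 2 * n * p"
   define \<N> where "\<N> = insert V ((\<lambda>v. E `` {v}) ` V)"
   have finW: "finite W" using W g finite_subset by blast
   have ww: "card W <= \<omega>2 * real n" "card W <= \<omega>1 / 2 * real n"
   proof -
    have "\<omega> * real n <= \<omega>2 * real n" "\<omega> * real n <= \<omega>1 / 2 * real n" by (intro mult_right_mono; simp add: \<omega>_def)+
    then show "card W <= \<omega>2 * real n" "card W <= \<omega>1 / 2 * real n" using W by linarith+
   qed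
   have famV: "hit_family E ?d W' \<subseteq> Pow V" if "W' \<subseteq> V" for W'
    using g(2) that by (auto simp: hit_family_def inner_bd_def)
   have Nbig: "c * c * ln n ^ 6 <= card (E `` {v})" if "v \<in> V" for v
   proof -
    have "c * c * ln n ^ 6 <= c * (n * p)" using g(7) assms by (simp add: mult.assoc)
    then show ?thesis using g(9)[OF that] by (simp add: mult.assoc)
   qed
   have EvV: "E `` {v} \<subseteq> V" for v using g(2) by auto
   have "\<forall>S\<in>\<N>. c * c * ln n ^ 6 <= card S"
   proof -
    obtain v where v: "v \<in> V" using ne by blast
    have "card (E `` {v}) <= card V" using EvV g by (intro card_mono)
    then have "c * c * ln n ^ 6 <= card V" using Nbig[OF v] by linarith
    then show ?thesis using Nbig by (auto simp: \<N>_def)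
   qed
   then have N1: "\<forall>S\<in>\<N>. c * c * ln n ^ 6 <= card S" .
   have N2: "\<N> \<subseteq> Pow V" using EvV by (auto simp: \<N>_def)
   have N3: "card \<N> <= n + 1"
   proof -
    have "card \<N> <= Suc (card ((\<lambda>v. E `` {v}) ` V))" unfolding \<N>_def using g by (intro card_insert_le_m1) auto
    also have "card ((\<lambda>v. E `` {v}) ` V) <= card V" using g by (intro card_image_le)
    finally show ?thesis using g by linarith
   qed
   have "finite V \<and> card V <= n \<and> W \<subseteq> V \<and> card W <= \<omega>2 * real n \<and> hit_family E ?d W \<subseteq> Pow V \<and>
    card (hit_family E ?d W) <= 2 * 4 ^ card W \<and> \<N> \<subseteq> Pow V \<and> card \<N> <= n + 1 \<and> (\<forall>S\<in>\<N>. c * c * ln n ^ 6 <= card S)"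
    using g(1,6) W(1) ww(1) famV[OF W(1)] card_hit_family(2)[OF finW, of E ?d] N1 N2 N3 by (intro conjI)
   from elim(2)[THEN spec, THEN spec, THEN spec, THEN spec, THEN mp, OF this]
   obtain Q0 where Q0': "Q0 \<subseteq> V - W \<and> (\<forall>F\<in>hit_family E ?d W. \<phi> * real n <= card F --> h2 * real n <= card (F \<inter> Q0)) \<and>
    (\<forall>S\<in>\<N>. card (S \<inter> Q0) <= 2 * eps1 * card S)" by (elim exE)
   then have Q0: "Q0 \<subseteq> V - W" "!!F. F \<in> hit_family E ?d W ==> \<phi> * real n <= card F ==> h2 * real n <= card (F \<inter> Q0)"
    "!!S. S \<in> \<N> ==> card (S \<inter> Q0) <= 2 * eps1 * card S" by simp_all
   have finQ0: "finite Q0" using Q0 g finite_subset by blast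
   have cQ0: "card Q0 <= 2 * eps1 * real n"
   proof -
    have "card (V \<inter> Q0) <= 2 * eps1 * card V" using Q0(3)[of V] by (simp add: \<N>_def)
    moreover have "V \<inter> Q0 = Q0" using Q0 by auto
    moreover have "2 * eps1 * card V <= 2 * eps1 * real n" using g e1 by (intro mult_left_mono) auto
    ultimately show ?thesis by simp
   qed
   have mm: "2 * eps1 * real n <= \<omega>1 / 2 * real n" "2 * eps1 * real n <= eps / 2 * real n" using e1 by (intro mult_right_mono; simp)+
   have "card (W \<union> Q0) <= card W + card Q0" by (rule card_Un_le)
   then have cW: "card (W \<union> Q0) <= \<omega>1 * real n" using ww cQ0 mm by simp
   have "W \<union> Q0 \<subseteq> V" using W Q0 by auto
   then have "good_graph n c \<xi> p V E \<and> V \<noteq> {} \<and> W \<union> Q0 \<subseteq> V \<and> card (W \<union> Q0) <= \<omega>1 * real n" using G ne cW by (intro conjI)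
   from elim(1)[THEN spec, THEN spec, THEN spec, THEN spec, THEN mp, OF this]
   obtain Q where "(\<forall>i<K. Q i \<subseteq> V - (W \<union> Q0)) \<and> (\<forall>i<K. \<forall>j<K. i \<noteq> j --> Q i \<inter> Q j = {}) \<and> (card (\<Union>i<K. Q i) <= eps / 2 * real n) \<and> (\<forall>v\<in>V. card (E `` {v} \<inter> (\<Union>i<K. Q i)) <= eps / 2 * card (E `` {v})) \<and> (\<forall>i<K. \<forall>F\<in>hit_family E ?d (W \<union> Q0 \<union> (\<Union>j<i. Q j)). \<phi> * real n <= card F --> h1 * real n <= card (F \<inter> Q i))" by (elim exE)
   then have Q: "\<forall>i<K. Q i \<subseteq> V - (W \<union> Q0)"
    "\<forall>i<K. \<forall>j<K. i \<noteq> j --> Q i \<inter> Q j = {}"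
    "card (\<Union>i<K. Q i) <= eps / 2 * real n"
    "\<forall>v\<in>V. card (E `` {v} \<inter> (\<Union>i<K. Q i)) <= eps / 2 * card (E `` {v})"
    "\<forall>i<K. \<forall>F\<in>hit_family E ?d (W \<union> Q0 \<union> (\<Union>j<i. Q j)). \<phi> * real n <= card F --> h1 * real n <= card (F \<inter> Q i)" by simp_all
   define Q' where "Q' i = (case i of 0 => Q0 | Suc j => Q j)" for i
   have Un: "(\<Union>j<Suc i. Q' j) = Q0 \<union> (\<Union>j<i. Q j)" for i
    by (simp add: lessThan_Suc_eq_insert_0 Q'_def)
   show "\<exists>Q :: nat => 'a set. (\<forall>i<Suc K. Q i \<subseteq> V - W) \<and> (\<forall>i<Suc K. \<forall>j<Suc K. i \<noteq> j --> Q i \<inter> Q j = {}) \<and>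
    card (\<Union>i<Suc K. Q i) <= eps * real n \<and> (\<forall>v\<in>V. card (E `` {v} \<inter> (\<Union>i<Suc K. Q i)) <= eps * card (E `` {v})) \<and>
    (\<forall>i<Suc K. \<forall>F\<in>hit_family E ?d (W \<union> (\<Union>j<i. Q j)). \<phi> * real n <= card F --> h * real n <= card (F \<inter> Q i))"
   proof (intro exI[of _ Q'] conjI allI impI ballI)
    show "Q' i \<subseteq> V - W" if "i < Suc K" for i using that Q Q0 by (cases i) (auto simp: Q'_def)
    show "Q' i \<inter> Q' j = {}" if "i < Suc K" "j < Suc K" "i \<noteq> j" for i j
    proof -
     have x: "Q l \<inter> Q0 = {}" if "l < K" for l using Q(1) that by blast
     show ?thesis using that Q(2) x by (cases i; cases j) (auto simp: Q'_def)
    qed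
    have "card (\<Union>i<Suc K. Q' i) <= card Q0 + card (\<Union>j<K. Q j)" unfolding Un by (rule card_Un_le)
    then show "card (\<Union>i<Suc K. Q' i) <= eps * real n" using Q(3) cQ0 mm by simp
    show "card (E `` {v} \<inter> (\<Union>i<Suc K. Q' i)) <= eps * card (E `` {v})" if v: "v \<in> V" for v
    proof -
     have "card (E `` {v} \<inter> (\<Union>i<Suc K. Q' i)) <= card (E `` {v} \<inter> Q0) + card (E `` {v} \<inter> (\<Union>j<K. Q j))"
      unfolding Un Int_Un_distrib by (rule card_Un_le)
     moreover have "card (E `` {v} \<inter> Q0) <= 2 * eps1 * card (E `` {v})" using Q0(3)[of "E `` {v}"] v by (simp add: \<N>_def)
     moreover have "2 * eps1 * card (E `` {v}) <= eps / 2 * card (E `` {v})" using e1 by (intro mult_right_mono) auto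
     moreover have "card (E `` {v} \<inter> (\<Union>j<K. Q j)) <= eps / 2 * card (E `` {v})" using Q(4) v by blast
     ultimately show ?thesis by (simp add: field_simps)
    qed
    show "h * real n <= card (F \<inter> Q' i)" if i: "i < Suc K" and F: "F \<in> hit_family E ?d (W \<union> (\<Union>j<i. Q' j))" "\<phi> * real n <= card F" for i F
    proof (cases i)
     case 0
     have "h * real n <= h2 * real n" by (intro mult_right_mono) (auto simp: h_def)
     moreover have "h2 * real n <= card (F \<inter> Q0)" using Q0(2)[of F] F 0 by simp
     ultimately show ?thesis using 0 by (simp add: Q'_def)
    next
     case (Suc l)
     have "h * real n <= h1 * real n" by (intro mult_right_mono) (auto simp: h_def)
     moreover have "h1 * real n <= card (F \<inter> Q l)" using Q(5) F i Suc by (simp only: Un Un_assoc)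
     ultimately show ?thesis using Suc by (simp add: Q'_def)
    qed
   qed
  qed
 qed
 moreover have "\<omega> > 0" "h > 0" using w1 w2 by (auto simp: \<omega>_def h_def)
 ultimately show ?case by (intro exI[of _ \<omega>] exI[of _ h] conjI)
qed

section \<open>Linking two large sets\<close>

text \<open>Unlike in \<open>reach\<close>, earlier vertices are kept, because the neighbourhoods
  have to increase from step to step; a path may therefore skip some of the sets
  \<open>Q j\<close>.\<close>

fun grow :: "('a \<times> 'a) set => (nat => 'a set) => 'a set => 'a set => nat => 'a set" where
 "grow E Q Z A 0 = A"
| "grow E Q Z A (Suc i) = grow E Q Z A i \<union> (E `` grow E Q Z A i \<inter> Q i - Z)"

lemma grow_subset: "grow E Q Z A i \<subseteq> A \<union> (\<Union>j<i. Q j)"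
 by (induction i) (auto simp: less_Suc_eq)

lemma grow_path:
 assumes "v \<in> grow E Q Z A i" "!!j l. j < i ==> l < i ==> j \<noteq> l ==> Q j \<inter> Q l = {}"
 shows "\<exists>a\<in>A. \<exists>zs. last (a # zs) = v \<and> distinct zs \<and> set zs \<subseteq> (\<Union>j<i. Q j) - Z \<and> length zs <= i \<and> chain E (a # zs)"
 using assms
proof (induction i arbitrary: v)
 case 0
 then show ?case by (intro bexI[of _ v] exI[of _ "[]"]) auto
next
 case (Suc i)
 have mono: "(\<Union>j<i. Q j) \<subseteq> (\<Union>j<Suc i. Q j)" for i by (intro UN_mono) auto
 have disj: "Q j \<inter> Q l = {}" if "j < i" "l < i" "j \<noteq> l" for j l using Suc.prems(2)[of j l] that by simp
 show ?case
 proof (cases "v \<in> grow E Q Z A i")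
  case True
  from Suc.IH[OF True disj] obtain a zs where "a \<in> A" "last (a # zs) = v" "distinct zs" "set zs \<subseteq> (\<Union>j<i. Q j) - Z" "length zs <= i" "chain E (a # zs)" by blast
  then show ?thesis using mono[of i] by (intro bexI[of _ a] exI[of _ zs]) auto
 next
  case False
  then obtain u where u: "u \<in> grow E Q Z A i" "(u, v) \<in> E" "v \<in> Q i - Z" using Suc.prems by auto
  from Suc.IH[OF u(1) disj] obtain a zs where a: "a \<in> A" "last (a # zs) = u" "distinct zs" "set zs \<subseteq> (\<Union>j<i. Q j) - Z" "length zs <= i" "chain E (a # zs)" by blast
  have "v \<notin> set zs"
  proof
   assume "v \<in> set zs"
   then obtain j where "j < i" "v \<in> Q j" using a(4) by blast
   then show False using Suc.prems(2)[of j i] u(3) by auto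
  qed
  moreover have "chain E ((a # zs) @ [v])" using a u by (subst successively_append_iff) auto
  ultimately show ?thesis using a u mono[of i] by (intro bexI[of _ a] exI[of _ "zs @ [v]"]) auto
 qed
qed

text \<open>Expansion by \<open>(c * ln n ^ 3 / 2)^2\<close> would lead beyond \<open>n\<close>
  vertices once \<open>card A >= t\<close>, so only the linear alternative of
  \<open>sparse_expand\<close> remains.\<close>

lemma nbhd_large:
 assumes G: "good_graph n c \<xi> p V E" and c: "0 < c" and n: "0 < ln (real n)" "real n < (c * ln (real n) ^ 3 / 2)\<^sup>2 * t"
  and A: "A \<subseteq> V" "t <= rcard A"
 shows "c / 2 * real n <= rcard (E `` A)"
proof -
 note g = good_graphD[OF G]
 have n0: "0 < real n" using n by (cases "n = 0") auto
 define \<beta> where "\<beta> = real n * p / ln (real n) ^ 3"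
 have b: "0 < \<beta>" using n0 g n by (simp add: \<beta>_def)
 have ex: "(c * real n * p - c * real n * p / 2) / p <= card (E `` A) \<or> (c * real n * p / 2 / \<beta>)\<^sup>2 * card A <= card (E `` A)"
 proof (rule sparse_expand[OF g(8)[folded \<beta>_def] A(1) _ g(1) g(5) b])
  show "E `` A \<subseteq> V" using g(2) by auto
  show "0 <= c * real n * p / 2" using c n0 g by simp
  fix x assume x: "x \<in> A"
  then have "E `` {x} \<inter> E `` A = E `` {x}" by auto
  then show "c * real n * p <= card (E `` {x} \<inter> E `` A)" using g(9)[of x] x A by auto
 qed
 have e1: "c * real n * p / 2 / \<beta> = c * ln (real n) ^ 3 / 2" using n0 g n by (simp add: \<beta>_def field_simps)
 have e2: "(c * real n * p - c * real n * p / 2) / p = c / 2 * real n" using g(5) by (simp add: field_simps)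
 have nb: "\<not> (c * ln (real n) ^ 3 / 2)\<^sup>2 * card A <= card (E `` A)"
 proof
  assume "(c * ln (real n) ^ 3 / 2)\<^sup>2 * card A <= card (E `` A)"
  moreover have "card (E `` A) <= card V" using g by (intro card_mono) auto
  moreover have "(c * ln (real n) ^ 3 / 2)\<^sup>2 * t <= (c * ln (real n) ^ 3 / 2)\<^sup>2 * card A" using A by (intro mult_left_mono) auto
  ultimately show False using n g by linarith
 qed
 show ?thesis using ex[unfolded e1 e2] nb by blast
qed

text \<open>While at least \<open>c n / 8\<close> vertices lie outside the current neighbourhood
  \<open>D i\<close>, the cut around it is dense, so its inner boundary is linear.
  \<open>Q i\<close> meets this boundary in linearly many vertices, half of which survive the
  removal of \<open>Z\<close>, and their neighbours enlarge \<open>D i\<close> by another \<xi> n /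
  4. This can happen fewer than \<open>K\<close> times; so \<open>D K\<close> misses fewer than
  \<open>c n / 8\<close> vertices, meets the neighbours of \<open>B\<close> in a linear set, and
  \<open>Q K\<close> contains a vertex there that closes the connection.\<close>

lemma link_exists:
 fixes Q :: "nat => 'a set"
 assumes G: "good_graph n c \<xi> p V E" and pos: "0 < c" "0 < \<xi>" "0 < h" and W: "W \<subseteq> V"
  and Q: "!!i. i < Suc K ==> Q i \<subseteq> V" "!!i j. i < Suc K ==> j < Suc K ==> i \<noteq> j ==> Q i \<inter> Q j = {}"
  and hit: "!!i F. i < Suc K ==> F \<in> hit_family E (\<xi> / 2 * real n * p) (W \<union> (\<Union>j<i. Q j)) ==> \<phi> * real n <= rcard F ==> h * real n <= rcard (F \<inter> Q i)"
  and \<phi>: "\<phi> <= \<xi> / 4" "\<phi> <= c / 8"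
  and n: "0 < ln (real n)" "1 / ln (real n) ^ 3 <= \<xi> / 4" "1 < (\<xi> * ln (real n) ^ 3 / 4)\<^sup>2 * (h / 2)"
  and K: "1 < c / 2 + real K * (\<xi> / 4)"
  and Z: "rcard (Z \<inter> (\<Union>i<Suc K. Q i)) <= h * real n / 2"
  and AB: "A \<subseteq> W" "B \<subseteq> W" "c / 2 * real n <= rcard (E `` A)" "c / 2 * real n <= rcard (E `` B)"
 shows "\<exists>a\<in>A. \<exists>b\<in>B. \<exists>zs. conn E ((\<Union>i<Suc K. Q i) - Z) a b zs \<and> length zs <= Suc K"
proof -
 note g = good_graphD[OF G]
 have n0: "0 < real n" using n by (cases "n = 0") auto
 define \<beta> where "\<beta> = real n * p / ln (real n) ^ 3"
 have b: "0 < \<beta>" using n0 g n by (simp add: \<beta>_def)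
 define C where "C = grow E Q Z A"
 define D where "D i = E `` C i" for i
 have CW: "C i \<subseteq> W \<union> (\<Union>j<i. Q j)" for i using grow_subset[of E Q Z A i] AB by (auto simp: C_def)
 have DV: "D i \<subseteq> V" for i using g(2) by (auto simp: D_def)
 have finD: "finite (D i)" for i using DV g finite_subset by blast
 have mono: "C i \<subseteq> C (Suc i)" "D i \<subseteq> D (Suc i)" for i by (auto simp: C_def D_def)
 have D0: "D 0 = E `` A" by (simp add: D_def C_def)
 have C_suc: "D i \<inter> Q i - Z \<subseteq> C (Suc i)" for i by (auto simp: C_def D_def)
 have QZ: "rcard (F \<inter> Q i) <= rcard (F \<inter> Q i - Z) + h * real n / 2" if "i < Suc K" for F i
 proof -
  have fin: "finite (F \<inter> Q i)" "finite (Z \<inter> (\<Union>i<Suc K. Q i))" using Q(1) that g(1) by (auto intro: finite_subset)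
  have "F \<inter> Q i \<subseteq> (F \<inter> Q i - Z) \<union> (Z \<inter> (\<Union>i<Suc K. Q i))" using that by auto
  then have "card (F \<inter> Q i) <= card ((F \<inter> Q i - Z) \<union> (Z \<inter> (\<Union>i<Suc K. Q i)))" using fin by (intro card_mono) auto
  also have "... <= card (F \<inter> Q i - Z) + card (Z \<inter> (\<Union>i<Suc K. Q i))" by (rule card_Un_le)
  finally show ?thesis using Z by linarith
 qed
 have claim: "rcard (V - D i) < c / 8 * real n \<or> c / 2 * real n + real i * (\<xi> / 4 * real n) <= rcard (D i)" if "i <= K" for i
  using that
 proof (induction i)
  case 0
  then show ?case using AB by (simp add: D0)
 next
  case (Suc i)
  show ?case
  proof (cases "rcard (V - D i) < c / 8 * real n")
   case True
   have "card (V - D (Suc i)) <= card (V - D i)" using mono(2)[of i] g by (intro card_mono) auto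
   then show ?thesis using True by linarith
  next
   case False
   then have big: "c / 2 * real n + real i * (\<xi> / 4 * real n) <= rcard (D i)" using Suc by simp
   have "0 <= real i * (\<xi> / 4 * real n)" using pos n0 by simp
   then have "c / 8 * real n <= rcard (D i)" using big mult_pos_pos[OF pos(1) n0] by (simp add: field_simps)
   then have cut: "\<xi> * (real n)\<^sup>2 * p <= ecount E (D i) (V - D i)" using g(10)[OF DV] False by simp
   \<comment> \<open>Vertices outside \<open>H\<close> contribute at most half of the required cut,
     so the other half leaves from \<open>H\<close>; sparseness limits what a small set can
     contribute and thereby forces \<open>H\<close> to be linear.\<close>
   define H where "H = inner_bd E (\<xi> / 2 * real n * p) (D i)"
   have HD: "H \<subseteq> D i" by (auto simp: H_def inner_bd_def)
   have "ecount E (D i) (V - D i) = ecount E (H \<union> (D i - H)) (V - D i)" using HD by (simp add: Un_absorb1)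
   also have "... = ecount E H (V - D i) + ecount E (D i - H) (V - D i)"
    using finD[of i] HD by (intro ecount_union_left) (auto intro: finite_subset)
   also have "ecount E (D i - H) (V - D i) <= (\<Sum>x\<in>D i - H. \<xi> / 2 * real n * p)"
    unfolding ecount_def
   proof (rule sum_mono)
    fix x assume x: "x \<in> D i - H"
    have eq: "E `` {x} \<inter> (V - D i) = E `` {x} - D i" using g(2) by auto
    have "\<not> \<xi> / 2 * real n * p <= rcard (E `` {x} - D i)" using x unfolding H_def inner_bd_def by blast
    then show "deg_in E x (V - D i) <= \<xi> / 2 * real n * p" unfolding eq by linarith
   qed
   also have "... <= real n * (\<xi> / 2 * real n * p)"
   proof -
    have "card (D i - H) <= card V" using DV g by (intro card_mono) auto
    then have "rcard (D i - H) <= real n" using g by linarith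
    then show ?thesis using pos n0 g by (simp only: sum_constant, intro mult_right_mono) auto
   qed
   also have "ecount E H (V - D i) <= p * rcard H * rcard (V - D i) + \<beta> * sqrt (rcard H * rcard (V - D i))"
    using HD DV by (intro sparse_relD[OF g(8)[folded \<beta>_def]]) auto
   also have "... <= p * rcard H * real n + \<beta> * real n"
   proof (intro add_mono mult_left_mono)
    have v: "card (V - D i) <= n" using card_mono[of V "V - D i"] g by auto
    then show "rcard (V - D i) <= real n" by simp
    have hh: "card H <= n" using card_mono[of V H] HD DV g by fastforce
    have "sqrt (rcard H * rcard (V - D i)) <= sqrt (real n * real n)"
     using v hh by (intro real_sqrt_le_mono mult_mono) auto
    then show "sqrt (rcard H * rcard (V - D i)) <= real n" by simp
   qed (use g b in auto)
   finally have fin1: "\<xi> * (real n)\<^sup>2 * p <= p * rcard H * real n + \<beta> * real n + real n * (\<xi> / 2 * real n * p)" using cut by linarith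
   have "(real n * p) * (\<xi> / 2 * real n) <= (real n * p) * (rcard H + real n * (1 / ln (real n) ^ 3))"
   proof -
    have "(real n * p) * (\<xi> / 2 * real n) = \<xi> * (real n)\<^sup>2 * p - real n * (\<xi> / 2 * real n * p)"
     by (simp add: power2_eq_square field_simps)
    moreover have "(real n * p) * (rcard H + real n * (1 / ln (real n) ^ 3)) = p * rcard H * real n + \<beta> * real n"
     by (simp add: \<beta>_def distrib_left)
    ultimately show ?thesis using fin1 by linarith
   qed
   then have "\<xi> / 2 * real n <= rcard H + real n * (1 / ln (real n) ^ 3)" using n0 g by (simp only: mult_le_cancel_left_pos mult_pos_pos)
   moreover have "real n * (1 / ln (real n) ^ 3) <= real n * (\<xi> / 4)" using n by (intro mult_left_mono) auto
   moreover have "real n * (\<xi> / 4) = \<xi> / 4 * real n" "\<xi> / 2 * real n = \<xi> / 4 * real n + \<xi> / 4 * real n" by simp_all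
   ultimately have "\<xi> / 4 * real n <= rcard H" by linarith
   moreover have "\<phi> * real n <= \<xi> / 4 * real n" using \<phi> by (intro mult_right_mono) auto
   ultimately have "\<phi> * real n <= rcard H" by linarith
   moreover have "H \<in> hit_family E (\<xi> / 2 * real n * p) (W \<union> (\<Union>j<i. Q j))"
    using CW[of i] unfolding H_def D_def hit_family_def by blast
   moreover have iK: "i < Suc K" using Suc by simp
   ultimately have "h * real n <= rcard (H \<inter> Q i)" by (intro hit)
   then have H': "h * real n / 2 <= rcard (H \<inter> Q i - Z)" using QZ[OF iK, of H] by linarith
   define Y where "Y = D (Suc i) - D i"
   have ex: "(\<xi> / 2 * real n * p - \<xi> / 4 * real n * p) / p <= card Y \<or> (\<xi> / 4 * real n * p / \<beta>)\<^sup>2 * card (H \<inter> Q i - Z) <= card Y"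
   proof (rule sparse_expand[OF g(8)[folded \<beta>_def] _ _ g(1) g(5) b])
    show "H \<inter> Q i - Z \<subseteq> V" using HD DV by blast
    show "Y \<subseteq> V" using DV by (auto simp: Y_def)
    show "0 <= \<xi> / 4 * real n * p" using pos n0 g by simp
    fix x assume x: "x \<in> H \<inter> Q i - Z"
    then have "x \<in> C (Suc i)" using C_suc[of i] HD by blast
    then have "E `` {x} \<inter> Y = E `` {x} - D i" by (auto simp: Y_def D_def)
    moreover have "x \<in> H" using x by blast
    ultimately show "\<xi> / 2 * real n * p <= card (E `` {x} \<inter> Y)" by (simp add: H_def inner_bd_def)
   qed
   have e1: "\<xi> / 4 * real n * p / \<beta> = \<xi> * ln (real n) ^ 3 / 4" using n0 g n by (simp add: \<beta>_def field_simps)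
   have e2: "(\<xi> / 2 * real n * p - \<xi> / 4 * real n * p) / p = \<xi> / 4 * real n" using g by (simp add: field_simps)
   have nb: "\<not> (\<xi> * ln (real n) ^ 3 / 4)\<^sup>2 * card (H \<inter> Q i - Z) <= card Y"
   proof
    assume a: "(\<xi> * ln (real n) ^ 3 / 4)\<^sup>2 * card (H \<inter> Q i - Z) <= card Y"
    have "1 * real n < (\<xi> * ln (real n) ^ 3 / 4)\<^sup>2 * (h / 2) * real n" using n n0 by (intro mult_strict_right_mono)
    also have "... = (\<xi> * ln (real n) ^ 3 / 4)\<^sup>2 * (h * real n / 2)" by simp
    also have "... <= (\<xi> * ln (real n) ^ 3 / 4)\<^sup>2 * card (H \<inter> Q i - Z)" using H' by (intro mult_left_mono) auto
    also have "... <= card V" using a card_mono[of V Y] DV g by (fastforce simp: Y_def)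
    finally show False using g by simp
   qed
   have Y: "\<xi> / 4 * real n <= card Y" using ex[unfolded e1 e2] nb by blast
   have "card (D (Suc i)) = card (D i) + card Y"
    using mono(2)[of i] finD unfolding Y_def by (simp add: card_Diff_subset card_mono)
   then have "rcard (D (Suc i)) = rcard (D i) + rcard Y" by simp
   moreover have "real (Suc i) * (\<xi> / 4 * real n) = real i * (\<xi> / 4 * real n) + \<xi> / 4 * real n" by (simp add: algebra_simps)
   ultimately show ?thesis using big Y by linarith
  qed
 qed
 have "rcard (V - D K) < c / 8 * real n"
 proof (rule ccontr)
  assume "\<not> ?thesis"
  then have "c / 2 * real n + real K * (\<xi> / 4 * real n) <= rcard (D K)" using claim[of K] by simp
  also have "... <= real n" using card_mono[OF g(1) DV[of K]] g by linarith
  finally have "(c / 2 + real K * (\<xi> / 4)) * real n <= 1 * real n" by (simp add: algebra_simps)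
  then have "c / 2 + real K * (\<xi> / 4) <= 1" by (rule mult_right_le_imp_le[OF _ n0])
  then show False using K by simp
 qed
 moreover have "rcard (E `` B) <= rcard (D K \<inter> E `` B) + rcard (V - D K)"
 proof -
  have "E `` B \<subseteq> (D K \<inter> E `` B) \<union> (V - D K)" using g(2) by auto
  then have "card (E `` B) <= card ((D K \<inter> E `` B) \<union> (V - D K))" using finD g by (intro card_mono) auto
  also have "... <= card (D K \<inter> E `` B) + card (V - D K)" by (rule card_Un_le)
  finally show ?thesis by linarith
 qed
 moreover have "\<phi> * real n <= c / 8 * real n" using \<phi> by (intro mult_right_mono) auto
 moreover have "c / 2 * real n = c / 8 * real n + c / 8 * real n + c / 4 * real n" "0 <= c / 4 * real n" using pos n0 by (simp_all add: field_simps)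
 ultimately have "\<phi> * real n <= rcard (D K \<inter> E `` B)" using AB by linarith
 moreover have "D K \<inter> E `` B \<in> hit_family E (\<xi> / 2 * real n * p) (W \<union> (\<Union>j<K. Q j))"
 proof -
  have "(C K, B) \<in> Pow (W \<union> (\<Union>j<K. Q j)) \<times> Pow (W \<union> (\<Union>j<K. Q j))" using CW[of K] AB by auto
  then show ?thesis unfolding hit_family_def D_def by (intro UnI2 image_eqI[of _ _ "(C K, B)"]) auto
 qed
 ultimately have "h * real n <= rcard (D K \<inter> E `` B \<inter> Q K)" by (intro hit) auto
 then have "h * real n / 2 <= rcard (D K \<inter> E `` B \<inter> Q K - Z)" using QZ[of K "D K \<inter> E `` B"] by simp
 moreover have "0 < h * real n / 2" using pos n0 by simp
 ultimately have "D K \<inter> E `` B \<inter> Q K - Z \<noteq> {}" by (intro notI) simp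
 then obtain w b where w: "w \<in> D K" "w \<in> Q K" "w \<notin> Z" "b \<in> B" "(b, w) \<in> E" by blast
 then obtain u where u: "u \<in> C K" "(u, w) \<in> E" by (auto simp: D_def)
 have QK: "Q j \<inter> Q l = {}" if "j < K" "l < K" "j \<noteq> l" for j l using Q(2) that by simp
 obtain a zs where a: "a \<in> A" "last (a # zs) = u" "distinct zs" "set zs \<subseteq> (\<Union>j<K. Q j) - Z" "length zs <= K" "chain E (a # zs)"
  using grow_path[OF u(1)[unfolded C_def] QK] by blast
 have "w \<notin> set zs"
 proof
  assume "w \<in> set zs"
  then obtain j where "j < K" "w \<in> Q j" using a(4) by blast
  then show False using Q(2)[of j K] w(2) by auto
 qed
 moreover have "chain E ((a # zs) @ [w, b])"
  using a u w symD[OF g(3) w(5)] by (subst successively_append_iff) auto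
 ultimately have wch: "w \<notin> set zs" "chain E ((a # zs) @ [w, b])" by auto
 have "conn E ((\<Union>i<Suc K. Q i) - Z) a b (zs @ [w])"
 proof -
  have "(\<Union>j<K. Q j) \<subseteq> (\<Union>i<Suc K. Q i)" by (intro UN_mono) auto
  moreover have "w \<in> (\<Union>i<Suc K. Q i)" using w(2) by blast
  ultimately show ?thesis using a w wch unfolding conn_def by auto
 qed
 then show ?thesis using a w by (intro bexI[of _ a] bexI[of _ b] exI[of _ "zs @ [w]"]) auto
qed

section \<open>Reserves that connect prescribed pairs\<close>

text \<open>Multiplicity 3 is what the switching gadgets need, where three connections start at one
  vertex. The index type is fixed to \<open>nat\<close>, because a definition cannot quantify over
  types; other index sets are encoded.\<close>

definition connector :: "'a set => ('a \<times> 'a) set => 'a set => real => real => bool" where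
 "connector V E R q b \<longleftrightarrow> (\<forall>(I :: nat set) x y. finite I \<and> rcard I <= q \<and> (\<forall>i\<in>I. x i \<in> V \<and> y i \<in> V) \<and>
   (\<forall>v. card {i \<in> I. x i = v} <= 3 \<and> card {i \<in> I. y i = v} <= 3) -->
   (\<exists>P. disj_lists I P \<and> (\<forall>i\<in>I. conn E R (x i) (y i) (P i) \<and> real (length (P i)) <= b)))"

abbreviation is_reserve where
 "is_reserve n eps q b V E W R \<equiv> R \<subseteq> V - W \<and> rcard R <= eps * real n \<and>
  (\<forall>v\<in>V. deg_in E v R <= eps * deg E v) \<and> connector V E R q b"

abbreviation reservable where
 "reservable n c \<xi> p \<omega> V E W \<equiv> good_graph n c \<xi> p V E \<and> V \<noteq> {} \<and> W \<subseteq> V \<and> rcard W <= \<omega> * real n \<and>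
  (\<forall>v\<in>V. deg_in E v W <= deg E v / 2)"

abbreviation reserve_pair where
 "reserve_pair n eps q b V E R1 R2 \<equiv> R1 \<subseteq> V \<and> R2 \<subseteq> V \<and> R1 \<inter> R2 = {} \<and> rcard R1 <= eps * real n \<and> rcard R2 <= eps * real n \<and>
  (\<forall>v\<in>V. deg_in E v R1 <= eps * deg E v \<and> deg_in E v R2 <= eps * deg E v) \<and>
  connector V E R1 q b \<and> connector V E R2 q b"

abbreviation layer_system where
 "layer_system n c p L eps \<sigma> V E W Y \<equiv> (\<forall>r<\<sigma>. \<forall>b. \<forall>s<\<sigma>. Y r b s \<subseteq> V - W) \<and>
  (\<forall>r<\<sigma>. \<forall>b. \<forall>s<\<sigma>. \<forall>r'<\<sigma>. \<forall>b'. \<forall>s'<\<sigma>. (r, b, s) \<noteq> (r', b', s') --> Y r b s \<inter> Y r' b' s' = {}) \<and>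
  (\<forall>v\<in>V. \<forall>r<\<sigma>. \<forall>b. \<forall>s<\<sigma>. eps * (1 / 2 ^ r / L + 1 / L\<^sup>2) * c * real n * p / 4 <= deg_in E v (Y r b s)) \<and>
  rcard (\<Union>r<\<sigma>. \<Union>b. \<Union>s<\<sigma>. Y r b s) <= 17 * eps * real n \<and>
  (\<forall>v\<in>V. deg_in E v (\<Union>r<\<sigma>. \<Union>b. \<Union>s<\<sigma>. Y r b s) <= 17 * eps * deg E v)"

abbreviation cycle_list where
 "cycle_list E C \<equiv> distinct C \<and> 3 <= length C \<and> chain E (last C # C)"

abbreviation cycle_cover :: "nat => 'a set => ('a \<times> 'a) set => bool" where
 "cycle_cover j V E \<equiv> \<exists>C. (\<forall>i<j. cycle_list E (C i) \<and> set (C i) \<subseteq> V) \<and> V \<subseteq> (\<Union>i<j. set (C i))"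

abbreviation hamiltonian where
 "hamiltonian V E \<equiv> \<exists>C. distinct C \<and> set C = V \<and> 3 <= length C \<and> chain E (last C # C)"

text \<open>The geometric part sums to at most 2 over \<open>r\<close> and is divided by
  \<open>L\<close>, the uniform part is divided by \<open>L^2\<close>. Against them stand the
  \<open>2 * \<sigma>\<close> choices of \<open>(b, s)\<close> and the \<sigma> choices of
  \<open>r\<close>, where \<sigma> is at most \<open>2 * L\<close>.\<close>

lemma sum_color_weights:
 fixes eps L :: real
 assumes "0 < eps" "1 <= L" "real \<sigma> <= 2 * L"
 shows "(\<Sum>(r, b, s)\<in>{..<\<sigma>} \<times> (UNIV :: bool set) \<times> {..<\<sigma>}. eps * (1 / 2 ^ r / L + 1 / L\<^sup>2)) <= 16 * eps"
proof -
 have geo: "(\<Sum>r<m. 1 / 2 ^ r :: real) <= 2" for m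
 proof -
  have "(\<Sum>r<m. 1 / 2 ^ r :: real) = 2 - 2 / 2 ^ m" by (induction m) (auto simp: field_simps)
  then show ?thesis by simp
 qed
 have "(\<Sum>(r, b, s)\<in>{..<\<sigma>} \<times> (UNIV :: bool set) \<times> {..<\<sigma>}. eps * (1 / 2 ^ r / L + 1 / L\<^sup>2))
  = (\<Sum>r<\<sigma>. 2 * real \<sigma> * (eps * (1 / 2 ^ r / L + 1 / L\<^sup>2)))"
 proof -
  let ?f = "\<lambda>r :: nat. eps * (1 / 2 ^ r / L + 1 / L\<^sup>2)" and ?D = "(UNIV :: bool set) \<times> {..<\<sigma>}"
  have "(\<Sum>(r, b, s)\<in>{..<\<sigma>} \<times> ?D. ?f r) = (\<Sum>r<\<sigma>. \<Sum>y\<in>?D. ?f r)"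
   unfolding sum.cartesian_product by (intro sum.cong) auto
  then show ?thesis by (simp add: card_cartesian_product)
 qed
 also have "... = 2 * real \<sigma> * eps * ((\<Sum>r<\<sigma>. 1 / 2 ^ r) / L + real \<sigma> / L\<^sup>2)"
  by (simp add: sum_distrib_left[symmetric] sum.distrib sum_divide_distrib mult.assoc)
 also have "... <= 2 * (2 * L) * eps * (2 / L + 2 * L / L\<^sup>2)"
  using assms geo by (intro mult_mono add_mono divide_right_mono) (auto intro!: add_nonneg_nonneg divide_nonneg_nonneg sum_nonneg)
 also have "... = 16 * eps" using assms by (simp add: field_simps power2_eq_square)
 finally show ?thesis .
qed

text \<open>A vertex outside \<open>W0\<close> joins layer \<open>(r, b, s)\<close> with probability
  \<open>eps0 * (1 / 2 ^ r / L + 1 / L^2)\<close>. The first summand is adapted to the order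
  \<open>n / (L * 2 ^ r)\<close> of pairs still open in round \<open>r\<close>; the second keeps
  every layer dense enough for concentration and for degrees above \<beta>. The Hoeffding exponent
  has order \<open>L^6 / L^4 = L^2\<close>, against order \<open>n * L^2\<close> events.\<close>

lemma layers_exist:
 fixes c \<xi> eps0 p L :: real and n \<sigma> :: nat
 assumes G: "good_graph n c \<xi> p V E" and ne: "V \<noteq> {}" and c: "0 < c" and e0: "0 < eps0" "16 * eps0 <= 1"
  and W0: "W0 \<subseteq> V" "\<forall>v\<in>V. deg_in E v W0 <= deg E v / 2"
  and L: "L = ln (real n)" "2 <= L" and \<sigma>: "real \<sigma> <= 2 * L"
  and small: "(real n * (8 * L\<^sup>2) + real n + 1) * (2 * exp (- (eps0\<^sup>2 * c\<^sup>2 / 4) * L\<^sup>2)) < 1"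
 shows "\<exists>Ly :: nat => bool => nat => 'a set.
  layer_system n c p L eps0 \<sigma> V E W0 Ly"
proof -
 note g = good_graphD[OF G]
 define \<pi> where "\<pi> r = eps0 * (1 / 2 ^ r / L + 1 / L\<^sup>2)" for r :: nat
 define Col where "Col = {..<\<sigma>} \<times> (UNIV :: bool set) \<times> {..<\<sigma>}"
 define w where "w = (\<lambda>(r, b :: bool, s :: nat). \<pi> r)"
 have \<pi>0: "eps0 / L\<^sup>2 <= \<pi> r" for r using e0 L by (simp add: \<pi>_def field_simps)
 have "0 < eps0 / L\<^sup>2" using e0 L by simp
 then have \<pi>pos: "0 < \<pi> r" for r using \<pi>0[of r] by linarith
 have finC: "finite Col" by (simp add: Col_def)
 have sumw: "sum w Col <= 16 * eps0" unfolding w_def Col_def \<pi>_def using e0 L \<sigma> by (intro sum_color_weights) auto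
 have "\<exists>P. (\<forall>D\<subseteq>Col. measure_pmf.prob P (Some ` D) = sum w D) \<and> set_pmf P \<subseteq> insert None (Some ` Col)"
  using finC sumw e0 \<pi>pos by (intro ex_pmf_option) (auto simp: w_def less_imp_le)
 then obtain P where P: "!!D. D \<subseteq> Col ==> measure_pmf.prob P (Some ` D) = sum w D" by blast
 define N where "N v = E `` {v} - W0" for v
 have NV: "N v \<subseteq> V - W0" for v using g(2) by (auto simp: N_def)
 have finN: "finite (N v)" for v using NV g(1) finite_subset by (metis finite_Diff)
 have Nbig: "c * real n * p / 2 <= rcard (N v)" if v: "v \<in> V" for v
 proof -
  have fE: "finite (E `` {v})" using g(1,2) by (auto intro: finite_subset)
  have "E `` {v} = N v \<union> (E `` {v} \<inter> W0)" by (auto simp: N_def)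
  then have "card (E `` {v}) <= card (N v) + card (E `` {v} \<inter> W0)" by (metis card_Un_le)
  then show ?thesis using W0(2)[rule_format, OF v] g(9)[OF v] by linarith
 qed
 have np: "c * c * L ^ 6 <= c * real n * p" using g(7) c by (simp add: L(1) mult.assoc)
 \<comment> \<open>The \<open>Inl\<close> events control degrees into single layers, the
   \<open>Inr\<close> events the size of the union of all layers and the degrees into it.\<close>
 define K where "K = Inl ` (V \<times> Col) \<union> Inr ` insert (V - W0) (N ` V)"
 define S :: "('a \<times> nat \<times> bool \<times> nat) + 'a set => 'a set" where "S k = (case k of Inl (v, _) => N v | Inr T => T)" for k
 define C :: "('a \<times> nat \<times> bool \<times> nat) + 'a set => (nat \<times> bool \<times> nat) option set" where
  "C k = (case k of Inl (v, x) => Some ` {x} | Inr T => Some ` Col)" for k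
 define \<tau> :: "('a \<times> nat \<times> bool \<times> nat) + 'a set => real" where
  "\<tau> k = (case k of Inl (v, x) => w x * rcard (N v) / 2 | Inr T => eps0 * rcard T)" for k
 have finK: "finite K" using finC g(1) by (simp add: K_def)
 have SV: "S k \<subseteq> V - W0" if "k \<in> K" for k using that by (auto simp: K_def S_def dest!: subsetD[OF NV])
 have finS: "finite (S k)" if "k \<in> K" for k using SV[OF that] g(1) finite_subset by (metis finite_Diff)
 have Sbig: "c * real n * p / 2 <= rcard (S k)" if k: "k \<in> K" for k
 proof -
  obtain v where v: "v \<in> V" "N v \<subseteq> S k"
  proof -
   obtain v0 where v0: "v0 \<in> V" using ne by blast
   show ?thesis
   proof (cases k)
    case (Inl a)
    then obtain v x where "k = Inl (v, x)" "v \<in> V" using k by (auto simp: K_def)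
    then show ?thesis using that[of v] by (simp add: S_def)
   next
    case (Inr T)
    then have "T = V - W0 \<or> T \<in> N ` V" using k by (auto simp: K_def)
    then show ?thesis
    proof
     assume "T = V - W0" then show ?thesis using that[OF v0] NV Inr by (simp add: S_def)
    next
     assume "T \<in> N ` V" then show ?thesis using that Inr by (auto simp: S_def)
    qed
   qed
  qed
  have "card (N v) <= card (S k)" using v finS[OF k] by (intro card_mono)
  then show ?thesis using Nbig[OF v(1)] by linarith
 qed
 have L6: "0 < c * c * L ^ 6" using c L by simp
 have Spos: "0 < rcard (S k)" if "k \<in> K" for k using Sbig[OF that] np L6 by linarith
 have wpos: "0 < w x" and wlow: "eps0 / L\<^sup>2 <= w x" for x using \<pi>pos \<pi>0 by (auto simp: w_def split: prod.split)
 have \<tau>low: "eps0 / L\<^sup>2 / 2 * rcard (S k) <= \<tau> k" if k: "k \<in> K" for k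
 proof (cases k)
  case (Inl a)
  then obtain v x where kk: "k = Inl (v, x)" by (cases a) auto
  have "eps0 / L\<^sup>2 / 2 * rcard (N v) <= w x / 2 * rcard (N v)" using wlow[of x] by (intro mult_right_mono) auto
  then show ?thesis by (simp add: kk \<tau>_def S_def)
 next
  case (Inr T)
  have "1 <= L\<^sup>2" using L by (simp add: power2_eq_square mult_ge1_I)
  then have "eps0 / (L\<^sup>2 * 2) <= eps0 / 1" using e0 by (intro divide_left_mono) linarith+
  then have "eps0 / L\<^sup>2 / 2 <= eps0" by simp
  then have "eps0 / L\<^sup>2 / 2 * rcard T <= eps0 * rcard T" by (intro mult_right_mono) auto
  then show ?thesis by (simp add: Inr \<tau>_def S_def)
 qed
 have e2: "0 < eps0 / L\<^sup>2 / 2" using e0 L by simp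
 have \<tau>pos: "0 < \<tau> k" if "k \<in> K" for k
  using mult_pos_pos[OF e2 Spos[OF that]] \<tau>low[OF that] by linarith
 have "\<exists>\<phi>. (\<forall>v\<in>V - W0. \<phi> v \<in> set_pmf P) \<and>
  (\<forall>k\<in>K. \<bar>card {v \<in> S k. \<phi> v \<in> C k} - (\<Sum>v\<in>S k. measure_pmf.prob P (C k))\<bar> < \<tau> k)"
 proof (rule sampling_card[where s = "\<lambda>k. rcard (S k)" and V = "V - W0"])
  have "2 * exp (- 2 * (\<tau> k)\<^sup>2 / rcard (S k)) <= 2 * exp (- (eps0\<^sup>2 * c\<^sup>2 / 4) * L\<^sup>2)" if k: "k \<in> K" for k
  proof -
   have "(eps0 / L\<^sup>2 / 2 * rcard (S k))\<^sup>2 <= (\<tau> k)\<^sup>2"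
   proof (rule power_mono[OF \<tau>low[OF k]])
    show "0 <= eps0 / L\<^sup>2 / 2 * rcard (S k)" using less_imp_le[OF e2] by (rule mult_nonneg_nonneg) simp
   qed
   then have "2 * (eps0 / L\<^sup>2 / 2 * rcard (S k))\<^sup>2 / rcard (S k) <= 2 * (\<tau> k)\<^sup>2 / rcard (S k)"
    using Spos[OF k] by (intro divide_right_mono mult_left_mono) auto
   moreover have "2 * (eps0 / L\<^sup>2 / 2 * rcard (S k))\<^sup>2 / rcard (S k) = eps0\<^sup>2 / (2 * L ^ 4) * rcard (S k)"
    using Spos[OF k] L by (simp add: field_simps power2_eq_square power4_eq_xxxx)
   moreover have "eps0\<^sup>2 / (2 * L ^ 4) * (c * c * L ^ 6 / 2) <= eps0\<^sup>2 / (2 * L ^ 4) * rcard (S k)"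
    using Sbig[OF k] np L by (intro mult_left_mono) auto
   moreover have "eps0\<^sup>2 / (2 * L ^ 4) * (c * c * L ^ 6 / 2) = (eps0\<^sup>2 * c\<^sup>2 / 4) * L\<^sup>2"
   proof -
    have "L ^ 6 = L ^ 4 * L\<^sup>2" by (simp add: power_add[symmetric])
    then show ?thesis using L by (simp add: field_simps power2_eq_square)
   qed
   ultimately have "(eps0\<^sup>2 * c\<^sup>2 / 4) * L\<^sup>2 <= 2 * (\<tau> k)\<^sup>2 / rcard (S k)" by linarith
   then show ?thesis by simp
  qed
  then have "(\<Sum>k\<in>K. 2 * exp (- 2 * (\<tau> k)\<^sup>2 / rcard (S k))) <= rcard K * (2 * exp (- (eps0\<^sup>2 * c\<^sup>2 / 4) * L\<^sup>2))"
   by (rule sum_bounded_above)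
  also have "... <= (real n * (8 * L\<^sup>2) + real n + 1) * (2 * exp (- (eps0\<^sup>2 * c\<^sup>2 / 4) * L\<^sup>2))"
  proof (intro mult_right_mono)
   have ci: "card (Inl ` X :: (('a \<times> nat \<times> bool \<times> nat) + 'a set) set) = card X"
    "card (Inr ` Y :: (('a \<times> nat \<times> bool \<times> nat) + 'a set) set) = card Y" for X Y by (simp_all add: card_image)
   have "card K <= card (Inl ` (V \<times> Col) :: (('a \<times> nat \<times> bool \<times> nat) + 'a set) set) + card (Inr ` insert (V - W0) (N ` V) :: (('a \<times> nat \<times> bool \<times> nat) + 'a set) set)"
    unfolding K_def by (rule card_Un_le)
   also have "... = card V * card Col + card (insert (V - W0) (N ` V))"
    by (simp only: ci card_cartesian_product)
   also have "card (insert (V - W0) (N ` V)) <= card V + 1"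
    using g(1) card_image_le[OF g(1), of N] by (simp add: card_insert_if)
   also have "card Col = 2 * (\<sigma> * \<sigma>)" by (simp add: Col_def card_cartesian_product)
   finally have "rcard K <= real (card V * (2 * (\<sigma> * \<sigma>)) + (card V + 1))" by (simp only: of_nat_le_iff)
   also have "... = rcard V * (2 * (real \<sigma> * real \<sigma>)) + rcard V + 1" by simp
   also have "... <= real n * (2 * ((2 * L) * (2 * L))) + real n + 1"
    using g(6) \<sigma> L by (intro add_mono mult_mono) auto
   finally show "rcard K <= real n * (8 * L\<^sup>2) + real n + 1" by (simp add: power2_eq_square)
  qed simp
  finally show "(\<Sum>k\<in>K. 2 * exp (- 2 * (\<tau> k)\<^sup>2 / rcard (S k))) < 1" using small by linarith
 qed (use g(1) finK SV \<tau>pos Spos in auto)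
 then obtain \<phi> where \<phi>: "!!k. k \<in> K ==> \<bar>card {v \<in> S k. \<phi> v \<in> C k} - (\<Sum>v\<in>S k. measure_pmf.prob P (C k))\<bar> < \<tau> k" by blast
 define Ly where "Ly r b s = {v \<in> V - W0. \<phi> v = Some (r, b, s)}" for r b s
 define \<Lambda> where "\<Lambda> = (\<Union>r<\<sigma>. \<Union>b. \<Union>s<\<sigma>. Ly r b s)"
 have \<Lambda>: "\<Lambda> = {v \<in> V - W0. \<phi> v \<in> Some ` Col}" by (auto simp: \<Lambda>_def Ly_def Col_def)
 have T: "rcard {v \<in> T. \<phi> v \<in> Some ` Col} <= 17 * eps0 * rcard T" if T: "T = V - W0 \<or> T \<in> N ` V" for T
 proof -
  have k: "Inr T \<in> K" using T by (auto simp: K_def)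
  have "\<bar>card {v \<in> T. \<phi> v \<in> Some ` Col} - (\<Sum>v\<in>T. sum w Col)\<bar> < eps0 * rcard T"
   using \<phi>[OF k] P[of Col] by (simp add: S_def C_def \<tau>_def)
  moreover have "(\<Sum>v\<in>T. sum w Col) <= 16 * eps0 * rcard T"
   using sumw mult_left_mono[OF sumw, of "rcard T"] by (simp add: mult.commute mult.left_commute)
  ultimately show ?thesis by linarith
 qed
 have "Ly r b s \<subseteq> V - W0" for r b s by (auto simp: Ly_def)
 moreover have "Ly r b s \<inter> Ly r' b' s' = {}" if "(r, b, s) \<noteq> (r', b', s')" for r b s r' b' s' using that by (auto simp: Ly_def)
 moreover have "\<pi> r * c * real n * p / 4 <= deg_in E v (Ly r b s)" if v: "v \<in> V" "r < \<sigma>" "s < \<sigma>" for v r b s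
 proof -
  have col: "(r, b, s) \<in> Col" using v by (simp add: Col_def)
  have k: "Inl (v, r, b, s) \<in> K" using v col by (auto simp: K_def)
  have pr: "measure_pmf.prob P (Some ` {(r, b, s)}) = \<pi> r" using P[of "{(r, b, s)}"] col by (simp add: w_def)
  have "\<bar>card {u \<in> N v. \<phi> u \<in> Some ` {(r, b, s)}} - (\<Sum>u\<in>N v. \<pi> r)\<bar> < \<pi> r * rcard (N v) / 2"
   using \<phi>[OF k] unfolding S_def C_def \<tau>_def sum.case prod.case pr by (simp add: w_def)
  note cc = this
  have "\<pi> r * rcard (N v) / 2 <= card {u \<in> N v. \<phi> u \<in> Some ` {(r, b, s)}}" 
  proof -
   have "(\<Sum>u\<in>N v. \<pi> r) = \<pi> r * rcard (N v) / 2 + \<pi> r * rcard (N v) / 2" by simp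
   with cc show ?thesis unfolding abs_less_iff by linarith
  qed
  moreover have eq: "{u \<in> N v. \<phi> u \<in> Some ` {(r, b, s)}} = E `` {v} \<inter> Ly r b s" using g(2) by (auto simp: N_def Ly_def)
  moreover have "\<pi> r / 2 * (c * real n * p / 2) <= \<pi> r / 2 * rcard (N v)" using Nbig[OF v(1)] \<pi>pos[of r] by (intro mult_left_mono) auto
  moreover have "\<pi> r * c * real n * p / 4 = \<pi> r / 2 * (c * real n * p / 2)" "\<pi> r * rcard (N v) / 2 = \<pi> r / 2 * rcard (N v)" by simp_all
  ultimately show ?thesis unfolding eq by linarith
 qed
 moreover have "rcard \<Lambda> <= 17 * eps0 * real n"
 proof -
  have "rcard \<Lambda> <= 17 * eps0 * rcard (V - W0)" using T[of "V - W0"] unfolding \<Lambda> by simp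
  also have "... <= 17 * eps0 * real n"
  proof -
   have "card (V - W0) <= n" using card_mono[OF g(1), of "V - W0"] g(6) by auto
   then show ?thesis using e0 by (intro mult_left_mono) auto
  qed
  finally show ?thesis .
 qed
 moreover have "deg_in E v \<Lambda> <= 17 * eps0 * deg E v" if v: "v \<in> V" for v
 proof -
  have "E `` {v} \<inter> \<Lambda> = {u \<in> N v. \<phi> u \<in> Some ` Col}" using g(2) unfolding \<Lambda> N_def by auto
  then have "deg_in E v \<Lambda> <= 17 * eps0 * rcard (N v)" using T[of "N v"] v by auto
  also have "... <= 17 * eps0 * deg E v"
  proof -
   have "finite (E `` {v})" using g(1,2) by (auto intro: finite_subset)
   then have "card (N v) <= card (E `` {v})" by (intro card_mono) (auto simp: N_def)
   then show ?thesis using e0 by (intro mult_left_mono) auto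
  qed
  finally show ?thesis .
 qed
 ultimately show ?thesis unfolding \<pi>_def \<Lambda>_def by (intro exI[of _ Ly] conjI allI impI ballI)
qed

text \<open>The linking sets are chosen over \<open>W0 \<union> \<Lambda>\<close>, so that they join
  any two large subsets of the layers. One number \<sigma> with \<open>n <= 2 ^ \<sigma>\<close>
  plays two roles: as the number of layers per round it lets a single source grow up to saturation,
  and as the number of rounds it ensures that no pair stays open.\<close>

lemma reserve:
 fixes c \<xi> eps :: real
 assumes "0 < c" "0 < \<xi>" "0 < eps"
 shows "\<exists>(\<omega> :: real) (\<kappa> :: real). 0 < \<omega> \<and> 0 < \<kappa> \<and> (\<forall>\<^sub>F n in sequentially. \<forall>(V :: 'a set) E p W0.
  reservable n c \<xi> p \<omega> V E W0 -->
  (\<exists>R. is_reserve n eps (\<kappa> * real n / ln (real n)) (5 * ln (real n)) V E W0 R))"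
proof -
 define K where "K = nat \<lceil>4 / \<xi>\<rceil> + 1"
 have K: "1 < c / 2 + real K * (\<xi> / 4)"
 proof -
  have "4 / \<xi> <= real K" unfolding K_def by linarith
  then have "4 / \<xi> * (\<xi> / 4) <= real K * (\<xi> / 4)" using assms by (intro mult_right_mono) auto
  then have "1 <= real K * (\<xi> / 4)" using assms by simp
  then show ?thesis using assms by linarith
 qed
 define \<phi> where "\<phi> = min (\<xi> / 4) (c / 8)"
 have \<phi>: "0 < \<phi>" "\<phi> <= \<xi> / 4" "\<phi> <= c / 8" using assms by (auto simp: \<phi>_def)
 have e2: "0 < eps / 2" using assms by simp
 from hit_sequence[OF \<phi>(1) assms(1) e2, where K = "Suc K" and \<xi> = \<xi> and ?'a = 'a]
 obtain \<omega>1 h :: real where wh: "0 < \<omega>1" "0 < h" and seq: "\<forall>\<^sub>F n in sequentially. \<forall>(V :: 'a set) E p W. good_graph n c \<xi> p V E \<and> V \<noteq> {} \<and> W \<subseteq> V \<and> rcard W <= \<omega>1 * real n -->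
  (\<exists>Q :: nat => 'a set. (\<forall>i<Suc K. Q i \<subseteq> V - W) \<and> (\<forall>i<Suc K. \<forall>j<Suc K. i \<noteq> j --> Q i \<inter> Q j = {}) \<and>
   rcard (\<Union>i<Suc K. Q i) <= eps / 2 * real n \<and> (\<forall>v\<in>V. deg_in E v (\<Union>i<Suc K. Q i) <= eps / 2 * deg E v) \<and>
   (\<forall>i<Suc K. \<forall>F\<in>hit_family E (\<xi> / 2 * real n * p) (W \<union> (\<Union>j<i. Q j)). \<phi> * real n <= rcard F --> h * real n <= rcard (F \<inter> Q i)))"
  by (elim exE conjE)
 define eps0 where "eps0 = min 1 (min \<omega>1 eps) / 80"
 have e0: "0 < eps0" "16 * eps0 <= 1" "17 * eps0 <= \<omega>1 / 2" "17 * eps0 <= eps / 2" using assms wh by (auto simp: eps0_def)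
 \<comment> \<open>These bounds make \<open>\<kappa> * n / L\<close> pairs few enough for the layers
   of every round and for the number \<open>zq\<close> of blocked vertices that the linking sets
   tolerate.\<close>
 define \<kappa> where "\<kappa> = min 1 (min (eps0 * c / 16) (h / (8 * real (Suc K))))"
 have \<kappa>: "0 < \<kappa>" "\<kappa> <= 1" "\<kappa> <= eps0 * c / 16" "\<kappa> <= h / (8 * real (Suc K))"
 proof -
  show "0 < \<kappa>" using assms wh e0 by (auto simp: \<kappa>_def)
  show "\<kappa> <= 1" unfolding \<kappa>_def by (rule min.cobounded1)
  show "\<kappa> <= eps0 * c / 16" unfolding \<kappa>_def by (rule min.coboundedI2, rule min.cobounded1)
  show "\<kappa> <= h / (8 * real (Suc K))" unfolding \<kappa>_def by (rule min.coboundedI2, rule min.cobounded2)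
 qed
 define a where "a = eps0\<^sup>2 * c\<^sup>2 / 4"
 have a: "0 < a" using e0 assms by (simp add: a_def)
 have "\<forall>\<^sub>F n :: nat in sequentially. 2 <= ln (real n)" by real_asymp
 moreover have "\<forall>\<^sub>F n :: nat in sequentially. 1 / ln (real n) ^ 3 <= \<xi> / 4" using assms by real_asymp
 moreover have "\<forall>\<^sub>F n :: nat in sequentially. 1 < (\<xi> * ln (real n) ^ 3 / 4)\<^sup>2 * (h / 2)" using assms wh by real_asymp
 moreover have "\<forall>\<^sub>F n :: nat in sequentially. 40 <= eps0 * c * ln (real n)" using assms e0 by real_asymp
 moreover have "\<forall>\<^sub>F n :: nat in sequentially. eps0 * c / (32 * (ln (real n))\<^sup>2) <= 1" using assms e0 by real_asymp
 moreover have "\<forall>\<^sub>F n :: nat in sequentially. 4 <= h * real n" using wh by real_asymp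
 moreover have "\<forall>\<^sub>F n :: nat in sequentially. 1 < (c * ln (real n) ^ 3 / 2)\<^sup>2 * (eps0 * c / (32 * (ln (real n))\<^sup>2))" using assms e0 by real_asymp
 moreover have "\<forall>\<^sub>F n :: nat in sequentially. (real n * (8 * (ln (real n))\<^sup>2) + real n + 1) * (2 * exp (- a * (ln (real n))\<^sup>2)) < 1" using a by real_asymp
 moreover have "\<forall>\<^sub>F n :: nat in sequentially. real (Suc K) <= ln (real n)" by real_asymp
 ultimately have "\<forall>\<^sub>F n in sequentially. \<forall>(V :: 'a set) E p W0.
  reservable n c \<xi> p (\<omega>1 / 2) V E W0 -->
  (\<exists>R. is_reserve n eps (\<kappa> * real n / ln (real n)) (5 * ln (real n)) V E W0 R)"
  using seq
 proof eventually_elim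
  case (elim n)
  define L where "L = ln (real n)"
  note el = elim(1-9)[folded L_def]
  have n0: "1 < real n"
  proof (rule ccontr)
   assume "\<not> 1 < real n"
   then have "n = 0 \<or> n = 1" by linarith
   then show False using el(1) unfolding L_def by auto
  qed
  define \<sigma> where "\<sigma> = nat \<lceil>log 2 (real n)\<rceil>"
  have lg0: "0 < log 2 (real n)" using n0 by simp
  have \<sigma>0: "0 < \<sigma>" using lg0 by (simp add: \<sigma>_def)
  have \<sigma>L: "real \<sigma> <= 2 * L"
  proof -
   have "real \<sigma> <= log 2 (real n) + 1" unfolding \<sigma>_def using lg0 by linarith
   also have "log 2 (real n) = L / ln 2" by (simp add: log_def L_def)
   also have "L / ln 2 <= L / (2 / 3)" using ln2_ge_two_thirds el(1) by (intro divide_left_mono) auto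
   finally show ?thesis using el(1) by simp
  qed
  have n\<sigma>: "real n <= 2 ^ \<sigma>"
  proof -
   have "log 2 (real n) <= real \<sigma>" unfolding \<sigma>_def by linarith
   then have "2 powr (log 2 (real n)) <= 2 powr (real \<sigma>)" by (intro powr_mono) auto
   then show ?thesis using n0 by (simp add: powr_realpow)
  qed
  show ?case
  proof (intro allI impI, elim conjE)
   fix V :: "'a set" and E p W0
   assume G: "good_graph n c \<xi> p V E" and ne: "V \<noteq> {}" and W0: "W0 \<subseteq> V" "rcard W0 <= \<omega>1 / 2 * real n"
    "\<forall>v\<in>V. deg_in E v W0 <= deg E v / 2"
   note g = good_graphD[OF G]
   from layers_exist[OF G ne assms(1) e0(1,2) W0(1) W0(3) L_def el(1) \<sigma>L el(8)[unfolded a_def]]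
   obtain Ly :: "nat => bool => nat => 'a set" where Ly': 
    "layer_system n c p L eps0 \<sigma> V E W0 Ly"
    by (elim exE)
   define \<Lambda> where "\<Lambda> = (\<Union>r<\<sigma>. \<Union>b. \<Union>s<\<sigma>. Ly r b s)"
   have Ly: "!!r b s. r < \<sigma> ==> s < \<sigma> ==> Ly r b s \<subseteq> V - W0"
    "!!r b s r' b' s'. r < \<sigma> ==> r' < \<sigma> ==> s < \<sigma> ==> s' < \<sigma> ==> (r, b, s) \<noteq> (r', b', s') ==> Ly r b s \<inter> Ly r' b' s' = {}"
    "!!v r b s. v \<in> V ==> r < \<sigma> ==> s < \<sigma> ==> eps0 * (1 / 2 ^ r / L + 1 / L\<^sup>2) * c * real n * p / 4 <= deg_in E v (Ly r b s)"
    "rcard \<Lambda> <= 17 * eps0 * real n" "!!v. v \<in> V ==> deg_in E v \<Lambda> <= 17 * eps0 * deg E v"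
    unfolding \<Lambda>_def
    by (rule Ly'[THEN conjunct1, rule_format] Ly'[THEN conjunct2, THEN conjunct1, rule_format]
     Ly'[THEN conjunct2, THEN conjunct2, THEN conjunct1, rule_format]
     Ly'[THEN conjunct2, THEN conjunct2, THEN conjunct2, THEN conjunct1]
     Ly'[THEN conjunct2, THEN conjunct2, THEN conjunct2, THEN conjunct2, rule_format]; assumption)+
   have \<Lambda>V: "\<Lambda> \<subseteq> V - W0" unfolding \<Lambda>_def using Ly(1) by blast
   have WV: "W0 \<union> \<Lambda> \<subseteq> V" using W0 \<Lambda>V by blast
   have "rcard (W0 \<union> \<Lambda>) <= \<omega>1 * real n"
   proof -
    have "card (W0 \<union> \<Lambda>) <= card W0 + card \<Lambda>" by (rule card_Un_le)
    moreover have "17 * eps0 * real n <= \<omega>1 / 2 * real n" using e0 by (intro mult_right_mono) auto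
    ultimately show ?thesis using W0(2) Ly(4) by simp
   qed
   then have "good_graph n c \<xi> p V E \<and> V \<noteq> {} \<and> W0 \<union> \<Lambda> \<subseteq> V \<and> rcard (W0 \<union> \<Lambda>) <= \<omega>1 * real n" using G ne WV by (intro conjI)
   from elim(10)[THEN spec, THEN spec, THEN spec, THEN spec, THEN mp, OF this]
   obtain Q :: "nat => 'a set" where Q': "(\<forall>i<Suc K. Q i \<subseteq> V - (W0 \<union> \<Lambda>)) \<and> (\<forall>i<Suc K. \<forall>j<Suc K. i \<noteq> j --> Q i \<inter> Q j = {}) \<and>
    rcard (\<Union>i<Suc K. Q i) <= eps / 2 * real n \<and> (\<forall>v\<in>V. deg_in E v (\<Union>i<Suc K. Q i) <= eps / 2 * deg E v) \<and>
    (\<forall>i<Suc K. \<forall>F\<in>hit_family E (\<xi> / 2 * real n * p) (W0 \<union> \<Lambda> \<union> (\<Union>j<i. Q j)). \<phi> * real n <= rcard F --> h * real n <= rcard (F \<inter> Q i))"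
    by (elim exE)
   define QQ where "QQ = (\<Union>i<Suc K. Q i)"
   have Q: "!!i. i < Suc K ==> Q i \<subseteq> V - (W0 \<union> \<Lambda>)" "!!i j. i < Suc K ==> j < Suc K ==> i \<noteq> j ==> Q i \<inter> Q j = {}"
    "rcard QQ <= eps / 2 * real n" "!!v. v \<in> V ==> deg_in E v QQ <= eps / 2 * deg E v"
    "!!i F. i < Suc K ==> F \<in> hit_family E (\<xi> / 2 * real n * p) (W0 \<union> \<Lambda> \<union> (\<Union>j<i. Q j)) ==> \<phi> * real n <= rcard F ==> h * real n <= rcard (F \<inter> Q i)"
    unfolding QQ_def
    by (rule Q'[THEN conjunct1, rule_format] Q'[THEN conjunct2, THEN conjunct1, rule_format]
     Q'[THEN conjunct2, THEN conjunct2, THEN conjunct1]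
     Q'[THEN conjunct2, THEN conjunct2, THEN conjunct2, THEN conjunct1, rule_format]
     Q'[THEN conjunct2, THEN conjunct2, THEN conjunct2, THEN conjunct2, rule_format]; assumption)+
   have QQV: "QQ \<subseteq> V - (W0 \<union> \<Lambda>)" unfolding QQ_def using Q(1) by blast
   define \<beta> where "\<beta> = real n * p / L ^ 3"
   have Lp: "0 < L" using el(1) by simp
   have b: "0 < \<beta>" using n0 g(5) Lp by (simp add: \<beta>_def)
   \<comment> \<open>The size that a source can reach even in the thinnest layers, of order
     \<open>n / L^2\<close>; by \<open>nbhd_large\<close>, with expansion of order
     \<open>L^6\<close>, such a set has a linear neighbourhood.\<close>
   define \<tau>0 where "\<tau>0 = eps0 * c / (32 * L\<^sup>2) * real n"
   define zq where "zq = nat \<lfloor>h * real n / 2\<rfloor>"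
   have nb: "c / 2 * real n <= rcard (E `` A)" if "A \<subseteq> \<Lambda>" "\<tau>0 <= rcard A" for A
   proof (rule nbhd_large[OF G assms(1), where t = \<tau>0])
    show "0 < ln (real n)" using Lp by (simp add: L_def)
    have "1 * real n < (c * L ^ 3 / 2)\<^sup>2 * (eps0 * c / (32 * L\<^sup>2)) * real n" using el(7) n0 by (intro mult_strict_right_mono) auto
    then show "real n < (c * ln (real n) ^ 3 / 2)\<^sup>2 * \<tau>0" unfolding \<tau>0_def L_def by (simp only: mult.assoc mult_1)
    show "A \<subseteq> V" using that \<Lambda>V by blast
   qed (use that in auto)
   interpret layered V E p \<beta> \<sigma> \<Lambda> QQ "Suc K" zq \<tau>0
   proof
    show "sparse_rel p \<beta> V E" using g(8) by (simp add: \<beta>_def L_def)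
    fix A B Z assume AB: "A \<subseteq> \<Lambda>" "B \<subseteq> \<Lambda>" "\<tau>0 <= rcard A" "\<tau>0 <= rcard B" "card (Z \<inter> QQ) <= zq"
    have z: "rcard (Z \<inter> QQ) <= h * real n / 2" 
    proof -
     have "0 <= h * real n / 2" using wh by simp
     then show ?thesis using AB(5) unfolding zq_def by linarith
    qed
    show "\<exists>a\<in>A. \<exists>b\<in>B. \<exists>zs. conn E (QQ - Z) a b zs \<and> length zs <= Suc K"
     unfolding QQ_def
    proof (rule link_exists[OF G assms(1,2) wh(2) WV _ Q(2,5) \<phi>(2,3) _ _ _ K])
     show "0 < ln (real n)" "1 / ln (real n) ^ 3 <= \<xi> / 4" "1 < (\<xi> * ln (real n) ^ 3 / 4)\<^sup>2 * (h / 2)" using elim Lp L_def by auto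
     show "c / 2 * real n <= rcard (E `` A)" "c / 2 * real n <= rcard (E `` B)" using nb AB by auto
    qed (use AB z Q(1) in \<open>auto simp: QQ_def\<close>)
   qed (use g b \<sigma>0 QQV \<Lambda>V in auto)
   define q0 where "q0 = \<kappa> * real n / L"
   define \<delta> where "\<delta> r = eps0 * (1 / 2 ^ r / L + 1 / L\<^sup>2) * c * real n * p / 4" for r :: nat
   have \<delta>low: "eps0 * (1 / L\<^sup>2) * c * real n * p / 4 <= \<delta> r" "eps0 * (1 / 2 ^ r / L) * c * real n * p / 4 <= \<delta> r" for r
    unfolding \<delta>_def using e0 assms g(5) n0 Lp
    by (intro divide_right_mono mult_right_mono mult_left_mono; simp)+
   have \<delta>: "0 < \<delta> r \<and> 10 * \<beta> <= \<delta> r \<and> \<tau>0 <= \<delta> r / (8 * p) \<and> q0 / 2 ^ r <= \<delta> r / (4 * p)" for r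
   proof (intro conjI)
    have "0 < eps0 * (1 / L\<^sup>2) * c * real n * p / 4" using e0 assms g(5) n0 Lp by simp
    then show "0 < \<delta> r" using \<delta>low(1)[of r] by linarith
    have "10 * \<beta> = (real n * p / L ^ 3 / 4) * 40" by (simp add: \<beta>_def)
    also have "... <= (real n * p / L ^ 3 / 4) * (eps0 * c * L)" using el(4) g(5) n0 Lp by (intro mult_left_mono) auto
    also have "... = eps0 * (1 / L\<^sup>2) * c * real n * p / 4" using Lp by (simp add: field_simps power2_eq_square power3_eq_cube)
    finally show "10 * \<beta> <= \<delta> r" using \<delta>low(1)[of r] by linarith
    have "\<tau>0 = (eps0 * (1 / L\<^sup>2) * c * real n * p / 4) / (8 * p)" using g(5) Lp by (simp add: \<tau>0_def field_simps)
    also have "... <= \<delta> r / (8 * p)" using \<delta>low(1) g(5) by (intro divide_right_mono) auto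
    finally show "\<tau>0 <= \<delta> r / (8 * p)" .
    have "q0 / 2 ^ r <= (eps0 * c / 16) * real n / L / 2 ^ r" unfolding q0_def using \<kappa>(3) n0 Lp
     by (intro divide_right_mono mult_right_mono) auto
    also have "... = (eps0 * (1 / 2 ^ r / L) * c * real n * p / 4) / (4 * p)" using g(5) Lp by (simp add: field_simps)
    also have "... <= \<delta> r / (4 * p)" using \<delta>low(2) g(5) by (intro divide_right_mono) auto
    finally show "q0 / 2 ^ r <= \<delta> r / (4 * p)" .
   qed
   have q0n: "q0 < real n" "0 <= q0"
   proof -
    have "\<kappa> * real n <= 1 * real n" using \<kappa> by (intro mult_right_mono) auto
    also have "1 * real n < real n * L" using el(1) n0 by simp
    finally show "q0 < real n" using Lp by (simp add: q0_def field_simps)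
    show "0 <= q0" using \<kappa> n0 Lp by (simp add: q0_def)
   qed
   have \<tau>s: "\<tau>0 <= 2 ^ \<sigma>"
   proof -
    have "\<tau>0 <= 1 * real n" unfolding \<tau>0_def using el(5) by (intro mult_right_mono) auto
    then show ?thesis using n\<sigma> by linarith
   qed
   define R where "R = \<Lambda> \<union> QQ"
   have "connector V E R q0 (5 * L)"
    unfolding connector_def
   proof (intro allI impI, elim conjE)
    fix I :: "nat set" and x y
    assume I: "finite I" "rcard I <= q0" and xy: "\<forall>i\<in>I. x i \<in> V \<and> y i \<in> V"
     and mult: "\<forall>v. card {i \<in> I. x i = v} <= 3 \<and> card {i \<in> I. y i = v} <= 3"
    have "\<exists>P. disj_lists I P \<and> (\<forall>i\<in>I. conn E ((\<Union>r'\<in>{0..<\<sigma>}. \<Union>b. \<Union>s<\<sigma>. Ly r' b s) \<union> QQ - {}) (x i) (y i) (P i) \<and> length (P i) <= 2 * \<sigma> + Suc K)"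
    proof (rule connect_all[where \<delta> = \<delta> and ?q0.0 = q0])
     show "Ly r b s \<subseteq> \<Lambda>" if "r < \<sigma>" "s < \<sigma>" for r b s using that unfolding \<Lambda>_def by blast
     show "Ly r b s \<inter> Ly r' b' s' = {}" if "r < \<sigma>" "r' < \<sigma>" "s < \<sigma>" "s' < \<sigma>" "(r, b, s) \<noteq> (r', b', s')" for r b s r' b' s'
      by (rule Ly(2)[OF that])
     show "\<delta> r <= deg_in E v (Ly r b s)" if "r < \<sigma>" "v \<in> V" "s < \<sigma>" for r v b s
      using Ly(3)[OF that(2,1,3)] by (simp add: \<delta>_def)
     show "q0 <= 2 ^ \<sigma>" "q0 < 2 ^ \<sigma>" using q0n n\<sigma> by linarith+
     show "rcard I <= q0 / 2 ^ 0" using I by simp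
     show "card {} + 2 * Suc K * card I <= zq"
     proof -
      have "2 * real (Suc K) * rcard I <= 2 * real (Suc K) * q0" using I(2) by (intro mult_left_mono) auto
      also have "q0 <= (h / (8 * real (Suc K))) * real n / 2"
      proof -
       have "\<kappa> * real n / L <= \<kappa> * real n / 2" using \<kappa> el(1) n0 by (intro divide_left_mono) auto
       also have "... <= (h / (8 * real (Suc K))) * real n / 2" using \<kappa>(4) by (intro divide_right_mono mult_right_mono) auto
       finally show ?thesis by (simp add: q0_def)
      qed
      also have "2 * real (Suc K) * ((h / (8 * real (Suc K))) * real n / 2) = h * real n / 8" by (simp add: field_simps)
      finally have "2 * real (Suc K) * rcard I <= h * real n / 8" by simp
      moreover have "real (2 * Suc K * card I) = 2 * real (Suc K) * rcard I" by (simp only: of_nat_mult of_nat_numeral)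
      ultimately have "real (2 * Suc K * card I) <= h * real n / 2 - 1" using el(6) by linarith
      then have "2 * Suc K * card I <= nat \<lfloor>h * real n / 2\<rfloor>" by (intro le_nat_floor) linarith
      then show ?thesis unfolding zq_def by (simp only: card.empty add_0)
     qed
    qed (use \<delta> \<tau>s I xy mult in auto)
    then obtain P where P: "disj_lists I P" "!!i. i \<in> I ==> conn E ((\<Union>r'\<in>{0..<\<sigma>}. \<Union>b. \<Union>s<\<sigma>. Ly r' b s) \<union> QQ - {}) (x i) (y i) (P i) \<and> length (P i) <= 2 * \<sigma> + Suc K" by blast
    have "(\<Union>r'\<in>{0..<\<sigma>}. \<Union>b. \<Union>s<\<sigma>. Ly r' b s) \<union> QQ - {} = R" unfolding R_def \<Lambda>_def by (simp add: atLeast0LessThan)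
    note eq = this
    have "conn E R (x i) (y i) (P i) \<and> real (length (P i)) <= 5 * L" if "i \<in> I" for i
    proof -
     have "real (length (P i)) <= real (2 * \<sigma> + Suc K)" using P(2)[OF that] by (simp only: of_nat_le_iff)
     also have "... = 2 * real \<sigma> + real (Suc K)" by simp
     also have "... <= 5 * L" using \<sigma>L el(9) by linarith
     finally show ?thesis using P(2)[OF that] unfolding eq by blast
    qed
    then show "\<exists>P. disj_lists I P \<and> (\<forall>i\<in>I. conn E R (x i) (y i) (P i) \<and> real (length (P i)) <= 5 * L)" using P(1) by blast
   qed
   moreover have "R \<subseteq> V - W0" using \<Lambda>V QQV by (auto simp: R_def)
   moreover have "rcard R <= eps * real n"
   proof -
    have "card R <= card \<Lambda> + card QQ" unfolding R_def by (rule card_Un_le)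
    moreover have "17 * eps0 * real n <= eps / 2 * real n" using e0 by (intro mult_right_mono) auto
    ultimately show ?thesis using Q(3) Ly(4) by simp
   qed
   moreover have "deg_in E v R <= eps * deg E v" if v: "v \<in> V" for v
   proof -
    have "card (E `` {v} \<inter> R) <= card (E `` {v} \<inter> \<Lambda>) + card (E `` {v} \<inter> QQ)" unfolding R_def Int_Un_distrib by (rule card_Un_le)
    moreover have "17 * eps0 * deg E v <= eps / 2 * deg E v" using e0 by (intro mult_right_mono) auto
    ultimately show ?thesis using Q(4)[OF v] Ly(5)[OF v] by simp
   qed
   ultimately show "\<exists>R. is_reserve n eps (\<kappa> * real n / ln (real n)) (5 * ln (real n)) V E W0 R"
    unfolding q0_def L_def by blast
  qed
 qed
 then show ?thesis using wh \<kappa> by (intro exI[of _ "\<omega>1 / 2"] exI[of _ \<kappa>]) simp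
qed

section \<open>Assembling walks\<close>

text \<open>A walk is given by its start and the list of its further vertices, so that walks compose by
 concatenation.\<close>

definition walk :: "('a \<times> 'a) set => 'a => 'a list => 'a => bool" where
 "walk E u xs v \<longleftrightarrow> chain E (u # xs) \<and> last (u # xs) = v"

lemma walk_Nil [simp]: "walk E u [] v \<longleftrightarrow> u = v"
 by (simp add: walk_def)

lemma walk_Cons: "walk E u (x # xs) v \<longleftrightarrow> (u, x) \<in> E \<and> walk E x xs v"
 by (auto simp: walk_def successively_Cons)

lemma walk_append: "walk E u xs v ==> walk E v ys w ==> walk E u (xs @ ys) w"
 by (induction xs arbitrary: u) (auto simp: walk_Cons)

lemma walk_chain_snoc: "chain E (u # xs @ [v]) ==> walk E u (xs @ [v]) v"
 by (simp add: walk_def)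

lemma walk_rev:
 assumes "sym E" "walk E u (xs @ [v]) v"
 shows "walk E v (rev xs @ [u]) u"
proof -
 have "chain E (rev (u # xs @ [v]))" using assms by (intro chain_rev) (auto simp: walk_def)
 then show ?thesis by (simp add: walk_def)
qed

lemma walk_concat:
 assumes "!!i. i < r ==> walk E (f i) (w i) (f (Suc i))"
 shows "walk E (f 0) (concat (map w [0..<r])) (f r)"
 using assms by (induction r) (auto intro: walk_append)

lemma mset_concat_map: "mset (concat (map f xs)) = (\<Sum>x\<leftarrow>xs. mset (f x))"
 by (induction xs) auto

lemma mset_concat_upt: "mset (concat (map f [0..<r])) = (\<Sum>i<r. mset (f i))"
 by (induction r) auto

section \<open>Switching gadgets\<close>

text \<open>The rails \<open>a\<close> and \<open>b\<close> together with the links \<open>P l\<close> between \<open>a l\<close> and \<open>b l\<close> are traversed in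
 zigzag: the walk to \<open>a (n + 1)\<close> arrives from \<open>a n\<close>, which it reaches over the link from \<open>b n\<close>.\<close>

lemma zigzag:
 assumes "sym E" "1 <= n" "(x, a 1) \<in> E" "(x, b 1) \<in> E"
  and "!!l. 1 <= l ==> l < n ==> (a l, a (Suc l)) \<in> E \<and> (b l, b (Suc l)) \<in> E"
  and "!!l. 1 <= l ==> l < n ==> walk E (a l) (P l @ [b l]) (b l)"
 shows "\<exists>zs. walk E x zs (a n) \<and>
  mset zs = (\<Sum>l\<in>{1..n}. {#a l#}) + (\<Sum>l\<in>{1..<n}. {#b l#}) + (\<Sum>l\<in>{1..<n}. mset (P l))"
 using assms(2) assms(1,3-)
proof (induction n arbitrary: a b P rule: nat_induct_at_least)
 case base
 then show ?case by (intro exI[of _ "[a 1]"]) (auto simp: walk_Cons)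
next
 case (Suc n)
 have "\<exists>zs. walk E x zs (b n) \<and>
  mset zs = (\<Sum>l\<in>{1..n}. {#b l#}) + (\<Sum>l\<in>{1..<n}. {#a l#}) + (\<Sum>l\<in>{1..<n}. mset (rev (P l)))"
 proof (rule Suc.IH)
  show "walk E (b l) (rev (P l) @ [a l]) (a l)" if "1 <= l" "l < n" for l
   using that Suc.prems by (intro walk_rev) auto
 qed (use Suc.prems in auto)
 then obtain zs where zs: "walk E x zs (b n)"
  "mset zs = (\<Sum>l\<in>{1..n}. {#b l#}) + (\<Sum>l\<in>{1..<n}. {#a l#}) + (\<Sum>l\<in>{1..<n}. mset (P l))" by auto
 have "walk E (b n) (rev (P n) @ [a n]) (a n)" using Suc.hyps Suc.prems(1) Suc.prems(5)[of n] by (intro walk_rev) auto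
 moreover have "walk E (a n) [a (Suc n)] (a (Suc n))" using Suc.hyps Suc.prems(4)[of n] by (simp add: walk_Cons)
 ultimately have "walk E x (zs @ (rev (P n) @ [a n]) @ [a (Suc n)]) (a (Suc n))"
  using zs(1) by (blast intro: walk_append)
 moreover have i1: "{1..Suc n} = insert (Suc n) {1..n}" and i2: "{1..<Suc n} = insert n {1..<n}" and i3: "{1..n} = insert n {1..<n}"
  using Suc.hyps by auto
 have "mset (zs @ (rev (P n) @ [a n]) @ [a (Suc n)]) =
  (\<Sum>l\<in>{1..Suc n}. {#a l#}) + (\<Sum>l\<in>{1..<Suc n}. {#b l#}) + (\<Sum>l\<in>{1..<Suc n}. mset (P l))"
  unfolding i1 i2 using zs(2) unfolding i3 by (simp add: ac_simps)
 ultimately show ?case by blast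
qed

text \<open>A closed walk with \<open>2 * n + 1\<close> vertices besides \<open>u\<close> has even
  length. It splits into two rails of \<open>n\<close> vertices, read off from the two ends of
  \<open>ps\<close>, and the middle vertex \<open>d\<close> opposite to \<open>u\<close>, which is
  adjacent to the last vertex of either rail.\<close>

lemma even_cycle_gadget:
 assumes E: "sym E" and ch: "chain E (u # ps @ [u])" and len: "length ps = 2 * n + 1" "1 <= n"
 obtains a b d where "(u, a 1) \<in> E" "(u, b 1) \<in> E" "(d, a n) \<in> E" "(d, b n) \<in> E"
  "!!l. 1 <= l ==> l < n ==> (a l, a (Suc l)) \<in> E \<and> (b l, b (Suc l)) \<in> E"
  "mset ps = (\<Sum>l\<in>{1..n}. {#a l#}) + (\<Sum>l\<in>{1..n}. {#b l#}) + {#d#}"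
proof -
 define a where "a l = ps ! (l - 1)" for l
 define b where "b l = ps ! (2 * n + 1 - l)" for l
 define d where "d = ps ! n"
 have adj: "(ps ! i, ps ! Suc i) \<in> E" if "Suc i < length ps" for i
 proof -
  have "chain E ps" using ch by (auto simp: successively_Cons successively_append_iff)
  then show ?thesis using that by (simp add: successively_conv_nth)
 qed
 have ne: "ps \<noteq> []" using len by auto
 have u1: "(u, hd ps) \<in> E" "(last ps, u) \<in> E" using ch ne by (auto simp: successively_Cons successively_append_iff)
 show ?thesis
 proof (rule that[of a b d])
  show "(u, a 1) \<in> E" using u1(1) ne by (simp add: a_def hd_conv_nth)
  show "(u, b 1) \<in> E" using u1(2) ne len symD[OF E] by (simp add: b_def last_conv_nth)
  show "(d, a n) \<in> E" using adj[of "n - 1"] len symD[OF E] by (simp add: a_def d_def)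
  show "(d, b n) \<in> E" using adj[of n] len by (simp add: b_def d_def)
  show "(a l, a (Suc l)) \<in> E \<and> (b l, b (Suc l)) \<in> E" if l: "1 <= l" "l < n" for l
  proof
   show "(a l, a (Suc l)) \<in> E" using adj[of "l - 1"] l len by (simp add: a_def)
   have "(ps ! (2 * n - l), ps ! Suc (2 * n - l)) \<in> E" using l len by (intro adj) simp
   moreover have "Suc (2 * n - l) = 2 * n + 1 - l" "2 * n - l = 2 * n + 1 - Suc l" using l by auto
   ultimately have "(b (Suc l), b l) \<in> E" by (simp only: b_def)
   then show "(b l, b (Suc l)) \<in> E" by (rule symD[OF E])
  qed
  have "mset ps = (\<Sum>i<2 * n + 1. {#ps ! i#})"
  proof -
   have "mset ps = mset (concat (map (\<lambda>i. [ps ! i]) [0..<length ps]))" by (simp add: map_nth)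
   then show ?thesis unfolding mset_concat_upt len by simp
  qed
  also have "{..<2 * n + 1} = {..<n} \<union> ({n} \<union> {n<..2 * n})" by auto
  also have "(\<Sum>i\<in>{..<n} \<union> ({n} \<union> {n<..2 * n}). {#ps ! i#}) = (\<Sum>i<n. {#ps ! i#}) + ({#ps ! n#} + (\<Sum>i\<in>{n<..2 * n}. {#ps ! i#}))"
   by (subst sum.union_disjoint; (subst sum.union_disjoint)?; auto)
  also have "(\<Sum>i<n. {#ps ! i#}) = (\<Sum>l\<in>{1..n}. {#a l#})"
   by (rule sum.reindex_bij_witness[of _ "\<lambda>l. l - 1" Suc]) (auto simp: a_def)
  also have "(\<Sum>i\<in>{n<..2 * n}. {#ps ! i#}) = (\<Sum>l\<in>{1..n}. {#b l#})"
   by (rule sum.reindex_bij_witness[of _ "\<lambda>l. 2 * n + 1 - l" "\<lambda>i. 2 * n + 1 - i"]) (auto simp: b_def)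
  finally show "mset ps = (\<Sum>l\<in>{1..n}. {#a l#}) + (\<Sum>l\<in>{1..n}. {#b l#}) + {#d#}"
   by (simp add: d_def ac_simps)
 qed
qed

section \<open>Merging cycles along a ring\<close>

text \<open>The cycle decomposition of \<pi>. \<open>T\<close> contains the least element of each
  orbit, so that every orbit is listed once, starting there.\<close>

lemma orbit_lists:
 assumes "bij_betw \<pi> {..<r} {..<(r :: nat)}"
 obtains T orb where "T \<subseteq> {..<r}" "!!i. i \<in> T ==> orb i \<noteq> []" "!!i. i \<in> T ==> hd (orb i) = i"
  "!!i. i \<in> T ==> distinct (orb i)" "!!i. i \<in> T ==> set (orb i) \<subseteq> {..<r}"
  "!!i m. i \<in> T ==> Suc m < length (orb i) ==> orb i ! Suc m = \<pi> (orb i ! m)" "!!i. i \<in> T ==> \<pi> (last (orb i)) = i"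
  "(\<Union>i\<in>T. set (orb i)) = {..<r}" "!!i j. i \<in> T ==> j \<in> T ==> i \<noteq> j ==> set (orb i) \<inter> set (orb j) = {}"
proof -
 \<comment> \<open>\<open>permutation\<close> and \<open>support\<close> concern maps on the whole
   type, hence the extension by the identity.\<close>
 define q where "q i = (if i < r then \<pi> i else i)" for i
 have qv: "q x = (if x < r then \<pi> x else x)" for x by (simp add: q_def)
 have "q permutes {..<r}"
 proof (rule bij_imp_permutes)
  show "bij_betw q {..<r} {..<r}" using assms by (rule bij_betw_cong[THEN iffD1, rotated]) (simp add: q_def)
 qed (simp add: q_def)
 then have perm: "permutation q" by (auto simp: permutation_permutes)
 define Ob where "Ob i = set (support q i)" for i
 have O_range: "Ob i = range (\<lambda>m. (q ^^ m) i)" for i unfolding Ob_def by (rule support_set[OF perm])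
 have self: "i \<in> Ob i" for i unfolding O_range by (rule image_eqI[of _ _ 0]) auto
 have eq: "Ob i = Ob j" if "i \<in> Ob j" for i j
 proof -
  have "Ob i \<inter> Ob j \<noteq> {}" using self[of i] that by blast
  moreover have "disjoint (range Ob)" using disjoint_support[OF perm] by (simp add: Ob_def)
  ultimately show ?thesis unfolding disjoint_def by blast
 qed
 have qr: "(q ^^ m) i < r" if "i < r" for i m
 proof (induction m)
  case (Suc m)
  have "\<pi> ((q ^^ m) i) \<in> {..<r}" using assms Suc bij_betwE by blast
  moreover have "q ((q ^^ m) i) = \<pi> ((q ^^ m) i)" using qv[of "(q ^^ m) i"] Suc by (simp only: if_True)
  ultimately show ?case by simp
 qed (use that in simp)
 have step: "q ((q ^^ m) i) = \<pi> ((q ^^ m) i)" if "i < r" for i m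
  using qv[of "(q ^^ m) i"] qr[OF that, of m] by (simp only: if_True)
 have Or: "Ob i \<subseteq> {..<r}" if "i < r" for i unfolding O_range using qr[OF that] by auto
 have finO: "finite (Ob i)" for i by (simp add: Ob_def)
 define T where "T = {i. i < r \<and> i = Min (Ob i)}"
 show ?thesis
 proof (rule that[of T "\<lambda>i. support q i"])
  show "T \<subseteq> {..<r}" by (auto simp: T_def)
  fix i assume i: "i \<in> T"
  then have ir: "i < r" by (simp add: T_def)
  have lp: "0 < least_power q i" by (rule least_power_of_permutation(2)[OF perm])
  show "support q i \<noteq> []" using lp by simp
  show "hd (support q i) = i" using lp by (simp add: hd_map upt_conv_Cons)
  show "distinct (support q i)" using cycle_of_permutation[OF perm, of i] by simp
  show "set (support q i) \<subseteq> {..<r}" using Or[OF ir] unfolding Ob_def .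
  show "support q i ! Suc m = \<pi> (support q i ! m)" if "Suc m < length (support q i)" for m
   using that step[OF ir, of m] by simp
  have "last (support q i) = (q ^^ (least_power q i - 1)) i" using lp by (simp add: last_map)
  moreover have "q ((q ^^ (least_power q i - 1)) i) = i"
  proof -
   have "q ((q ^^ (least_power q i - 1)) i) = (q ^^ Suc (least_power q i - 1)) i" by simp
   also have "... = i" using lp least_power_of_permutation(1)[OF perm, of i] by simp
   finally show ?thesis .
  qed
  ultimately show "\<pi> (last (support q i)) = i" using step[OF ir, of "least_power q i - 1"] by simp
 next
  show "(\<Union>i\<in>T. set (support q i)) = {..<r}"
  proof
   show "(\<Union>i\<in>T. set (support q i)) \<subseteq> {..<r}" using Or unfolding Ob_def T_def by blast
   show "{..<r} \<subseteq> (\<Union>i\<in>T. set (support q i))"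
   proof
    fix j assume j: "j \<in> {..<r}"
    define i where "i = Min (Ob j)"
    have iO: "i \<in> Ob j" unfolding i_def using finO self by (intro Min_in) auto
    then have "Ob i = Ob j" by (rule eq)
    then have "i \<in> T" using Or[of j] j iO by (auto simp: T_def i_def)
    moreover have "j \<in> Ob i" using \<open>Ob i = Ob j\<close> self by simp
    ultimately show "j \<in> (\<Union>i\<in>T. set (support q i))" unfolding Ob_def by blast
   qed
  qed
  show "set (support q i) \<inter> set (support q j) = {}" if "i \<in> T" "j \<in> T" "i \<noteq> j" for i j
  proof (rule ccontr)
   assume "\<not> ?thesis"
   then obtain m where "m \<in> Ob i" "m \<in> Ob j" unfolding Ob_def by blast
   then have "Ob i = Ob j" using eq by metis
   then show False using that by (auto simp: T_def)
  qed
 qed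
qed

text \<open>In its first state gadget \<open>i\<close> offers the walk \<open>tA i\<close> from \<open>B i\<close> to \<open>c i\<close> and the edge from \<open>d i\<close> to
 \<open>e i\<close>, in its second state the walk \<open>tB i\<close> from \<open>B i\<close> to \<open>e i\<close> and the edge from \<open>d i\<close> to \<open>c i\<close>. With all
 gadgets in the first state there is one ring through all edges \<open>(d i, e i)\<close>, and the paths \<open>T i\<close> form
 further cycles, one for each orbit of \<open>\<pi>\<close>. Switching one gadget per orbit inserts them all into the ring.\<close>

lemma ring_cycle:
 assumes r: "0 < r" and bij: "bij_betw \<pi> {..<r} {..<r}"
  and T: "!!i. i < r ==> walk E (A i) (T i) (B (\<pi> i))"
  and tA: "!!i. i < r ==> walk E (B i) (tA i) (c i)" and tB: "!!i. i < r ==> walk E (B i) (tB i) (e i)"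
  and d: "!!i. i < r ==> (d i, c i) \<in> E \<and> (d i, e i) \<in> E"
  and ms: "!!i. i < r ==> add_mset (c i) (mset (tB i)) = add_mset (e i) (mset (tA i))"
  and k: "!!i. i < r ==> walk E (c i) (k i @ [A i]) (A i)"
  and m: "!!i. i < r ==> walk E (e i) (m i @ [d (Suc i mod r)]) (d (Suc i mod r))"
 shows "\<exists>C. C \<noteq> [] \<and> chain E (last C # C) \<and> mset C = (\<Sum>i<r. mset (tA i @ [d i, e i] @ m i @ k i @ [A i] @ T i))"
proof -
 obtain R orb where R: "R \<subseteq> {..<r}" "!!i. i \<in> R ==> orb i \<noteq> []" "!!i. i \<in> R ==> hd (orb i) = i"
  "!!i. i \<in> R ==> distinct (orb i)" "!!i. i \<in> R ==> set (orb i) \<subseteq> {..<r}"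
  "!!i m. i \<in> R ==> Suc m < length (orb i) ==> orb i ! Suc m = \<pi> (orb i ! m)" "!!i. i \<in> R ==> \<pi> (last (orb i)) = i"
  "(\<Union>i\<in>R. set (orb i)) = {..<r}" "!!i j. i \<in> R ==> j \<in> R ==> i \<noteq> j ==> set (orb i) \<inter> set (orb j) = {}"
  by (rule orbit_lists[OF bij]) (rule that; assumption)
 define kT where "kT j = k j @ [A j] @ T j" for j
 define U where "U j = tA j @ kT j" for j
 have kT: "walk E (c j) (kT j) (B (\<pi> j))" if "j < r" for j
  unfolding kT_def using walk_append[OF k[OF that] T[OF that]] by simp
 have U: "walk E (B j) (U j) (B (\<pi> j))" if "j < r" for j
  unfolding U_def using tA[OF that] kT[OF that] by (rule walk_append)
 have chainU: "walk E (B j) (concat (map U (j # js))) (B (\<pi> (last (j # js))))"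
  if "set (j # js) \<subseteq> {..<r}" "!!m. Suc m < length (j # js) ==> (j # js) ! Suc m = \<pi> ((j # js) ! m)" for j js
  using that
 proof (induction js arbitrary: j)
  case Nil
  then show ?case using U by simp
 next
  case (Cons j' js)
  have "walk E (B j') (concat (map U (j' # js))) (B (\<pi> (last (j' # js))))"
  proof (rule Cons.IH)
   show "(j' # js) ! Suc m = \<pi> ((j' # js) ! m)" if "Suc m < length (j' # js)" for m
    using Cons.prems(2)[of "Suc m"] that by simp
  qed (use Cons.prems in auto)
  moreover have "walk E (B j) (U j) (B j')" using U[of j] Cons.prems(1) Cons.prems(2)[of 0] by simp
  ultimately show ?case using walk_append by fastforce
 qed
 \<comment> \<open>For the representative of an orbit the way from \<open>d i\<close> to
   \<open>e i\<close> enters at \<open>c i\<close>, runs through all paths of the orbit with its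
   other gadgets in the first state, returns to \<open>B i\<close> and leaves by
   \<open>tB i\<close>. All other gadgets contribute the edge to \<open>e i\<close>.\<close>
 define seg where "seg i = (if i \<in> R then [c i] @ kT i @ concat (map U (tl (orb i))) @ tB i else [e i])" for i
 have seg: "walk E (d i) (seg i) (e i)" if i: "i < r" for i
 proof (cases "i \<in> R")
  case True
  then obtain js where js: "orb i = i # js" using R(2,3)[OF True] by (cases "orb i") auto
  have main: "walk E (c i) (kT i @ concat (map U js)) (B i)"
  proof (cases js)
   case Nil
   then show ?thesis using kT[OF i] R(7)[OF True] js by simp
  next
   case (Cons j' js')
   have "j' = \<pi> i" using R(6)[OF True, of 0] js Cons by simp
   moreover have "walk E (B j') (concat (map U (j' # js'))) (B (\<pi> (last (j' # js'))))"
   proof (rule chainU)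
    show "set (j' # js') \<subseteq> {..<r}" using R(5)[OF True] js Cons by simp
    show "(j' # js') ! Suc m = \<pi> ((j' # js') ! m)" if "Suc m < length (j' # js')" for m
     using R(6)[OF True, of "Suc m"] js Cons that by simp
   qed
   moreover have "\<pi> (last (j' # js')) = i" using R(7)[OF True] js Cons by simp
   ultimately show ?thesis using walk_append[OF kT[OF i]] Cons by simp
  qed
  have "walk E (d i) [c i] (c i)" using d[OF i] by (simp add: walk_Cons)
  from walk_append[OF walk_append[OF this main] tB[OF i]] show ?thesis using True js by (simp add: seg_def)
 next
  case False
  then show ?thesis using d[OF i] by (simp add: seg_def walk_Cons)
 qed
 define w where "w i = seg i @ m i @ [d (Suc i mod r)]" for i
 define C where "C = concat (map w [0..<r])"
 define f where "f i = d (i mod r)" for i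
 have "walk E (f 0) C (f r)" unfolding C_def
 proof (rule walk_concat)
  fix i assume i: "i < r"
  show "walk E (f i) (w i) (f (Suc i))"
   using walk_append[OF seg[OF i] m[OF i]] i by (simp add: w_def f_def)
 qed
 then have W: "walk E (d 0) C (d 0)" by (simp add: f_def)
 have Cne: "C \<noteq> []" using r by (auto simp: C_def w_def)
 \<comment> \<open>By \<open>ms\<close> the vertices of \<open>tB i\<close> together with
   \<open>c i\<close> are those of \<open>tA i\<close> together with \<open>e i\<close>, so a
   switched gadget covers the same vertices as an unswitched one.\<close>
 have segm: "mset (seg i) = {#e i#} + (if i \<in> R then (\<Sum>j\<in>set (orb i). mset (U j)) else {#})" if i: "i < r" for i
 proof (cases "i \<in> R")
  case True
  then obtain js where js: "orb i = i # js" using R(2,3)[OF True] by (cases "orb i") auto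
  have dist: "distinct (i # js)" using R(4)[OF True] js by simp
  have "mset (concat (map U js)) = (\<Sum>j\<in>set js. mset (U j))"
   unfolding mset_concat_map using dist by (subst sum_list_distinct_conv_sum_set) auto
  then show ?thesis using True js dist ms[OF i] by (simp add: seg_def U_def ac_simps)
 qed (simp add: seg_def)
 have dshift: "(\<Sum>i<r. {#d (Suc i mod r)#}) = (\<Sum>i<r. {#d i#})"
 proof -
  obtain r' where r': "r = Suc r'" using r by (cases r) auto
  have "(\<Sum>i<r. {#d (Suc i mod r)#}) = (\<Sum>i<r'. {#d (Suc i)#}) + {#d 0#}" unfolding r' by simp
  also have "... = (\<Sum>i<r. {#d i#})" unfolding r' by (simp add: sum.lessThan_Suc_shift del: sum.lessThan_Suc)
  finally show ?thesis .
 qed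
 have "mset C = (\<Sum>i<r. mset (w i))" unfolding C_def by (rule mset_concat_upt)
 also have "... = (\<Sum>i<r. mset (seg i)) + (\<Sum>i<r. mset (m i)) + (\<Sum>i<r. {#d (Suc i mod r)#})"
 proof -
  have "mset (w i) = mset (seg i) + mset (m i) + {#d (Suc i mod r)#}" for i by (simp add: w_def)
  then show ?thesis by (simp only: sum.distrib)
 qed
 also have "(\<Sum>i<r. mset (seg i)) = (\<Sum>i<r. {#e i#}) + (\<Sum>i<r. mset (U i))"
 proof -
  have "(\<Sum>i<r. mset (seg i)) = (\<Sum>i<r. {#e i#}) + (\<Sum>i<r. if i \<in> R then (\<Sum>j\<in>set (orb i). mset (U j)) else {#})"
   unfolding sum.distrib[symmetric] by (rule sum.cong[OF refl], rule segm) simp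
  also have "(\<Sum>i<r. if i \<in> R then (\<Sum>j\<in>set (orb i). mset (U j)) else {#}) = (\<Sum>i\<in>R. \<Sum>j\<in>set (orb i). mset (U j))"
   using R(1) by (simp add: sum.inter_restrict[symmetric] Int_absorb1)
  also have "... = (\<Sum>j\<in>(\<Union>i\<in>R. set (orb i)). mset (U j))"
   using R(1,9) finite_subset[OF R(1)] by (subst sum.UNION_disjoint) auto
  finally show ?thesis unfolding R(8) .
 qed
 finally have fin: "mset C = (\<Sum>i<r. {#e i#}) + (\<Sum>i<r. mset (U i)) + (\<Sum>i<r. mset (m i)) + (\<Sum>i<r. {#d i#})"
  unfolding dshift .
 have "mset C = (\<Sum>i<r. mset (tA i @ [d i, e i] @ m i @ k i @ [A i] @ T i))"
 proof -
  have "mset (tA i @ [d i, e i] @ m i @ k i @ [A i] @ T i) = {#e i#} + mset (U i) + mset (m i) + {#d i#}" for i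
   by (simp add: U_def kT_def)
  then show ?thesis unfolding fin by (simp only: sum.distrib)
 qed
 moreover have "chain E (last C # C)" using W Cne by (simp add: walk_def)
 ultimately show ?thesis using Cne by blast
qed

section \<open>Building the gadgets inside two reserves\<close>

lemma disj_listsD: "disj_lists I P ==> i \<in> I ==> j \<in> I ==> i \<noteq> j ==> set (P i) \<inter> set (P j) = {}"
 unfolding disj_lists_def by (drule (1) bspec, drule (1) bspec, drule (1) mp)

lemma disj_lists_subset: "disj_lists I P ==> J \<subseteq> I ==> disj_lists J P"
 unfolding disj_lists_def by (meson subsetD)

text \<open>Vertices are accounted for by multisets: an equation with \<open>mset_set\<close> says
  at once that every vertex is used and that none is used twice.\<close>

lemma sum_mset_disj_lists:
 assumes "finite I" "disj_lists I P" "!!i. i \<in> I ==> distinct (P i)"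
 shows "(\<Sum>i\<in>I. mset (P i)) = mset_set (\<Union>i\<in>I. set (P i))"
 using assms
proof (induction I rule: finite_induct)
 case (insert x F)
 have "set (P x) \<inter> set (P i) = {}" if i: "i \<in> F" for i
 proof (rule disj_listsD[OF insert.prems(1)])
  show "x \<noteq> i" using i insert.hyps by auto
 qed (use i in auto)
 then have d: "set (P x) \<inter> (\<Union>i\<in>F. set (P i)) = {}" by auto
 have "disj_lists F P" using insert.prems(1) by (rule disj_lists_subset) auto
 then have IH: "(\<Sum>i\<in>F. mset (P i)) = mset_set (\<Union>i\<in>F. set (P i))" using insert.IH insert.prems(2) by blast
 have x: "mset (P x) = mset_set (set (P x))" using insert.prems(2)[of x] by (simp add: mset_set_set)
 have "(\<Sum>i\<in>insert x F. mset (P i)) = mset_set (set (P x)) + mset_set (\<Union>i\<in>F. set (P i))"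
  unfolding sum.insert[OF insert.hyps] x IH ..
 also have "... = mset_set (set (P x) \<union> (\<Union>i\<in>F. set (P i)))" using d insert.hyps by (intro mset_set_Union[symmetric]) auto
 finally show ?case by simp
qed simp

text \<open>Converts the multiplicity condition of \<open>connector\<close> into a multiset count,
  so that it follows from the accounting of vertices.\<close>

lemma card_eq_count: "finite J ==> card {j \<in> J. x j = v} = count (\<Sum>j\<in>J. {#x j#}) v"
proof (induction J rule: finite_induct)
 case (insert j F)
 have "{i \<in> insert j F. x i = v} = (if x j = v then insert j {i \<in> F. x i = v} else {i \<in> F. x i = v})" by auto
 then show ?case using insert by simp
qed simp

lemma sum_subseteq_mset:
 "(!!i. i \<in> I ==> f i \<subseteq># g i) ==> (\<Sum>i\<in>I. f i) \<subseteq># (\<Sum>i\<in>I. g i)"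
 by (induction I rule: infinite_finite_induct) (auto intro!: subset_mset.add_mono)

text \<open>Of three connections in \<open>R1\<close> from \<open>B i\<close> to \<open>D i\<close>,
  two have lengths of equal parity; together with \<open>B i\<close> and \<open>D i\<close> they
  form an even cycle, to which \<open>even_cycle_gadget\<close> applies. Connections in
  \<open>R2\<close> supply the rungs between the rails, the exit from \<open>c i\<close> to
  \<open>A i\<close>, and the passage from \<open>e i\<close> to the next \<open>d\<close>. Reserve
  vertices outside \<open>S\<close> stay uncovered here and are left to the paths between the
  blocks.\<close>

lemma gadget_system:
 fixes A B D :: "nat => 'a" and q b :: real
 assumes E: "sym E" and con: "connector V E R1 q b" "connector V E R2 q b"
  and q: "3 * real r <= q" "real r * (b + 1) <= q"
  and inj: "inj_on A {..<r}" "inj_on B {..<r}" "inj_on D {..<r}"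
  and V: "A ` {..<r} \<subseteq> V" "B ` {..<r} \<subseteq> V" "D ` {..<r} \<subseteq> V" "R1 \<subseteq> V" "R2 \<subseteq> V" "finite V"
  and disj: "R1 \<inter> R2 = {}" "D ` {..<r} \<inter> (R1 \<union> R2) = {}"
 shows "\<exists>tA tB c d e k m S. (\<forall>i<r. walk E (B i) (tA i) (c i) \<and> walk E (B i) (tB i) (e i) \<and>
   (d i, c i) \<in> E \<and> (d i, e i) \<in> E \<and> add_mset (c i) (mset (tB i)) = add_mset (e i) (mset (tA i)) \<and>
   walk E (c i) (k i @ [A i]) (A i) \<and> walk E (e i) (m i @ [d (Suc i mod r)]) (d (Suc i mod r))) \<and>
  S \<subseteq> R1 \<union> R2 \<union> D ` {..<r} \<and> (\<Sum>i<r. mset (tA i @ [d i, e i] @ m i @ k i)) = mset_set S"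
proof -
 have finR: "finite R1" "finite R2" using V finite_subset by auto
 \<comment> \<open>Request \<open>i\<close> belongs to gadget \<open>i div 3\<close>, which gives
   three connections per gadget.\<close>
 have "finite {..<3 * r} \<and> rcard {..<3 * r} <= q \<and> (\<forall>i\<in>{..<3 * r}. B (i div 3) \<in> V \<and> D (i div 3) \<in> V) \<and>
   (\<forall>v. card {i \<in> {..<3 * r}. B (i div 3) = v} <= 3 \<and> card {i \<in> {..<3 * r}. D (i div 3) = v} <= 3)"
 proof (intro conjI ballI allI)
  have three: "card {i \<in> {..<3 * r}. f (i div 3) = v} <= 3" if "inj_on f {..<r}" for f :: "nat => 'a" and v
  proof (cases "\<exists>j<r. f j = v")
   case True
   then obtain j where j: "j < r" "f j = v" by blast
   have "{i \<in> {..<3 * r}. f (i div 3) = v} \<subseteq> {3 * j, 3 * j + 1, 3 * j + 2}"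
   proof
    fix i assume i: "i \<in> {i \<in> {..<3 * r}. f (i div 3) = v}"
    then have "i div 3 < r" by auto
    then have "i div 3 = j" using that i j by (auto simp: inj_on_def)
    then show "i \<in> {3 * j, 3 * j + 1, 3 * j + 2}" by auto
   qed
   then have "card {i \<in> {..<3 * r}. f (i div 3) = v} <= card {3 * j, 3 * j + 1, 3 * j + 2}" by (intro card_mono) auto
   also have "... <= 3" by (simp add: card_insert_if)
   finally show ?thesis .
  next
   case False
   then have "{i \<in> {..<3 * r}. f (i div 3) = v} = {}" by (auto simp: less_mult_imp_div_less mult.commute)
   then show ?thesis by (metis card.empty le0)
  qed
  show "card {i \<in> {..<3 * r}. B (i div 3) = v} <= 3" "card {i \<in> {..<3 * r}. D (i div 3) = v} <= 3" for v
   using three inj by auto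
  show "B (i div 3) \<in> V" "D (i div 3) \<in> V" if "i \<in> {..<3 * r}" for i
  proof -
   have "i div 3 < r" using that by auto
   then show "B (i div 3) \<in> V" "D (i div 3) \<in> V" using V by auto
  qed
 qed (use q in auto)
 then have "\<exists>P. disj_lists {..<3 * r} P \<and> (\<forall>i\<in>{..<3 * r}. conn E R1 (B (i div 3)) (D (i div 3)) (P i) \<and> real (length (P i)) <= b)"
  by (rule con(1)[unfolded connector_def, rule_format])
 then obtain P where P: "disj_lists {..<3 * r} P"
  "!!i. i < 3 * r ==> conn E R1 (B (i div 3)) (D (i div 3)) (P i)" "!!i. i < 3 * r ==> real (length (P i)) <= b" by auto
 have "\<exists>j1 j2. j1 \<noteq> j2 \<and> j1 div 3 = i \<and> j2 div 3 = i \<and> even (length (P j1) + length (P j2))" for i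
 proof -
  have d3: "(3 * i) div 3 = i" "(3 * i + 1) div 3 = i" "(3 * i + 2) div 3 = i" by auto
  consider "even (length (P (3 * i)) + length (P (3 * i + 1)))" | "even (length (P (3 * i)) + length (P (3 * i + 2)))"
   | "even (length (P (3 * i + 1)) + length (P (3 * i + 2)))" by auto
  then show ?thesis
  proof cases
   case 1 then show ?thesis using d3 by (intro exI[of _ "3 * i"] exI[of _ "3 * i + 1"]) simp
  next
   case 2 then show ?thesis using d3 by (intro exI[of _ "3 * i"] exI[of _ "3 * i + 2"]) simp
  next
   case 3 then show ?thesis using d3 by (intro exI[of _ "3 * i + 1"] exI[of _ "3 * i + 2"]) simp
  qed
 qed
 then obtain j1 j2 where j: "!!i. j1 i \<noteq> j2 i" "!!i. j1 i div 3 = i" "!!i. j2 i div 3 = i"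
  "!!i. even (length (P (j1 i)) + length (P (j2 i)))" by metis
 have jr: "j1 i < 3 * r" "j2 i < 3 * r" if "i < r" for i
 proof -
  show "j1 i < 3 * r" using that j(2)[of i] by linarith
  show "j2 i < 3 * r" using that j(3)[of i] by linarith
 qed
 define ps where "ps i = P (j1 i) @ [D i] @ rev (P (j2 i))" for i
 define N where "N i = (length (P (j1 i)) + length (P (j2 i))) div 2" for i
 have cP: "conn E R1 (B i) (D i) (P (j1 i))" "conn E R1 (B i) (D i) (P (j2 i))" if "i < r" for i
  using P(2)[OF jr(1)[OF that]] P(2)[OF jr(2)[OF that]] by (simp_all only: j(2,3))
 have lenps: "length (ps i) = 2 * N i + 1" for i using j(4)[of i] by (simp add: ps_def N_def)
 have N1: "1 <= N i" if "i < r" for i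
 proof -
  have "0 < length (P (j1 i))" "0 < length (P (j2 i))" using cP[OF that] by (auto simp: conn_def)
  then show ?thesis unfolding N_def by linarith
 qed
 have Nb: "real (N i) <= b" if "i < r" for i
 proof -
  have "2 * real (N i) <= real (length (P (j1 i))) + real (length (P (j2 i)))"
  proof -
   have "2 * N i <= length (P (j1 i)) + length (P (j2 i))" unfolding N_def by simp
   then show ?thesis by linarith
  qed
  then show ?thesis using P(3)[OF jr(1)[OF that]] P(3)[OF jr(2)[OF that]] by linarith
 qed
 have chps: "chain E (B i # ps i @ [B i])" if "i < r" for i
 proof -
  have w1: "walk E (B i) (P (j1 i) @ [D i]) (D i)" using cP(1)[OF that] by (intro walk_chain_snoc) (simp add: conn_def)
  have "walk E (B i) (P (j2 i) @ [D i]) (D i)" using cP(2)[OF that] by (intro walk_chain_snoc) (simp add: conn_def)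
  then have "walk E (D i) (rev (P (j2 i)) @ [B i]) (B i)" by (rule walk_rev[OF E])
  from walk_append[OF w1 this] show ?thesis by (simp add: walk_def ps_def)
 qed
 have "\<forall>i. \<exists>a bb d. i < r --> (B i, a (1::nat)) \<in> E \<and> (B i, bb (1::nat)) \<in> E \<and> (d, a (N i)) \<in> E \<and> (d, bb (N i)) \<in> E \<and>
  (\<forall>l. 1 <= l --> l < N i --> (a l, a (Suc l)) \<in> E \<and> (bb l, bb (Suc l)) \<in> E) \<and>
  mset (ps i) = (\<Sum>l\<in>{1..N i}. {#a l#}) + (\<Sum>l\<in>{1..N i}. {#bb l#}) + {#d#}"
 proof
  fix i
  show "\<exists>a bb d. i < r --> (B i, a (1::nat)) \<in> E \<and> (B i, bb (1::nat)) \<in> E \<and> (d, a (N i)) \<in> E \<and> (d, bb (N i)) \<in> E \<and>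
   (\<forall>l. 1 <= l --> l < N i --> (a l, a (Suc l)) \<in> E \<and> (bb l, bb (Suc l)) \<in> E) \<and>
   mset (ps i) = (\<Sum>l\<in>{1..N i}. {#a l#}) + (\<Sum>l\<in>{1..N i}. {#bb l#}) + {#d#}"
  proof (cases "i < r")
   case True
   obtain a bb d where "(B i, a (1::nat)) \<in> E" "(B i, bb (1::nat)) \<in> E" "(d, a (N i)) \<in> E" "(d, bb (N i)) \<in> E"
    "!!l. 1 <= l ==> l < N i ==> (a l, a (Suc l)) \<in> E \<and> (bb l, bb (Suc l)) \<in> E"
    "mset (ps i) = (\<Sum>l\<in>{1..N i}. {#a l#}) + (\<Sum>l\<in>{1..N i}. {#bb l#}) + {#d#}"
    by (rule even_cycle_gadget[OF E chps[OF True] lenps N1[OF True]]) (rule that; assumption)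
   then show ?thesis by blast
  qed blast
 qed
 then obtain a bb d where G: "!!i. i < r ==> (B i, a i (1::nat)) \<in> E \<and> (B i, bb i (1::nat)) \<in> E \<and> (d i, a i (N i)) \<in> E \<and> (d i, bb i (N i)) \<in> E \<and>
  (\<forall>l. 1 <= l --> l < N i --> (a i l, a i (Suc l)) \<in> E \<and> (bb i l, bb i (Suc l)) \<in> E) \<and>
  mset (ps i) = (\<Sum>l\<in>{1..N i}. {#a i l#}) + (\<Sum>l\<in>{1..N i}. {#bb i l#}) + {#d i#}"
  by metis
 have dps: "distinct (ps i)" "set (ps i) \<subseteq> R1 \<union> D ` {..<r}" if "i < r" for i
 proof -
  have "set (P (j1 i)) \<inter> set (P (j2 i)) = {}" using jr[OF that] j(1)[of i] by (intro disj_listsD[OF P(1)]) auto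
  moreover have "D i \<notin> R1" using disj that by auto
  moreover have "set (P (j1 i)) \<subseteq> R1" "set (P (j2 i)) \<subseteq> R1" "distinct (P (j1 i))" "distinct (P (j2 i))" using cP[OF that] by (auto simp: conn_def)
  ultimately show "distinct (ps i)" "set (ps i) \<subseteq> R1 \<union> D ` {..<r}" using that by (auto simp: ps_def)
 qed
 have "disj_lists {..<r} ps"
  unfolding disj_lists_def
 proof (intro ballI impI)
  fix i i' assume ii: "i \<in> {..<r}" "i' \<in> {..<r}" "i \<noteq> i'"
  have ne: "set (P u) \<inter> set (P v) = {}" if "u \<in> {j1 i, j2 i}" "v \<in> {j1 i', j2 i'}" for u v
  proof -
   have "u div 3 = i" "v div 3 = i'" using that j(2,3) by auto
   then have "u \<noteq> v" "u < 3 * r" "v < 3 * r" using ii by auto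
   then show ?thesis by (intro disj_listsD[OF P(1)]) auto
  qed
  have n4: "set (P (j1 i)) \<inter> set (P (j1 i')) = {}" "set (P (j1 i)) \<inter> set (P (j2 i')) = {}"
   "set (P (j2 i)) \<inter> set (P (j1 i')) = {}" "set (P (j2 i)) \<inter> set (P (j2 i')) = {}" by (rule ne; simp)+
  have "set (P (j1 i)) \<subseteq> R1" "set (P (j2 i)) \<subseteq> R1" "set (P (j1 i')) \<subseteq> R1" "set (P (j2 i')) \<subseteq> R1"
   using cP[of i] cP[of i'] ii by (auto simp: conn_def)
  moreover have "D i \<notin> R1" "D i' \<notin> R1" "D i \<noteq> D i'" using disj ii inj(3) by (auto simp: inj_on_def)
  ultimately show "set (ps i) \<inter> set (ps i') = {}" using n4 unfolding ps_def by auto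
 qed
 then have sumps: "(\<Sum>i<r. mset (ps i)) = mset_set (\<Union>i<r. set (ps i))" using dps by (intro sum_mset_disj_lists) auto
 define S1 where "S1 = (\<Union>i<r. set (ps i))"
 have S1: "S1 \<subseteq> R1 \<union> D ` {..<r}" using dps by (auto simp: S1_def)
 have sumG: "(\<Sum>i<r. (\<Sum>l\<in>{1..N i}. {#a i l#}) + (\<Sum>l\<in>{1..N i}. {#bb i l#}) + {#d i#}) = mset_set S1"
  unfolding S1_def sumps[symmetric] using G by (intro sum.cong) auto
 \<comment> \<open>Index \<open>(i, 0)\<close> asks for the passage from \<open>e i\<close> to the
   next \<open>d\<close>, \<open>(i, N i)\<close> for the exit from \<open>c i\<close> to
   \<open>A i\<close>, and \<open>(i, l)\<close> with \<open>0 < l < N i\<close> for the rung at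
   height \<open>l\<close>.\<close>
 define Idx where "Idx = (SIGMA i:{..<r}. {0..N i})"
 define J where "J = prod_encode ` Idx"
 define xx where "xx = (\<lambda>(i, l). if l = 0 then bb i (N i) else a i l)"
 define yy where "yy = (\<lambda>(i, l). if l = 0 then d (Suc i mod r) else if l = N i then A i else bb i l)"
 have finI: "finite Idx" by (simp add: Idx_def)
 have injJ: "inj_on prod_encode Idx" by (rule inj_prod_encode)
 have split0: "(\<Sum>l\<in>{0..N i}. f l) = f 0 + (\<Sum>l\<in>{1..N i}. f l)" for f :: "nat => 'c :: comm_monoid_add" and i
  by (simp add: sum.atLeast_Suc_atMost)
 have splitN: "(\<Sum>l\<in>{1..N i}. f l) = (\<Sum>l\<in>{1..<N i}. f l) + f (N i)" if "i < r" for f :: "nat => 'c :: comm_monoid_add" and i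
 proof -
  have "{1..N i} = insert (N i) {1..<N i}" using N1[OF that] by auto
  then show ?thesis by (simp add: add.commute)
 qed
 have count1: "count (mset_set X) v <= 1" for X :: "'a set" and v by (cases "finite X"; cases "v \<in> X") auto
 \<comment> \<open>The starting vertices form a submultiset of \<open>S1\<close>, and the end
   vertices one of \<open>S1\<close> together with the distinct \<open>A i\<close>; so no vertex
   starts more than one connection or ends more than two.\<close>
 have multx: "card {j \<in> J. xx (prod_decode j) = v} <= 3" for v
 proof -
  have "card {j \<in> J. xx (prod_decode j) = v} = count (\<Sum>j\<in>J. {#xx (prod_decode j)#}) v"
   using finI by (intro card_eq_count) (simp add: J_def)
  also have "(\<Sum>j\<in>J. {#xx (prod_decode j)#}) = (\<Sum>x\<in>Idx. {#xx x#})"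
   unfolding J_def by (subst sum.reindex[OF injJ]) simp
  also have "... = (\<Sum>i<r. \<Sum>l\<in>{0..N i}. {#xx (i, l)#})"
   unfolding Idx_def by (subst sum.Sigma) (auto intro!: sum.cong)
  also have "... = (\<Sum>i<r. {#bb i (N i)#} + (\<Sum>l\<in>{1..N i}. {#a i l#}))"
   unfolding split0 by (intro sum.cong refl arg_cong2[where f = "(+)"]) (auto simp: xx_def)
  finally have ceq: "card {j \<in> J. xx (prod_decode j) = v} = count (\<Sum>i<r. {#bb i (N i)#} + (\<Sum>l\<in>{1..N i}. {#a i l#})) v" .
  have "(\<Sum>i<r. {#bb i (N i)#} + (\<Sum>l\<in>{1..N i}. {#a i l#})) \<subseteq># (\<Sum>i<r. (\<Sum>l\<in>{1..N i}. {#a i l#}) + (\<Sum>l\<in>{1..N i}. {#bb i l#}) + {#d i#})"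
  proof (rule sum_subseteq_mset)
   fix i assume "i \<in> {..<r}"
   then have e: "(\<Sum>l\<in>{1..N i}. {#bb i l#}) = (\<Sum>l\<in>{1..<N i}. {#bb i l#}) + {#bb i (N i)#}" using splitN[of i "\<lambda>l. {#bb i l#}"] by simp
   have "(\<Sum>l\<in>{1..N i}. {#a i l#}) + (\<Sum>l\<in>{1..N i}. {#bb i l#}) + {#d i#} =
    ({#bb i (N i)#} + (\<Sum>l\<in>{1..N i}. {#a i l#})) + ((\<Sum>l\<in>{1..<N i}. {#bb i l#}) + {#d i#})" unfolding e by (simp add: ac_simps)
   then show "{#bb i (N i)#} + (\<Sum>l\<in>{1..N i}. {#a i l#}) \<subseteq># (\<Sum>l\<in>{1..N i}. {#a i l#}) + (\<Sum>l\<in>{1..N i}. {#bb i l#}) + {#d i#}"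
    by (simp only: mset_subset_eq_add_left)
  qed
  then have "count (\<Sum>i<r. {#bb i (N i)#} + (\<Sum>l\<in>{1..N i}. {#a i l#})) v <= count (mset_set S1) v"
   unfolding sumG by (rule mset_subset_eq_count)
  then show ?thesis using count1[of S1 v] unfolding ceq by linarith
 qed
 have multy: "card {j \<in> J. yy (prod_decode j) = v} <= 3" for v
 proof -
  have dshift: "(\<Sum>i<r. {#d (Suc i mod r)#}) = (\<Sum>i<r. {#d i#})"
  proof (cases r)
   case (Suc r')
   have "(\<Sum>i<r. {#d (Suc i mod r)#}) = (\<Sum>i<r'. {#d (Suc i)#}) + {#d 0#}" unfolding Suc by simp
   also have "... = (\<Sum>i<r. {#d i#})" unfolding Suc by (simp add: sum.lessThan_Suc_shift del: sum.lessThan_Suc)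
   finally show ?thesis .
  qed simp
  have sumA: "(\<Sum>i<r. {#A i#}) = mset_set (A ` {..<r})"
   by (simp add: image_mset_mset_set[OF inj(1), symmetric] sum_unfold_sum_mset)
  have "card {j \<in> J. yy (prod_decode j) = v} = count (\<Sum>j\<in>J. {#yy (prod_decode j)#}) v"
   using finI by (intro card_eq_count) (simp add: J_def)
  also have "(\<Sum>j\<in>J. {#yy (prod_decode j)#}) = (\<Sum>x\<in>Idx. {#yy x#})"
   unfolding J_def by (subst sum.reindex[OF injJ]) simp
  also have "... = (\<Sum>i<r. \<Sum>l\<in>{0..N i}. {#yy (i, l)#})"
   unfolding Idx_def by (subst sum.Sigma) (auto intro!: sum.cong)
  also have "... = (\<Sum>i<r. {#d (Suc i mod r)#} + ((\<Sum>l\<in>{1..<N i}. {#bb i l#}) + {#A i#}))"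
  proof (rule sum.cong[OF refl])
   fix i assume "i \<in> {..<r}"
   then have i: "i < r" by simp
   have "(\<Sum>l\<in>{0..N i}. {#yy (i, l)#}) = {#yy (i, 0)#} + ((\<Sum>l\<in>{1..<N i}. {#yy (i, l)#}) + {#yy (i, N i)#})"
    unfolding split0 splitN[OF i] ..
   also have "(\<Sum>l\<in>{1..<N i}. {#yy (i, l)#}) = (\<Sum>l\<in>{1..<N i}. {#bb i l#})" by (intro sum.cong) (auto simp: yy_def)
   also have "yy (i, 0) = d (Suc i mod r)" by (simp add: yy_def)
   also have "yy (i, N i) = A i" using N1[OF i] by (simp add: yy_def)
   finally show "(\<Sum>l\<in>{0..N i}. {#yy (i, l)#}) = {#d (Suc i mod r)#} + ((\<Sum>l\<in>{1..<N i}. {#bb i l#}) + {#A i#})" .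
  qed
  also have "... = (\<Sum>i<r. (\<Sum>l\<in>{1..<N i}. {#bb i l#}) + {#d i#}) + mset_set (A ` {..<r})"
   by (simp only: sum.distrib dshift sumA ac_simps)
  finally have "card {j \<in> J. yy (prod_decode j) = v} = count (\<Sum>i<r. (\<Sum>l\<in>{1..<N i}. {#bb i l#}) + {#d i#}) v + count (mset_set (A ` {..<r})) v"
   by simp
  moreover have "(\<Sum>i<r. (\<Sum>l\<in>{1..<N i}. {#bb i l#}) + {#d i#}) \<subseteq># (\<Sum>i<r. (\<Sum>l\<in>{1..N i}. {#a i l#}) + (\<Sum>l\<in>{1..N i}. {#bb i l#}) + {#d i#})"
  proof (rule sum_subseteq_mset)
   fix i assume "i \<in> {..<r}"
   then have e: "(\<Sum>l\<in>{1..N i}. {#bb i l#}) = (\<Sum>l\<in>{1..<N i}. {#bb i l#}) + {#bb i (N i)#}" using splitN[of i "\<lambda>l. {#bb i l#}"] by simp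
   have "(\<Sum>l\<in>{1..N i}. {#a i l#}) + (\<Sum>l\<in>{1..N i}. {#bb i l#}) + {#d i#} =
    ((\<Sum>l\<in>{1..<N i}. {#bb i l#}) + {#d i#}) + ((\<Sum>l\<in>{1..N i}. {#a i l#}) + {#bb i (N i)#})" unfolding e by (simp add: ac_simps)
   then show "(\<Sum>l\<in>{1..<N i}. {#bb i l#}) + {#d i#} \<subseteq># (\<Sum>l\<in>{1..N i}. {#a i l#}) + (\<Sum>l\<in>{1..N i}. {#bb i l#}) + {#d i#}"
    by (simp only: mset_subset_eq_add_left)
  qed
  then have "count (\<Sum>i<r. (\<Sum>l\<in>{1..<N i}. {#bb i l#}) + {#d i#}) v <= count (mset_set S1) v"
   unfolding sumG by (rule mset_subset_eq_count)
  ultimately show ?thesis using count1[of S1 v] count1[of "A ` {..<r}" v] by linarith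
 qed
 have S1V: "S1 \<subseteq> V" using S1 V by blast
 have finS1: "finite S1" by (rule finite_subset[OF S1V V(6)])
 have inS1: "a i l \<in> S1 \<and> bb i l \<in> S1" if "i < r" "1 <= l" "l <= N i" for i l
 proof -
  have l: "l \<in> {1..N i}" using that by simp
  have e: "mset (ps i) = (\<Sum>l\<in>{1..N i}. {#a i l#}) + (\<Sum>l\<in>{1..N i}. {#bb i l#}) + {#d i#}" using G[OF that(1)] by simp
  have "a i l \<in># mset (ps i)" unfolding e using l by (auto simp: set_mset_sum)
  moreover have "bb i l \<in># mset (ps i)" unfolding e using l by (auto simp: set_mset_sum)
  ultimately show ?thesis using that(1) by (auto simp: S1_def)
 qed
 have inS1d: "d i \<in> S1" if "i < r" for i
 proof -
  have e: "mset (ps i) = (\<Sum>l\<in>{1..N i}. {#a i l#}) + (\<Sum>l\<in>{1..N i}. {#bb i l#}) + {#d i#}" using G[OF that] by simp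
  have "d i \<in># mset (ps i)" unfolding e by simp
  then show ?thesis using that by (auto simp: S1_def)
 qed
 have cardJ: "rcard J <= q"
 proof -
  have "card J = card Idx" unfolding J_def by (rule card_image[OF injJ])
  also have "... = (\<Sum>i<r. N i + 1)" unfolding Idx_def by simp
  finally have "card J = (\<Sum>i<r. N i + 1)" .
  then have "rcard J = (\<Sum>i<r. real (N i) + 1)" by (simp add: add.commute)
  also have "... <= (\<Sum>i<r. b + 1)" using Nb by (intro sum_mono) auto
  finally show ?thesis using q(2) by simp
 qed
 have "finite J \<and> rcard J <= q \<and> (\<forall>j\<in>J. xx (prod_decode j) \<in> V \<and> yy (prod_decode j) \<in> V) \<and>
   (\<forall>v. card {j \<in> J. xx (prod_decode j) = v} <= 3 \<and> card {j \<in> J. yy (prod_decode j) = v} <= 3)"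
 proof (intro conjI ballI allI)
  show "finite J" using finI by (simp add: J_def)
  fix j assume "j \<in> J"
  then obtain i l where il: "j = prod_encode (i, l)" "i < r" "l <= N i" by (auto simp: J_def Idx_def)
  show "xx (prod_decode j) \<in> V"
   using il inS1[of i l] inS1[of i "N i"] N1[of i] S1V by (auto simp: xx_def)
  have "Suc i mod r < r" using il by simp
  then show "yy (prod_decode j) \<in> V"
   using il inS1[of i l] inS1d[of "Suc i mod r"] V(1) S1V by (auto simp: yy_def)
 qed (use cardJ multx multy in auto)
 then have "\<exists>Q. disj_lists J Q \<and> (\<forall>j\<in>J. conn E R2 (xx (prod_decode j)) (yy (prod_decode j)) (Q j) \<and> real (length (Q j)) <= b)"
  by (rule con(2)[unfolded connector_def, rule_format])
 then obtain Q where Q: "disj_lists J Q" "!!j. j \<in> J ==> conn E R2 (xx (prod_decode j)) (yy (prod_decode j)) (Q j)" by blast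
 define Lk where "Lk i l = Q (prod_encode (i, l))" for i l
 have Lk: "walk E (xx (i, l)) (Lk i l @ [yy (i, l)]) (yy (i, l))" if "i < r" "l <= N i" for i l
 proof -
  have "prod_encode (i, l) \<in> J" using that by (auto simp: J_def Idx_def)
  from Q(2)[OF this] show ?thesis by (intro walk_chain_snoc) (simp add: conn_def Lk_def)
 qed
 define S2 where "S2 = (\<Union>j\<in>J. set (Q j))"
 have S2: "S2 \<subseteq> R2" using Q(2) by (auto simp: S2_def conn_def)
 have sumQ: "(\<Sum>i<r. \<Sum>l\<in>{0..N i}. mset (Lk i l)) = mset_set S2"
 proof -
  have "(\<Sum>i<r. \<Sum>l\<in>{0..N i}. mset (Lk i l)) = (\<Sum>x\<in>Idx. mset (Q (prod_encode x)))"
   unfolding Idx_def Lk_def by (subst sum.Sigma) (auto intro!: sum.cong)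
  also have "... = (\<Sum>j\<in>J. mset (Q j))" unfolding J_def by (subst sum.reindex[OF injJ]) simp
  also have "... = mset_set S2" unfolding S2_def using Q finI by (intro sum_mset_disj_lists) (auto simp: J_def conn_def)
  finally show ?thesis .
 qed
 have "\<forall>i. \<exists>tA tB. i < r --> walk E (B i) tA (a i (N i)) \<and> walk E (B i) tB (bb i (N i)) \<and>
  mset tA = (\<Sum>l\<in>{1..N i}. {#a i l#}) + (\<Sum>l\<in>{1..<N i}. {#bb i l#}) + (\<Sum>l\<in>{1..<N i}. mset (Lk i l)) \<and>
  mset tB = (\<Sum>l\<in>{1..N i}. {#bb i l#}) + (\<Sum>l\<in>{1..<N i}. {#a i l#}) + (\<Sum>l\<in>{1..<N i}. mset (Lk i l))"
 proof
  fix i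
  show "\<exists>tA tB. i < r --> walk E (B i) tA (a i (N i)) \<and> walk E (B i) tB (bb i (N i)) \<and>
   mset tA = (\<Sum>l\<in>{1..N i}. {#a i l#}) + (\<Sum>l\<in>{1..<N i}. {#bb i l#}) + (\<Sum>l\<in>{1..<N i}. mset (Lk i l)) \<and>
   mset tB = (\<Sum>l\<in>{1..N i}. {#bb i l#}) + (\<Sum>l\<in>{1..<N i}. {#a i l#}) + (\<Sum>l\<in>{1..<N i}. mset (Lk i l))"
  proof (cases "i < r")
   case True
   note g = G[OF True]
   have lk: "walk E (a i l) (Lk i l @ [bb i l]) (bb i l)" if "1 <= l" "l < N i" for l
    using Lk[OF True, of l] that by (simp add: xx_def yy_def)
   \<comment> \<open>Exchanging the rails and reversing the rungs turns the zigzag of the first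
     state into that of the second.\<close>
   have lk': "walk E (bb i l) (rev (Lk i l) @ [a i l]) (a i l)" if "1 <= l" "l < N i" for l
    using lk[OF that] by (rule walk_rev[OF E])
   have "\<exists>zs. walk E (B i) zs (a i (N i)) \<and>
    mset zs = (\<Sum>l\<in>{1..N i}. {#a i l#}) + (\<Sum>l\<in>{1..<N i}. {#bb i l#}) + (\<Sum>l\<in>{1..<N i}. mset (Lk i l))"
    using g lk by (intro zigzag[OF E N1[OF True]]) auto
   moreover have "\<exists>zs. walk E (B i) zs (bb i (N i)) \<and>
    mset zs = (\<Sum>l\<in>{1..N i}. {#bb i l#}) + (\<Sum>l\<in>{1..<N i}. {#a i l#}) + (\<Sum>l\<in>{1..<N i}. mset (rev (Lk i l)))"
    using g lk' by (intro zigzag[OF E N1[OF True]]) auto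
   ultimately show ?thesis by auto
  qed blast
 qed
 then obtain tA tB where t: "!!i. i < r ==> walk E (B i) (tA i) (a i (N i)) \<and> walk E (B i) (tB i) (bb i (N i)) \<and>
  mset (tA i) = (\<Sum>l\<in>{1..N i}. {#a i l#}) + (\<Sum>l\<in>{1..<N i}. {#bb i l#}) + (\<Sum>l\<in>{1..<N i}. mset (Lk i l)) \<and>
  mset (tB i) = (\<Sum>l\<in>{1..N i}. {#bb i l#}) + (\<Sum>l\<in>{1..<N i}. {#a i l#}) + (\<Sum>l\<in>{1..<N i}. mset (Lk i l))"
  by metis
 define c where "c i = a i (N i)" for i
 define e where "e i = bb i (N i)" for i
 define k where "k i = Lk i (N i)" for i
 define m where "m i = Lk i 0" for i
 have main: "walk E (B i) (tA i) (c i) \<and> walk E (B i) (tB i) (e i) \<and>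
   (d i, c i) \<in> E \<and> (d i, e i) \<in> E \<and> add_mset (c i) (mset (tB i)) = add_mset (e i) (mset (tA i)) \<and>
   walk E (c i) (k i @ [A i]) (A i) \<and> walk E (e i) (m i @ [d (Suc i mod r)]) (d (Suc i mod r))" if i: "i < r" for i
 proof (intro conjI)
  show "walk E (B i) (tA i) (c i)" "walk E (B i) (tB i) (e i)" using t[OF i] by (auto simp: c_def e_def)
  show "(d i, c i) \<in> E" "(d i, e i) \<in> E" using G[OF i] by (auto simp: c_def e_def)
  show "add_mset (c i) (mset (tB i)) = add_mset (e i) (mset (tA i))"
   using t[OF i] splitN[OF i, of "\<lambda>l. {#a i l#}"] splitN[OF i, of "\<lambda>l. {#bb i l#}"] by (simp add: c_def e_def ac_simps)
  show "walk E (c i) (k i @ [A i]) (A i)" using Lk[OF i, of "N i"] N1[OF i] by (simp add: xx_def yy_def c_def k_def)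
  show "walk E (e i) (m i @ [d (Suc i mod r)]) (d (Suc i mod r))" using Lk[OF i, of 0] by (simp add: xx_def yy_def e_def m_def)
 qed
 have "mset (tA i @ [d i, e i] @ m i @ k i) =
  ((\<Sum>l\<in>{1..N i}. {#a i l#}) + (\<Sum>l\<in>{1..N i}. {#bb i l#}) + {#d i#}) + (\<Sum>l\<in>{0..N i}. mset (Lk i l))" if i: "i < r" for i
  unfolding split0 splitN[OF i, of "\<lambda>l. mset (Lk i l)"] splitN[OF i, of "\<lambda>l. {#bb i l#}"]
  using t[OF i] by (simp add: e_def m_def k_def ac_simps)
 then have "(\<Sum>i<r. mset (tA i @ [d i, e i] @ m i @ k i)) =
  (\<Sum>i<r. ((\<Sum>l\<in>{1..N i}. {#a i l#}) + (\<Sum>l\<in>{1..N i}. {#bb i l#}) + {#d i#}) + (\<Sum>l\<in>{0..N i}. mset (Lk i l)))"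
  by (intro sum.cong refl) simp
 also have "... = mset_set S1 + mset_set S2" unfolding sum.distrib[of _ "\<lambda>i. \<Sum>l\<in>{0..N i}. mset (Lk i l)"] sumQ sumG[symmetric] by (simp only: sum.distrib)
 also have "... = mset_set (S1 \<union> S2)"
 proof (rule mset_set_Union[symmetric, OF finS1 finite_subset[OF S2 finR(2)]])
  show "S1 \<inter> S2 = {}" using S1 S2 disj by blast
 qed
 finally have sm: "(\<Sum>i<r. mset (tA i @ [d i, e i] @ m i @ k i)) = mset_set (S1 \<union> S2)" .
 have sub: "S1 \<union> S2 \<subseteq> R1 \<union> R2 \<union> D ` {..<r}" using S1 S2 by blast
 have all: "\<forall>i<r. walk E (B i) (tA i) (c i) \<and> walk E (B i) (tB i) (e i) \<and>
   (d i, c i) \<in> E \<and> (d i, e i) \<in> E \<and> add_mset (c i) (mset (tB i)) = add_mset (e i) (mset (tA i)) \<and>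
   walk E (c i) (k i @ [A i]) (A i) \<and> walk E (e i) (m i @ [d (Suc i mod r)]) (d (Suc i mod r))"
  by (intro allI impI main)
 show ?thesis
  by (intro exI[of _ tA] exI[of _ tB] exI[of _ c] exI[of _ d] exI[of _ e] exI[of _ k] exI[of _ m] exI[of _ "S1 \<union> S2"] conjI)
   (rule all sub sm)+
qed

section \<open>Advancing a front of paths through blocks\<close>

text \<open>\<open>F\<close> consists of the current ends of \<open>r\<close> paths. The ends in
  \<open>X\<close> advance along the matching and the others wait, so a block with fewer than
  \<open>r\<close> vertices is still absorbed completely.\<close>

lemma front_step:
 fixes r :: nat
 assumes e: "bij_betw e {..<r} F" and T: "!!i. i < r ==> walk E (A i) (T i) (e i)"
  and ms: "(\<Sum>i<r. mset (T i)) = mset_set U" and fin: "finite U" "finite Y"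
  and f: "X \<subseteq> F" "bij_betw f X Y" "!!x. x \<in> X ==> (x, f x) \<in> E" and disj: "U \<inter> Y = {}" "F \<inter> Y = {}"
 shows "\<exists>T' e'. bij_betw e' {..<r} (F - X \<union> Y) \<and> (\<forall>i<r. walk E (A i) (T' i) (e' i)) \<and> (\<Sum>i<r. mset (T' i)) = mset_set (U \<union> Y)"
proof -
 define g where "g x = (if x \<in> X then f x else x)" for x
 have "bij_betw g F (Y \<union> (F - X))"
 proof -
  have "bij_betw g X Y" using f(2) by (rule bij_betw_cong[THEN iffD1, rotated]) (simp add: g_def)
  moreover have "bij_betw g (F - X) (F - X)" by (rule bij_betw_cong[THEN iffD1, OF _ bij_betw_id]) (simp add: g_def)
  ultimately have "bij_betw g (X \<union> (F - X)) (Y \<union> (F - X))" using disj by (intro bij_betw_combine) auto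
  then show ?thesis using f(1) by (simp add: Un_absorb1)
 qed
 then have bij: "bij_betw (g \<circ> e) {..<r} (F - X \<union> Y)" using e by (auto simp: Un_commute intro: bij_betw_trans)
 define T' where "T' i = T i @ (if e i \<in> X then [f (e i)] else [])" for i
 have "walk E (A i) (T' i) ((g \<circ> e) i)" if i: "i < r" for i
  using walk_append[OF T[OF i], of "[f (e i)]"] T[OF i] f(3)[of "e i"] by (auto simp: T'_def g_def walk_Cons)
 moreover have "(\<Sum>i<r. mset (T' i)) = mset_set (U \<union> Y)"
 proof -
  have "(\<Sum>i<r. mset (T' i)) = (\<Sum>i<r. mset (T i)) + (\<Sum>i<r. if e i \<in> X then {#f (e i)#} else {#})"
   unfolding sum.distrib[symmetric] by (intro sum.cong) (auto simp: T'_def)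
  also have "(\<Sum>i<r. if e i \<in> X then {#f (e i)#} else {#}) = (\<Sum>x\<in>F. if x \<in> X then {#f x#} else {#})"
   by (rule sum.reindex_bij_betw[OF e])
  also have "... = (\<Sum>x\<in>X. {#f x#})"
  proof -
   have "finite F" using bij_betw_finite[OF e] finite_lessThan[of r] by (rule iffD1)
   moreover have "F \<inter> X = X" using f(1) by blast
   ultimately show ?thesis using sum.inter_restrict[of F "\<lambda>x. {#f x#}" X] by simp
  qed
  also have "... = (\<Sum>y\<in>Y. {#y#})" by (rule sum.reindex_bij_betw[OF f(2)])
  also have "... = mset_set Y" by (simp add: sum_unfold_sum_mset)
  finally show ?thesis unfolding ms using fin disj(1) by (simp add: mset_set_Union)
 qed
 ultimately show ?thesis using bij by blast
qed

text \<open>The front before block \<open>s\<close> is not known in advance, only that it contains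
  \<open>core s\<close>; hence \<open>M\<close> asks for a matching out of every such front. Each
  block lies entirely in the front that follows it, so a last block with \<open>r\<close> vertices
  determines the final front.\<close>

lemma front_iterate:
 fixes A :: "nat => 'a" and Es core :: "nat => 'a set"
 assumes A: "inj_on A {..<r}" "core 0 \<subseteq> A ` {..<r}"
  and Es: "!!s s'. s < t ==> s' < t ==> s \<noteq> s' ==> Es s \<inter> Es s' = {}" "!!s. s < t ==> Es s \<inter> A ` {..<r} = {}"
   "!!s. s < t ==> finite (Es s)" "!!s. s < t ==> core (Suc s) \<subseteq> Es s"
  and M: "!!s F. s < t ==> F \<subseteq> A ` {..<r} \<union> (\<Union>s'<s. Es s') ==> card F = r ==> core s \<subseteq> F ==>
   \<exists>X f. X \<subseteq> F \<and> bij_betw f X (Es s) \<and> (\<forall>x\<in>X. (x, f x) \<in> E)"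
  and u: "u <= t"
 shows "\<exists>T e F. bij_betw e {..<r} F \<and> F \<subseteq> A ` {..<r} \<union> (\<Union>s'<u. Es s') \<and> core u \<subseteq> F \<and> (\<forall>s. u = Suc s --> Es s \<subseteq> F) \<and>
  (\<forall>i<r. walk E (A i) (T i) (e i)) \<and> (\<Sum>i<r. mset (T i)) = mset_set (\<Union>s<u. Es s)"
 using u
proof (induction u)
 case 0
 show ?case using A by (intro exI[of _ "\<lambda>_. []"] exI[of _ A] exI[of _ "A ` {..<r}"]) (auto simp: bij_betw_def)
next
 case (Suc u)
 then obtain T e F where IH: "bij_betw e {..<r} F" "F \<subseteq> A ` {..<r} \<union> (\<Union>s'<u. Es s')" "core u \<subseteq> F"
  "!!i. i < r ==> walk E (A i) (T i) (e i)" "(\<Sum>i<r. mset (T i)) = mset_set (\<Union>s<u. Es s)" by auto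
 have u: "u < t" using Suc by simp
 have "card F = r" using bij_betw_same_card[OF IH(1)] by simp
 from M[OF u IH(2) this IH(3)] obtain X f where Xf: "X \<subseteq> F" "bij_betw f X (Es u)" "!!x. x \<in> X ==> (x, f x) \<in> E" by blast
 have d1: "(\<Union>s<u. Es s) \<inter> Es u = {}"
 proof -
  have "Es s \<inter> Es u = {}" if "s < u" for s using Es(1)[of s u] that u by simp
  then show ?thesis by blast
 qed
 have d2: "F \<inter> Es u = {}" using IH(2) d1 Es(2)[OF u] by blast
 have fin: "finite (\<Union>s<u. Es s)" using Es(3) u by auto
 from front_step[OF IH(1,4,5) fin Es(3)[OF u] Xf d1 d2]
 obtain T' e' where n: "bij_betw e' {..<r} (F - X \<union> Es u)" "\<forall>i<r. walk E (A i) (T' i) (e' i)" "(\<Sum>i<r. mset (T' i)) = mset_set ((\<Union>s<u. Es s) \<union> Es u)"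
  by blast
 have un: "(\<Union>s<Suc u. Es s) = (\<Union>s<u. Es s) \<union> Es u" by (simp add: lessThan_Suc Un_commute)
 show ?case
 proof (intro exI conjI)
  show "bij_betw e' {..<r} (F - X \<union> Es u)" "\<forall>i<r. walk E (A i) (T' i) (e' i)" by fact+
  show "(\<Sum>i<r. mset (T' i)) = mset_set (\<Union>s<Suc u. Es s)" using n(3) unfolding un .
  show "F - X \<union> Es u \<subseteq> A ` {..<r} \<union> (\<Union>s'<Suc u. Es s')" using IH(2) unfolding un by blast
  show "core (Suc u) \<subseteq> F - X \<union> Es u" using Es(4)[OF u] by blast
  show "\<forall>s. Suc u = Suc s --> Es s \<subseteq> F - X \<union> Es u" by blast
 qed
qed

text \<open>The last block can be completed from vertices outside all the sets \<open>C s\<close>,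
  because the other \<open>C s\<close> occupy no more than the sizes reserved for their blocks; it
  is then removed from \<open>W\<close>.\<close>

lemma fill_partition:
 fixes C :: "nat => 'a set" and e :: "nat => nat"
 assumes "finite W" "!!s. s < t ==> C s \<subseteq> W" "!!s s'. s < t ==> s' < t ==> s \<noteq> s' ==> C s \<inter> C s' = {}"
  "!!s. s < t ==> card (C s) <= e s" "(\<Sum>s<t. e s) = card W"
 shows "\<exists>Es. (\<forall>s<t. C s \<subseteq> Es s \<and> card (Es s) = e s) \<and> (\<forall>s<t. \<forall>s'<t. s \<noteq> s' --> Es s \<inter> Es s' = {}) \<and> (\<Union>s<t. Es s) = W"
 using assms
proof (induction t arbitrary: W)
 case 0
 then show ?case by auto
next
 case (Suc t)
 have finC: "finite (C s)" if "s < Suc t" for s using Suc.prems(1) Suc.prems(2)[OF that] finite_subset by blast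
 have "card (\<Union>s<Suc t. C s) = (\<Sum>s<Suc t. card (C s))"
  using finC Suc.prems(3) by (intro card_UN_disjoint) auto
 moreover have sub: "(\<Union>s<Suc t. C s) \<subseteq> W" using Suc.prems(2) by blast
 ultimately have "card (W - (\<Union>s<Suc t. C s)) = (\<Sum>s<Suc t. e s) - (\<Sum>s<Suc t. card (C s))"
  using finC Suc.prems(5) by (subst card_Diff_subset) auto
 moreover have "(\<Sum>s<t. card (C s)) <= (\<Sum>s<t. e s)" using Suc.prems(4) by (intro sum_mono) auto
 ultimately have "e t - card (C t) <= card (W - (\<Union>s<Suc t. C s))" by simp
 then obtain G where G: "G \<subseteq> W - (\<Union>s<Suc t. C s)" "card G = e t - card (C t)" by (meson obtain_subset_with_card_n)
 have finG: "finite G" using G Suc.prems(1) finite_subset by blast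
 define D where "D = C t \<union> G"
 have "C t \<inter> G = {}" using G(1) by blast
 then have cD: "card D = e t" using G finG finC[of t] Suc.prems(4)[of t] by (simp add: D_def card_Un_disjoint)
 have DW: "D \<subseteq> W" using G Suc.prems(2)[of t] by (auto simp: D_def)
 have dC: "C s \<inter> D = {}" if "s < t" for s using G(1) Suc.prems(3)[of s t] that by (auto simp: D_def)
 have "\<exists>Es. (\<forall>s<t. C s \<subseteq> Es s \<and> card (Es s) = e s) \<and> (\<forall>s<t. \<forall>s'<t. s \<noteq> s' --> Es s \<inter> Es s' = {}) \<and> (\<Union>s<t. Es s) = W - D"
 proof (rule Suc.IH)
  show "C s \<subseteq> W - D" if "s < t" for s using dC[OF that] Suc.prems(2)[of s] that by auto
  show "(\<Sum>s<t. e s) = card (W - D)" using Suc.prems(1,5) DW cD finite_subset[OF DW] by (simp add: card_Diff_subset)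
 qed (use Suc.prems in auto)
 then obtain Es where Es: "\<forall>s<t. C s \<subseteq> Es s \<and> card (Es s) = e s" "\<forall>s<t. \<forall>s'<t. s \<noteq> s' --> Es s \<inter> Es s' = {}" "(\<Union>s<t. Es s) = W - D" by blast
 have EsD: "Es s \<inter> D = {}" if "s < t" for s using Es(3) that by blast
 show ?case
 proof (intro exI[of _ "Es(t := D)"] conjI allI impI)
  show "C s \<subseteq> (Es(t := D)) s" "card ((Es(t := D)) s) = e s" if "s < Suc t" for s
   using that Es(1) cD by (auto simp: D_def less_Suc_eq)
  show "(Es(t := D)) s \<inter> (Es(t := D)) s' = {}" if "s < Suc t" "s' < Suc t" "s \<noteq> s'" for s s'
  proof (cases "s = t \<or> s' = t")
   case True
   then show ?thesis using that EsD[of s] EsD[of s'] by (auto simp: less_Suc_eq)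
  next
   case False
   then have "s < t" "s' < t" using that by auto
   then show ?thesis using Es(2) that(3) False by simp
  qed
  have "(\<Union>s<Suc t. (Es(t := D)) s) = (\<Union>s<t. Es s) \<union> D" by (auto simp: less_Suc_eq)
  then show "(\<Union>s<Suc t. (Es(t := D)) s) = W" using Es(3) DW by auto
 qed
qed

section \<open>Hamilton cycles for large minimum degree\<close>

text \<open>An independent colouring with probabilities \<pi> i. Errors are relative to
  \<open>deg_in E v \<Omega>\<close> and to \<open>card \<Omega>\<close>; the latter is used for the
  exceptional set as well, since \<open>X \<inter> \<Omega>\<close> may be too small to
  concentrate.\<close>

lemma cores_exist:
 fixes \<pi> :: "nat => real" and d0 \<pi>0 \<tau> :: real
 assumes fin: "finite V" "V \<noteq> {}" and EV: "E \<subseteq> V \<times> V" and \<Omega>: "\<Omega> \<subseteq> V"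
  and d0: "0 < d0" "!!v. v \<in> V ==> d0 <= deg_in E v \<Omega>"
  and \<pi>: "0 < \<pi>0" "!!i. i < t ==> \<pi>0 <= \<pi> i" "sum \<pi> {..<t} <= 1" and \<tau>: "0 < \<tau>"
  and small: "real t * (rcard V + 2) * (2 * exp (- 2 * \<tau>\<^sup>2 * \<pi>0\<^sup>2 * d0)) < 1"
 shows "\<exists>C :: nat => 'a set. (\<forall>i<t. C i \<subseteq> \<Omega>) \<and> (\<forall>i<t. \<forall>j<t. i \<noteq> j --> C i \<inter> C j = {}) \<and>
  (\<forall>i<t. (1 - \<tau>) * \<pi> i * rcard \<Omega> <= rcard (C i) \<and> rcard (C i) <= (1 + \<tau>) * \<pi> i * rcard \<Omega>) \<and>
  (\<forall>i<t. \<forall>v\<in>V. (1 - \<tau>) * \<pi> i * deg_in E v \<Omega> <= deg_in E v (C i) \<and>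
    deg_in E v (C i) <= (1 + \<tau>) * \<pi> i * deg_in E v \<Omega>) \<and>
  (\<forall>i<t. rcard (C i \<inter> X) <= \<pi> i * rcard (X \<inter> \<Omega>) + \<tau> * \<pi> i * rcard \<Omega>)"
proof -
 have \<pi>pos: "0 < \<pi> i" if "i < t" for i using \<pi>(1) \<pi>(2)[OF that] by linarith
 have "\<exists>P. (\<forall>D\<subseteq>{..<t}. measure_pmf.prob P (Some ` D) = sum \<pi> D) \<and> set_pmf P \<subseteq> insert None (Some ` {..<t})"
  using \<pi>pos \<pi>(3) by (intro ex_pmf_option) (auto simp: less_imp_le)
 then obtain P where P: "!!D. D \<subseteq> {..<t} ==> measure_pmf.prob P (Some ` D) = sum \<pi> D" by blast
 have Pi: "measure_pmf.prob P {Some i} = \<pi> i" if "i < t" for i using P[of "{i}"] that by simp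
 have fin\<Omega>: "finite \<Omega>" using \<Omega> fin(1) finite_subset by blast
 obtain v0 where v0: "v0 \<in> V" using fin by blast
 have \<Omega>big: "d0 <= rcard \<Omega>"
 proof -
  have "card (E `` {v0} \<inter> \<Omega>) <= card \<Omega>" using fin\<Omega> by (intro card_mono) auto
  then show ?thesis using d0(2)[OF v0] by linarith
 qed
 define G where "G = {\<Omega>, X \<inter> \<Omega>}"
 define K where "K = (Inl ` V \<union> Inr ` G) \<times> {..<t}"
 define S :: "('a + 'a set) \<times> nat => 'a set" where "S = (\<lambda>(a, i). case a of Inl v => E `` {v} \<inter> \<Omega> | Inr T => T)"
 define s :: "('a + 'a set) \<times> nat => real" where "s = (\<lambda>(a, i). case a of Inl v => deg_in E v \<Omega> | Inr T => rcard \<Omega>)"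
 define \<tau>' :: "('a + 'a set) \<times> nat => real" where "\<tau>' = (\<lambda>(a, i). \<tau> * \<pi> i * s (a, i))"
 define Cl :: "('a + 'a set) \<times> nat => nat option set" where "Cl = (\<lambda>(a, i). {Some i})"
 have sbig: "d0 <= s k" if "k \<in> K" for k
  using that d0(2) \<Omega>big by (auto simp: K_def s_def split: sum.split)
 have "\<exists>\<phi>. (\<forall>v\<in>\<Omega>. \<phi> v \<in> set_pmf P) \<and>
  (\<forall>k\<in>K. \<bar>card {v \<in> S k. \<phi> v \<in> Cl k} - (\<Sum>v\<in>S k. measure_pmf.prob P (Cl k))\<bar> < \<tau>' k)"
 proof (rule sampling_card[where s = s])
  show "finite \<Omega>" by fact
  show "finite K" using fin by (simp add: K_def G_def)
  show "S k \<subseteq> \<Omega>" if "k \<in> K" for k using that by (auto simp: K_def S_def G_def)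
  show "0 < \<tau>' k" if "k \<in> K" for k
  proof -
   obtain a i where k: "k = (a, i)" by (cases k)
   have i: "i < t" using that k by (simp add: K_def)
   have "0 < s k" using sbig[OF that] d0(1) by linarith
   then show ?thesis using \<pi>pos[OF i] \<tau> by (simp add: \<tau>'_def k)
  qed
  show "0 < s k \<and> rcard (S k) <= s k" if "k \<in> K" for k
  proof
   show "0 < s k" using sbig[OF that] d0(1) by linarith
   have "card (X \<inter> \<Omega>) <= card \<Omega>" using fin\<Omega> by (intro card_mono) auto
   then show "rcard (S k) <= s k" using that by (auto simp: K_def S_def s_def G_def)
  qed
  have "2 * exp (- 2 * (\<tau>' k)\<^sup>2 / s k) <= 2 * exp (- 2 * \<tau>\<^sup>2 * \<pi>0\<^sup>2 * d0)" if kK: "k \<in> K" for k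
  proof -
   obtain a i where k: "k = (a, i)" by (cases k)
   have i: "i < t" using kK k by (simp add: K_def)
   have s0: "0 < s k" using sbig[OF kK] d0(1) by linarith
   have "2 * (\<tau>' k)\<^sup>2 / s k = 2 * \<tau>\<^sup>2 * (\<pi> i)\<^sup>2 * s k"
    using s0 by (simp add: \<tau>'_def k power2_eq_square)
   moreover have "2 * \<tau>\<^sup>2 * \<pi>0\<^sup>2 * d0 <= 2 * \<tau>\<^sup>2 * (\<pi> i)\<^sup>2 * s k"
    using sbig[OF kK] \<pi>(1) \<pi>(2)[OF i] d0(1) by (intro mult_mono mult_left_mono power_mono) auto
   ultimately show ?thesis by simp
  qed
  then have "(\<Sum>k\<in>K. 2 * exp (- 2 * (\<tau>' k)\<^sup>2 / s k)) <= rcard K * (2 * exp (- 2 * \<tau>\<^sup>2 * \<pi>0\<^sup>2 * d0))"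
   by (rule sum_bounded_above)
  also have "... <= (real t * (rcard V + 2)) * (2 * exp (- 2 * \<tau>\<^sup>2 * \<pi>0\<^sup>2 * d0))"
  proof (rule mult_right_mono)
   have "card (Inl ` V \<union> Inr ` G :: ('a + 'a set) set) <= card (Inl ` V :: ('a + 'a set) set) + card (Inr ` G :: ('a + 'a set) set)" by (rule card_Un_le)
   also have "... = card V + card G" by (simp add: card_image)
   also have "card G <= 2" by (simp add: G_def card_insert_if)
   finally have "card (Inl ` V \<union> Inr ` G :: ('a + 'a set) set) <= card V + 2" by simp
   then have "card (Inl ` V \<union> Inr ` G :: ('a + 'a set) set) * t <= (card V + 2) * t" by (rule mult_le_mono1)
   then have "card K <= (card V + 2) * t" unfolding K_def card_cartesian_product by simp
   then have "rcard K <= real ((card V + 2) * t)" by (simp only: of_nat_le_iff)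
   then show "rcard K <= real t * (rcard V + 2)" by (simp add: algebra_simps)
  qed simp
  finally show "(\<Sum>k\<in>K. 2 * exp (- 2 * (\<tau>' k)\<^sup>2 / s k)) < 1" using small by simp
 qed
 then obtain \<phi> where \<phi>: "!!k. k \<in> K ==> \<bar>card {v \<in> S k. \<phi> v \<in> Cl k} - (\<Sum>v\<in>S k. measure_pmf.prob P (Cl k))\<bar> < \<tau>' k" by blast
 define C where "C i = {v \<in> \<Omega>. \<phi> v = Some i}" for i
 have res: "\<bar>rcard (T \<inter> C i) - \<pi> i * rcard T\<bar> < \<tau> * \<pi> i * s (a, i)"
  if "(a, i) \<in> K" "S (a, i) = T" "T \<subseteq> \<Omega>" for a i T
 proof -
  have i: "i < t" using that(1) by (simp add: K_def)
  have "{v \<in> T. \<phi> v \<in> Cl (a, i)} = T \<inter> C i" using that(3) by (auto simp: Cl_def C_def)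
  moreover have "(\<Sum>v\<in>T. measure_pmf.prob P (Cl (a, i))) = \<pi> i * rcard T" using Pi[OF i] by (simp add: Cl_def)
  ultimately show ?thesis using \<phi>[OF that(1)] unfolding that(2) by (simp only: \<tau>'_def prod.case)
 qed
 show ?thesis
 proof (intro exI[of _ C] conjI allI impI ballI)
  show "C i \<subseteq> \<Omega>" for i by (auto simp: C_def)
  show "C i \<inter> C j = {}" if "i \<noteq> j" for i j using that by (auto simp: C_def)
  fix i assume i: "i < t"
  have C\<Omega>: "\<Omega> \<inter> C i = C i" by (auto simp: C_def)
  have k1: "(Inr \<Omega>, i) \<in> K" "(Inr (X \<inter> \<Omega>), i) \<in> K" using i by (auto simp: K_def G_def)
  have r1: "\<bar>rcard (C i) - \<pi> i * rcard \<Omega>\<bar> < \<tau> * \<pi> i * rcard \<Omega>"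
   using res[OF k1(1), of \<Omega>] by (simp add: S_def s_def C\<Omega>)
  have e1: "(1 - \<tau>) * \<pi> i * rcard \<Omega> = \<pi> i * rcard \<Omega> - \<tau> * \<pi> i * rcard \<Omega>"
   "(1 + \<tau>) * \<pi> i * rcard \<Omega> = \<pi> i * rcard \<Omega> + \<tau> * \<pi> i * rcard \<Omega>" by (simp_all add: algebra_simps)
  show "(1 - \<tau>) * \<pi> i * rcard \<Omega> <= rcard (C i)" "rcard (C i) <= (1 + \<tau>) * \<pi> i * rcard \<Omega>"
   using r1 unfolding e1 by linarith+
  have "\<bar>rcard (X \<inter> \<Omega> \<inter> C i) - \<pi> i * rcard (X \<inter> \<Omega>)\<bar> < \<tau> * \<pi> i * rcard \<Omega>"
   using res[OF k1(2), of "X \<inter> \<Omega>"] by (simp add: S_def s_def)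
  moreover have "X \<inter> \<Omega> \<inter> C i = C i \<inter> X" by (auto simp: C_def)
  ultimately show "rcard (C i \<inter> X) <= \<pi> i * rcard (X \<inter> \<Omega>) + \<tau> * \<pi> i * rcard \<Omega>" by simp
  fix v assume v: "v \<in> V"
  have k: "(Inl v, i) \<in> K" using v i by (auto simp: K_def)
  have "E `` {v} \<inter> \<Omega> \<inter> C i = E `` {v} \<inter> C i" by (auto simp: C_def)
  then have r2: "\<bar>deg_in E v (C i) - \<pi> i * deg_in E v \<Omega>\<bar> < \<tau> * \<pi> i * deg_in E v \<Omega>"
   using res[OF k, of "E `` {v} \<inter> \<Omega>"] by (simp add: S_def s_def)
  have e2: "(1 - \<tau>) * \<pi> i * deg_in E v \<Omega> = \<pi> i * deg_in E v \<Omega> - \<tau> * \<pi> i * deg_in E v \<Omega>"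
   "(1 + \<tau>) * \<pi> i * deg_in E v \<Omega> = \<pi> i * deg_in E v \<Omega> + \<tau> * \<pi> i * deg_in E v \<Omega>" by (simp_all add: algebra_simps)
  show "(1 - \<tau>) * \<pi> i * deg_in E v \<Omega> <= deg_in E v (C i)"
   "deg_in E v (C i) <= (1 + \<tau>) * \<pi> i * deg_in E v \<Omega>"
   using r2 unfolding e2 by linarith+
 qed
qed

text \<open>A core guarantees the degree conditions of \<open>sparse_matching\<close> for every set of at most \<open>r\<close>
 vertices that contains it.\<close>

definition is_core :: "'a set => ('a \<times> 'a) set => real => real => real => 'a set => nat => nat => 'a set => bool" where
 "is_core V E p c a X r e0 C \<longleftrightarrow> C \<subseteq> V \<and> card C <= e0 \<and> (\<forall>v\<in>V. c * p * real r <= deg_in E v C) \<and>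
   (\<forall>v\<in>V - X. (1/2 + a) * p * real r <= deg_in E v C) \<and>
   rcard (C \<inter> X) + (real r - rcard C) <= c / 4 * real e0"

text \<open>A core already has the degrees required for \<open>r\<close> vertices, so further
  vertices do no harm to them. The additional vertices might all lie in \<open>X\<close>; the
  summand \<open>real r - rcard C\<close> in \<open>is_core\<close> has accounted for this.\<close>

lemma core_superset:
 assumes C: "is_core V E p c a X r e0 C" and Y: "C \<subseteq> Y" "Y \<subseteq> V" and fin: "finite V" and e: "e0 <= card Y" "card Y <= r" and pos: "0 < p" "0 < c" "0 < a"
 shows "!!v. v \<in> V ==> c * p * rcard Y <= deg_in E v Y"
  "!!v. v \<in> V - X ==> (1/2 + a) * p * rcard Y <= deg_in E v Y"
  "rcard (Y \<inter> X) <= c / 4 * rcard Y"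
proof -
 have finY: "finite Y" using Y fin finite_subset by blast
 have mono: "deg_in E v C <= deg_in E v Y" for v using Y finY by (auto intro!: card_mono)
 show "c * p * rcard Y <= deg_in E v Y" if "v \<in> V" for v
 proof -
  have "c * p * rcard Y <= c * p * real r" using e pos by (intro mult_left_mono) auto
  also have "... <= deg_in E v C" using C that by (simp add: is_core_def)
  finally show ?thesis using mono[of v] by linarith
 qed
 show "(1/2 + a) * p * rcard Y <= deg_in E v Y" if "v \<in> V - X" for v
 proof -
  have "(1/2 + a) * p * rcard Y <= (1/2 + a) * p * real r" using e pos by (intro mult_left_mono) auto
  also have "... <= deg_in E v C" using C that unfolding is_core_def by blast
  finally show ?thesis using mono[of v] by linarith
 qed
 have "Y \<inter> X \<subseteq> (C \<inter> X) \<union> (Y - C)" by auto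
 then have "card (Y \<inter> X) <= card ((C \<inter> X) \<union> (Y - C))" using finY Y(1) by (intro card_mono) (auto intro: finite_subset)
 also have "... <= card (C \<inter> X) + card (Y - C)" by (rule card_Un_le)
 finally have "card (Y \<inter> X) <= card (C \<inter> X) + card (Y - C)" .
 moreover have "card (Y - C) = card Y - card C" using Y finY finite_subset by (metis card_Diff_subset)
 moreover have "card C <= card Y" using Y finY by (intro card_mono)
 ultimately have "rcard (Y \<inter> X) <= rcard (C \<inter> X) + (rcard Y - rcard C)" by linarith
 also have "... <= rcard (C \<inter> X) + (real r - rcard C)" using e by simp
 also have "... <= c / 4 * real e0" using C by (simp add: is_core_def)
 also have "... <= c / 4 * rcard Y" using e pos by (intro mult_left_mono) auto
 finally show "rcard (Y \<inter> X) <= c / 4 * rcard Y" .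
qed

text \<open>Of the \<open>r\<close> vertices of the front only \<open>card Y\<close> are to be
  matched; choosing them around the core \<open>C\<close> preserves all degree conditions.\<close>

lemma core_match:
 assumes sp: "sparse_rel p \<beta> V E" and symE: "sym E" and fin: "finite V"
  and C: "is_core V E p c a X r e0 C" "C \<subseteq> F" "F \<subseteq> V" "card F = r"
  and C': "is_core V E p c a X r e0 C'" "C' \<subseteq> Y" "Y \<subseteq> V" "e0 <= card Y" "card Y <= r"
  and pos: "0 < p" "0 < \<beta>" "0 < a" "0 < c" and \<beta>: "4 * \<beta> <= c * p * real e0" "4 * \<beta> <= a * p * real e0"
 shows "\<exists>Z f. Z \<subseteq> F \<and> bij_betw f Z Y \<and> (\<forall>x\<in>Z. (x, f x) \<in> E)"
proof -
 have finF: "finite F" "finite C" using C(2,3) fin finite_subset by (blast, metis)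
 have "card C <= card Y" using C(1) C'(4) by (simp add: is_core_def)
 then have "card Y - card C <= card (F - C)" using C C' finF by (simp add: card_Diff_subset)
 then obtain G where G: "G \<subseteq> F - C" "card G = card Y - card C" by (meson obtain_subset_with_card_n)
 define Z where "Z = C \<union> G"
 have finG: "finite G" using G finF finite_subset by blast
 have cZ: "card Z = card Y" using G finG finF(2) \<open>card C <= card Y\<close> unfolding Z_def by (subst card_Un_disjoint) auto
 have ZF: "C \<subseteq> Z" "Z \<subseteq> F" using G C by (auto simp: Z_def)
 have ZV: "Z \<subseteq> V" using ZF C by blast
 note z = core_superset[OF C(1) ZF(1) ZV fin _ _ pos(1,4,3), unfolded cZ, OF C'(4,5)]
 note y = core_superset[OF C'(1-3) fin C'(4,5) pos(1,4,3)]
 have ee: "c * p * real e0 <= c * p * rcard Y" "a * p * real e0 <= a * p * rcard Y"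
  using C'(4) pos by (auto intro!: mult_left_mono)
 have "\<exists>f. bij_betw f Z Y \<and> (\<forall>x\<in>Z. (x, f x) \<in> E)"
 proof (rule sparse_matching[OF sp symE ZV C'(3) fin cZ refl pos, where B = "Z \<inter> X" and C = "Y \<inter> X"])
  show "4 * \<beta> <= c * p * rcard Y" "4 * \<beta> <= a * p * rcard Y" using \<beta> ee by linarith+
  show "c * p * rcard Y <= deg_in E x Y" if "x \<in> Z" for x using y(1) that ZV by blast
  show "c * p * rcard Y <= deg_in E y Z" if "y \<in> Y" for y using z(1) that C'(3) by blast
  show "(1/2 + a) * p * rcard Y <= deg_in E x Y" if "x \<in> Z - Z \<inter> X" for x using y(2)[of x] that ZV by blast
  show "(1/2 + a) * p * rcard Y <= deg_in E y Z" if "y \<in> Y - Y \<inter> X" for y using z(2)[of y] that C'(3) by blast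
  show "Z \<inter> X \<subseteq> Z" "Y \<inter> X \<subseteq> Y" by auto
  show "rcard (Z \<inter> X) <= c / 4 * rcard Y" by (rule z(3))
  show "rcard (Y \<inter> X) <= c / 4 * rcard Y" by (rule y(3))
 qed
 then show ?thesis using ZF by blast
qed

text \<open>The deterministic part: given two reserves, cores \<open>A0\<close>, \<open>B0\<close> and a pool \<open>T0\<close> of spare vertices, the
 gadgets are built inside the reserves and every remaining vertex is put on one of \<open>r\<close> paths from \<open>A\<close> to \<open>B\<close>.\<close>

lemma hamilton_from_cores:
 fixes q b :: real
 assumes sp: "sparse_rel p \<beta> V E" and EV: "E \<subseteq> V \<times> V" and symE: "sym E" and fin: "finite V" and pos: "0 < p" "0 < \<beta>" "0 < a" "0 < c"
  and con: "connector V E R1 q b" "connector V E R2 q b" and q: "3 * real r <= q" "real r * (b + 1) <= q" and r: "2 <= r"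
  and \<beta>: "4 * \<beta> <= c * p * real e0" "4 * \<beta> <= a * p * real e0" and e0r: "e0 <= r"
  and R: "R1 \<subseteq> V" "R2 \<subseteq> V" "R1 \<inter> R2 = {}"
  and A0: "is_core V E p c a X r e0 A0" and B0: "is_core V E p c a X r e0 B0"
  and dis: "A0 \<inter> B0 = {}" "A0 \<inter> T0 = {}" "B0 \<inter> T0 = {}" "(A0 \<union> B0 \<union> T0) \<inter> (R1 \<union> R2) = {}" and T0: "T0 \<subseteq> V" "3 * r <= card T0"
  and pool: "!!W. V - (A0 \<union> B0 \<union> T0 \<union> R1 \<union> R2) \<subseteq> W ==> W \<subseteq> V - (A0 \<union> B0) ==>
   \<exists>(t::nat) Es core. (\<Union>s<t. Es s) = W \<and> (\<forall>s<t. \<forall>s'<t. s \<noteq> s' --> Es s \<inter> Es s' = {}) \<and>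
    (\<forall>s<t. is_core V E p c a X r e0 (core s) \<and> core s \<subseteq> Es s \<and> e0 <= card (Es s) \<and> card (Es s) <= r)"
 shows "hamiltonian V E"
proof -
 have finT: "finite T0" using T0 fin finite_subset by blast
 have cA: "card A0 <= r" "card B0 <= r" "A0 \<subseteq> V" "B0 \<subseteq> V" using A0 B0 e0r by (auto simp: is_core_def)
 have finA: "finite A0" "finite B0" using cA fin finite_subset by auto
 \<comment> \<open>The pool fills \<open>A0\<close> and \<open>B0\<close> up to \<open>r\<close>
   vertices each and provides the \<open>r\<close> vertices \<open>D i\<close>, hence
   \<open>3 * r <= card T0\<close>.\<close>
 have "r - card A0 <= card T0" using T0(2) by linarith
 then obtain FA where FA: "FA \<subseteq> T0" "card FA = r - card A0" by (meson obtain_subset_with_card_n)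
 have finFA: "finite FA" using FA finT finite_subset by blast
 have "r - card B0 <= card (T0 - FA)" using FA T0 finFA by (simp add: card_Diff_subset)
 then obtain FB where FB: "FB \<subseteq> T0 - FA" "card FB = r - card B0" by (meson obtain_subset_with_card_n)
 have finFB: "finite FB" using FB finT finite_subset by blast
 have "r <= card (T0 - FA - FB)" using FA FB T0 finFA finFB finT by (simp add: card_Diff_subset)
 then obtain DD where DD: "DD \<subseteq> T0 - FA - FB" "card DD = r" by (meson obtain_subset_with_card_n)
 have finDD: "finite DD" using DD finT finite_subset by blast
 define AA where "AA = A0 \<union> FA"
 define BB where "BB = B0 \<union> FB"
 have cAA: "card AA = r" "card BB = r"
  unfolding AA_def BB_def using FA FB finA finFA finFB dis cA by (subst card_Un_disjoint; auto)+
 have finAA: "finite AA" "finite BB" using finA finFA finFB by (auto simp: AA_def BB_def)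
 have AB: "AA \<inter> BB = {}" "AA \<inter> DD = {}" "BB \<inter> DD = {}" using dis FA FB DD unfolding AA_def BB_def by blast+
 have RD: "(AA \<union> BB \<union> DD) \<inter> (R1 \<union> R2) = {}" using dis FA FB DD unfolding AA_def BB_def by blast
 have sub: "AA \<subseteq> V" "BB \<subseteq> V" "DD \<subseteq> V" using cA FA FB DD T0 unfolding AA_def BB_def by blast+
 obtain A where A: "bij_betw A {..<r} AA" using ex_bij_betw_nat_finite[OF finAA(1)] cAA by (auto simp: atLeast0LessThan)
 obtain B where B: "bij_betw B {..<r} BB" using ex_bij_betw_nat_finite[OF finAA(2)] cAA by (auto simp: atLeast0LessThan)
 obtain D where D: "bij_betw D {..<r} DD" using ex_bij_betw_nat_finite[OF finDD] DD by (auto simp: atLeast0LessThan)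
 have im: "A ` {..<r} = AA" "B ` {..<r} = BB" "D ` {..<r} = DD" using A B D by (auto simp: bij_betw_def)
 have inj: "inj_on A {..<r}" "inj_on B {..<r}" "inj_on D {..<r}" using A B D by (auto simp: bij_betw_def)
 have "D ` {..<r} \<inter> (R1 \<union> R2) = {}" using RD unfolding im by blast
 from gadget_system[OF symE con q inj _ _ _ R(1,2) fin R(3) this, unfolded im, OF sub]
 obtain tA tB c' d e k m S where gs: "(\<forall>i<r. walk E (B i) (tA i) (c' i) \<and> walk E (B i) (tB i) (e i) \<and>
   (d i, c' i) \<in> E \<and> (d i, e i) \<in> E \<and> add_mset (c' i) (mset (tB i)) = add_mset (e i) (mset (tA i)) \<and>
   walk E (c' i) (k i @ [A i]) (A i) \<and> walk E (e i) (m i @ [d (Suc i mod r)]) (d (Suc i mod r))) \<and>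
  S \<subseteq> R1 \<union> R2 \<union> DD \<and> (\<Sum>i<r. mset (tA i @ [d i, e i] @ m i @ k i)) = mset_set S"
  by (elim exE) (rule that; assumption)
 note g = conjunct1[OF gs, rule_format]
 note S = conjunct1[OF conjunct2[OF gs]] conjunct2[OF conjunct2[OF gs]]
 have finS: "finite S" using S(1) R finDD fin by (meson finite_UnI finite_subset)
 \<comment> \<open>\<open>W\<close> also receives the pool and reserve vertices that the gadgets
   left over. It depends on the gadgets, which is why \<open>pool\<close> speaks about every set in
   this range.\<close>
 define W where "W = V - (AA \<union> BB \<union> S)"
 have SAB: "S \<inter> (AA \<union> BB) = {}" using S(1) AB RD by blast
 have W1: "V - (A0 \<union> B0 \<union> T0 \<union> R1 \<union> R2) \<subseteq> W" using S(1) FA FB DD unfolding W_def AA_def BB_def by blast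
 have W2: "W \<subseteq> V - (A0 \<union> B0)" unfolding W_def AA_def BB_def by blast
 from pool[OF W1 W2] obtain t :: nat and Es core where Ess: "(\<Union>s<t. Es s) = W \<and> (\<forall>s<t. \<forall>s'<t. s \<noteq> s' --> Es s \<inter> Es s' = {}) \<and>
    (\<forall>s<t. is_core V E p c a X r e0 (core s) \<and> core s \<subseteq> Es s \<and> e0 <= card (Es s) \<and> card (Es s) <= r)"
  by (elim exE) (rule that; assumption)
 have Es: "(\<Union>s<t. Es s) = W" "!!s s'. s < t ==> s' < t ==> s \<noteq> s' ==> Es s \<inter> Es s' = {}"
  "!!s. s < t ==> is_core V E p c a X r e0 (core s) \<and> core s \<subseteq> Es s \<and> e0 <= card (Es s) \<and> card (Es s) <= r"
  using Ess by simp_all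
 define Es' where "Es' s = (if s < t then Es s else BB)" for s
 \<comment> \<open>\<open>core' s\<close> must lie in the front that precedes block
   \<open>s\<close>, hence the shift by one against \<open>core\<close>; it starts with
   \<open>A0\<close> and ends with \<open>B0\<close>, as \<open>BB\<close> is appended as the last
   block.\<close>
 define core' where "core' s = (if s = 0 then A0 else if s <= t then core (s - 1) else B0)" for s
 have EsW: "Es s \<subseteq> W" if "s < t" for s using Es(1) that by blast
 have Es'V: "Es' s \<subseteq> V" for s using EsW sub unfolding Es'_def W_def by (cases "s < t") auto
 have core': "is_core V E p c a X r e0 (core' s)" if "s <= Suc t" for s
  using that A0 B0 Es(3)[of "s - 1"] by (auto simp: core'_def)
 have core_sub: "core' (Suc s) \<subseteq> Es' s" if "s < Suc t" for s
  using that Es(3)[of s] unfolding core'_def Es'_def BB_def by (cases "s < t") auto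
 have Es'card: "e0 <= card (Es' s) \<and> card (Es' s) <= r" for s using Es(3)[of s] cAA e0r unfolding Es'_def by (cases "s < t") auto
 have dj: "Es' s \<inter> Es' s' = {}" if "s < Suc t" "s' < Suc t" "s \<noteq> s'" for s s'
  using that Es(2)[of s s'] EsW[of s] EsW[of s'] unfolding Es'_def W_def by (auto simp: less_Suc_eq)
 have djA: "Es' s \<inter> A ` {..<r} = {}" if "s < Suc t" for s
  using that EsW[of s] AB(1) unfolding im Es'_def W_def by (cases "s < t") auto
 have "\<exists>T e F. bij_betw e {..<r} F \<and> F \<subseteq> A ` {..<r} \<union> (\<Union>s'<Suc t. Es' s') \<and> core' (Suc t) \<subseteq> F \<and> (\<forall>s. Suc t = Suc s --> Es' s \<subseteq> F) \<and>
  (\<forall>i<r. walk E (A i) (T i) (e i)) \<and> (\<Sum>i<r. mset (T i)) = mset_set (\<Union>s<Suc t. Es' s)"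
 proof (rule front_iterate[OF inj(1), where core = core' and t = "Suc t"])
  show "core' 0 \<subseteq> A ` {..<r}" unfolding im by (auto simp: core'_def AA_def)
  show "finite (Es' s)" for s using Es'V fin finite_subset by blast
  fix s F assume s: "s < Suc t" and F: "F \<subseteq> A ` {..<r} \<union> (\<Union>s'<s. Es' s')" "card F = r" "core' s \<subseteq> F"
  have FV: "F \<subseteq> V" using F(1) sub(1) Es'V unfolding im by blast
  show "\<exists>X f. X \<subseteq> F \<and> bij_betw f X (Es' s) \<and> (\<forall>x\<in>X. (x, f x) \<in> E)"
   using s Es'card[of s] core_sub[OF s]
   by (intro core_match[OF sp symE fin core'[of s] F(3) FV F(2) core'[of "Suc s"] _ Es'V _ _ pos \<beta>]) auto
 qed (use dj djA core_sub in auto)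
 then obtain T ee F where T: "bij_betw ee {..<r} F" "Es' t \<subseteq> F" "!!i. i < r ==> walk E (A i) (T i) (ee i)"
  "(\<Sum>i<r. mset (T i)) = mset_set (\<Union>s<Suc t. Es' s)" by auto
 have "card F = r" "finite F" using bij_betw_same_card[OF T(1)] bij_betw_finite[OF T(1)] by auto
 then have FB': "F = BB" using T(2) cAA(2) by (simp add: Es'_def) (metis card_subset_eq)
 have un: "(\<Union>s<Suc t. Es' s) = W \<union> BB"
 proof -
  have "(\<Union>s<Suc t. Es' s) = (\<Union>s<t. Es s) \<union> BB" by (auto simp: Es'_def less_Suc_eq)
  then show ?thesis using Es(1) by simp
 qed
 \<comment> \<open>The paths arrive at \<open>BB\<close> in an uncontrolled order; \<pi> records it,
   and \<open>ring_cycle\<close> copes with any such permutation.\<close>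
 define \<pi> where "\<pi> i = inv_into {..<r} B (ee i)" for i
 have \<pi>: "bij_betw \<pi> {..<r} {..<r}"
  unfolding \<pi>_def using bij_betw_trans[OF T(1)[unfolded FB'] bij_betw_inv_into[OF B]] by (simp add: comp_def)
 have B\<pi>: "B (\<pi> i) = ee i" if "i < r" for i
 proof -
  have "ee i \<in> BB" using T(1) that unfolding FB' bij_betw_def by auto
  then show ?thesis unfolding \<pi>_def using im(2) by (intro f_inv_into_f) auto
 qed
 have "\<exists>C. C \<noteq> [] \<and> chain E (last C # C) \<and> mset C = (\<Sum>i<r. mset (tA i @ [d i, e i] @ m i @ k i @ [A i] @ T i))"
  using r g T(3) B\<pi> by (intro ring_cycle[OF _ \<pi>, where c = c' and B = B and tB = tB]) auto
 then obtain C where C: "C \<noteq> []" "chain E (last C # C)" "mset C = (\<Sum>i<r. mset (tA i @ [d i, e i] @ m i @ k i @ [A i] @ T i))" by blast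
 have "mset (tA i @ [d i, e i] @ m i @ k i @ [A i] @ T i) = mset (tA i @ [d i, e i] @ m i @ k i) + {#A i#} + mset (T i)" for i by simp
 then have "mset C = mset_set S + (\<Sum>i<r. {#A i#}) + mset_set (W \<union> BB)"
  unfolding C(3) by (simp only: sum.distrib S(2) T(4) un)
 also have "(\<Sum>i<r. {#A i#}) = mset_set AA"
  using image_mset_mset_set[OF inj(1)] by (simp add: im sum_unfold_sum_mset)
 also have "mset_set S + mset_set AA + mset_set (W \<union> BB) = mset_set (S \<union> AA \<union> (W \<union> BB))"
 proof -
  have f: "finite (S \<union> AA)" "finite (W \<union> BB)" using finS finAA fin by (auto simp: W_def)
  have "mset_set (S \<union> AA) = mset_set S + mset_set AA" using finS finAA SAB by (intro mset_set_Union) auto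
  moreover have "mset_set ((S \<union> AA) \<union> (W \<union> BB)) = mset_set (S \<union> AA) + mset_set (W \<union> BB)"
   using f SAB AB(1) by (intro mset_set_Union) (auto simp: W_def)
  ultimately show ?thesis by simp
 qed
 also have "S \<union> AA \<union> (W \<union> BB) = V" using S(1) R sub unfolding W_def by blast
 finally have mC: "mset C = mset_set V" .
 have "set C = V" using mC fin by (metis finite_set_mset_mset_set set_mset_mset)
 moreover have "distinct C"
 proof (rule card_distinct)
  have "length C = card V" using arg_cong[OF mC, of size] by simp
  then show "card (set C) = length C" using \<open>set C = V\<close> by simp
 qed
 moreover have "3 <= length C"
 proof -
  have "card (AA \<union> BB) = 2 * r" using cAA AB finAA by (subst card_Un_disjoint) auto
  then have "2 * r <= card V" using card_mono[OF fin, of "AA \<union> BB"] sub by auto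
  moreover have "length C = card V" using mC by (metis size_mset size_mset_set)
  ultimately show ?thesis using r by simp
 qed
 ultimately show ?thesis using C(2) by blast
qed

section \<open>Two disjoint reserves and the parameters of the Hamilton cycle\<close>

lemma connector_mono:
 assumes "connector V E R q b" "q' <= q"
 shows "connector V E R q' b"
 unfolding connector_def
proof (intro allI impI, elim conjE)
 fix I :: "nat set" and x y
 assume a: "finite I" "rcard I <= q'" "\<forall>i\<in>I. x i \<in> V \<and> y i \<in> V"
  "\<forall>v. card {i \<in> I. x i = v} <= 3 \<and> card {i \<in> I. y i = v} <= 3"
 have "rcard I <= q" using a(2) assms(2) by linarith
 with a show "\<exists>P. disj_lists I P \<and> (\<forall>i\<in>I. conn E R (x i) (y i) (P i) \<and> real (length (P i)) <= b)"
  by (intro assms(1)[unfolded connector_def, rule_format]) simp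
qed

text \<open>The second reserve has to avoid the first. Its tolerance \<open>\<omega>2\<close> is
  therefore obtained before the density \<open>eps1\<close> of the first reserve is chosen below
  it.\<close>

lemma two_reserves:
 fixes c \<xi> eps :: real
 assumes "0 < c" "0 < \<xi>" "0 < eps"
 shows "\<exists>\<kappa>::real. 0 < \<kappa> \<and> (\<forall>\<^sub>F n in sequentially. \<forall>(V :: 'a set) E p. good_graph n c \<xi> p V E \<and> V \<noteq> {} -->
  (\<exists>R1 R2. reserve_pair n eps (\<kappa> * real n / ln (real n)) (5 * ln (real n)) V E R1 R2))" (is "\<exists>\<kappa>::real. 0 < \<kappa> \<and> ?E \<kappa>")
proof -
 obtain \<omega>2 \<kappa>2 :: real where w2: "0 < \<omega>2" "0 < \<kappa>2" and ev2: "\<forall>\<^sub>F n in sequentially. \<forall>(V :: 'a set) E p W0.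
  reservable n c \<xi> p \<omega>2 V E W0 -->
  (\<exists>R. is_reserve n eps (\<kappa>2 * real n / ln (real n)) (5 * ln (real n)) V E W0 R)"
  using reserve[OF assms, where ?'a = 'a] by (elim exE conjE) (rule that; assumption)
 define eps1 where "eps1 = min (1/2) (min eps \<omega>2)"
 have e1: "0 < eps1" "eps1 <= 1/2" "eps1 <= eps" "eps1 <= \<omega>2" using assms w2 by (auto simp: eps1_def)
 obtain \<omega>1 \<kappa>1 :: real where w1: "0 < \<omega>1" "0 < \<kappa>1" and ev1: "\<forall>\<^sub>F n in sequentially. \<forall>(V :: 'a set) E p W0.
  reservable n c \<xi> p \<omega>1 V E W0 -->
  (\<exists>R. is_reserve n eps1 (\<kappa>1 * real n / ln (real n)) (5 * ln (real n)) V E W0 R)"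
  using reserve[OF assms(1,2) e1(1), where ?'a = 'a] by (elim exE conjE) (rule that; assumption)
 define \<kappa> where "\<kappa> = min \<kappa>1 \<kappa>2"
 have ln1: "\<forall>\<^sub>F n in sequentially. 1 <= ln (real n)" by real_asymp
 show ?thesis
 proof (intro exI[of _ \<kappa>] conjI)
  show "0 < \<kappa>" using w1 w2 by (simp add: \<kappa>_def)
  show "?E \<kappa>"
   using ev1 ev2 ln1
  proof eventually_elim
   case (elim n)
   show ?case
   proof (intro allI impI, elim conjE)
    fix V :: "'a set" and E p
    assume G: "good_graph n c \<xi> p V E" and ne: "V \<noteq> {}"
    have "good_graph n c \<xi> p V E \<and> V \<noteq> {} \<and> {} \<subseteq> V \<and> rcard ({} :: 'a set) <= \<omega>1 * real n \<and>
      (\<forall>v\<in>V. deg_in E v {} <= deg E v / 2)"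
     using G ne w1 by simp
    from elim(1)[rule_format, OF this] obtain R1 where R1: "R1 \<subseteq> V" "rcard R1 <= eps1 * real n"
     "!!v. v \<in> V ==> deg_in E v R1 <= eps1 * deg E v"
     "connector V E R1 (\<kappa>1 * real n / ln (real n)) (5 * ln (real n))" by auto
    have m: "eps1 * real k <= eps * real k" "eps1 * real k <= \<omega>2 * real k" "eps1 * real k <= 1/2 * real k" for k
     using mult_right_mono[OF e1(3), of "real k"] mult_right_mono[OF e1(4), of "real k"] mult_right_mono[OF e1(2), of "real k"] by linarith+
    have "reservable n c \<xi> p \<omega>2 V E R1"
    proof (intro conjI ballI)
     show "rcard R1 <= \<omega>2 * real n" using R1(2) m(2)[of n] by linarith
     show "deg_in E v R1 <= deg E v / 2" if "v \<in> V" for v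
      using R1(3)[OF that] m(3)[of "card (E `` {v})"] by linarith
    qed fact+
    from elim(2)[rule_format, OF this] obtain R2 where R2: "R2 \<subseteq> V - R1" "rcard R2 <= eps * real n"
     "!!v. v \<in> V ==> deg_in E v R2 <= eps * deg E v"
     "connector V E R2 (\<kappa>2 * real n / ln (real n)) (5 * ln (real n))" by auto
    have \<kappa>: "\<kappa> * real n / ln (real n) <= \<kappa>1 * real n / ln (real n)" "\<kappa> * real n / ln (real n) <= \<kappa>2 * real n / ln (real n)"
     using elim(3) by (auto intro!: divide_right_mono mult_right_mono simp: \<kappa>_def)
    show "\<exists>R1 R2. reserve_pair n eps (\<kappa> * real n / ln (real n)) (5 * ln (real n)) V E R1 R2"
    proof (rule exI[of _ R1], rule exI[of _ R2], intro conjI ballI)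
     show "R1 \<inter> R2 = {}" using R2(1) by blast
     show "rcard R1 <= eps * real n" using R1(2) m(1)[of n] by linarith
     show "deg_in E v R1 <= eps * deg E v" if "v \<in> V" for v
      using R1(3)[OF that] m(1)[of "card (E `` {v})"] by linarith
    qed (use R1(1) R2 connector_mono[OF R1(4) \<kappa>(1)] connector_mono[OF R2(4) \<kappa>(2)] in auto)
   qed
  qed
 qed
qed

text \<open>Bookkeeping of relative errors. The slack \<open>1 - 2 * \<tau>\<close> in the colour
  probabilities keeps \<open>C\<close> at size at most \<rho> - 1, hence at most \<open>e0\<close>.
  The losses in degree multiply to at least \<open>1 - 7 * \<tau>\<close>, and \<tau> is small
  enough against \<alpha> and \<open>c\<close> for \<open>\<alpha> / 2\<close> and
  \<open>c / 2\<close> to remain.\<close>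

lemma is_coreI:
 fixes c \<alpha> \<tau> \<pi> \<pi>0 \<rho> p N :: real
 assumes \<tau>: "0 < \<tau>" "\<tau> <= 1/40" "40 * \<tau> <= \<alpha>" "160 * \<tau> <= c" and \<pi>0: "0 < \<pi>0" and p: "0 < p"
  and \<rho>: "\<rho> = \<pi>0 * rcard V" "1 <= \<tau>\<^sup>2 * \<rho>" "2 <= \<rho>"
  and r: "real r <= (1 + 3 * \<tau>) * \<rho>" and e0: "\<rho> - 1 <= real e0"
  and \<pi>: "(1 - 2 * \<tau>) * \<pi>0 <= \<pi>" "\<pi> * rcard W <= (1 + \<tau>) * (1 - 2 * \<tau>) * \<rho>" "(1 - 3 * \<tau>) * \<rho> <= \<pi> * rcard W" "\<pi> <= 2 * \<pi>0"
  and C: "C \<subseteq> V" "(1 - \<tau>) * \<pi> * rcard W <= rcard C" "rcard C <= (1 + \<tau>) * \<pi> * rcard W"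
   "!!v. v \<in> V ==> (1 - \<tau>) * \<pi> * deg_in E v W <= deg_in E v C"
   "rcard (C \<inter> X) <= \<pi> * rcard (X \<inter> W) + \<tau> * \<pi> * rcard W"
  and W: "!!v. v \<in> V ==> (1 - 4 * \<tau>) * deg E v <= deg_in E v W"
  and X: "X \<subseteq> V" "finite V" "rcard X <= \<tau> * rcard V"
  and deg: "!!v. v \<in> V ==> c * rcard V * p <= deg E v"
   "!!v. v \<in> V - X ==> (1/2 + \<alpha>) * rcard V * p <= deg E v"
 shows "is_core V E p (c / 2) (\<alpha> / 2) X r e0 C"
proof -
 have \<rho>0: "0 < \<rho>" using \<rho>(3) by linarith
 have t1: "0 <= 1 - \<tau>" "0 <= 1 - 2 * \<tau>" "0 <= 1 - 4 * \<tau>" "0 <= 1 - 3 * \<tau>" using \<tau> by linarith+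
 have \<pi>pos: "0 <= \<pi>" using \<pi>(1) mult_nonneg_nonneg[OF t1(2) less_imp_le[OF \<pi>0]] by linarith
 have tt: "\<tau>\<^sup>2 <= \<tau> * (1/40)" "0 <= \<tau>\<^sup>2" using \<tau>(1,2) by (auto simp: power2_eq_square intro: mult_left_mono)
 have up: "rcard C <= \<rho> - 1"
 proof -
  have "rcard C <= (1 + \<tau>) * (\<pi> * rcard W)" using C(3) by (simp add: mult.assoc)
  also have "... <= (1 + \<tau>) * ((1 + \<tau>) * (1 - 2 * \<tau>) * \<rho>)" using \<pi>(2) \<tau>(1) by (intro mult_left_mono) auto
  also have "... = (1 - 3 * \<tau>\<^sup>2 - 2 * \<tau> * \<tau>\<^sup>2) * \<rho>" by (simp add: algebra_simps power2_eq_square)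
  also have "... <= (1 - \<tau>\<^sup>2) * \<rho>" proof (rule mult_right_mono)
   have "0 <= \<tau> * \<tau>\<^sup>2" using \<tau>(1) by simp
   then show "1 - 3 * \<tau>\<^sup>2 - 2 * \<tau> * \<tau>\<^sup>2 <= 1 - \<tau>\<^sup>2" using tt by linarith
  qed (use \<rho>0 in simp)
  also have "... = \<rho> - \<tau>\<^sup>2 * \<rho>" by (simp add: algebra_simps)
  finally show ?thesis using \<rho>(2) by linarith
 qed
 have lo: "(1 - 4 * \<tau>) * \<rho> <= rcard C"
 proof -
  have "(1 - 4 * \<tau>) * \<rho> <= (1 - 4 * \<tau> + 3 * \<tau>\<^sup>2) * \<rho>" using tt \<rho>0 by (intro mult_right_mono) auto
  also have "... = (1 - \<tau>) * ((1 - 3 * \<tau>) * \<rho>)" by (simp add: algebra_simps power2_eq_square)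
  also have "... <= (1 - \<tau>) * (\<pi> * rcard W)" using \<pi>(3) t1 by (intro mult_left_mono)
  finally show ?thesis using C(2) by (simp add: mult.assoc)
 qed
 have dC: "(1 - 7 * \<tau>) * \<pi>0 * deg E v <= deg_in E v C" if v: "v \<in> V" for v
 proof -
  have "(1 - 7 * \<tau>) * \<pi>0 * deg E v <= ((1 - \<tau>) * (1 - 2 * \<tau>) * (1 - 4 * \<tau>)) * \<pi>0 * deg E v"
  proof (intro mult_right_mono)
   have "(1 - \<tau>) * (1 - 2 * \<tau>) * (1 - 4 * \<tau>) = 1 - 7 * \<tau> + \<tau>\<^sup>2 * (14 - 8 * \<tau>)" by (simp add: algebra_simps power2_eq_square)
   moreover have "0 <= \<tau>\<^sup>2 * (14 - 8 * \<tau>)" using \<tau> by (intro mult_nonneg_nonneg) auto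
   ultimately show "1 - 7 * \<tau> <= (1 - \<tau>) * (1 - 2 * \<tau>) * (1 - 4 * \<tau>)" by linarith
  qed (use \<pi>0 in auto)
  also have "... = (1 - \<tau>) * (((1 - 2 * \<tau>) * \<pi>0) * ((1 - 4 * \<tau>) * deg E v))" by (simp add: mult_ac)
  also have "... <= (1 - \<tau>) * (\<pi> * deg_in E v W)"
   using \<pi>(1) W[OF v] t1 \<pi>pos by (intro mult_left_mono mult_mono mult_nonneg_nonneg) auto
  also have "... <= deg_in E v C" using C(4)[OF v] by (simp add: mult.assoc)
  finally show ?thesis .
 qed
 have pr: "p * real r <= p * ((1 + 3 * \<tau>) * (\<pi>0 * rcard V))" using r p unfolding \<rho>(1) by (intro mult_left_mono) auto
 have gen: "A * p * real r <= deg_in E v C" if v: "v \<in> V" and D: "D * rcard V * p <= deg E v"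
   and AD: "A * (1 + 3 * \<tau>) <= (1 - 7 * \<tau>) * D" and A: "0 <= A" for A D v
 proof -
  have "A * p * real r <= A * (p * ((1 + 3 * \<tau>) * (\<pi>0 * rcard V)))" using mult_left_mono[OF pr A] by (simp add: mult.assoc)
  also have "... = (A * (1 + 3 * \<tau>)) * (p * \<pi>0 * rcard V)" by (simp add: mult_ac)
  also have "... <= ((1 - 7 * \<tau>) * D) * (p * \<pi>0 * rcard V)" using AD p \<pi>0 by (intro mult_right_mono) auto
  also have "... = (1 - 7 * \<tau>) * \<pi>0 * (D * rcard V * p)" by (simp add: mult_ac)
  also have "... <= (1 - 7 * \<tau>) * \<pi>0 * deg E v" using D \<tau> \<pi>0 by (intro mult_left_mono) auto
  finally show ?thesis using dC[OF v] by linarith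
 qed
 have c0: "0 < c" "0 < \<alpha>" using \<tau> by linarith+
 show ?thesis unfolding is_core_def
 proof (intro conjI ballI)
  show "C \<subseteq> V" by fact
  show "card C <= e0" using up e0 by linarith
  show "c / 2 * p * real r <= deg_in E v C" if v: "v \<in> V" for v
  proof (rule gen[OF v deg(1)[OF v]])
   have "c * ((1 + 3 * \<tau>) / 2) <= c * (1 - 7 * \<tau>)" using c0 \<tau> by (intro mult_left_mono) auto
   then show "c / 2 * (1 + 3 * \<tau>) <= (1 - 7 * \<tau>) * c" by (simp add: mult_ac)
  qed (use c0 in auto)
  show "(1/2 + \<alpha> / 2) * p * real r <= deg_in E v C" if v: "v \<in> V - X" for v
  proof (rule gen[OF _ deg(2)[OF v]])
   have "\<tau> * \<alpha> <= 1/40 * \<alpha>" using \<tau>(2) c0 by (intro mult_right_mono) auto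
   moreover have "(1 - 7 * \<tau>) * (1/2 + \<alpha>) - (1/2 + \<alpha> / 2) * (1 + 3 * \<tau>) = \<alpha> / 2 - 5 * \<tau> - 17 / 2 * (\<tau> * \<alpha>)" by (simp add: field_simps)
   ultimately show "(1/2 + \<alpha> / 2) * (1 + 3 * \<tau>) <= (1 - 7 * \<tau>) * (1/2 + \<alpha>)" using \<tau>(3) c0(2) by linarith
  qed (use v c0 in auto)
  have "rcard (X \<inter> W) <= rcard X" using finite_subset[OF X(1,2)] by (auto intro: card_mono)
  then have "rcard (X \<inter> W) <= \<tau> * rcard V" using X(3) by linarith
  then have "\<pi> * rcard (X \<inter> W) <= (2 * \<pi>0) * (\<tau> * rcard V)" using \<pi>(4) \<pi>pos \<pi>0 by (intro mult_mono) auto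
  also have "... = 2 * (\<tau> * \<rho>)" by (simp add: \<rho>(1))
  finally have a1: "\<pi> * rcard (X \<inter> W) <= 2 * (\<tau> * \<rho>)" .
  have "(1 + \<tau>) * (1 - 2 * \<tau>) = 1 - \<tau> - 2 * \<tau>\<^sup>2" by (simp add: algebra_simps power2_eq_square)
  then have "(1 + \<tau>) * (1 - 2 * \<tau>) * \<rho> <= 1 * \<rho>" using tt(2) \<tau>(1) \<rho>0 by (intro mult_right_mono) linarith+
  then have "\<tau> * (\<pi> * rcard W) <= \<tau> * \<rho>" using \<pi>(2) \<tau>(1) by (intro mult_left_mono) auto
  then have a2: "\<tau> * \<pi> * rcard W <= \<tau> * \<rho>" by (simp add: mult.assoc)
  have a3: "real r - rcard C <= 7 * (\<tau> * \<rho>)" using r lo by (simp add: algebra_simps)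
  have "c * \<rho> / 16 <= c / 8 * real e0"
  proof -
   have "c / 8 * (\<rho> / 2) <= c / 8 * real e0" using e0 \<rho>(3) c0 by (intro mult_left_mono) auto
   then show ?thesis by simp
  qed
  moreover have "160 * \<tau> * \<rho> <= c * \<rho>" using \<tau>(4) \<rho>0 by (intro mult_right_mono) auto
  ultimately have "10 * (\<tau> * \<rho>) <= c / 8 * real e0" by linarith
  moreover have "0 <= \<tau> * \<rho>" using \<tau> \<rho>0 by simp
  ultimately show "rcard (C \<inter> X) + (real r - rcard C) <= c / 2 / 4 * real e0"
   using C(5) a1 a2 a3 by simp
 qed
qed

lemma sum_balanced_parts: "0 < t ==> (\<Sum>s<t. w div t + (if s < w mod t then 1 else 0)) = (w :: nat)"
proof -
 assume t: "0 < t"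
 have e: "{s \<in> {..<t}. s < w mod t} = {..<w mod t}" using t by (auto intro: less_trans[OF _ mod_less_divisor])
 have "(\<Sum>s<t. if s < w mod t then 1 else 0 :: nat) = (\<Sum>s\<in>{s \<in> {..<t}. s < w mod t}. 1)" by (rule sum.inter_filter[symmetric]) simp
 also have "... = w mod t" unfolding e by simp
 finally have "(\<Sum>s<t. if s < w mod t then 1 else 0 :: nat) = w mod t" .
 then show ?thesis by (simp add: sum.distrib)
qed

text \<open>Block sizes are close to \<rho>, namely between \<open>e0\<close> and \<open>r\<close>.
  Sampling takes place twice: the end cores \<open>C 0\<close>, \<open>C 1\<close> and the pool
  \<open>C 2\<close> are drawn outside the reserves before the gadgets exist, whereas the cores of
  the inner blocks are drawn from \<open>W\<close>, for each \<open>W\<close> that the gadgets may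
  leave.\<close>

lemma hamilton_fixed:
 fixes c \<alpha> \<tau> \<pi>0 \<rho> p q b \<beta> :: real
 assumes sp: "sparse_rel p \<beta> V E" and EV: "E \<subseteq> V \<times> V" and symE: "sym E" and fin: "finite V" "V \<noteq> {}" and pos: "0 < p" "0 < \<beta>"
  and \<tau>: "0 < \<tau>" "\<tau> <= 1/40" "40 * \<tau> <= \<alpha>" "160 * \<tau> <= c" and \<pi>0: "0 < \<pi>0" "12 * \<pi>0 <= \<tau>"
  and \<rho>: "\<rho> = \<pi>0 * rcard V" "1 <= \<tau>\<^sup>2 * \<rho>"
  and r: "r = nat \<lceil>(1 + 2 * \<tau>) * \<rho>\<rceil>" and e0: "e0 = nat \<lfloor>\<rho>\<rfloor>"
  and X: "X \<subseteq> V" "rcard X <= \<tau> * rcard V"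
  and deg: "!!v. v \<in> V ==> c * rcard V * p <= deg E v"
   "!!v. v \<in> V - X ==> (1/2 + \<alpha>) * rcard V * p <= deg E v"
  and R: "R1 \<subseteq> V" "R2 \<subseteq> V" "R1 \<inter> R2 = {}" "rcard (R1 \<union> R2) <= \<tau> * rcard V"
   "!!v. v \<in> V ==> deg_in E v (R1 \<union> R2) <= \<tau> * deg E v"
  and con: "connector V E R1 q b" "connector V E R2 q b" and q: "3 * real r <= q" "real r * (b + 1) <= q"
  and \<beta>: "8 * \<beta> <= c * p * real e0" "8 * \<beta> <= \<alpha> * p * real e0"
  and small: "(1 / \<pi>0 + 3) * (rcard V + 2) * (2 * exp (- 2 * \<tau>\<^sup>2 * ((1 - 2 * \<tau>) * \<pi>0)\<^sup>2 * (c / 2 * rcard V * p))) < 1"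
 shows "hamiltonian V E"
proof -
 define N where "N = rcard V"
 define d0 where "d0 = c / 2 * N * p"
 have N0: "0 < N" using fin by (simp add: N_def card_gt_0_iff)
 have c0: "0 < c" "0 < \<alpha>" using \<tau> by linarith+
 have d00: "0 < d0" using c0 N0 pos by (simp add: d0_def)
 have t1: "0 < 1 - \<tau>" "0 < 1 - 2 * \<tau>" "0 < 1 - 4 * \<tau>" "0 < 1 - 3 * \<tau>" using \<tau> by linarith+
 have tt: "\<tau>\<^sup>2 <= \<tau> * (1/40)" "0 <= \<tau>\<^sup>2" using \<tau>(1,2) by (auto simp: power2_eq_square intro: mult_left_mono)
 have \<rho>N: "\<rho> = \<pi>0 * N" using \<rho> by (simp add: N_def)
 have \<rho>0: "0 < \<rho>" using \<rho>N \<pi>0 N0 by simp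
 have t\<rho>: "40 <= \<tau> * \<rho>" using \<rho>(2) mult_right_mono[OF tt(1) less_imp_le[OF \<rho>0]] by simp
 have "\<tau> * \<rho> <= 1/40 * \<rho>" using \<tau>(2) \<rho>0 by (intro mult_right_mono) auto
 then have \<rho>2: "2 <= \<rho>" using t\<rho> by linarith
 have rb: "(1 + 2 * \<tau>) * \<rho> <= real r" "real r <= (1 + 3 * \<tau>) * \<rho>"
 proof -
  have "0 <= (1 + 2 * \<tau>) * \<rho>" using \<tau> \<rho>0 by simp
  then have "(1 + 2 * \<tau>) * \<rho> <= real r" "real r <= (1 + 2 * \<tau>) * \<rho> + 1" unfolding r by linarith+
  then show "(1 + 2 * \<tau>) * \<rho> <= real r" "real r <= (1 + 3 * \<tau>) * \<rho>" using t\<rho> by (auto simp: algebra_simps)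
 qed
 have eb: "\<rho> - 1 <= real e0" "real e0 <= \<rho>" unfolding e0 using \<rho>0 by linarith+
 have "(1 + 2 * \<tau>) * \<rho> = \<rho> + 2 * (\<tau> * \<rho>)" by (simp add: algebra_simps)
 then have r\<rho>: "\<rho> <= real r" "\<rho> + 80 <= real r" using rb(1) t\<rho> by linarith+
 have r2: "2 <= r" "e0 <= r" using r\<rho> \<rho>2 eb by linarith+
 have r2\<rho>: "real r <= 2 * \<rho>"
 proof -
  have "(1 + 3 * \<tau>) * \<rho> <= 2 * \<rho>" using \<tau> \<rho>0 by (intro mult_right_mono) auto
  then show ?thesis using rb by linarith
 qed
 define \<Omega> where "\<Omega> = V - (R1 \<union> R2)"
 have \<Omega>V: "\<Omega> \<subseteq> V" by (auto simp: \<Omega>_def)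
 have EvV: "E `` {v} \<subseteq> V" "finite (E `` {v})" for v using EV fin finite_subset[of "E `` {v}" V] by auto
 have \<Omega>c: "(1 - \<tau>) * N <= rcard \<Omega>" "rcard \<Omega> <= N"
 proof -
  have "card V - card (R1 \<union> R2) <= card \<Omega>" unfolding \<Omega>_def by (rule diff_card_le_card_Diff) (use R fin finite_subset in auto)
  then have "N <= rcard \<Omega> + rcard (R1 \<union> R2)" unfolding N_def by linarith
  then show "(1 - \<tau>) * N <= rcard \<Omega>" using R(4) by (simp add: N_def algebra_simps)
  show "rcard \<Omega> <= N" using card_mono[OF fin(1) \<Omega>V] by (simp add: N_def)
 qed
 have \<Omega>d: "(1 - \<tau>) * deg E v <= deg_in E v \<Omega>" if v: "v \<in> V" for v
 proof -
  have "E `` {v} = (E `` {v} \<inter> \<Omega>) \<union> (E `` {v} \<inter> (R1 \<union> R2))" using EvV(1)[of v] unfolding \<Omega>_def by blast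
  then have "card (E `` {v}) <= card (E `` {v} \<inter> \<Omega>) + card (E `` {v} \<inter> (R1 \<union> R2))" by (metis card_Un_le)
  then have "deg E v <= deg_in E v \<Omega> + deg_in E v (R1 \<union> R2)" by linarith
  then show ?thesis using R(5)[OF v] by (simp add: algebra_simps)
 qed
 have degN: "c * N * p <= deg E v" if "v \<in> V" for v using deg(1)[OF that] by (simp add: N_def)
 have d0le: "d0 <= x" if v: "v \<in> V" and x: "(1 - 4 * \<tau>) * deg E v <= x" for v x
 proof -
  have "1/2 * (c * N * p) <= (1 - 4 * \<tau>) * deg E v" using degN[OF v] \<tau> c0 N0 pos by (intro mult_mono) auto
  then show ?thesis using x by (simp add: d0_def)
 qed
 let ?sm = "2 * exp (- 2 * \<tau>\<^sup>2 * ((1 - 2 * \<tau>) * \<pi>0)\<^sup>2 * d0)"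
 have smallt: "real t * (rcard V + 2) * ?sm < 1" if "real t <= 1 / \<pi>0 + 3" for t
 proof -
  have "real t * (rcard V + 2) * ?sm <= (1 / \<pi>0 + 3) * (rcard V + 2) * ?sm"
   using that by (intro mult_right_mono) auto
  then show ?thesis using small unfolding d0_def N_def by linarith
 qed
 have p1: "0 < (1 - 2 * \<tau>) * \<pi>0" using t1 \<pi>0 by simp
 have p2: "(1 - 2 * \<tau>) * \<pi>0 <= \<pi>0" using \<tau> \<pi>0 by (simp add: algebra_simps)
 \<comment> \<open>Colours 0 and 1 give the end cores, colour 2 the pool;
   \<open>12 * \<pi>0 <= \<tau>\<close> makes the pool large enough for \<open>3 * r\<close>
   vertices.\<close>
 define w0 where "w0 i = (if i < 2 then (1 - 2 * \<tau>) * \<pi>0 else \<tau>)" for i :: nat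
 have s3: "{..<3} = {0, 1, 2 :: nat}" by auto
 have "\<exists>C :: nat => 'a set. (\<forall>i<3. C i \<subseteq> \<Omega>) \<and> (\<forall>i<3. \<forall>j<3. i \<noteq> j --> C i \<inter> C j = {}) \<and>
  (\<forall>i<3. (1 - \<tau>) * w0 i * rcard \<Omega> <= rcard (C i) \<and> rcard (C i) <= (1 + \<tau>) * w0 i * rcard \<Omega>) \<and>
  (\<forall>i<3. \<forall>v\<in>V. (1 - \<tau>) * w0 i * deg_in E v \<Omega> <= deg_in E v (C i) \<and>
    deg_in E v (C i) <= (1 + \<tau>) * w0 i * deg_in E v \<Omega>) \<and>
  (\<forall>i<3. rcard (C i \<inter> X) <= w0 i * rcard (X \<inter> \<Omega>) + \<tau> * w0 i * rcard \<Omega>)" (is "\<exists>C. ?P C")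
 proof (rule cores_exist[OF fin EV \<Omega>V d00 _ p1])
  show "d0 <= deg_in E v \<Omega>" if v: "v \<in> V" for v
  proof (rule d0le[OF v])
   have "(1 - 4 * \<tau>) * deg E v <= (1 - \<tau>) * deg E v" using \<tau> by (intro mult_right_mono) auto
   then show "(1 - 4 * \<tau>) * deg E v <= deg_in E v \<Omega>" using \<Omega>d[OF v] by linarith
  qed
  have "(1 - 2 * \<tau>) * \<pi>0 <= \<tau>" using p2 \<pi>0 by linarith
  then show "(1 - 2 * \<tau>) * \<pi>0 <= w0 i" for i by (simp add: w0_def)
  have "sum w0 {..<3} = 2 * ((1 - 2 * \<tau>) * \<pi>0) + \<tau>" unfolding s3 by (simp add: w0_def)
  then show "sum w0 {..<3} <= 1" using p2 \<pi>0 \<tau> by linarith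
  show "0 < \<tau>" by fact
  show "real 3 * (rcard V + 2) * ?sm < 1" by (rule smallt) (use \<pi>0 in simp)
 qed
 then obtain C where CC0: "?P C" by (elim exE) (rule that; assumption)
 note CC = conjunct1[OF CC0, rule_format] conjunct1[OF conjunct2[OF CC0], rule_format]
  conjunct1[OF conjunct2[OF conjunct2[OF CC0]], rule_format] conjunct1[OF conjunct2[OF conjunct2[OF conjunct2[OF CC0]]], rule_format]
  conjunct2[OF conjunct2[OF conjunct2[OF conjunct2[OF CC0]]], rule_format]
 note coreI = is_coreI[OF \<tau> \<pi>0(1) pos(1) \<rho> \<rho>2 rb(2) eb(1) _ _ _ _ _ _ _ _ _ _ X(1) fin(1) X(2) deg]
 have core01: "is_core V E p (c / 2) (\<alpha> / 2) X r e0 (C i)" if i: "i < 2" for i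
 proof (rule coreI[where \<pi> = "w0 i" and W = \<Omega>])
  have w: "w0 i = (1 - 2 * \<tau>) * \<pi>0" using i by (simp add: w0_def)
  have i3: "i < 3" using i by simp
  show "(1 - 2 * \<tau>) * \<pi>0 <= w0 i" "w0 i <= 2 * \<pi>0" unfolding w using p2 \<pi>0 by linarith+
  have "w0 i * rcard \<Omega> <= (1 - 2 * \<tau>) * \<pi>0 * N" unfolding w using \<Omega>c p1 by (intro mult_left_mono) auto
  also have "... = 1 * ((1 - 2 * \<tau>) * \<rho>)" by (simp add: \<rho>N)
  also have "... <= (1 + \<tau>) * ((1 - 2 * \<tau>) * \<rho>)" using \<tau> \<rho>0 t1 by (intro mult_right_mono) auto
  finally show "w0 i * rcard \<Omega> <= (1 + \<tau>) * (1 - 2 * \<tau>) * \<rho>" by (simp add: mult.assoc)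
  have "(1 - 3 * \<tau>) * \<rho> <= (1 - 3 * \<tau> + 2 * \<tau>\<^sup>2) * \<rho>" using \<rho>0 tt by (intro mult_right_mono) auto
  also have "... = (1 - 2 * \<tau>) * \<pi>0 * ((1 - \<tau>) * N)" by (simp add: \<rho>N algebra_simps power2_eq_square)
  also have "... <= w0 i * rcard \<Omega>" unfolding w using \<Omega>c p1 by (intro mult_left_mono) auto
  finally show "(1 - 3 * \<tau>) * \<rho> <= w0 i * rcard \<Omega>" .
  show "C i \<subseteq> V" using CC(1)[OF i3] \<Omega>V by blast
  show "(1 - \<tau>) * w0 i * rcard \<Omega> <= rcard (C i)" "rcard (C i) <= (1 + \<tau>) * w0 i * rcard \<Omega>"
   using CC(3)[OF i3] by auto
  show "(1 - \<tau>) * w0 i * deg_in E v \<Omega> <= deg_in E v (C i)" if "v \<in> V" for v using CC(4)[OF i3 that] by auto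
  show "rcard (C i \<inter> X) <= w0 i * rcard (X \<inter> \<Omega>) + \<tau> * w0 i * rcard \<Omega>" by (rule CC(5)[OF i3])
  fix v assume v: "v \<in> V"
  have "(1 - 4 * \<tau>) * deg E v <= (1 - \<tau>) * deg E v" using \<tau> by (intro mult_right_mono) auto
  then show "(1 - 4 * \<tau>) * deg E v <= deg_in E v \<Omega>" using \<Omega>d[OF v] by linarith
 qed
 have wsum: "(1 + \<tau>) * w0 0 + (1 + \<tau>) * w0 1 + (1 + \<tau>) * w0 2 <= 3 * \<tau>"
 proof -
  have "w0 0 + w0 1 + w0 2 = 2 * ((1 - 2 * \<tau>) * \<pi>0) + \<tau>" by (simp add: w0_def)
  then have "w0 0 + w0 1 + w0 2 <= 2 * \<pi>0 + \<tau>" using p2 by linarith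
  also have "... <= 2 * \<tau>" using \<pi>0 by linarith
  finally have "(1 + \<tau>) * (w0 0 + w0 1 + w0 2) <= (1 + \<tau>) * (2 * \<tau>)" using \<tau> by (intro mult_left_mono) auto
  also have "... = 2 * \<tau> + 2 * \<tau>\<^sup>2" by (simp add: algebra_simps power2_eq_square)
  also have "... <= 3 * \<tau>" using tt \<tau> by linarith
  finally show ?thesis by (simp add: distrib_left)
 qed
 have CV: "C i \<subseteq> V" "finite (C i)" if "i < 3" for i using CC(1)[OF that] \<Omega>V finite_subset[of "C i" V] fin by auto
 define U where "U = C 0 \<union> C 1 \<union> C 2"
 have Ucard: "rcard U <= 3 * \<tau> * N"
 proof -
  have "card U <= card (C 0 \<union> C 1) + card (C 2)" unfolding U_def by (rule card_Un_le)
  moreover have "card (C 0 \<union> C 1) <= card (C 0) + card (C 1)" by (rule card_Un_le)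
  ultimately have "rcard U <= rcard (C 0) + rcard (C 1) + rcard (C 2)" by linarith
  also have "... <= ((1 + \<tau>) * w0 0 + (1 + \<tau>) * w0 1 + (1 + \<tau>) * w0 2) * rcard \<Omega>"
   using CC(3)[of 0] CC(3)[of 1] CC(3)[of 2] by (simp add: distrib_right)
  also have "... <= 3 * \<tau> * N" using wsum \<Omega>c \<tau> by (intro mult_mono) auto
  finally show ?thesis .
 qed
 have Udeg: "deg_in E v U <= 3 * \<tau> * deg E v" if v: "v \<in> V" for v
 proof -
  have "E `` {v} \<inter> U = (E `` {v} \<inter> C 0) \<union> (E `` {v} \<inter> C 1) \<union> (E `` {v} \<inter> C 2)" by (auto simp: U_def)
  then have "card (E `` {v} \<inter> U) <= card ((E `` {v} \<inter> C 0) \<union> (E `` {v} \<inter> C 1)) + card (E `` {v} \<inter> C 2)" by (simp only: card_Un_le)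
  moreover have "card ((E `` {v} \<inter> C 0) \<union> (E `` {v} \<inter> C 1)) <= card (E `` {v} \<inter> C 0) + card (E `` {v} \<inter> C 1)" by (rule card_Un_le)
  ultimately have "deg_in E v U <= deg_in E v (C 0) + deg_in E v (C 1) + deg_in E v (C 2)" by linarith
  also have "... <= ((1 + \<tau>) * w0 0 + (1 + \<tau>) * w0 1 + (1 + \<tau>) * w0 2) * deg_in E v \<Omega>"
   using CC(4)[OF _ v, of 0] CC(4)[OF _ v, of 1] CC(4)[OF _ v, of 2] by (simp add: distrib_right)
  also have "... <= 3 * \<tau> * deg E v" using wsum \<tau> card_mono[OF EvV(2), of "E `` {v} \<inter> \<Omega>" v] by (intro mult_mono) auto
  finally show ?thesis .
 qed
 have poolW: "\<exists>(t::nat) Es core. (\<Union>s<t. Es s) = W \<and> (\<forall>s<t. \<forall>s'<t. s \<noteq> s' --> Es s \<inter> Es s' = {}) \<and>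
    (\<forall>s<t. is_core V E p (c / 2) (\<alpha> / 2) X r e0 (core s) \<and> core s \<subseteq> Es s \<and> e0 <= card (Es s) \<and> card (Es s) <= r)"
  if W: "V - (C 0 \<union> C 1 \<union> C 2 \<union> R1 \<union> R2) \<subseteq> W" "W \<subseteq> V - (C 0 \<union> C 1)" for W
 proof -
  have finW: "finite W" and WV: "W \<subseteq> V" using W fin finite_subset by (blast, blast)
  have \<Omega>UW: "\<Omega> \<subseteq> W \<union> U" using W(1) unfolding \<Omega>_def U_def by blast
  have finU: "finite U" using CV by (simp add: U_def)
  have Wc: "(1 - 4 * \<tau>) * N <= rcard W" "rcard W <= N"
  proof -
   have "card \<Omega> <= card (W \<union> U)" using \<Omega>UW finW finU by (intro card_mono) auto
   also have "... <= card W + card U" by (rule card_Un_le)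
   finally have "rcard \<Omega> <= rcard W + rcard U" by linarith
   then show "(1 - 4 * \<tau>) * N <= rcard W" using Ucard \<Omega>c by (simp add: algebra_simps)
   show "rcard W <= N" using card_mono[OF fin(1) WV] by (simp add: N_def)
  qed
  have Wd: "(1 - 4 * \<tau>) * deg E v <= deg_in E v W" if v: "v \<in> V" for v
  proof -
   have "E `` {v} \<inter> \<Omega> \<subseteq> (E `` {v} \<inter> W) \<union> (E `` {v} \<inter> U)" using \<Omega>UW by blast
   then have "card (E `` {v} \<inter> \<Omega>) <= card ((E `` {v} \<inter> W) \<union> (E `` {v} \<inter> U))" using EvV by (intro card_mono) auto
   also have "... <= card (E `` {v} \<inter> W) + card (E `` {v} \<inter> U)" by (rule card_Un_le)
   finally have "deg_in E v \<Omega> <= deg_in E v W + deg_in E v U" by linarith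
   then show ?thesis using Udeg[OF v] \<Omega>d[OF v] by (simp add: algebra_simps)
  qed
  define w where "w = rcard W"
  have wN: "9/10 * N <= w" "w <= N"
  proof -
   have "9/10 * N <= (1 - 4 * \<tau>) * N" using \<tau> N0 by (intro mult_right_mono) auto
   then show "9/10 * N <= w" using Wc by (simp add: w_def)
  qed (use Wc in \<open>simp add: w_def\<close>)
  have w\<rho>: "12 * \<rho> <= \<tau> * N" using mult_right_mono[OF \<pi>0(2) less_imp_le[OF N0]] by (simp add: \<rho>N)
  have tw: "\<tau> * (9/10 * N) <= \<tau> * w" using wN \<tau> by (intro mult_left_mono) auto
  have tN: "\<tau> * N <= 1/40 * N" using \<tau> N0 by (intro mult_right_mono) auto
  \<comment> \<open>With this number of blocks the average block size \<open>w / t\<close> lies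
    between \<rho> and \<open>(1 + \<tau>) * \<rho>\<close>.\<close>
  define t where "t = nat \<lfloor>w / \<rho>\<rfloor>"
  have w\<rho>1: "2 <= w / \<rho>" using w\<rho> wN tN \<rho>0 by (simp add: field_simps)
  have tb: "real t <= w / \<rho>" "w / \<rho> - 1 <= real t" "1 <= t" unfolding t_def using w\<rho>1 by linarith+
  have t0: "0 < real t" using tb by simp
  have tr: "real t * \<rho> <= w" using tb(1) \<rho>0 by (simp add: field_simps)
  have wt: "\<rho> <= w / real t" using tr t0 by (simp add: field_simps)
  have wt': "w / real t <= (1 + \<tau>) * \<rho>"
  proof -
   have "w - \<rho> <= real t * \<rho>" using mult_right_mono[OF tb(2) less_imp_le[OF \<rho>0]] \<rho>0 by (simp add: left_diff_distrib)
   then have "(1 + \<tau>) * (w - \<rho>) <= (1 + \<tau>) * (real t * \<rho>)" using \<tau> by (intro mult_left_mono) auto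
   moreover have "w <= (1 + \<tau>) * (w - \<rho>)"
   proof -
    have "(1 + \<tau>) * \<rho> <= 2 * \<rho>" using \<tau> \<rho>0 by (intro mult_right_mono) auto
    moreover have "(1 + \<tau>) * (w - \<rho>) = w + \<tau> * w - (1 + \<tau>) * \<rho>" by (simp add: algebra_simps)
    moreover have "0 <= \<tau> * N" using \<tau> N0 by simp
    ultimately show ?thesis using w\<rho> tw by linarith
   qed
   ultimately have "w <= (1 + \<tau>) * \<rho> * real t" by (simp add: mult_ac)
   then show ?thesis using t0 by (simp add: divide_le_eq)
  qed
  define \<pi> where "\<pi> = (1 - 2 * \<tau>) / real t"
  have \<pi>w: "\<pi> * rcard W = (1 - 2 * \<tau>) * (w / real t)" by (simp add: \<pi>_def w_def)
  have t\<pi>: "real t * \<pi>0 <= 1"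
  proof -
   have "real t * \<rho> <= N" using tr wN by linarith
   then have "(real t * \<pi>0) * N <= 1 * N" by (simp add: \<rho>N)
   then show ?thesis using N0 by (rule mult_right_le_imp_le)
  qed
  have \<pi>lo: "(1 - 2 * \<tau>) * \<pi>0 <= \<pi>"
  proof -
   have "\<pi>0 <= 1 / real t" using t\<pi> t0 by (simp add: field_simps)
   then show ?thesis unfolding \<pi>_def using t1 mult_left_mono[of \<pi>0 "1 / real t" "1 - 2 * \<tau>"] by simp
  qed
  have \<pi>up: "\<pi> <= 2 * \<pi>0"
  proof -
   have "(1 - 2 * \<tau>) * (w / real t) <= 1 * ((1 + \<tau>) * \<rho>)" using wt' \<tau> wt \<rho>0 by (intro mult_mono) auto
   also have "... <= 41/40 * \<rho>" using \<tau> \<rho>0 by (auto intro: mult_right_mono)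
   finally have "\<pi> * w <= 41/40 * \<pi>0 * N" using \<pi>w by (simp add: w_def \<rho>N)
   moreover have "\<pi> * (9/10 * N) <= \<pi> * w" using wN p1 \<pi>lo by (intro mult_left_mono) auto
   moreover have "41/40 * \<pi>0 * N <= 2 * \<pi>0 * (9/10 * N)" using \<pi>0 N0 by simp
   ultimately have "\<pi> * (9/10 * N) <= 2 * \<pi>0 * (9/10 * N)" by linarith
   then show ?thesis using N0 by (auto dest: mult_right_le_imp_le)
  qed
  have "\<exists>Cs :: nat => 'a set. (\<forall>i<t. Cs i \<subseteq> W) \<and> (\<forall>i<t. \<forall>j<t. i \<noteq> j --> Cs i \<inter> Cs j = {}) \<and>
   (\<forall>i<t. (1 - \<tau>) * \<pi> * rcard W <= rcard (Cs i) \<and> rcard (Cs i) <= (1 + \<tau>) * \<pi> * rcard W) \<and>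
   (\<forall>i<t. \<forall>v\<in>V. (1 - \<tau>) * \<pi> * deg_in E v W <= deg_in E v (Cs i) \<and>
     deg_in E v (Cs i) <= (1 + \<tau>) * \<pi> * deg_in E v W) \<and>
   (\<forall>i<t. rcard (Cs i \<inter> X) <= \<pi> * rcard (X \<inter> W) + \<tau> * \<pi> * rcard W)" (is "\<exists>Cs. ?Q Cs")
  proof (rule cores_exist[OF fin EV WV d00 _ p1, where \<pi> = "\<lambda>_. \<pi>"])
   show "d0 <= deg_in E v W" if v: "v \<in> V" for v by (rule d0le[OF v Wd[OF v]])
   show "(1 - 2 * \<tau>) * \<pi>0 <= \<pi>" by fact
   show "sum (\<lambda>_. \<pi>) {..<t} <= 1" using t0 \<tau> by (simp add: \<pi>_def)
   show "0 < \<tau>" by fact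
   have "real t <= 1 / \<pi>0" using t\<pi> \<pi>0 by (simp add: field_simps)
   then show "real t * (rcard V + 2) * ?sm < 1" by (intro smallt) simp
  qed
  then obtain Cs where Cs0: "?Q Cs" by (elim exE) (rule that; assumption)
  note Cs = conjunct1[OF Cs0, rule_format] conjunct1[OF conjunct2[OF Cs0], rule_format]
   conjunct1[OF conjunct2[OF conjunct2[OF Cs0]], rule_format] conjunct1[OF conjunct2[OF conjunct2[OF conjunct2[OF Cs0]]], rule_format]
   conjunct2[OF conjunct2[OF conjunct2[OF conjunct2[OF Cs0]]], rule_format]
  have core: "is_core V E p (c / 2) (\<alpha> / 2) X r e0 (Cs i)" if i: "i < t" for i
  proof (rule coreI[where \<pi> = \<pi> and W = W])
   show "(1 - 2 * \<tau>) * \<pi>0 <= \<pi>" "\<pi> <= 2 * \<pi>0" by fact+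
   have "(1 - 2 * \<tau>) * (w / real t) <= (1 - 2 * \<tau>) * ((1 + \<tau>) * \<rho>)" using wt' t1 by (intro mult_left_mono) auto
   then show "\<pi> * rcard W <= (1 + \<tau>) * (1 - 2 * \<tau>) * \<rho>" unfolding \<pi>w by (simp add: mult_ac)
   have "(1 - 3 * \<tau>) * \<rho> <= (1 - 2 * \<tau>) * \<rho>" using \<tau> \<rho>0 by (intro mult_right_mono) auto
   also have "... <= (1 - 2 * \<tau>) * (w / real t)" using wt t1 by (intro mult_left_mono) auto
   finally show "(1 - 3 * \<tau>) * \<rho> <= \<pi> * rcard W" unfolding \<pi>w .
   show "Cs i \<subseteq> V" using Cs(1)[OF i] WV by blast
   show "(1 - \<tau>) * \<pi> * rcard W <= rcard (Cs i)" "rcard (Cs i) <= (1 + \<tau>) * \<pi> * rcard W" using Cs(3)[OF i] by auto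
   show "(1 - \<tau>) * \<pi> * deg_in E v W <= deg_in E v (Cs i)" if "v \<in> V" for v using Cs(4)[OF i that] by auto
   show "rcard (Cs i \<inter> X) <= \<pi> * rcard (X \<inter> W) + \<tau> * \<pi> * rcard W" by (rule Cs(5)[OF i])
   show "(1 - 4 * \<tau>) * deg E v <= deg_in E v W" if "v \<in> V" for v by (rule Wd[OF that])
  qed
  define e where "e s = card W div t + (if s < card W mod t then 1 else 0)" for s
  have e0div: "e0 <= card W div t"
  proof -
   have "real t * real e0 <= real t * \<rho>" using eb t0 by (intro mult_left_mono) auto
   then have "real (t * e0) <= rcard W" using tr unfolding w_def of_nat_mult by linarith
   then have "t * e0 <= card W" by (simp only: of_nat_le_iff)
   then show ?thesis using tb(3) by (simp add: less_eq_div_iff_mult_less_eq mult.commute)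
  qed
  have divr: "card W div t + 1 <= r"
  proof -
   have "real (card W div t) <= w / real t" unfolding w_def by (rule of_nat_div_le_of_nat)
   also have "... <= (1 + \<tau>) * \<rho>" by (rule wt')
   finally have "real (card W div t) + 1 <= (1 + 2 * \<tau>) * \<rho>" using t\<rho> by (simp add: algebra_simps)
   then show ?thesis using rb(1) by linarith
  qed
  have es: "e0 <= e s \<and> e s <= r" for s using e0div divr by (auto simp: e_def)
  have "\<exists>Es. (\<forall>s<t. Cs s \<subseteq> Es s \<and> card (Es s) = e s) \<and> (\<forall>s<t. \<forall>s'<t. s \<noteq> s' --> Es s \<inter> Es s' = {}) \<and> (\<Union>s<t. Es s) = W"
  proof (rule fill_partition[OF finW Cs(1,2)])
   show "card (Cs s) <= e s" if "s < t" for s using core[OF that] es[of s] unfolding is_core_def by linarith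
   show "(\<Sum>s<t. e s) = card W" unfolding e_def using tb(3) by (intro sum_balanced_parts) auto
  qed
  then obtain Es where Es: "\<forall>s<t. Cs s \<subseteq> Es s \<and> card (Es s) = e s" "\<forall>s<t. \<forall>s'<t. s \<noteq> s' --> Es s \<inter> Es s' = {}" "(\<Union>s<t. Es s) = W"
   by (elim exE conjE) (rule that; assumption)
  show ?thesis using Es core es by (rule_tac x = t in exI, rule_tac x = Es in exI, rule_tac x = Cs in exI) simp
 qed
 have T0: "3 * r <= card (C 2)"
 proof -
  have "(1 - \<tau>) * \<tau> * rcard \<Omega> <= rcard (C 2)" using CC(3)[of 2] by (simp add: w0_def)
  moreover have "(1 - \<tau>) * \<tau> * rcard \<Omega> \<ge> (39/40) * \<tau> * (39/40 * N)"
  proof -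
   have "39/40 * N <= (1 - \<tau>) * N" using \<tau> N0 by (intro mult_right_mono) auto
   then have "39/40 * N <= rcard \<Omega>" using \<Omega>c by linarith
   then show ?thesis using \<tau> N0 by (intro mult_mono) auto
  qed
  moreover have "12 * \<rho> <= \<tau> * N" using mult_right_mono[OF \<pi>0(2) less_imp_le[OF N0]] by (simp add: \<rho>N)
  moreover have "(39/40) * \<tau> * (39/40 * N) = 1521/1600 * (\<tau> * N)" by simp
  ultimately have "3 * real r <= rcard (C 2)" using r2\<rho> \<rho>0 by linarith
  then show ?thesis by linarith
 qed
 show ?thesis
 proof (rule hamilton_from_cores[OF sp EV symE fin(1) pos _ _ con q r2(1) _ _ r2(2) R(1-3) core01 core01, of 0 1 "C 2"])
  show "0 < \<alpha> / 2" "0 < c / 2" using c0 by auto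
  show "4 * \<beta> <= c / 2 * p * real e0" "4 * \<beta> <= \<alpha> / 2 * p * real e0" using \<beta> by auto
  show "C 0 \<inter> C 1 = {}" "C 0 \<inter> C 2 = {}" "C 1 \<inter> C 2 = {}" by (rule CC(2); simp)+
  show "(C 0 \<union> C 1 \<union> C 2) \<inter> (R1 \<union> R2) = {}" using CC(1)[of 0] CC(1)[of 1] CC(1)[of 2] unfolding \<Omega>_def by auto
  show "C 2 \<subseteq> V" using CV by auto
  show "3 * r <= card (C 2)" by fact
 qed (use poolW in simp_all)
qed

text \<open>The reserves dictate the order \<open>n / L^2\<close> of \<open>r\<close>: gadgets with
  about \<open>5 * L\<close> connections each must stay within \<open>\<kappa> * n / L\<close>
  connections in total. Degrees between blocks of this size still exceed \<beta> by a factor of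
  order \<open>L\<close>, and the Hoeffding exponent has order \<open>L^6 / L^4\<close>.\<close>

lemma hamilton:
 fixes c \<xi> \<alpha> \<tau> :: real
 assumes "0 < c" "0 < \<xi>" "0 < \<alpha>" and \<tau>: "0 < \<tau>" "\<tau> <= 1/40" "40 * \<tau> <= \<alpha>" "160 * \<tau> <= c"
 shows "\<forall>\<^sub>F n in sequentially. \<forall>(V :: 'a set) E p X. good_graph n c \<xi> p V E \<and> c * real n <= rcard V \<and>
   X \<subseteq> V \<and> rcard X <= \<tau> * c * real n \<and> (\<forall>v\<in>V - X. (1/2 + \<alpha>) * rcard V * p <= deg E v) -->
   (hamiltonian V E)"
proof -
 define eps where "eps = min (\<tau> / 2) (c * \<tau> / 2)"
 have eps: "0 < eps" "2 * eps <= \<tau>" "2 * eps <= c * \<tau>" using assms \<tau> by (auto simp: eps_def)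
 obtain \<kappa> :: real where \<kappa>: "0 < \<kappa>" and ev: "\<forall>\<^sub>F n in sequentially. \<forall>(V :: 'a set) E p. good_graph n c \<xi> p V E \<and> V \<noteq> {} -->
  (\<exists>R1 R2. reserve_pair n eps (\<kappa> * real n / ln (real n)) (5 * ln (real n)) V E R1 R2)"
  using two_reserves[OF assms(1,2) eps(1), where ?'a = 'a] by (elim exE conjE) (rule that; assumption)
 \<comment> \<open>The 12 is the product of the factors in \<open>r <= 2 * \<rho>\<close> and
   \<open>5 * L + 1 <= 6 * L\<close>.\<close>
 define \<kappa>0 where "\<kappa>0 = \<kappa> / 12"
 have \<kappa>0: "0 < \<kappa>0" using \<kappa> by (simp add: \<kappa>0_def)
 define \<gamma> where "\<gamma> = \<tau>\<^sup>2 * \<kappa>0\<^sup>2 * c ^ 3 / 4"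
 have \<gamma>: "0 < \<gamma>" using \<tau> \<kappa>0 assms by (simp add: \<gamma>_def)
 have c0: "0 < c" and \<alpha>0: "0 < \<alpha>" and \<tau>0: "0 < \<tau>" using assms \<tau> by auto
 have e1: "\<forall>\<^sub>F n in sequentially. 1 <= ln (real n)" by real_asymp
 have e2: "\<forall>\<^sub>F n in sequentially. 12 * (\<kappa>0 / (ln (real n))\<^sup>2) <= \<tau>" using \<kappa>0 \<tau>0 by real_asymp
 have e3: "\<forall>\<^sub>F n in sequentially. 1 <= \<tau>\<^sup>2 * (\<kappa>0 / (ln (real n))\<^sup>2 * (c * real n))" using \<kappa>0 \<tau>0 c0 by real_asymp
 have e4: "\<forall>\<^sub>F n in sequentially. 16 <= c * (\<kappa>0 * c * ln (real n))" using \<kappa>0 c0 by real_asymp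
 have e5: "\<forall>\<^sub>F n in sequentially. 16 <= \<alpha> * (\<kappa>0 * c * ln (real n))" using \<kappa>0 c0 \<alpha>0 by real_asymp
 have e6: "\<forall>\<^sub>F n in sequentially. ((ln (real n))\<^sup>2 / \<kappa>0 + 3) * (real n + 2) * (2 * exp (- \<gamma> * (ln (real n))\<^sup>2)) < 1"
  using \<kappa>0 \<gamma> by real_asymp
 show ?thesis
   using ev e1 e2 e3 e4 e5 e6 eventually_gt_at_top[of 0]
  proof eventually_elim
   case (elim n)
   show ?case
   proof (intro allI impI, elim conjE)
    fix V :: "'a set" and E p X
    assume G: "good_graph n c \<xi> p V E" and cV: "c * real n <= rcard V" and X: "X \<subseteq> V" "rcard X <= \<tau> * c * real n"
     and typic: "\<forall>v\<in>V - X. (1/2 + \<alpha>) * rcard V * p <= deg E v"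
    note g = good_graphD[OF G]
    define L where "L = ln (real n)"
    note el = elim(2-7)[folded L_def]
    have n0: "0 < real n" using elim(8) by simp
    have L0: "0 < L" "1 <= L" using el(1) by auto
    have "0 < c * real n" using c0 n0 by simp
    then have cV0: "0 < card V" using cV by linarith
    then have Vne: "V \<noteq> {}" by auto
    have Nn: "rcard V <= real n" using g(6) by simp
    from elim(1)[rule_format, OF conjI[OF G Vne], folded L_def] obtain R1 R2 where R: "reserve_pair n eps (\<kappa> * real n / L) (5 * L) V E R1 R2"
     by (elim exE) (rule that; assumption)
    define \<pi>0 where "\<pi>0 = \<kappa>0 / L\<^sup>2"
    have \<pi>0: "0 < \<pi>0" "12 * \<pi>0 <= \<tau>" using \<kappa>0 L0 el(2) by (auto simp: \<pi>0_def)
    define \<rho> where "\<rho> = \<pi>0 * rcard V"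
    have \<rho>lo: "\<pi>0 * (c * real n) <= \<rho>" unfolding \<rho>_def using cV \<pi>0 by (intro mult_left_mono) auto
    have \<rho>up: "\<rho> <= \<pi>0 * real n" unfolding \<rho>_def using Nn \<pi>0 by (intro mult_left_mono) auto
    have \<rho>1: "1 <= \<tau>\<^sup>2 * \<rho>"
    proof -
     have "\<tau>\<^sup>2 * (\<pi>0 * (c * real n)) <= \<tau>\<^sup>2 * \<rho>" using \<rho>lo by (intro mult_left_mono) auto
     then show ?thesis using el(3) unfolding \<pi>0_def by linarith
    qed
    have "\<tau>\<^sup>2 * \<rho> <= (1/40)\<^sup>2 * \<rho>" using \<tau> \<pi>0 by (intro mult_right_mono power_mono) (auto simp: \<rho>_def)
    then have \<rho>2: "1600 <= \<rho>" using \<rho>1 by (simp add: power2_eq_square)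
    define r where "r = nat \<lceil>(1 + 2 * \<tau>) * \<rho>\<rceil>"
    define e0 where "e0 = nat \<lfloor>\<rho>\<rfloor>"
    have r2: "real r <= 2 * \<rho>"
    proof -
     have "(1 + 2 * \<tau>) * \<rho> <= 21/20 * \<rho>" using \<tau> \<rho>2 by (intro mult_right_mono) auto
     moreover have "0 <= (1 + 2 * \<tau>) * \<rho>" using \<tau> \<rho>2 by simp
     then have "real r <= (1 + 2 * \<tau>) * \<rho> + 1" unfolding r_def by linarith
     ultimately show ?thesis using \<rho>2 by linarith
    qed
    have e0h: "\<rho> / 2 <= real e0" unfolding e0_def using \<rho>2 by linarith
    have r3: "real r <= 2 * (\<kappa>0 * real n / L\<^sup>2)" using r2 \<rho>up by (simp add: \<pi>0_def)
    have LL: "L\<^sup>2 = L * L" by (simp add: power2_eq_square)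
    have q2: "real r * (5 * L + 1) <= \<kappa> * real n / L"
    proof -
     have "real r * (5 * L + 1) <= (2 * (\<kappa>0 * real n / L\<^sup>2)) * (6 * L)" using r3 L0 by (intro mult_mono) auto
     also have "... = \<kappa> * real n / L" using L0 by (simp add: \<kappa>0_def LL)
     finally show ?thesis .
    qed
    have q1: "3 * real r <= \<kappa> * real n / L"
    proof -
     have "real r * 3 <= real r * (5 * L + 1)" using L0 by (intro mult_left_mono) auto
     then show ?thesis using q2 by linarith
    qed
    define \<beta> where "\<beta> = real n * p / L ^ 3"
    have \<beta>0: "0 < \<beta>" using n0 g(5) L0 by (simp add: \<beta>_def)
    have \<beta>b: "8 * \<beta> <= A * p * real e0" if A: "0 < A" "16 <= A * (\<kappa>0 * c * L)" for A
    proof -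
     have "16 * (real n * p / L ^ 3) <= A * (\<kappa>0 * c * L) * (real n * p / L ^ 3)" using A(2) n0 g(5) L0 by (intro mult_right_mono) auto
     also have "... = A * p * (\<pi>0 * (c * real n))" using L0 by (simp add: \<pi>0_def field_simps power2_eq_square power3_eq_cube)
     also have "... <= A * p * \<rho>" using \<rho>lo A g(5) by (intro mult_left_mono) auto
     also have "... <= A * p * (2 * real e0)" using e0h A g(5) by (intro mult_left_mono) auto
     finally show ?thesis by (simp add: \<beta>_def)
    qed
    have deg1: "c * rcard V * p <= deg E v" if "v \<in> V" for v
    proof -
     have "c * rcard V * p <= c * real n * p" using Nn c0 g(5) by (intro mult_right_mono mult_left_mono) auto
     then show ?thesis using g(9)[OF that] by linarith
    qed
    have sm: "(1 / \<pi>0 + 3) * (rcard V + 2) * (2 * exp (- 2 * \<tau>\<^sup>2 * ((1 - 2 * \<tau>) * \<pi>0)\<^sup>2 * (c / 2 * rcard V * p))) < 1"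
    proof -
     have h: "\<gamma> * L\<^sup>2 <= 2 * \<tau>\<^sup>2 * ((1 - 2 * \<tau>) * \<pi>0)\<^sup>2 * (c / 2 * rcard V * p)"
     proof -
      have "c * (c * L ^ 6) <= c * (real n * p)" using g(7) c0 unfolding L_def by (intro mult_left_mono) auto
      also have "... = (c * real n) * p" by simp
      also have "... <= rcard V * p" using cV g(5) by (intro mult_right_mono) auto
      finally have d: "c / 2 * (c * (c * L ^ 6)) <= c / 2 * (rcard V * p)" using c0 by (intro mult_left_mono) auto
      have "(1/2 * \<pi>0)\<^sup>2 <= ((1 - 2 * \<tau>) * \<pi>0)\<^sup>2" using \<tau> \<pi>0 by (intro power_mono mult_right_mono) auto
      then have sq: "2 * \<tau>\<^sup>2 * (1/2 * \<pi>0)\<^sup>2 <= 2 * \<tau>\<^sup>2 * ((1 - 2 * \<tau>) * \<pi>0)\<^sup>2" by (intro mult_left_mono) auto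
      have m: "2 * \<tau>\<^sup>2 * (1/2 * \<pi>0)\<^sup>2 * (c / 2 * (c * (c * L ^ 6))) <= 2 * \<tau>\<^sup>2 * ((1 - 2 * \<tau>) * \<pi>0)\<^sup>2 * (c / 2 * (rcard V * p))"
       by (rule mult_mono[OF sq d]) (use c0 L0 in simp_all)
      have "2 * \<tau>\<^sup>2 * (1/2 * \<pi>0)\<^sup>2 * (c / 2 * (c * (c * L ^ 6))) = \<gamma> * L\<^sup>2"
       using L0 by (simp add: \<gamma>_def \<pi>0_def field_simps power2_eq_square numeral_eq_Suc)
      with m show ?thesis by (simp add: mult.assoc)
     qed
     have "1 / \<pi>0 = L\<^sup>2 / \<kappa>0" by (simp add: \<pi>0_def)
     then have "(1 / \<pi>0 + 3) * (rcard V + 2) * (2 * exp (- 2 * \<tau>\<^sup>2 * ((1 - 2 * \<tau>) * \<pi>0)\<^sup>2 * (c / 2 * rcard V * p)))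
      <= (L\<^sup>2 / \<kappa>0 + 3) * (real n + 2) * (2 * exp (- \<gamma> * L\<^sup>2))"
      using h Nn \<kappa>0 by (intro mult_mono) auto
     then show ?thesis using el(6) by linarith
    qed
    have epsn: "2 * eps * real n <= \<tau> * rcard V"
    proof -
     have "2 * eps * real n <= c * \<tau> * real n" using eps n0 by (intro mult_right_mono) auto
     also have "... = \<tau> * (c * real n)" by simp
     also have "... <= \<tau> * rcard V" using cV \<tau> by (intro mult_left_mono) auto
     finally show ?thesis .
    qed
    show "hamiltonian V E"
    proof (rule hamilton_fixed[OF g(8)[folded L_def, folded \<beta>_def] g(2,3,1) Vne g(5) \<beta>0 \<tau> \<pi>0 \<rho>_def \<rho>1 r_def e0_def X(1) _ deg1])
     have "\<tau> * c * real n = \<tau> * (c * real n)" by simp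
     also have "... <= \<tau> * rcard V" using cV \<tau> by (intro mult_left_mono) auto
     finally show "rcard X <= \<tau> * rcard V" using X(2) by linarith
     show "(1/2 + \<alpha>) * rcard V * p <= deg E v" if "v \<in> V - X" for v using typic that by blast
     show "R1 \<subseteq> V" "R2 \<subseteq> V" "R1 \<inter> R2 = {}" using R by auto
     have "rcard (R1 \<union> R2) <= rcard R1 + rcard R2" using card_Un_le[of R1 R2] by linarith
     then show "rcard (R1 \<union> R2) <= \<tau> * rcard V" using R epsn by linarith
     show "deg_in E v (R1 \<union> R2) <= \<tau> * deg E v" if v: "v \<in> V" for v
     proof -
      have "card (E `` {v} \<inter> (R1 \<union> R2)) <= card (E `` {v} \<inter> R1) + card (E `` {v} \<inter> R2)" unfolding Int_Un_distrib by (rule card_Un_le)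
      then have "deg_in E v (R1 \<union> R2) <= deg_in E v R1 + deg_in E v R2" by linarith
      also have "... <= 2 * eps * deg E v" using R v by fastforce
      also have "... <= \<tau> * deg E v" using eps by (intro mult_right_mono) auto
      finally show ?thesis .
     qed
     show "connector V E R1 (\<kappa> * real n / L) (5 * L)" "connector V E R2 (\<kappa> * real n / L) (5 * L)" using R by auto
     show "3 * real r <= \<kappa> * real n / L" "real r * (5 * L + 1) <= \<kappa> * real n / L" by fact+
     show "8 * \<beta> <= c * p * real e0" "8 * \<beta> <= \<alpha> * p * real e0" using \<beta>b[OF c0 el(4)] \<beta>b[OF \<alpha>0 el(5)] by auto
    qed (assumption | rule sm)+
   qed
  qed
qed

section \<open>Covering by several cycles\<close>

text \<open>A quadratic upper bound whose linear coefficient is the derivative of the squared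
  positive part; it replaces calculus in the variation of the minimiser below.\<close>

lemma max_sq_shift: "(max 0 (a + h :: real))\<^sup>2 <= (max 0 a)\<^sup>2 + 2 * h * max 0 a + h\<^sup>2"
proof (cases "0 <= a")
 case True
 have "\<bar>max 0 (a + h)\<bar> <= \<bar>a + h\<bar>" by auto
 then have "(max 0 (a + h))\<^sup>2 <= (a + h)\<^sup>2" by (simp only: abs_le_square_iff)
 also have "... = a\<^sup>2 + 2 * h * a + h\<^sup>2" by (simp add: power2_eq_square algebra_simps)
 finally show ?thesis using True by (simp add: max_def)
next
 case False
 then have "\<bar>max 0 (a + h)\<bar> <= \<bar>h\<bar>" by auto
 then have "(max 0 (a + h))\<^sup>2 <= h\<^sup>2" by (simp only: abs_le_square_iff)
 then show ?thesis using False by (simp add: max_def)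
qed

text \<open>A weighting of the edges with all degrees between \<open>l v\<close> and \<open>b\<close>, found by minimising the total squared
 violation over the compact cube of all weightings: at a minimiser the edges from vertices of too small degree to
 vertices of admissible degree are saturated, and those from vertices of too large degree to all but the ones of too small degree carry no weight.\<close>

lemma fractional_factor:
 fixes E :: "('a \<times> 'a) set" and l :: "'a => real" and b :: real
 assumes fin: "finite V" and EV: "E \<subseteq> V \<times> V" and symE: "sym E" and irr: "irrefl E"
  and lb: "!!v. v \<in> V ==> l v <= b" and b: "0 <= b"
  and H: "!!S T. S \<subseteq> V ==> T \<subseteq> V ==> S \<inter> T = {} ==> S \<noteq> {} ==> sum l S <= ecount E S (V - T) + b * rcard T"
 shows "\<exists>g :: 'a set => real. (\<forall>e. 0 <= g e \<and> g e <= 1) \<and> (\<forall>v\<in>V. l v <= (\<Sum>u\<in>E `` {v}. g {u, v}) \<and> (\<Sum>u\<in>E `` {v}. g {u, v}) <= b)"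
proof -
 define d where "d g v = (\<Sum>u\<in>E `` {v}. g {u, v})" for g :: "'a set => real" and v
 define \<Phi> where "\<Phi> g = (\<Sum>v\<in>V. (max 0 (l v - d g v))\<^sup>2 + (max 0 (d g v - b))\<^sup>2)" for g
 \<comment> \<open>Weights are assigned to all sets, so the weightings form a full product of
   intervals, compact by Tychonoff's theorem.\<close>
 define K where "K = PiE (UNIV :: 'a set set) (\<lambda>_. {0..1::real})"
 have Kiff: "g \<in> K \<longleftrightarrow> (\<forall>e. 0 <= g e \<and> g e <= 1)" for g by (auto simp: K_def PiE_iff)
 have "compactin (product_topology (\<lambda>_. euclidean) UNIV) K"
  unfolding K_def compactin_PiE by (simp add: compactin_euclidean_iff)
 then have cK: "compact K" by (simp add: euclidean_product_topology compactin_euclidean_iff)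
 have finN: "finite (E `` {v})" for v using EV fin finite_subset[of "E `` {v}" V] by auto
 have cd: "continuous_on K (\<lambda>g. d g v)" for v
  unfolding d_def by (intro continuous_on_sum continuous_on_subset[OF continuous_on_product_coordinates]) simp
 have "continuous_on K \<Phi>" unfolding \<Phi>_def by (intro continuous_intros cd)
 moreover have "(\<lambda>_. 0) \<in> K" by (simp add: Kiff)
 ultimately have "\<exists>g\<in>K. \<forall>g'\<in>K. \<Phi> g <= \<Phi> g'" using cK by (intro continuous_attains_inf) auto
 then obtain g where g: "g \<in> K" and gmin: "!!g'. g' \<in> K ==> \<Phi> g <= \<Phi> g'" by (elim bexE) (rule that; blast)
 \<comment> \<open>Half the derivative of the penalty at \<open>v\<close>: the excess over
   \<open>b\<close> minus the deficit below \<open>l v\<close>. Changing \<open>g {u, v}\<close> by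
   \<open>h\<close> changes \<Phi> by \<open>2 * (s u + s v) * h\<close> up to a quadratic
   error.\<close>
 define s where "s v = max 0 (d g v - b) - max 0 (l v - d g v)" for v
 have pert: "0 <= 2 * (s u + s v) * h + 4 * h\<^sup>2" if uv: "(u, v) \<in> E" and h: "0 <= g {u, v} + h" "g {u, v} + h <= 1" for u v h
 proof -
  have ne: "u \<noteq> v" using uv irr by (auto simp: irrefl_def)
  have vu: "(v, u) \<in> E" using uv symE by (auto dest: symD)
  have uvV: "u \<in> V" "v \<in> V" using uv EV by auto
  define g' where "g' = g({u, v} := g {u, v} + h)"
  have g': "g' \<in> K" using g h by (simp add: Kiff g'_def)
  have d': "d g' x = d g x + (if x = u \<or> x = v then h else 0)" for x
  proof -
   have e: "g' {y, x} = g {y, x} + (if (x = u \<and> y = v) \<or> (x = v \<and> y = u) then h else 0)" for y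
    using ne by (auto simp: g'_def doubleton_eq_iff insert_commute)
   have "d g' x = d g x + (\<Sum>y\<in>E `` {x}. if (x = u \<and> y = v) \<or> (x = v \<and> y = u) then h else 0)"
    unfolding d_def e sum.distrib ..
   moreover have "(\<Sum>y\<in>E `` {x}. if (x = u \<and> y = v) \<or> (x = v \<and> y = u) then h else 0) = (if x = u \<or> x = v then h else 0)"
   proof -
    consider "x = u" | "x = v" | "x \<noteq> u" "x \<noteq> v" by blast
    then show ?thesis
    proof cases
     case 1 then show ?thesis using ne uv finN by (simp add: sum.delta)
    next
     case 2 then show ?thesis using ne vu finN by (simp add: sum.delta)
    next
     case 3 then show ?thesis by simp
    qed
   qed
   ultimately show ?thesis by simp
  qed
  let ?\<phi> = "\<lambda>x y. (max 0 (l x - y))\<^sup>2 + (max 0 (y - b))\<^sup>2"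
  have one: "?\<phi> x (d g x + h) <= ?\<phi> x (d g x) + (2 * s x * h + 2 * h\<^sup>2)" for x
  proof -
   have "(max 0 ((l x - d g x) + (- h)))\<^sup>2 <= (max 0 (l x - d g x))\<^sup>2 + 2 * (- h) * max 0 (l x - d g x) + (- h)\<^sup>2" by (rule max_sq_shift)
   moreover have "(max 0 ((d g x - b) + h))\<^sup>2 <= (max 0 (d g x - b))\<^sup>2 + 2 * h * max 0 (d g x - b) + h\<^sup>2" by (rule max_sq_shift)
   moreover have e: "l x - (d g x + h) = (l x - d g x) + (- h)" "(d g x + h) - b = (d g x - b) + h" by simp_all
   moreover have "2 * s x * h = 2 * h * max 0 (d g x - b) + 2 * (- h) * max 0 (l x - d g x)" by (simp add: s_def algebra_simps)
   moreover have "(- h)\<^sup>2 = h\<^sup>2" by simp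
   ultimately show ?thesis unfolding e by linarith
  qed
  have "\<Phi> g' <= (\<Sum>x\<in>V. ?\<phi> x (d g x) + (if x = u then 2 * s u * h + 2 * h\<^sup>2 else 0) + (if x = v then 2 * s v * h + 2 * h\<^sup>2 else 0))"
   unfolding \<Phi>_def
  proof (rule sum_mono)
   fix x
   show "?\<phi> x (d g' x) <= ?\<phi> x (d g x) + (if x = u then 2 * s u * h + 2 * h\<^sup>2 else 0) + (if x = v then 2 * s v * h + 2 * h\<^sup>2 else 0)"
    using one[of x] ne unfolding d' by (cases "x = u"; cases "x = v") auto
  qed
  also have "... = \<Phi> g + (2 * s u * h + 2 * h\<^sup>2) + (2 * s v * h + 2 * h\<^sup>2)"
   unfolding sum.distrib \<Phi>_def using fin uvV by (simp add: sum.delta)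
  finally have "0 <= (2 * s u * h + 2 * h\<^sup>2) + (2 * s v * h + 2 * h\<^sup>2)" using gmin[OF g'] by linarith
  then show ?thesis by (simp add: algebra_simps)
 qed
 have g01: "0 <= g e" "g e <= 1" for e using g by (auto simp: Kiff)
 have sat: "g {u, v} = 1" if "(u, v) \<in> E" "s u + s v < 0" for u v
 proof (rule ccontr)
  assume "g {u, v} \<noteq> 1"
  then have lt: "g {u, v} < 1" using g01[of "{u, v}"] by linarith
  \<comment> \<open>A step of at most a quarter of \<open>- (s u + s v)\<close> keeps the quadratic
    error below the linear gain.\<close>
  define h where "h = min (1 - g {u, v}) (- (s u + s v) / 4)"
  have "h <= - (s u + s v) / 4" unfolding h_def by (rule min.cobounded2)
  then have h4: "4 * h <= - (s u + s v)" by (simp add: field_simps)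
  have "0 < h" "h <= 1 - g {u, v}" using lt that by (simp_all add: h_def)
  note h = this h4
  have "0 <= 2 * (s u + s v) * h + 4 * h\<^sup>2" using h g01[of "{u, v}"] by (intro pert that) linarith+
  also have "... = h * (2 * (s u + s v) + 4 * h)" by (simp add: power2_eq_square algebra_simps)
  finally have "0 <= 2 * (s u + s v) + 4 * h" using h(1) by (simp add: zero_le_mult_iff)
  then show False using h that unfolding distrib_left by linarith
 qed
 have zero: "g {u, v} = 0" if "(u, v) \<in> E" "0 < s u + s v" for u v
 proof (rule ccontr)
  assume "g {u, v} \<noteq> 0"
  then have lt: "0 < g {u, v}" using g01[of "{u, v}"] by linarith
  define h where "h = min (g {u, v}) ((s u + s v) / 4)"
  have "h <= (s u + s v) / 4" unfolding h_def by (rule min.cobounded2)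
  then have h4: "4 * h <= s u + s v" by (simp add: field_simps)
  have "0 < h" "h <= g {u, v}" using lt that by (simp_all add: h_def)
  note h = this h4
  have "0 <= 2 * (s u + s v) * (- h) + 4 * (- h)\<^sup>2" using h g01[of "{u, v}"] by (intro pert that) linarith+
  also have "... = h * (4 * h - 2 * (s u + s v))" by (simp add: power2_eq_square algebra_simps)
  finally have "0 <= 4 * h - 2 * (s u + s v)" using h(1) by (simp add: zero_le_mult_iff)
  then show False using h that unfolding distrib_left by linarith
 qed
 \<comment> \<open>Edges from \<open>S\<close> to \<open>V - T\<close> are saturated, and edges at
   \<open>T\<close> carry weight only towards \<open>S\<close>. So the degrees in \<open>S\<close>
   sum to at least the right-hand side of \<open>H\<close>, although each is below
   \<open>l v\<close>; this rules out a nonempty \<open>S\<close>. Without \<open>S\<close> the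
   vertices of \<open>T\<close> would have degree 0.\<close>
 define S where "S = {v \<in> V. s v < 0}"
 define T where "T = {v \<in> V. 0 < s v}"
 have ST: "S \<subseteq> V" "T \<subseteq> V" "S \<inter> T = {}" "finite S" "finite T" using fin by (auto simp: S_def T_def)
 have dS: "d g v < l v" if "v \<in> S" for v using that by (auto simp: S_def s_def max_def split: if_splits)
 have dT: "b < d g v" if "v \<in> T" for v using that by (auto simp: T_def s_def max_def split: if_splits)
 have EvV: "E `` {v} \<subseteq> V" for v using EV by auto
 define X where "X = (\<Sum>v\<in>S. \<Sum>u\<in>E `` {v} \<inter> T. g {u, v})"
 have sumS: "ecount E S (V - T) + X <= (\<Sum>v\<in>S. d g v)"
  unfolding ecount_def X_def sum.distrib[symmetric]
 proof (rule sum_mono)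
  fix v assume v: "v \<in> S"
  have e: "E `` {v} = (E `` {v} \<inter> (V - T)) \<union> (E `` {v} \<inter> T)" using EvV[of v] ST by blast
  have "d g v = (\<Sum>u\<in>E `` {v} \<inter> (V - T). g {u, v}) + (\<Sum>u\<in>E `` {v} \<inter> T. g {u, v})"
   unfolding d_def by (subst e, rule sum.union_disjoint) (use finN in auto)
  moreover have "(\<Sum>u\<in>E `` {v} \<inter> (V - T). g {u, v}) = (\<Sum>u\<in>E `` {v} \<inter> (V - T). 1)"
  proof (rule sum.cong[OF refl])
   fix u assume u: "u \<in> E `` {v} \<inter> (V - T)"
   have "(u, v) \<in> E" using u symE by (auto dest: symD)
   moreover have "s u + s v < 0" using u v by (auto simp: S_def T_def)
   ultimately show "g {u, v} = 1" by (rule sat)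
  qed
  ultimately show "deg_in E v (V - T) + (\<Sum>u\<in>E `` {v} \<inter> T. g {u, v}) <= d g v" by simp
 qed
 have sumT: "(\<Sum>v\<in>T. d g v) = X"
 proof -
  have "(\<Sum>v\<in>T. d g v) = (\<Sum>v\<in>T. \<Sum>u\<in>{u \<in> S. (v, u) \<in> E}. g {u, v})"
  proof (rule sum.cong[OF refl])
   fix v assume v: "v \<in> T"
   show "d g v = (\<Sum>u\<in>{u \<in> S. (v, u) \<in> E}. g {u, v})" unfolding d_def
   proof (rule sum.mono_neutral_right[OF finN])
    show "{u \<in> S. (v, u) \<in> E} \<subseteq> E `` {v}" by auto
    show "\<forall>u\<in>E `` {v} - {u \<in> S. (v, u) \<in> E}. g {u, v} = 0"
    proof
     fix u assume u: "u \<in> E `` {v} - {u \<in> S. (v, u) \<in> E}"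
     have "(u, v) \<in> E" using u symE by (auto dest: symD)
     moreover have "u \<in> V" using u EV by auto
     then have "0 < s u + s v" using u v by (auto simp: S_def T_def)
     ultimately show "g {u, v} = 0" by (rule zero)
    qed
   qed
  qed
  also have "... = (\<Sum>u\<in>S. \<Sum>v\<in>{v \<in> T. (v, u) \<in> E}. g {u, v})" using ST by (intro sum.swap_restrict)
  also have "... = X" unfolding X_def
  proof (rule sum.cong[OF refl])
   fix u assume "u \<in> S"
   have "{v \<in> T. (v, u) \<in> E} = E `` {u} \<inter> T" using symE by (auto dest: symD)
   then show "(\<Sum>v\<in>{v \<in> T. (v, u) \<in> E}. g {u, v}) = (\<Sum>v\<in>E `` {u} \<inter> T. g {v, u})" by (simp add: insert_commute)
  qed
  finally show ?thesis .
 qed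
 have bT: "b * rcard T <= (\<Sum>v\<in>T. d g v)"
  using sum_bounded_below[of T b "d g"] dT by (auto simp: mult.commute less_imp_le)
 have S0: "S = {}"
 proof (rule ccontr)
  assume ne: "S \<noteq> {}"
  have "(\<Sum>v\<in>S. d g v) < sum l S" using ST(4) ne dS by (intro sum_strict_mono) auto
  then show False using H[OF ST(1-3) ne] sumS sumT bT by linarith
 qed
 have T0: "T = {}"
 proof (rule ccontr)
  assume ne: "T \<noteq> {}"
  have "0 < d g v" if "v \<in> T" for v using dT[OF that] b by linarith
  then have "0 < (\<Sum>v\<in>T. d g v)" using ST(5) ne by (intro sum_pos) auto
  then show False unfolding sumT X_def S0 by simp
 qed
 have "l v <= d g v \<and> d g v <= b" if v: "v \<in> V" for v
 proof -
  have "\<not> s v < 0" "\<not> 0 < s v" using v S0 T0 unfolding S_def T_def by blast+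
  then show ?thesis using lb[OF v] by (auto simp: s_def max_def split: if_splits)
 qed
 then show ?thesis using g01 unfolding d_def by (intro exI[of _ g]) blast
qed

section \<open>Random nonempty index sets with prescribed marginals\<close>

text \<open>\<open>measure_pmf_prob_product\<close> is applied to countable sets, hence the passage
  to the supports.\<close>

lemma prob_pair_Times: "measure_pmf.prob (pair_pmf M N) (A \<times> B) = measure_pmf.prob M A * measure_pmf.prob N B"
proof -
 have "measure_pmf.prob (pair_pmf M N) (A \<times> B) = measure_pmf.prob (pair_pmf M N) ((A \<inter> set_pmf M) \<times> (B \<inter> set_pmf N))"
  by (subst measure_Int_set_pmf[symmetric], rule arg_cong[where f = "measure _"]) auto
 also have "... = measure_pmf.prob M (A \<inter> set_pmf M) * measure_pmf.prob N (B \<inter> set_pmf N)"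
  by (intro measure_pmf_prob_product) (auto intro: countable_subset[OF _ countable_set_pmf])
 finally show ?thesis by (simp add: measure_Int_set_pmf)
qed

text \<open>One index is drawn with probability proportional to \<open>x\<close>, which excludes the
  empty set. Every index is moreover added independently with the probability \<open>z i\<close>
  that lifts its marginal from \<open>y i\<close> to \<open>x i\<close>, that is
  \<open>(1 - y i) * (1 - z i) = 1 - x i\<close>.\<close>

lemma random_cover:
 fixes x :: "'i => real"
 assumes fin: "finite I" and x: "!!i. i \<in> I ==> 0 <= x i \<and> x i <= 1" "1 <= sum x I"
 shows "\<exists>P :: 'i set pmf. (\<forall>T\<in>set_pmf P. T \<noteq> {} \<and> T \<subseteq> I) \<and> (\<forall>i\<in>I. measure_pmf.prob P {T. i \<in> T} = x i)"
proof -
 define y where "y i = x i / sum x I" for i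
 have y: "0 <= y i" "y i <= x i" if "i \<in> I" for i
  using x(1)[OF that] x(2) by (auto simp: y_def divide_le_eq mult_le_cancel_left1)
 have y1: "sum y I = 1" using x(2) by (simp add: y_def sum_divide_distrib[symmetric])
 obtain A :: "'i option pmf" where A: "!!D. D \<subseteq> I ==> measure_pmf.prob A (Some ` D) = sum y D"
  using ex_pmf_option[of I y] fin y(1) y1 by auto
 have AS: "set_pmf A \<subseteq> Some ` I"
 proof -
  have "measure_pmf.prob A (Some ` I) = 1" using A[of I] y1 by simp
  then have "AE a in measure_pmf A. a \<in> Some ` I" by (subst (asm) measure_pmf.prob_eq_1) auto
  then show ?thesis by (auto simp: AE_measure_pmf_iff)
 qed
 define z where "z i = (if y i = 1 then 1 else (x i - y i) / (1 - y i))" for i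
 have yle: "y i <= 1" if "i \<in> I" for i using y(2)[OF that] x(1)[OF that] by linarith
 have z: "0 <= z i \<and> z i <= 1 \<and> (1 - y i) * (1 - z i) = 1 - x i" if i: "i \<in> I" for i
 proof (cases "y i = 1")
  case True
  then show ?thesis using y(2)[OF i] x(1)[OF i] by (simp add: z_def)
 next
  case False
  then have lt: "y i < 1" using yle[OF i] by simp
  have "(1 - y i) * z i = x i - y i" using lt False by (simp add: z_def)
  then have "(1 - y i) * (1 - z i) = 1 - x i" by (simp add: right_diff_distrib)
  then show ?thesis using lt False y(2)[OF i] x(1)[OF i] by (simp add: z_def divide_le_eq)
 qed
 define Q where "Q = Pi_pmf I False (\<lambda>i. bernoulli_pmf (z i))"
 have Q: "measure_pmf.prob Q {c. \<not> c i} = 1 - z i" if i: "i \<in> I" for i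
 proof -
  have "measure_pmf.prob (map_pmf (\<lambda>c. c i) Q) {False} = measure_pmf.prob Q {c. \<not> c i}"
   by (simp add: vimage_def)
  moreover have "map_pmf (\<lambda>c. c i) Q = bernoulli_pmf (z i)" unfolding Q_def using fin i by (simp add: Pi_pmf_component)
  ultimately show ?thesis using z[OF i] by (simp add: measure_pmf_single)
 qed
 define F :: "'i option \<times> ('i => bool) => 'i set" where "F = (\<lambda>(a, c). {i \<in> I. a = Some i \<or> c i})"
 define P where "P = map_pmf F (pair_pmf A Q)"
 show ?thesis
 proof (intro exI[of _ P] conjI ballI)
  fix T assume "T \<in> set_pmf P"
  then show "T \<noteq> {}" "T \<subseteq> I" using AS by (auto simp: P_def F_def)
 next
  fix i assume i: "i \<in> I"
  have "measure_pmf.prob P {T. i \<in> T} = measure_pmf.prob (pair_pmf A Q) {ac. i \<in> F ac}" by (simp add: P_def vimage_def)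
  also have "{ac. i \<in> F ac} = - ((- {Some i}) \<times> {c. \<not> c i})" using i by (auto simp: F_def)
  also have "measure_pmf.prob (pair_pmf A Q) ... = 1 - measure_pmf.prob (pair_pmf A Q) ((- {Some i}) \<times> {c. \<not> c i})"
   using measure_pmf.prob_compl[of "(- {Some i}) \<times> {c. \<not> c i}" "pair_pmf A Q"] by (simp add: Compl_eq_Diff_UNIV)
  also have "... = 1 - measure_pmf.prob A (- {Some i}) * (1 - z i)" by (simp add: prob_pair_Times Q[OF i])
  also have "measure_pmf.prob A (- {Some i}) = 1 - y i"
   using measure_pmf.prob_compl[of "{Some i}" A] A[of "{i}"] i by (simp add: Compl_eq_Diff_UNIV)
  finally show "measure_pmf.prob P {T. i \<in> T} = x i" using z[OF i] by simp
 qed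
qed

section \<open>Path families and closing them to cycles\<close>

text \<open>Distinctness of the concatenation expresses that the paths are simple and pairwise
  disjoint. \<open>Z\<close> collects ends at which paths may still be extended; it is a mere
  subset, so ends can be left idle.\<close>

definition path_family :: "('a \<times> 'a) set => 'a list list => 'a set => 'a set => bool" where
 "path_family E PS W Z \<longleftrightarrow> (\<forall>p\<in>set PS. p \<noteq> [] \<and> chain E p) \<and> distinct (concat PS) \<and> set (concat PS) = W \<and> Z \<subseteq> last ` set PS"

lemma path_family_extend:
 assumes "path_family E PS W Z" "x \<notin> W" "u \<in> Z" "(u, x) \<in> E"
 shows "\<exists>PS'. path_family E PS' (insert x W) (insert x (Z - {u})) \<and> length PS' = length PS"
proof -
 obtain p where p: "p \<in> set PS" "u = last p" using assms unfolding path_family_def by auto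
 obtain A B where AB: "PS = A @ p # B" using p by (meson split_list)
 have pn: "p \<noteq> []" "chain E p" using assms(1) p unfolding path_family_def by auto
 have "path_family E (A @ (p @ [x]) # B) (insert x W) (insert x (Z - {u}))"
  unfolding path_family_def
 proof (intro conjI)
  show "\<forall>q\<in>set (A @ (p @ [x]) # B). q \<noteq> [] \<and> chain E q"
   using assms(1,4) pn p(2) unfolding path_family_def AB by (auto simp: successively_append_iff)
  show "distinct (concat (A @ (p @ [x]) # B))" using assms(1,2) unfolding path_family_def AB by auto
  show "set (concat (A @ (p @ [x]) # B)) = insert x W" using assms(1) unfolding path_family_def AB by auto
  show "insert x (Z - {u}) \<subseteq> last ` set (A @ (p @ [x]) # B)"
   using assms(1) p(2) unfolding path_family_def AB by auto
 qed
 then show ?thesis using AB by (intro exI[of _ "A @ (p @ [x]) # B"]) simp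
qed

lemma path_family_match:
 assumes "finite M" "path_family E PS W Z" "M \<inter> W = {}" "inj_on f M" "f ` M \<subseteq> Z" "!!x. x \<in> M ==> (f x, x) \<in> E" "f ` M \<inter> M = {}"
 shows "\<exists>PS'. path_family E PS' (W \<union> M) (M \<union> (Z - f ` M)) \<and> length PS' = length PS"
 using assms
proof (induction M)
 case empty
 then show ?case by auto
next
 case (insert x M)
 then obtain PS' where PS': "path_family E PS' (W \<union> M) (M \<union> (Z - f ` M))" "length PS' = length PS" by auto
 have "\<exists>PS''. path_family E PS'' (insert x (W \<union> M)) (insert x (M \<union> (Z - f ` M) - {f x})) \<and> length PS'' = length PS'"
  using insert by (intro path_family_extend[OF PS'(1)]) auto
 moreover have "insert x (M \<union> (Z - f ` M) - {f x}) = insert x M \<union> (Z - f ` insert x M)" using insert.prems(6) by auto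
 ultimately show ?case using PS'(2) by auto
qed

lemma path_family_singles:
 assumes "finite M" "path_family E PS W Z" "M \<inter> W = {}"
 shows "\<exists>PS'. path_family E PS' (W \<union> M) (M \<union> Z) \<and> length PS' = length PS + card M"
 using assms
proof (induction M)
 case empty
 then show ?case by auto
next
 case (insert x M)
 then obtain PS' where PS': "path_family E PS' (W \<union> M) (M \<union> Z)" "length PS' = length PS + card M" by auto
 have "path_family E ([x] # PS') (insert x (W \<union> M)) (insert x (M \<union> Z))"
  using PS'(1) insert unfolding path_family_def by auto
 then show ?case using PS'(2) insert by (intro exI[of _ "[x] # PS'"]) simp
qed

text \<open>When paths are extended along the matchings, a new path starts only at a vertex of the
  initial class or at one of the at most \<open>d s\<close> unmatched vertices of class
  \<open>Suc s\<close>.\<close>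

lemma matching_paths:
 assumes "!!s. s <= t ==> finite (U s)" "!!s s'. s <= t ==> s' <= t ==> s \<noteq> s' ==> U s \<inter> U s' = {}"
  and "!!s. s < t ==> \<exists>M f. M \<subseteq> U (Suc s) \<and> card (U (Suc s)) <= card M + d s \<and> inj_on f M \<and> (\<forall>x\<in>M. f x \<in> U s \<and> (f x, x) \<in> E)"
 shows "\<exists>PS. path_family E PS (\<Union>s\<le>t. U s) (U t) \<and> length PS <= card (U 0) + (\<Sum>s<t. d s)"
 using assms
proof (induction t)
 case 0
 have "path_family E [] {} {}" by (simp add: path_family_def)
 from path_family_singles[OF _ this, of "U 0"] 0 show ?case by auto
next
 case (Suc t)
 have "\<exists>PS. path_family E PS (\<Union>s\<le>t. U s) (U t) \<and> length PS <= card (U 0) + (\<Sum>s<t. d s)"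
  by (rule Suc.IH) (use Suc.prems in auto)
 then obtain PS where PS: "path_family E PS (\<Union>s\<le>t. U s) (U t)" "length PS <= card (U 0) + (\<Sum>s<t. d s)" by blast
 from Suc.prems(3)[OF lessI] obtain M f where M: "M \<subseteq> U (Suc t)" "card (U (Suc t)) <= card M + d t" "inj_on f M" "\<forall>x\<in>M. f x \<in> U t \<and> (f x, x) \<in> E"
  by (elim exE conjE) (rule that; assumption)
 have finU: "finite (U (Suc t))" using Suc.prems(1) by simp
 have finM: "finite M" using M(1) finU finite_subset by blast
 have dj: "U (Suc t) \<inter> (\<Union>s\<le>t. U s) = {}"
 proof -
  have "U (Suc t) \<inter> U s = {}" if "s <= t" for s using Suc.prems(2)[of "Suc t" s] that by auto
  then show ?thesis by blast
 qed
 have "\<exists>PS'. path_family E PS' ((\<Union>s\<le>t. U s) \<union> M) (M \<union> (U t - f ` M)) \<and> length PS' = length PS"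
 proof (rule path_family_match[OF finM PS(1) _ M(3)])
  show "M \<inter> (\<Union>s\<le>t. U s) = {}" using dj M(1) by blast
  show "f ` M \<subseteq> U t" using M(4) by blast
  show "(f x, x) \<in> E" if "x \<in> M" for x using M(4) that by blast
  show "f ` M \<inter> M = {}" using M(1,4) Suc.prems(2)[of "Suc t" t] by auto
 qed
 then obtain PS' where PS': "path_family E PS' ((\<Union>s\<le>t. U s) \<union> M) (M \<union> (U t - f ` M))" "length PS' = length PS" by blast
 have "\<exists>PS''. path_family E PS'' ((\<Union>s\<le>t. U s) \<union> M \<union> (U (Suc t) - M)) ((U (Suc t) - M) \<union> (M \<union> (U t - f ` M))) \<and> length PS'' = length PS' + card (U (Suc t) - M)"
  by (rule path_family_singles[OF _ PS'(1)]) (use finU dj in auto)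
 then obtain PS'' where PS'': "path_family E PS'' ((\<Union>s\<le>t. U s) \<union> M \<union> (U (Suc t) - M)) ((U (Suc t) - M) \<union> (M \<union> (U t - f ` M)))"
  "length PS'' = length PS' + card (U (Suc t) - M)" by blast
 have "(\<Union>s\<le>t. U s) \<union> M \<union> (U (Suc t) - M) = (\<Union>s\<le>Suc t. U s)" using M(1) by (auto simp: le_Suc_eq)
 moreover have "U (Suc t) \<subseteq> (U (Suc t) - M) \<union> (M \<union> (U t - f ` M))" by auto
 ultimately have "path_family E PS'' (\<Union>s\<le>Suc t. U s) (U (Suc t))"
  using PS''(1) unfolding path_family_def by auto
 moreover have "card (U (Suc t) - M) = card (U (Suc t)) - card M" using M(1) finM by (intro card_Diff_subset)
 then have "length PS'' <= card (U 0) + (\<Sum>s<Suc t. d s)" using PS''(2) PS'(2) PS(2) M(2) by simp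
 ultimately show ?case by blast
qed

text \<open>The end of each path is connected through \<open>Q\<close> to the start of the
  cyclically next one; a single path is closed onto itself. A connection has a vertex outside
  \<open>W\<close>, so \<open>2 <= card W\<close> gives length at least 3.\<close>

lemma close_paths:
 fixes q b :: real
 assumes con: "connector V E Q q b" and PS: "path_family E PS W Z" and W: "W \<subseteq> V - Q" "2 <= card W" "finite W" and q: "real (length PS) <= q"
 shows "\<exists>C. cycle_list E C \<and> W \<subseteq> set C \<and> set C \<subseteq> W \<union> Q"
proof -
 define N where "N = length PS"
 have P: "!!p. p \<in> set PS ==> p \<noteq> []" "!!p. p \<in> set PS ==> chain E p" "distinct (concat PS)" "set (concat PS) = W"
  using PS unfolding path_family_def by blast+
 have N0: "0 < N" using P(4) W(2) by (cases PS) (auto simp: N_def)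
 have nth: "PS ! i \<in> set PS" if "i < N" for i using that by (simp add: N_def)
 have rem: "removeAll [] PS = PS" using P(1) by (intro removeAll_id) blast
 have dPS: "distinct PS" "!!p. p \<in> set PS ==> distinct p" "!!p r. p \<in> set PS ==> r \<in> set PS ==> p \<noteq> r ==> set p \<inter> set r = {}"
  using P(3) unfolding distinct_concat_iff rem by blast+
 have dj: "set (PS ! i) \<inter> set (PS ! j) = {}" if "i < N" "j < N" "i \<noteq> j" for i j
  using that dPS(1) by (intro dPS(3) nth) (auto simp: nth_eq_iff_index_eq N_def)
 have PV: "set (PS ! i) \<subseteq> W" if "i < N" for i using nth[OF that] P(4) by auto
 define \<sigma> where "\<sigma> i = Suc i mod N" for i
 have \<sigma>: "\<sigma> i < N" for i using N0 by (simp add: \<sigma>_def)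
 have \<sigma>inj: "\<sigma> i \<noteq> \<sigma> j" if "i < N" "j < N" "i \<noteq> j" for i j using that by (auto simp: \<sigma>_def mod_Suc split: if_splits)
 have lh: "last (PS ! i) \<in> set (PS ! i)" "hd (PS ! i) \<in> set (PS ! i)" if "i < N" for i using P(1)[OF nth[OF that]] by auto
 have one: "card {i \<in> {..<N}. f i = v} <= 3" if "!!i j. i < N ==> j < N ==> i \<noteq> j ==> f i \<noteq> f j" for f :: "nat => 'a" and v
 proof -
  have "card {i \<in> {..<N}. f i = v} <= Suc 0" using that by (subst card_le_Suc0_iff_eq) auto
  then show ?thesis by simp
 qed
 have "finite {..<N} \<and> rcard {..<N} <= q \<and> (\<forall>i\<in>{..<N}. last (PS ! i) \<in> V \<and> hd (PS ! \<sigma> i) \<in> V) \<and>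
  (\<forall>v. card {i \<in> {..<N}. last (PS ! i) = v} <= 3 \<and> card {i \<in> {..<N}. hd (PS ! \<sigma> i) = v} <= 3)"
 proof (intro conjI ballI allI)
  show "rcard {..<N} <= q" using q by (simp add: N_def)
  show "last (PS ! i) \<in> V" if "i \<in> {..<N}" for i using that lh(1)[of i] PV[of i] W(1) by auto
  show "hd (PS ! \<sigma> i) \<in> V" for i using lh(2)[OF \<sigma>] PV[OF \<sigma>] W(1) by auto
  show "card {i \<in> {..<N}. last (PS ! i) = v} <= 3" for v
  proof (rule one)
   fix i j assume ij: "i < N" "j < N" "i \<noteq> j"
   show "last (PS ! i) \<noteq> last (PS ! j)" using lh(1)[OF ij(1)] lh(1)[OF ij(2)] dj[OF ij] by auto
  qed
  show "card {i \<in> {..<N}. hd (PS ! \<sigma> i) = v} <= 3" for v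
  proof (rule one)
   fix i j assume ij: "i < N" "j < N" "i \<noteq> j"
   show "hd (PS ! \<sigma> i) \<noteq> hd (PS ! \<sigma> j)" using lh(2)[OF \<sigma>, of i] lh(2)[OF \<sigma>, of j] dj[OF \<sigma> \<sigma> \<sigma>inj[OF ij]] by auto
  qed
 qed simp
 from con[unfolded connector_def, rule_format, OF this] obtain Zs where Zs: "disj_lists {..<N} Zs"
  "\<forall>i\<in>{..<N}. conn E Q (last (PS ! i)) (hd (PS ! \<sigma> i)) (Zs i) \<and> real (length (Zs i)) <= b"
  by (elim exE conjE) (rule that; assumption)
 have zc: "Zs i \<noteq> []" "distinct (Zs i)" "set (Zs i) \<subseteq> Q" "chain E (last (PS ! i) # Zs i @ [hd (PS ! \<sigma> i)])" if "i < N" for i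
  using Zs(2) that unfolding conn_def by auto
 define w where "w i = Zs i @ PS ! \<sigma> i" for i
 define f where "f i = last (PS ! (i mod N))" for i
 have walk: "walk E (f i) (w i) (f (Suc i))" if i: "i < N" for i
 proof -
  obtain h tl where pe: "PS ! \<sigma> i = h # tl" using P(1)[OF nth[OF \<sigma>[of i]]] by (cases "PS ! \<sigma> i") auto
  have ch: "chain E (h # tl)" using P(2)[OF nth[OF \<sigma>[of i]]] pe by simp
  have a: "chain E (last (PS ! i) # Zs i @ [h])" using zc(4)[OF i] unfolding pe list.sel(1) .
  have "chain E ((last (PS ! i) # Zs i @ [h]) @ tl)"
  proof (cases tl)
   case Nil
   then show ?thesis using a by simp
  next
   case (Cons a' tl')
   have "chain E tl" "(h, a') \<in> E" using ch Cons by auto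
   then show ?thesis unfolding successively_append_iff[of _ "last (PS ! i) # Zs i @ [h]" tl] using a Cons by auto
  qed
  then have "chain E (last (PS ! i) # Zs i @ h # tl)" by simp
  then show ?thesis using i pe by (simp add: walk_def f_def w_def \<sigma>_def)
 qed
 define C where "C = concat (map w [0..<N])"
 have wC: "walk E (f 0) C (f N)" unfolding C_def by (rule walk_concat) (rule walk)
 have fN: "f N = f 0" by (simp add: f_def)
 have wne: "w i \<noteq> []" if "i < N" for i using zc(1)[OF that] by (simp add: w_def)
 have Cne: "C \<noteq> []" unfolding C_def using N0 wne[of 0] by (auto simp: upt_conv_Cons)
 have lastC: "last C = f 0" using wC Cne unfolding walk_def fN by simp
 have sC: "set C = (\<Union>i<N. set (w i))" unfolding C_def by auto
 have wdj: "set (w i) \<inter> set (w j) = {}" if ij: "i < N" "j < N" "i \<noteq> j" for i j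
 proof -
  have "set (Zs i) \<inter> set (Zs j) = {}" using Zs(1) ij by (intro disj_listsD) auto
  moreover have "set (PS ! \<sigma> i) \<inter> set (PS ! \<sigma> j) = {}" by (rule dj[OF \<sigma> \<sigma> \<sigma>inj[OF ij]])
  ultimately show ?thesis using zc(3)[OF ij(1)] zc(3)[OF ij(2)] PV[OF \<sigma>[of i]] PV[OF \<sigma>[of j]] W(1) unfolding w_def set_append by blast
 qed
 have dC: "distinct C" unfolding C_def
 proof (rule distinct_concat)
  have "inj_on w {0..<N}"
  proof (rule inj_onI, rule ccontr)
   fix i j assume "i \<in> {0..<N}" "j \<in> {0..<N}" "w i = w j" "i \<noteq> j"
   then show False using wdj[of i j] wne[of i] by auto
  qed
  then show "distinct (map w [0..<N])" by (simp add: distinct_map)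
  show "distinct ys" if ys: "ys \<in> set (map w [0..<N])" for ys
  proof -
   obtain i where i: "i < N" "ys = w i" using ys by auto
   show ?thesis using zc(2,3)[OF i(1)] dPS(2)[OF nth[OF \<sigma>[of i]]] PV[OF \<sigma>[of i]] W(1) unfolding i(2) w_def by auto
  qed
  show "set ys \<inter> set zs = {}" if yz: "ys \<in> set (map w [0..<N])" "zs \<in> set (map w [0..<N])" "ys \<noteq> zs" for ys zs
  proof -
   obtain i j where ij: "i < N" "ys = w i" "j < N" "zs = w j" using yz by auto
   then have "i \<noteq> j" using yz(3) by auto
   then show ?thesis unfolding ij(2,4) by (intro wdj ij)
  qed
 qed
 have WC: "W \<subseteq> set C"
 proof
  fix v assume "v \<in> W"
  then obtain p where p: "p \<in> set PS" "v \<in> set p" using P(4) by auto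
  then obtain j where j: "j < N" "p = PS ! j" by (auto simp: in_set_conv_nth N_def)
  have "\<exists>i<N. \<sigma> i = j"
  proof (cases j)
   case 0
   then show ?thesis using N0 by (intro exI[of _ "N - 1"]) (simp add: \<sigma>_def)
  next
   case (Suc j')
   then show ?thesis using j by (intro exI[of _ j']) (simp add: \<sigma>_def)
  qed
  then obtain i where i: "i < N" "\<sigma> i = j" by blast
  have "v \<in> set (w i)" using p j i by (simp add: w_def)
  then show "v \<in> set C" using i sC by blast
 qed
 have CWQ: "set C \<subseteq> W \<union> Q" unfolding sC w_def using zc(3) PV[OF \<sigma>] by auto
 have "3 <= length C"
 proof -
  have "hd (Zs 0) \<in> set (w 0)" using zc(1)[OF N0] by (simp add: w_def)
  then have "insert (hd (Zs 0)) W \<subseteq> set C" using WC N0 sC by blast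
  then have "card (insert (hd (Zs 0)) W) <= card (set C)" by (intro card_mono) auto
  moreover have "hd (Zs 0) \<in> Q" using zc(1,3)[OF N0] hd_in_set by blast
  then have "hd (Zs 0) \<notin> W" using W(1) by blast
  moreover have "card (set C) = length C" using dC by (rule distinct_card)
  ultimately show ?thesis using W(2,3) by simp
 qed
 moreover have "chain E (last C # C)" using wC unfolding lastC walk_def by simp
 ultimately show ?thesis using dC WC CWQ by blast
qed

section \<open>Random classes and a cycle through them\<close>

lemma sum_if_subset: "finite V ==> A \<subseteq> V ==> (\<Sum>u\<in>V. if u \<in> A then g u else 0) = sum g A"
 by (simp only: sum.inter_restrict[symmetric] Int_absorb1)

abbreviation regular_classes :: "nat => nat => real => 'a set => (nat => 'a set) => (nat => ('a \<times> 'a) set) => (nat => 'a set => real) =>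
  (nat => 'a => real) => (nat => nat => 'a set) => bool" where
 "regular_classes j t eps V Y E w x U \<equiv> (\<forall>i<j. \<forall>s<t. U i s \<subseteq> Y i) \<and>
  (\<forall>i<j. \<forall>s<t. \<forall>s'<t. s \<noteq> s' --> U i s \<inter> U i s' = {}) \<and> (\<forall>v\<in>V. \<exists>i<j. \<exists>s<t. v \<in> U i s) \<and>
  (\<forall>i<j. \<forall>s<t. \<forall>v\<in>Y i. \<bar>(\<Sum>u\<in>E i `` {v} \<inter> U i s. w i {u, v} / x i u) - (\<Sum>u\<in>E i `` {v}. w i {u, v}) / real t\<bar>
    < eps * ((\<Sum>u\<in>E i `` {v}. w i {u, v}) / real t))"

text \<open>The classes \<open>U i s\<close> of cycle \<open>i\<close> are random with \<open>u \<in> U i s\<close> of probability \<open>x i u / t\<close>, where \<open>x i u\<close> is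
 the weighted degree of \<open>u\<close> divided by \<open>b\<close>; weighting \<open>u\<close> by \<open>1 / x i u\<close> makes all pairs of classes almost regular.\<close>

lemma regular_clusters:
 fixes w :: "nat => 'a set => real" and x :: "nat => 'a => real" and eps b :: real
 assumes fin: "finite V" and Vi: "!!i. i < j ==> Vi i \<subseteq> V" and Ei: "!!i. i < j ==> Ei i \<subseteq> Vi i \<times> Vi i"
  and w: "!!i e. i < j ==> 0 <= w i e \<and> w i e <= 1"
  and d: "!!i v. i < j ==> v \<in> Vi i ==> b / real j <= (\<Sum>u\<in>Ei i `` {v}. w i {u, v}) \<and> (\<Sum>u\<in>Ei i `` {v}. w i {u, v}) <= b"
  and x: "!!i v. i < j ==> v \<in> Vi i ==> x i v = (\<Sum>u\<in>Ei i `` {v}. w i {u, v}) / b" "!!i v. i < j ==> v \<in> V - Vi i ==> x i v = 0"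
  and cov: "!!v. v \<in> V ==> 1 <= (\<Sum>i<j. x i v)" and pos: "0 < b" "0 < eps" "0 < j" "0 < t"
  and small: "real j * real t * rcard V * (2 * exp (- 2 * eps\<^sup>2 * b / (real j ^ 4 * (real t)\<^sup>2))) < 1"
 shows "\<exists>U :: nat => nat => 'a set. regular_classes j t eps V Vi Ei w x U"
proof -
 define D where "D i v = (\<Sum>u\<in>Ei i `` {v}. w i {u, v})" for i v
 have rj: "0 < real j" "0 < real t" using pos by auto
 have Dpos: "b / real j <= D i v" "D i v <= b" "0 < D i v" if "i < j" "v \<in> Vi i" for i v
 proof -
  show "b / real j <= D i v" "D i v <= b" using d[OF that] by (auto simp: D_def)
  moreover have "0 < b / real j" using pos by simp
  ultimately show "0 < D i v" by linarith
 qed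
 have xD: "x i v = D i v / b" if "i < j" "v \<in> Vi i" for i v using x(1)[OF that] by (simp add: D_def)
 have xlo: "1 / real j <= x i v" "0 < x i v" "x i v <= 1" if iv: "i < j" "v \<in> Vi i" for i v
 proof -
  show "1 / real j <= x i v" unfolding xD[OF iv] using Dpos(1)[OF iv] pos by (simp add: field_simps)
  show "0 < x i v" "x i v <= 1" unfolding xD[OF iv] using Dpos(2,3)[OF iv] pos by (auto simp: field_simps)
 qed
 have x01: "0 <= x i v \<and> x i v <= 1" if "i < j" "v \<in> V" for i v
  using that xlo(2,3)[of i v] x(2)[of i v] by (cases "v \<in> Vi i") auto
 have "\<exists>P :: nat set pmf. (\<forall>T\<in>set_pmf P. T \<noteq> {} \<and> T \<subseteq> {..<j}) \<and> (\<forall>i\<in>{..<j}. measure_pmf.prob P {T. i \<in> T} = x i v)" if "v \<in> V" for v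
  using x01 cov that by (intro random_cover) auto
 then obtain R :: "'a => nat set pmf" where R: "!!v. v \<in> V ==> (\<forall>T\<in>set_pmf (R v). T \<noteq> {} \<and> T \<subseteq> {..<j}) \<and> (\<forall>i\<in>{..<j}. measure_pmf.prob (R v) {T. i \<in> T} = x i v)"
  by metis
 \<comment> \<open>A vertex draws a uniform class and, independently, a nonempty set of cycles with
   marginals \<open>x i v\<close>; nonemptiness makes the cycles cover \<open>V\<close>.\<close>
 define P where "P v = pair_pmf (pmf_of_set {..<t}) (R v)" for v
 have tne: "{..<t} \<noteq> {}" "finite {..<t}" using pos by auto
 have prob: "measure_pmf.prob (P v) ({s} \<times> {T. i \<in> T}) = x i v / real t" if "v \<in> V" "i < j" "s < t" for v i s
  using R[OF that(1)] that tne by (simp add: P_def prob_pair_Times measure_pmf_single)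
 define K where "K = (SIGMA i:{..<j}. {..<t} \<times> Vi i)"
 define f :: "nat \<times> nat \<times> 'a => 'a => nat \<times> nat set => real" where
  "f = (\<lambda>(i, s, v) u c. (if u \<in> Ei i `` {v} then w i {u, v} / x i u else 0) * indicator ({s} \<times> {T. i \<in> T}) c)"
 define B :: "nat \<times> nat \<times> 'a => 'a => real" where "B = (\<lambda>(i, s, v) u. if u \<in> Ei i `` {v} then real j * w i {u, v} else 0)"
 define \<tau> where "\<tau> = (\<lambda>(i, s :: nat, v). eps * (D i v / real t))"
 \<comment> \<open>As \<open>w\<close> is at most 1, the squared ranges \<open>(j * w)^2\<close> are
   at most \<open>j^2 * w\<close>, and these sum to \<open>j^2\<close> times a weighted
   degree.\<close>
 define S where "S = (real j)\<^sup>2 * b"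
 have finVi: "finite (Vi i)" if "i < j" for i using Vi[OF that] fin finite_subset by blast
 have EV: "Ei i `` {v} \<subseteq> Vi i" "Ei i `` {v} \<subseteq> V" "finite (Ei i `` {v})" if "i < j" for i v
  using Ei[OF that] Vi[OF that] finite_subset[OF _ finVi[OF that], of "Ei i `` {v}"] by auto
 have wx: "0 <= w i e / x i u \<and> w i e / x i u <= real j * w i e" if "i < j" "u \<in> Vi i" for i u e
 proof
  show "0 <= w i e / x i u" using w[OF that(1)] xlo(2)[OF that] by simp
  have "w i e * 1 <= w i e * (real j * x i u)"
   using w[OF that(1)] xlo(1)[OF that] rj by (intro mult_left_mono) (auto simp: field_simps)
  then show "w i e / x i u <= real j * w i e" using xlo(2)[OF that] by (simp add: divide_le_eq mult_ac)
 qed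
 have "\<exists>\<phi>. (\<forall>v\<in>V. \<phi> v \<in> set_pmf (P v)) \<and>
  (\<forall>k\<in>K. \<bar>(\<Sum>v\<in>V. f k v (\<phi> v)) - (\<Sum>v\<in>V. measure_pmf.expectation (P v) (f k v))\<bar> < \<tau> k)"
 proof (rule sampling[where b = B and s = "\<lambda>_. S"])
  show "finite K" unfolding K_def using finVi by auto
  show "0 <= f k v c \<and> f k v c <= B k v" if "k \<in> K" for k v c
  proof -
   obtain i s u where k: "k = (i, s, u)" by (cases k) auto
   have i: "i < j" using that k by (simp add: K_def)
   have jw: "0 <= real j * w i e" for e using w[OF i] by simp
   show ?thesis using wx[OF i] EV(1)[OF i, of u] jw[of "{v, u}"] unfolding k f_def B_def by (auto simp: indicator_def)
  qed
  show "0 < \<tau> k" if "k \<in> K" for k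
   using that Dpos(3) pos by (auto simp: K_def \<tau>_def)
  show "0 < S \<and> (\<Sum>v\<in>V. (B k v)\<^sup>2) <= S" if "k \<in> K" for k
  proof
   show "0 < S" using pos by (simp add: S_def)
   obtain i s v where k: "k = (i, s, v)" by (cases k) auto
   have i: "i < j" and v: "v \<in> Vi i" using that k by (auto simp: K_def)
   have "(\<Sum>u\<in>V. (B k u)\<^sup>2) = (\<Sum>u\<in>V. if u \<in> Ei i `` {v} then (real j * w i {u, v})\<^sup>2 else 0)"
    unfolding k B_def by (intro sum.cong) auto
   also have "... = (\<Sum>u\<in>Ei i `` {v}. (real j * w i {u, v})\<^sup>2)"
    by (rule sum_if_subset[OF fin EV(2)[OF i]])
   also have "... <= (\<Sum>u\<in>Ei i `` {v}. (real j)\<^sup>2 * w i {u, v})"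
   proof (rule sum_mono)
    fix u
    have "(w i {u, v})\<^sup>2 <= w i {u, v}" using w[OF i, of "{u, v}"] by (simp add: power2_eq_square mult_left_le)
    then show "(real j * w i {u, v})\<^sup>2 <= (real j)\<^sup>2 * w i {u, v}" unfolding power_mult_distrib by (intro mult_left_mono) auto
   qed
   also have "... = (real j)\<^sup>2 * D i v" by (simp add: D_def sum_distrib_left)
   also have "... <= S" unfolding S_def using Dpos(2)[OF i v] by (intro mult_left_mono) auto
   finally show "(\<Sum>u\<in>V. (B k u)\<^sup>2) <= S" .
  qed
  have "2 * exp (- 2 * (\<tau> k)\<^sup>2 / S) <= 2 * exp (- 2 * eps\<^sup>2 * b / (real j ^ 4 * (real t)\<^sup>2))" if k: "k \<in> K" for k
  proof -
   obtain i s v where k': "k = (i, s, v)" by (cases k) auto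
   have i: "i < j" and v: "v \<in> Vi i" using k k' by (auto simp: K_def)
   have "(eps * ((b / real j) / real t))\<^sup>2 <= (\<tau> k)\<^sup>2"
    unfolding k' \<tau>_def prod.case using Dpos(1)[OF i v] pos rj by (intro power_mono mult_left_mono divide_right_mono) auto
   then have "2 * (eps * ((b / real j) / real t))\<^sup>2 / S <= 2 * (\<tau> k)\<^sup>2 / S"
    using pos by (intro divide_right_mono) (auto simp: S_def)
   moreover have "2 * (eps * ((b / real j) / real t))\<^sup>2 / S = 2 * eps\<^sup>2 * b / (real j ^ 4 * (real t)\<^sup>2)"
    using pos rj by (simp add: S_def field_simps power2_eq_square numeral_eq_Suc)
   ultimately show ?thesis by simp
  qed
  then have "(\<Sum>k\<in>K. 2 * exp (- 2 * (\<tau> k)\<^sup>2 / S)) <= rcard K * (2 * exp (- 2 * eps\<^sup>2 * b / (real j ^ 4 * (real t)\<^sup>2)))"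
   by (rule sum_bounded_above)
  also have "... <= real j * real t * rcard V * (2 * exp (- 2 * eps\<^sup>2 * b / (real j ^ 4 * (real t)\<^sup>2)))"
  proof (rule mult_right_mono)
   have "card K <= card ({..<j} \<times> {..<t} \<times> V)" unfolding K_def using Vi fin by (intro card_mono) auto
   then have "card K <= j * (t * card V)" by (simp add: card_cartesian_product)
   then have "rcard K <= real (j * (t * card V))" by (simp only: of_nat_le_iff)
   then show "rcard K <= real j * real t * rcard V" by (simp add: mult.assoc)
  qed simp
  finally show "(\<Sum>k\<in>K. 2 * exp (- 2 * (\<tau> k)\<^sup>2 / S)) < 1" using small by linarith
 qed (rule fin)
 then obtain \<phi> where \<phi>: "!!v. v \<in> V ==> \<phi> v \<in> set_pmf (P v)"
  "!!k. k \<in> K ==> \<bar>(\<Sum>v\<in>V. f k v (\<phi> v)) - (\<Sum>v\<in>V. measure_pmf.expectation (P v) (f k v))\<bar> < \<tau> k" by blast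
 define U where "U i s = {u \<in> Vi i. fst (\<phi> u) = s \<and> i \<in> snd (\<phi> u)}" for i s
 show ?thesis
 proof (intro exI[of _ U] conjI allI impI ballI)
  show "U i s \<subseteq> Vi i" for i s by (auto simp: U_def)
  show "U i s \<inter> U i s' = {}" if "s \<noteq> s'" for i s s' using that by (auto simp: U_def)
  show "\<exists>i<j. \<exists>s<t. v \<in> U i s" if v: "v \<in> V" for v
  proof -
   have fs: "fst (\<phi> v) < t" "snd (\<phi> v) \<in> set_pmf (R v)" using \<phi>(1)[OF v] tne by (auto simp: P_def)
   then obtain i where i: "i \<in> snd (\<phi> v)" "i < j" using R[OF v] by blast
   \<comment> \<open>For \<open>v\<close> outside \<open>Vi i\<close> the marginal
     \<open>x i v\<close> is 0, so no set in the support contains \<open>i\<close>.\<close>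
   have "v \<in> Vi i"
   proof (rule ccontr)
    assume "v \<notin> Vi i"
    then have "measure_pmf.prob (R v) {T. i \<in> T} = 0" using R[OF v] i x(2)[of i v] v by auto
    moreover have "pmf (R v) (snd (\<phi> v)) <= measure_pmf.prob (R v) {T. i \<in> T}"
     unfolding measure_pmf_single[symmetric] using i by (intro measure_pmf.finite_measure_mono) auto
    moreover have "0 < pmf (R v) (snd (\<phi> v))" using fs(2) by (simp add: pmf_positive)
    ultimately show False by linarith
   qed
   then show ?thesis using fs(1) i by (intro exI[of _ i] conjI exI[of _ "fst (\<phi> v)"]) (auto simp: U_def)
  qed
  fix i s v assume i: "i < j" and s: "s < t" and v: "v \<in> Vi i"
  have k: "(i, s, v) \<in> K" using i s v by (simp add: K_def)
  have "(\<Sum>u\<in>V. f (i, s, v) u (\<phi> u)) = (\<Sum>u\<in>V. if u \<in> Ei i `` {v} \<inter> U i s then w i {u, v} / x i u else 0)"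
   using EV(1)[OF i] by (intro sum.cong refl) (auto simp: f_def U_def indicator_def mem_Times_iff)
  also have "... = (\<Sum>u\<in>Ei i `` {v} \<inter> U i s. w i {u, v} / x i u)"
   using EV(2)[OF i, of v] by (intro sum_if_subset[OF fin]) blast
  finally have e1: "(\<Sum>u\<in>V. f (i, s, v) u (\<phi> u)) = (\<Sum>u\<in>Ei i `` {v} \<inter> U i s. w i {u, v} / x i u)" .
  have ex: "measure_pmf.expectation (P u) (f (i, s, v) u) = (if u \<in> Ei i `` {v} then w i {u, v} / real t else 0)" if u: "u \<in> V" for u
  proof (cases "u \<in> Ei i `` {v}")
   case True
   then have "u \<in> Vi i" using EV(1)[OF i] by blast
   then have "0 < x i u" by (rule xlo(2)[OF i])
   then show ?thesis using True prob[OF u i s] by (simp add: f_def)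
  next
   case False
   then show ?thesis by (simp add: f_def)
  qed
  have "(\<Sum>u\<in>V. measure_pmf.expectation (P u) (f (i, s, v) u)) = (\<Sum>u\<in>V. if u \<in> Ei i `` {v} then w i {u, v} / real t else 0)"
   using ex by (intro sum.cong) auto
  also have "... = (\<Sum>u\<in>Ei i `` {v}. w i {u, v} / real t)"
   by (rule sum_if_subset[OF fin EV(2)[OF i]])
  also have "... = D i v / real t" by (simp add: D_def sum_divide_distrib)
  finally have e2: "(\<Sum>u\<in>V. measure_pmf.expectation (P u) (f (i, s, v) u)) = D i v / real t" .
  show "\<bar>(\<Sum>u\<in>Ei i `` {v} \<inter> U i s. w i {u, v} / x i u) - (\<Sum>u\<in>Ei i `` {v}. w i {u, v}) / real t\<bar>
    < eps * ((\<Sum>u\<in>Ei i `` {v}. w i {u, v}) / real t)"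
   using \<phi>(2)[OF k] unfolding e1 e2 unfolding \<tau>_def prod.case D_def .
 qed
qed

text \<open>In the symmetric weighting \<open>y v u = w {u, v} / (x u * x v)\<close> every vertex of
  \<open>Vi\<close> has total weight about \<open>b / t\<close> towards every class, because
  dividing by \<open>x v\<close> cancels its individual degree. Two classes thus form an almost
  regular weighted bipartite graph, and double counting yields Hall's condition up to a deficiency
  of \<open>2 * eps\<close> times the class size.\<close>

lemma cluster_cycle:
 fixes w :: "'a set => real" and x :: "'a => real" and eps b q bb :: real
 assumes fin: "finite V" and Vi: "Vi = V - Q" "Vi \<noteq> {}" and QV: "Q \<subseteq> V" and Ei: "Ei \<subseteq> Vi \<times> Vi" "Ei \<subseteq> E" "sym Ei"
  and w: "!!e. 0 <= w e" and d: "!!v. v \<in> Vi ==> 0 < (\<Sum>u\<in>Ei `` {v}. w {u, v})"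
  and x: "!!v. v \<in> Vi ==> x v = (\<Sum>u\<in>Ei `` {v}. w {u, v}) / b" and pos: "0 < b" "0 < eps" "eps <= 1/2" "2 <= t"
  and U: "!!s. s < t ==> U s \<subseteq> Vi" "!!s s'. s < t ==> s' < t ==> s \<noteq> s' ==> U s \<inter> U s' = {}"
  and reg: "!!s v. s < t ==> v \<in> Vi ==> \<bar>(\<Sum>u\<in>Ei `` {v} \<inter> U s. w {u, v} / x u) - (\<Sum>u\<in>Ei `` {v}. w {u, v}) / real t\<bar>
    < eps * ((\<Sum>u\<in>Ei `` {v}. w {u, v}) / real t)"
  and con: "connector V E Q q bb" and q: "rcard V * (1 / real t + 2 * eps) + real t <= q"
 shows "\<exists>C. cycle_list E C \<and> (\<Union>s<t. U s) \<subseteq> set C \<and> set C \<subseteq> V"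
proof -
 define D where "D v = (\<Sum>u\<in>Ei `` {v}. w {u, v})" for v
 define y where "y v u = w {u, v} / (x u * x v)" for v u
 have finVi: "finite Vi" using Vi fin by simp
 have t0: "0 < real t" "0 < t" using pos by auto
 have EV: "Ei `` {v} \<subseteq> Vi" "finite (Ei `` {v})" for v using Ei(1) finite_subset[OF _ finVi, of "Ei `` {v}"] by auto
 have D0: "0 < D v" if "v \<in> Vi" for v using d[OF that] by (simp add: D_def)
 have x0: "0 < x v" "x v = D v / b" if "v \<in> Vi" for v using D0[OF that] x[OF that] pos by (auto simp: D_def)
 have ysym: "y v u = y u v" for u v by (simp add: y_def insert_commute mult.commute)
 have finU: "finite (U s)" if "s < t" for s using U(1)[OF that] finVi finite_subset by blast
 have Y: "(1 - eps) * (b / real t) <= (\<Sum>u\<in>Ei `` {v} \<inter> U s. y v u) \<and> (\<Sum>u\<in>Ei `` {v} \<inter> U s. y v u) <= (1 + eps) * (b / real t)"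
  if s: "s < t" and v: "v \<in> Vi" for s v
 proof -
  let ?A = "\<Sum>u\<in>Ei `` {v} \<inter> U s. w {u, v} / x u"
  have "(\<Sum>u\<in>Ei `` {v} \<inter> U s. y v u) = ?A / x v" by (simp add: y_def sum_divide_distrib)
  moreover have a: "(1 - eps) * (D v / real t) <= ?A" "?A <= (1 + eps) * (D v / real t)"
   using reg[OF s v] unfolding D_def[symmetric] by (simp_all only: abs_less_iff left_diff_distrib distrib_right mult_1) linarith+
  note divide_right_mono[OF a(1) less_imp_le[OF x0(1)[OF v]]] divide_right_mono[OF a(2) less_imp_le[OF x0(1)[OF v]]]
  moreover have "a * (D v / real t) / x v = a * (b / real t)" for a using D0[OF v] pos by (simp add: x0(2)[OF v])
  ultimately show ?thesis by simp
 qed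
 have ne: "U s \<noteq> {}" if s: "s < t" for s
 proof
  assume "U s = {}"
  moreover obtain v where v: "v \<in> Vi" using Vi(2) by blast
  ultimately have "(1 - eps) * (b / real t) <= 0" using Y[OF s v] by simp
  moreover have "0 < (1 - eps) * (b / real t)" using pos t0 by simp
  ultimately show False by linarith
 qed
 define dd where "dd A = nat \<lceil>2 * eps * rcard A\<rceil>" for A :: "'a set"
 have match: "\<exists>M f. M \<subseteq> U s' \<and> card (U s') <= card M + dd (U s') \<and> inj_on f M \<and> (\<forall>z\<in>M. f z \<in> U s \<and> (f z, z) \<in> E)"
  if s: "s < t" and s': "s' < t" for s s'
 proof -
  have "\<exists>M f. M \<subseteq> U s' \<and> card (U s') <= card M + dd (U s') \<and> inj_on f M \<and> (\<forall>z\<in>M. f z \<in> Ei `` {z} \<inter> U s)"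
  proof (rule hall_deficiency[OF finU[OF s']])
   show "finite (Ei `` {z} \<inter> U s)" for z using EV(2) by blast
   fix S assume S: "S \<subseteq> U s'"
   define N where "N = (\<Union>z\<in>S. Ei `` {z} \<inter> U s)"
   have finS: "finite S" using S finU[OF s'] finite_subset by blast
   have finN: "finite N" unfolding N_def using finS EV(2) by auto
   have SV: "S \<subseteq> Vi" "N \<subseteq> Vi" using S U(1)[OF s'] U(1)[OF s] by (auto simp: N_def)
   have "((1 - eps) * (b / real t)) * rcard S <= (\<Sum>z\<in>S. \<Sum>u\<in>Ei `` {z} \<inter> U s. y z u)"
    using sum_bounded_below[of S "(1 - eps) * (b / real t)" "\<lambda>z. \<Sum>u\<in>Ei `` {z} \<inter> U s. y z u"] Y[OF s] SV(1) by (auto simp: mult.commute)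
   also have "... = (\<Sum>z\<in>S. \<Sum>u\<in>{u \<in> N. (z, u) \<in> Ei}. y z u)"
    by (intro sum.cong refl) (auto simp: N_def)
   also have "... = (\<Sum>u\<in>N. \<Sum>z\<in>{z \<in> S. (z, u) \<in> Ei}. y z u)" using finS finN by (intro sum.swap_restrict)
   also have "... <= (\<Sum>u\<in>N. (1 + eps) * (b / real t))"
   proof (rule sum_mono)
    fix u assume u: "u \<in> N"
    have "(\<Sum>z\<in>{z \<in> S. (z, u) \<in> Ei}. y z u) <= (\<Sum>z\<in>Ei `` {u} \<inter> U s'. y z u)"
    proof (rule sum_mono2)
     show "{z \<in> S. (z, u) \<in> Ei} \<subseteq> Ei `` {u} \<inter> U s'" using S Ei(3) by (auto dest: symD)
     show "0 <= y z u" if z: "z \<in> Ei `` {u} \<inter> U s' - {z \<in> S. (z, u) \<in> Ei}" for z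
     proof -
      have "z \<in> Vi" using z EV(1)[of u] by blast
      moreover have "u \<in> Vi" using u SV(2) by blast
      ultimately have "0 < x u * x z" using x0(1) by simp
      then show ?thesis unfolding y_def using w by simp
     qed
    qed (use EV(2) in auto)
    also have "... = (\<Sum>z\<in>Ei `` {u} \<inter> U s'. y u z)" by (simp add: ysym)
    also have "... <= (1 + eps) * (b / real t)" using Y[OF s'] u SV(2) by blast
    finally show "(\<Sum>z\<in>{z \<in> S. (z, u) \<in> Ei}. y z u) <= (1 + eps) * (b / real t)" .
   qed
   also have "... = ((1 + eps) * (b / real t)) * rcard N" by simp
   finally have "((1 - eps) * rcard S) * (b / real t) <= ((1 + eps) * rcard N) * (b / real t)" by (simp add: mult_ac)
   moreover have "0 < b / real t" using pos t0 by simp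
   ultimately have k: "(1 - eps) * rcard S <= (1 + eps) * rcard N" by (rule mult_right_le_imp_le)
   show "card S <= card (\<Union>z\<in>S. Ei `` {z} \<inter> U s) + dd (U s')"
   proof (cases "card S <= card N")
    case True
    then show ?thesis by (simp add: N_def)
   next
    case False
    then have "eps * rcard N <= eps * rcard S" using pos by (intro mult_left_mono) auto
    then have "rcard S <= rcard N + 2 * (eps * rcard S)" using k by (simp add: left_diff_distrib distrib_right)
    moreover have "card S <= card (U s')" using S finU[OF s'] by (rule card_mono[rotated])
    then have "eps * rcard S <= eps * rcard (U s')" using pos by (intro mult_left_mono) auto
    moreover have "2 * eps * rcard (U s') <= real (dd (U s'))" unfolding dd_def by linarith
    ultimately have "rcard S <= rcard N + real (dd (U s'))" by linarith
    then show ?thesis unfolding N_def by linarith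
   qed
  qed
  then obtain M f where Mf: "M \<subseteq> U s' \<and> card (U s') <= card M + dd (U s') \<and> inj_on f M \<and> (\<forall>z\<in>M. f z \<in> Ei `` {z} \<inter> U s)"
   by (elim exE) (rule that; assumption)
  have "(f z, z) \<in> E" if "z \<in> M" for z
  proof -
   have "(z, f z) \<in> Ei" using Mf that by blast
   then show ?thesis using Ei(2,3) by (blast dest: symD)
  qed
  then show ?thesis using Mf by (intro exI[of _ M] exI[of _ f]) blast
 qed
 have sumU: "(\<Sum>s<t. card (U s)) <= card Vi"
 proof -
  have "(\<Sum>s<t. card (U s)) = card (\<Union>s<t. U s)" using finU U(2) by (subst card_UN_disjoint) auto
  also have "... <= card Vi" using finVi U(1) by (intro card_mono) auto
  finally show ?thesis .
 qed
 have sumUr: "(\<Sum>s<t. rcard (U s)) <= rcard Vi" using sumU by (simp flip: of_nat_sum)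
 \<comment> \<open>The initial class contributes one path per vertex, so a class of at most average
   size is put first; \<sigma> exchanges it with class 0.\<close>
 obtain s0 where s0: "s0 < t" "rcard (U s0) <= rcard Vi / real t"
 proof -
  have "\<exists>s0<t. rcard (U s0) <= rcard Vi / real t"
  proof (rule ccontr)
   assume "\<not> ?thesis"
   then have "(\<Sum>s<t. rcard Vi / real t) < (\<Sum>s<t. rcard (U s))" using t0 by (intro sum_strict_mono) auto
   then show False using sumUr t0 by simp
  qed
  then show thesis using that by blast
 qed
 define \<sigma> where "\<sigma> s = (if s = 0 then s0 else if s = s0 then 0 else s)" for s
 have \<sigma>t: "\<sigma> s < t" if "s < t" for s using that s0 t0 by (auto simp: \<sigma>_def)
 have \<sigma>inj: "\<sigma> s \<noteq> \<sigma> s'" if "s \<noteq> s'" for s s' using that by (auto simp: \<sigma>_def split: if_splits)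
 have \<sigma>\<sigma>: "\<sigma> (\<sigma> s) = s" for s by (auto simp: \<sigma>_def)
 obtain t' where t': "t = Suc t'" using t0 by (cases t) auto
 have "\<exists>PS. path_family E PS (\<Union>s\<le>t'. U (\<sigma> s)) (U (\<sigma> t')) \<and> length PS <= card (U (\<sigma> 0)) + (\<Sum>s<t'. dd (U (\<sigma> (Suc s))))"
 proof (rule matching_paths)
  show "finite (U (\<sigma> s))" if "s <= t'" for s using that finU \<sigma>t t' by auto
  show "U (\<sigma> s) \<inter> U (\<sigma> s') = {}" if "s <= t'" "s' <= t'" "s \<noteq> s'" for s s' using that \<sigma>inj \<sigma>t t' by (intro U(2)) auto
  show "\<exists>M f. M \<subseteq> U (\<sigma> (Suc s)) \<and> card (U (\<sigma> (Suc s))) <= card M + dd (U (\<sigma> (Suc s))) \<and> inj_on f M \<and> (\<forall>x\<in>M. f x \<in> U (\<sigma> s) \<and> (f x, x) \<in> E)"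
   if "s < t'" for s using that \<sigma>t t' by (intro match) auto
 qed
 then obtain PS where PS: "path_family E PS (\<Union>s\<le>t'. U (\<sigma> s)) (U (\<sigma> t'))" "length PS <= card (U (\<sigma> 0)) + (\<Sum>s<t'. dd (U (\<sigma> (Suc s))))"
  by blast
 have \<sigma>im: "\<sigma> ` {..<t} = {..<t}"
 proof
  show "\<sigma> ` {..<t} \<subseteq> {..<t}" using \<sigma>t by auto
  show "{..<t} \<subseteq> \<sigma> ` {..<t}"
  proof
   fix s assume "s \<in> {..<t}"
   then show "s \<in> \<sigma> ` {..<t}" using \<sigma>t[of s] \<sigma>\<sigma>[of s] by (intro image_eqI[of _ _ "\<sigma> s"]) auto
  qed
 qed
 have un: "(\<Union>s\<le>t'. U (\<sigma> s)) = (\<Union>s<t. U s)"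
 proof -
  have "(\<Union>s\<le>t'. U (\<sigma> s)) = (\<Union>s\<in>\<sigma> ` {..<t}. U s)" by (simp add: t' lessThan_Suc_atMost)
  then show ?thesis unfolding \<sigma>im .
 qed
 have sub: "(\<Union>s<t. U s) \<subseteq> Vi" using U(1) by blast
 have "\<exists>C. cycle_list E C \<and> (\<Union>s<t. U s) \<subseteq> set C \<and> set C \<subseteq> (\<Union>s<t. U s) \<union> Q"
 proof (rule close_paths[OF con PS(1)[unfolded un]])
  show "(\<Union>s<t. U s) \<subseteq> V - Q" using sub Vi by simp
  show fU: "finite (\<Union>s<t. U s)" using finU by auto
  have "card (U 0 \<union> U 1) <= card (\<Union>s<t. U s)" using fU UN_upper[of 0 "{..<t}" U] UN_upper[of 1 "{..<t}" U] pos by (intro card_mono Un_least) auto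
  moreover have "card (U 0 \<union> U 1) = card (U 0) + card (U 1)" using finU U(2)[of 0 1] pos by (intro card_Un_disjoint) auto
  moreover have "0 < card (U 0)" "0 < card (U 1)" using ne finU pos by (auto simp: card_gt_0_iff)
  ultimately show "2 <= card (\<Union>s<t. U s)" by linarith
  have "real (length PS) <= rcard (U (\<sigma> 0)) + (\<Sum>s<t'. real (dd (U (\<sigma> (Suc s)))))"
   using PS(2) by (simp flip: of_nat_sum of_nat_add)
  also have "rcard (U (\<sigma> 0)) <= rcard Vi / real t" using s0 by (simp add: \<sigma>_def)
  also have "(\<Sum>s<t'. real (dd (U (\<sigma> (Suc s))))) <= (\<Sum>s<t'. 2 * eps * rcard (U (\<sigma> (Suc s))) + 1)"
  proof (rule sum_mono)
   fix s
   have "0 <= 2 * eps * rcard (U (\<sigma> (Suc s)))" using pos by simp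
   then show "real (dd (U (\<sigma> (Suc s)))) <= 2 * eps * rcard (U (\<sigma> (Suc s))) + 1" unfolding dd_def by linarith
  qed
  also have "... = 2 * eps * (\<Sum>s<t'. rcard (U (\<sigma> (Suc s)))) + real t'" by (simp add: sum.distrib sum_distrib_left)
  also have "(\<Sum>s<t'. rcard (U (\<sigma> (Suc s)))) <= rcard Vi"
  proof -
   have "(\<Sum>s<t'. rcard (U (\<sigma> (Suc s)))) <= (\<Sum>s<t. rcard (U (\<sigma> s)))" 
   proof -
    have "(\<Sum>s<Suc t'. rcard (U (\<sigma> s))) = rcard (U (\<sigma> 0)) + (\<Sum>s<t'. rcard (U (\<sigma> (Suc s))))" by (rule sum.lessThan_Suc_shift)
    then show ?thesis unfolding t' by simp
   qed
   also have "... = (\<Sum>s\<in>\<sigma> ` {..<t}. rcard (U s))"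
    by (subst sum.reindex) (auto intro!: inj_onI dest: \<sigma>inj)
   also have "... <= rcard Vi" unfolding \<sigma>im by (rule sumUr)
   finally show ?thesis .
  qed
  finally have "real (length PS) <= rcard Vi / real t + (2 * eps * rcard Vi + real t')" using pos by (simp add: mult_left_mono)
  also have "... <= rcard V / real t + (2 * eps * rcard V + real t)"
  proof -
   have "rcard Vi <= rcard V" using Vi fin by (auto intro: card_mono)
   then have "rcard Vi / real t <= rcard V / real t" "2 * eps * rcard Vi <= 2 * eps * rcard V"
    using t0 pos by (auto intro: divide_right_mono mult_left_mono)
   then show ?thesis using t' by simp
  qed
  also have "... = rcard V * (1 / real t + 2 * eps) + real t" by (simp add: algebra_simps)
  finally show "real (length PS) <= q" using q by linarith
 qed
 then obtain C where C: "cycle_list E C \<and> (\<Union>s<t. U s) \<subseteq> set C \<and> set C \<subseteq> (\<Union>s<t. U s) \<union> Q"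
  by (elim exE) (rule that; assumption)
 have "(\<Union>s<t. U s) \<union> Q \<subseteq> V" using sub QV unfolding Vi(1) by (intro Un_least) (rule subset_trans, assumption, rule Diff_subset)
 then have "set C \<subseteq> V" using C by (meson subset_trans)
 with C show ?thesis by (intro exI[of _ C]) simp
qed

section \<open>The weighting condition and the parameters of the cover\<close>

text \<open>In a violating pair almost all edges at \<open>S\<close> go to \<open>T\<close>, which
  is no larger than \<open>S\<close>. Sparseness then gives \<open>T\<close> at least
  \<open>c n / 4\<close> vertices, so \<open>S\<close> is linear too and its exceptional vertices
  are negligible; the typical degrees raise \<open>T\<close> to at least
  \<open>(\<gamma> + \<alpha> / 4) * n\<close>. Since the violation also makes \<open>S\<close>
  nearly \<open>j\<close> times as large as \<open>T\<close>, both together exceed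
  \<open>(j + 1) * \<gamma> * n\<close>.\<close>

lemma star_condition:
 fixes n p \<beta> b c \<gamma> \<alpha> eps :: real
 assumes sp: "sparse_rel p \<beta> V E" and V': "V' \<subseteq> V" "finite V" and E': "E' \<subseteq> E" "E' \<subseteq> V' \<times> V'" and j: "1 <= j"
  and pos: "0 < n" "0 < p" "0 < \<beta>" "0 < b" "0 < c" "0 < \<gamma>" "0 < \<alpha>"
  and card: "rcard V' <= (real j + 1) * \<gamma> * n" and \<Phi>: "rcard \<Phi> <= \<alpha> / 4 * n" "finite \<Phi>"
  and X: "rcard X <= c * \<alpha> / (32 * (\<gamma> + \<alpha>)) * n" "finite X"
  and deg: "!!v. v \<in> V' ==> c / 2 * n * p <= deg E' v" "!!v. v \<in> V' - X ==> (\<gamma> + \<alpha> / 2) * n * p <= deg E' v"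
  and b: "b <= c / 8 * n * p" "b <= \<alpha> / 16 * n * p" and \<beta>: "\<beta> <= c / 8 * n * p" "\<beta> <= \<alpha> / 16 * n * p"
  and S: "S \<subseteq> V'" "T \<subseteq> V'" "S \<inter> T = {}" "S \<noteq> {}"
 shows "sum (\<lambda>v. if v \<in> \<Phi> then b else b / real j) S <= ecount E' S (V' - T) + b * rcard T"
proof (rule ccontr)
 assume "\<not> ?thesis"
 then have neg: "ecount E' S (V' - T) + b * rcard T < sum (\<lambda>v. if v \<in> \<Phi> then b else b / real j) S" by simp
 define \<sigma> where "\<sigma> = rcard S"
 define \<tau> where "\<tau> = rcard T"
 have fin': "finite V'" "finite S" "finite T" using V' S finite_subset by metis+
 have \<sigma>0: "0 < \<sigma>" using S(4) fin' by (simp add: \<sigma>_def card_gt_0_iff)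
 have bj: "b / real j <= b" using pos j by (simp add: divide_le_eq)
 have l1: "sum (\<lambda>v. if v \<in> \<Phi> then b else b / real j) S <= b * \<sigma>"
  using sum_bounded_above[of S "\<lambda>v. if v \<in> \<Phi> then b else b / real j" b] bj by (simp add: \<sigma>_def mult.commute)
 have l2: "sum (\<lambda>v. if v \<in> \<Phi> then b else b / real j) S <= b / real j * \<sigma> + b * rcard \<Phi>"
 proof -
  have "sum (\<lambda>v. if v \<in> \<Phi> then b else b / real j) S <= (\<Sum>v\<in>S. b / real j + (if v \<in> \<Phi> then b else 0))"
   using pos by (intro sum_mono) auto
  also have "... = b / real j * \<sigma> + b * rcard (S \<inter> \<Phi>)" using fin' by (simp add: sum.distrib sum.If_cases \<sigma>_def Int_def mult.commute)
  also have "... <= b / real j * \<sigma> + b * rcard \<Phi>" using pos \<Phi>(2) by (auto intro!: mult_left_mono card_mono)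
  finally show ?thesis .
 qed
 have e0: "0 <= ecount E' S (V' - T)" by (rule ecount_nonneg)
 have b\<tau>: "0 <= b * \<tau>" using pos by (simp add: \<tau>_def)
 have eS: "ecount E' S (V' - T) <= b * \<sigma>" using neg l1 b\<tau> unfolding \<tau>_def by linarith
 have "b * \<tau> <= b * \<sigma>" using neg l1 e0 unfolding \<tau>_def by linarith
 then have \<tau>\<sigma>: "\<tau> <= \<sigma>" using pos by simp
 have eT: "ecount E' S T <= p * \<sigma> * \<tau> + \<beta> * \<sigma>"
 proof -
  have "ecount E' S T <= ecount E S T" unfolding ecount_def using E'(1) fin' by (intro sum_mono) (auto intro!: card_mono)
  also have "... <= p * \<sigma> * \<tau> + \<beta> * sqrt (\<sigma> * \<tau>)" unfolding \<sigma>_def \<tau>_def using S V' by (intro sparse_relD[OF sp]) auto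
  also have "sqrt (\<sigma> * \<tau>) <= sqrt (\<sigma> * \<sigma>)" using \<tau>\<sigma> \<sigma>0 by (intro real_sqrt_le_mono mult_left_mono) auto
  then have "\<beta> * sqrt (\<sigma> * \<tau>) <= \<beta> * \<sigma>" using pos \<sigma>0 by simp
  finally show ?thesis by simp
 qed
 have split: "ecount E' S T + ecount E' S (V' - T) = (\<Sum>v\<in>S. deg E' v)"
 proof -
  have "ecount E' S (T \<union> (V' - T)) = ecount E' S T + ecount E' S (V' - T)" using fin' by (intro ecount_union_right) auto
  moreover have "E' `` {v} \<inter> (T \<union> (V' - T)) = E' `` {v}" for v using E'(2) by blast
  ultimately show ?thesis by (simp add: ecount_def)
 qed
 have main: "(\<Sum>v\<in>S. deg E' v) <= p * \<sigma> * \<tau> + \<beta> * \<sigma> + b * \<sigma>" using split eT eS by linarith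
 have \<tau>1: "c / 4 * n <= \<tau>"
 proof -
  have "c / 2 * n * p * \<sigma> <= (\<Sum>v\<in>S. deg E' v)"
   using sum_bounded_below[of S "c / 2 * n * p" "\<lambda>v. deg E' v"] deg(1) S by (auto simp: \<sigma>_def mult.commute)
  then have "(c / 2 * n * p) * \<sigma> <= (p * \<tau> + \<beta> + b) * \<sigma>" using main by (simp add: algebra_simps)
  then have "c / 2 * n * p <= p * \<tau> + \<beta> + b" using \<sigma>0 by (rule mult_right_le_imp_le)
  moreover have "c / 2 * n * p = c / 8 * n * p + c / 8 * n * p + (c / 4 * n) * p" by (simp add: algebra_simps)
  ultimately have "(c / 4 * n) * p <= \<tau> * p" using b(1) \<beta>(1) by (simp add: mult.commute)
  then show ?thesis using pos(2) by (rule mult_right_le_imp_le)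
 qed
 \<comment> \<open>The step from \<alpha> / 2 down to \<alpha> / 4 in \<open>\<tau>2\<close> is
   spent on exceptional vertices, costing \<alpha> / 8, and on \<open>b\<close> and \<beta>, costing
   \<alpha> / 16 each; \<delta> is the fraction of \<open>S\<close> that the first amount pays
   for.\<close>
 define \<delta> where "\<delta> = \<alpha> / 8 / (\<gamma> + \<alpha>)"
 have ga: "0 < \<gamma> + \<alpha>" using pos by simp
 have \<delta>: "0 < \<delta>" "(\<gamma> + \<alpha>) * \<delta> = \<alpha> / 8" 
 proof -
  show "0 < \<delta>" using pos ga unfolding \<delta>_def by (intro divide_pos_pos) auto
  have "s * (\<alpha> / 8 / s) = \<alpha> / 8" if "0 < s" for s :: real using that by simp
  from this[OF ga] show "(\<gamma> + \<alpha>) * \<delta> = \<alpha> / 8" unfolding \<delta>_def .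
 qed
 have X\<sigma>: "rcard X <= \<delta> * \<sigma>"
 proof -
  have "c * \<alpha> / (32 * s) * n = \<alpha> / 8 / s * (c / 4 * n)" for s :: real by simp
  from this[of "\<gamma> + \<alpha>"] have "c * \<alpha> / (32 * (\<gamma> + \<alpha>)) * n = \<delta> * (c / 4 * n)" unfolding \<delta>_def .
  also have "... <= \<delta> * \<sigma>" using \<tau>1 \<tau>\<sigma> \<delta> by (intro mult_left_mono) auto
  finally show ?thesis using X(1) by linarith
 qed
 have \<tau>2: "(\<gamma> + \<alpha> / 4) * n <= \<tau>"
 proof -
  let ?D = "(\<gamma> + \<alpha> / 2) * n * p"
  have D0: "0 <= ?D" using pos by simp
  have "\<sigma> - rcard X <= rcard (S - X)"
   using diff_card_le_card_Diff[OF X(2), of S] by (simp add: \<sigma>_def)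
  then have "\<sigma> - \<delta> * \<sigma> <= rcard (S - X)" using X\<sigma> by linarith
  then have "?D * (\<sigma> - \<delta> * \<sigma>) <= ?D * rcard (S - X)" using D0 by (intro mult_left_mono)
  also have "... <= (\<Sum>v\<in>S - X. deg E' v)"
   using sum_bounded_below[of "S - X" ?D "\<lambda>v. deg E' v"] deg(2) S by (auto simp: mult.commute)
  also have "... <= (\<Sum>v\<in>S. deg E' v)" using fin' by (intro sum_mono2) auto
  finally have "(?D * (1 - \<delta>)) * \<sigma> <= (p * \<tau> + \<beta> + b) * \<sigma>" using main by (simp add: algebra_simps)
  then have "?D * (1 - \<delta>) <= p * \<tau> + \<beta> + b" using \<sigma>0 by (rule mult_right_le_imp_le)
  moreover have "((\<gamma> + \<alpha> / 4) * n) * p + \<alpha> / 16 * n * p + \<alpha> / 16 * n * p <= ?D * (1 - \<delta>)"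
  proof -
   have "(\<gamma> + \<alpha> / 2) * \<delta> <= (\<gamma> + \<alpha>) * \<delta>" using \<delta>(1) pos by (intro mult_right_mono) auto
   then have "\<gamma> + \<alpha> / 4 + \<alpha> / 16 + \<alpha> / 16 <= (\<gamma> + \<alpha> / 2) * (1 - \<delta>)" unfolding \<delta>(2) by (simp add: right_diff_distrib)
   then have "(\<gamma> + \<alpha> / 4 + \<alpha> / 16 + \<alpha> / 16) * (n * p) <= (\<gamma> + \<alpha> / 2) * (1 - \<delta>) * (n * p)" using pos by (intro mult_right_mono) auto
   then show ?thesis by (simp add: algebra_simps)
  qed
  ultimately have "((\<gamma> + \<alpha> / 4) * n) * p <= \<tau> * p" using b(2) \<beta>(2) mult.commute[of p \<tau>] by linarith
  then show ?thesis using pos(2) by (rule mult_right_le_imp_le)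
 qed
 have "\<sigma> + \<tau> <= (real j + 1) * \<gamma> * n"
 proof -
  have "card S + card T = card (S \<union> T)" using fin' S by (intro card_Un_disjoint[symmetric]) auto
  also have "... <= card V'" using fin' S by (intro card_mono) auto
  finally have "\<sigma> + \<tau> <= rcard V'" by (simp add: \<sigma>_def \<tau>_def flip: of_nat_add)
  then show ?thesis using card by linarith
 qed
 moreover have "real j * \<tau> < \<sigma> + real j * (\<alpha> / 4 * n)"
 proof -
  have "b * \<tau> < b / real j * \<sigma> + b * rcard \<Phi>" using neg l2 e0 unfolding \<tau>_def by linarith
  also have "... <= b / real j * \<sigma> + b * (\<alpha> / 4 * n)" using \<Phi>(1) pos by (intro add_left_mono mult_left_mono) auto
  also have "... = b * (\<sigma> / real j + \<alpha> / 4 * n)" by (simp add: algebra_simps)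
  finally have "\<tau> < \<sigma> / real j + \<alpha> / 4 * n" using pos by simp
  then have "real j * \<tau> < real j * (\<sigma> / real j + \<alpha> / 4 * n)" using j by (intro mult_strict_left_mono) auto
  then show ?thesis using j by (simp add: distrib_left)
 qed
 ultimately have "(real j + 1) * \<tau> < (real j + 1) * \<gamma> * n + real j * (\<alpha> / 4 * n)" by (simp add: distrib_right)
 also have "... <= (real j + 1) * ((\<gamma> + \<alpha> / 4) * n)"
 proof -
  have "0 <= \<alpha> / 4 * n" using pos by simp
  then show ?thesis by (simp add: algebra_simps)
 qed
 also have "... <= (real j + 1) * \<tau>" using \<tau>2 by (intro mult_left_mono) auto
 finally show False by simp
qed

text \<open>Cycle 0 closes through \<open>R1\<close> and all others through \<open>R2\<close>, which
  they may share because the cycles need not be disjoint. The lower bound \<open>b\<close> on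
  \<open>\<Phi> i\<close> gives \<open>x 0 = 1\<close> on \<open>R2\<close> and
  \<open>x 1 = 1\<close> on \<open>R1\<close>; outside both reserves each of the \<open>j\<close>
  cycles contributes at least \<open>1 / j\<close>. So the marginals sum to at least 1
  everywhere.\<close>

lemma cover_fixed:
 fixes n p \<beta> b c \<gamma> \<alpha> eps \<delta> q bb :: real
 assumes sp: "sparse_rel p \<beta> V E" and EV: "E \<subseteq> V \<times> V" and symE: "sym E" and irr: "irrefl E" and fin: "finite V" "V \<noteq> {}" and j: "2 <= j"
  and pos: "0 < n" "0 < p" "0 < \<beta>" "0 < b" "0 < c" "0 < \<gamma>" "0 < \<alpha>"
  and card: "rcard V <= (real j + 1) * \<gamma> * n"
  and R: "R1 \<subseteq> V" "R2 \<subseteq> V" "R1 \<inter> R2 = {}" "rcard R1 <= \<alpha> / 4 * n" "rcard R2 <= \<alpha> / 4 * n"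
   "!!v. v \<in> V ==> deg_in E v R1 <= \<delta> * deg E v"
   "!!v. v \<in> V ==> deg_in E v R2 <= \<delta> * deg E v"
  and \<delta>: "\<delta> <= 1/2" "\<delta> * (\<gamma> + \<alpha>) <= \<alpha> / 2"
  and X: "X \<subseteq> V" "rcard X <= c * \<alpha> / (32 * (\<gamma> + \<alpha>)) * n"
  and deg: "!!v. v \<in> V ==> c * n * p <= deg E v" "!!v. v \<in> V - X ==> (\<gamma> + \<alpha>) * n * p <= deg E v"
  and b: "b <= c / 8 * n * p" "b <= \<alpha> / 16 * n * p" and \<beta>: "\<beta> <= c / 8 * n * p" "\<beta> <= \<alpha> / 16 * n * p"
  and con: "connector V E R1 q bb" "connector V E R2 q bb" and t: "2 <= t" and eps: "0 < eps" "eps <= 1/2"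
  and q: "rcard V * (1 / real t + 2 * eps) + real t <= q"
  and small: "real j * real t * rcard V * (2 * exp (- 2 * eps\<^sup>2 * b / (real j ^ 4 * (real t)\<^sup>2))) < 1"
 shows "cycle_cover j V E"
proof -
 define Q where "Q i = (if i = 0 then R1 else R2)" for i :: nat
 define \<Phi> where "\<Phi> i = (if i = 0 then R2 else R1)" for i :: nat
 define Vi where "Vi i = V - Q i" for i
 define Ei where "Ei i = E \<inter> Vi i \<times> Vi i" for i
 have QV: "Q i \<subseteq> V" for i using R by (simp add: Q_def)
 have EiE: "Ei i \<subseteq> E" "Ei i \<subseteq> Vi i \<times> Vi i" "Vi i \<subseteq> V" for i by (auto simp: Ei_def Vi_def)
 have symi: "sym (Ei i)" for i using symE by (auto simp: Ei_def sym_def)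
 have irri: "irrefl (Ei i)" for i using irr by (auto simp: Ei_def irrefl_def)
 have EvV: "E `` {v} \<subseteq> V" "finite (E `` {v})" for v using EV fin finite_subset[of "E `` {v}" V] by auto
 have di: "(1 - \<delta>) * deg E v <= deg (Ei i) v" if v: "v \<in> Vi i" for i v
 proof -
  have "E `` {v} \<subseteq> Ei i `` {v} \<union> (E `` {v} \<inter> Q i)" using EvV(1)[of v] v by (auto simp: Ei_def Vi_def)
  moreover have "Ei i `` {v} \<subseteq> E `` {v}" using EiE(1)[of i] by blast
  then have "finite (Ei i `` {v})" using EvV(2)[of v] by (rule finite_subset)
  ultimately have "card (E `` {v}) <= card (Ei i `` {v} \<union> (E `` {v} \<inter> Q i))" using EvV by (intro card_mono) auto
  also have "... <= card (Ei i `` {v}) + card (E `` {v} \<inter> Q i)" by (rule card_Un_le)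
  finally have "deg E v <= deg (Ei i) v + deg_in E v (Q i)" by linarith
  moreover have "deg_in E v (Q i) <= \<delta> * deg E v" using R(6,7) v by (simp add: Q_def Vi_def)
  ultimately show ?thesis by (simp add: left_diff_distrib)
 qed
 have d1: "c / 2 * n * p <= deg (Ei i) v" if v: "v \<in> Vi i" for i v
 proof -
  have "1/2 * (c * n * p) <= (1 - \<delta>) * deg E v" using \<delta> deg(1)[of v] v pos by (intro mult_mono) (auto simp: Vi_def)
  then show ?thesis using di[OF v] by simp
 qed
 have d2: "(\<gamma> + \<alpha> / 2) * n * p <= deg (Ei i) v" if v: "v \<in> Vi i - X" for i v
 proof -
  have "\<gamma> + \<alpha> / 2 <= (1 - \<delta>) * (\<gamma> + \<alpha>)" using \<delta>(2) by (simp add: left_diff_distrib)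
  then have "(\<gamma> + \<alpha> / 2) * (n * p) <= (1 - \<delta>) * (\<gamma> + \<alpha>) * (n * p)" using pos by (intro mult_right_mono) auto
  also have "... = (1 - \<delta>) * ((\<gamma> + \<alpha>) * n * p)" by (simp add: mult_ac)
  also have "... <= (1 - \<delta>) * deg E v" using \<delta> deg(2)[of v] v by (intro mult_left_mono) (auto simp: Vi_def)
  finally show ?thesis using di[of v i] v by (simp add: mult.assoc)
 qed
 define l where "l i v = (if v \<in> \<Phi> i then b else b / real j)" for i v
 have jb: "b / real j <= b" "0 < b / real j" using pos j by (auto simp: divide_le_eq)
 have "\<exists>g :: 'a set => real. (\<forall>e. 0 <= g e \<and> g e <= 1) \<and>
  (\<forall>v\<in>Vi i. l i v <= (\<Sum>u\<in>Ei i `` {v}. g {u, v}) \<and> (\<Sum>u\<in>Ei i `` {v}. g {u, v}) <= b)" for i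
 proof (rule fractional_factor)
  show "finite (Vi i)" using fin by (simp add: Vi_def)
  show "Ei i \<subseteq> Vi i \<times> Vi i" "sym (Ei i)" "irrefl (Ei i)" using EiE symi irri by auto
  show "l i v <= b" for v using jb by (simp add: l_def)
  show "0 <= b" using pos by simp
  fix S T assume ST: "S \<subseteq> Vi i" "T \<subseteq> Vi i" "S \<inter> T = {}" "S \<noteq> {}"
  show "sum (l i) S <= ecount (Ei i) S (Vi i - T) + b * rcard T"
   unfolding l_def
  proof (rule star_condition[OF sp EiE(3) fin(1) EiE(1,2) _ pos _ _ _ X(2) _ d1 d2 b \<beta> ST])
   show "1 <= j" using j by simp
   have "card (Vi i) <= card V" using fin EiE(3) by (intro card_mono)
   then show "rcard (Vi i) <= (real j + 1) * \<gamma> * n" using card by linarith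
   show "rcard (\<Phi> i) <= \<alpha> / 4 * n" using R(4,5) by (simp add: \<Phi>_def)
   show "finite (\<Phi> i)" using finite_subset[OF R(1) fin(1)] finite_subset[OF R(2) fin(1)] by (simp add: \<Phi>_def)
   show "finite X" by (rule finite_subset[OF X(1) fin(1)])
  qed
 qed
 then obtain w :: "nat => 'a set => real" where w: "!!i e. 0 <= w i e \<and> w i e <= 1"
  "!!i v. v \<in> Vi i ==> l i v <= (\<Sum>u\<in>Ei i `` {v}. w i {u, v}) \<and> (\<Sum>u\<in>Ei i `` {v}. w i {u, v}) <= b"
  by metis
 define D where "D i v = (\<Sum>u\<in>Ei i `` {v}. w i {u, v})" for i v
 have Dl: "b / real j <= D i v" "D i v <= b" "0 < D i v" if v: "v \<in> Vi i" for i v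
 proof -
  have "b / real j <= l i v" using jb by (simp add: l_def)
  then show "b / real j <= D i v" "D i v <= b" "0 < D i v" using w(2)[OF v] jb unfolding D_def by linarith+
 qed
 define x where "x i v = (if v \<in> Vi i then D i v / b else 0)" for i v
 have x0: "0 <= x i v" for i v using Dl(3)[of v i] pos by (simp add: x_def less_imp_le)
 have x1: "x i v = 1" if v: "v \<in> Vi i" "v \<in> \<Phi> i" for i v
 proof -
  have "D i v = b" using w(2)[OF v(1)] v(2) unfolding D_def l_def by simp
  then show ?thesis using v pos by (simp add: x_def)
 qed
 have xj: "1 / real j <= x i v" if v: "v \<in> Vi i" for i v
  using Dl(1)[OF v] v pos j by (simp add: x_def field_simps)
 have cov: "1 <= (\<Sum>i<j. x i v)" if v: "v \<in> V" for v
 proof -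
  have ge: "x i v <= (\<Sum>i<j. x i v)" if "i < j" for i using that x0 by (intro member_le_sum) auto
  consider "v \<in> R2" | "v \<in> R1" | "v \<notin> R1" "v \<notin> R2" by blast
  then show ?thesis
  proof cases
   case 1
   then have "x 0 v = 1" using v R(3) by (intro x1) (auto simp: Vi_def Q_def \<Phi>_def)
   then show ?thesis using ge[of 0] j by simp
  next
   case 2
   then have "x 1 v = 1" using v R(3) by (intro x1) (auto simp: Vi_def Q_def \<Phi>_def)
   then show ?thesis using ge[of 1] j by simp
  next
   case 3
   then have "1 / real j <= x i v" for i using v by (intro xj) (auto simp: Vi_def Q_def)
   then have "(\<Sum>i<j. 1 / real j) <= (\<Sum>i<j. x i v)" by (intro sum_mono)
   then show ?thesis using j by simp
  qed
 qed
 have "\<exists>U :: nat => nat => 'a set. regular_classes j t eps V Vi Ei w x U" (is "\<exists>U. ?P U")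
 proof (rule regular_clusters[OF fin(1) EiE(3,2)])
  show "0 <= w i e \<and> w i e <= 1" for i e by (rule w(1))
  show "b / real j <= (\<Sum>u\<in>Ei i `` {v}. w i {u, v}) \<and> (\<Sum>u\<in>Ei i `` {v}. w i {u, v}) <= b" if "v \<in> Vi i" for i v
   using Dl(1,2)[OF that] unfolding D_def by simp
  show "x i v = (\<Sum>u\<in>Ei i `` {v}. w i {u, v}) / b" if "v \<in> Vi i" for i v using that by (simp add: x_def D_def)
  show "x i v = 0" if "v \<in> V - Vi i" for i v using that by (simp add: x_def)
  show "1 <= (\<Sum>i<j. x i v)" if "v \<in> V" for v by (rule cov[OF that])
  show "0 < b" "0 < eps" "0 < j" "0 < t" using pos eps j t by auto
  show "real j * real t * rcard V * (2 * exp (- 2 * eps\<^sup>2 * b / (real j ^ 4 * (real t)\<^sup>2))) < 1" by (rule small)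
 qed
 then obtain U where U0: "?P U" by (elim exE) (rule that; assumption)
 note U = conjunct1[OF U0, rule_format] conjunct1[OF conjunct2[OF U0], rule_format]
  conjunct1[OF conjunct2[OF conjunct2[OF U0]]] conjunct2[OF conjunct2[OF conjunct2[OF U0]], rule_format]
 have Vne: "Vi i \<noteq> {}" for i
 proof
  assume e: "Vi i = {}"
  obtain v where v: "v \<in> V" using fin by blast
  have "0 < c * n * p" using pos by simp
  then have "0 < deg E v" using deg(1)[OF v] by linarith
  moreover have "E `` {v} \<inter> Q i = E `` {v}" using e EvV(1)[of v] unfolding Vi_def by blast
  moreover have "deg_in E v (Q i) <= \<delta> * deg E v" using R(6,7) v by (simp add: Q_def)
  moreover have "\<delta> * deg E v <= 1/2 * deg E v" using \<delta> by (intro mult_right_mono) auto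
  ultimately show False by simp
 qed
 have "\<exists>C. cycle_list E C \<and> (\<Union>s<t. U i s) \<subseteq> set C \<and> set C \<subseteq> V" if i: "i < j" for i
 proof (rule cluster_cycle[OF fin(1) Vi_def Vne QV EiE(2,1) symi, where w = "w i" and x = "x i" and b = b and eps = eps])
  show "0 <= w i e" for e using w(1) by blast
  show "0 < (\<Sum>u\<in>Ei i `` {v}. w i {u, v})" if "v \<in> Vi i" for v using Dl(3)[OF that] by (simp add: D_def)
  show "x i v = (\<Sum>u\<in>Ei i `` {v}. w i {u, v}) / b" if "v \<in> Vi i" for v using that by (simp add: x_def D_def)
  show "0 < b" "0 < eps" "eps <= 1/2" "2 <= t" using pos eps t by auto
  show "U i s \<subseteq> Vi i" if "s < t" for s by (rule U(1)[OF i that])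
  show "U i s \<inter> U i s' = {}" if "s < t" "s' < t" "s \<noteq> s'" for s s' by (rule U(2)[OF i that])
  show "\<bar>(\<Sum>u\<in>Ei i `` {v} \<inter> U i s. w i {u, v} / x i u) - (\<Sum>u\<in>Ei i `` {v}. w i {u, v}) / real t\<bar>
    < eps * ((\<Sum>u\<in>Ei i `` {v}. w i {u, v}) / real t)" if "s < t" "v \<in> Vi i" for s v by (rule U(4)[OF i that])
  show "connector V E (Q i) q bb" using con by (simp add: Q_def)
  show "rcard V * (1 / real t + 2 * eps) + real t <= q" by (rule q)
 qed
 then have "\<forall>i. \<exists>C. i < j --> cycle_list E C \<and> (\<Union>s<t. U i s) \<subseteq> set C \<and> set C \<subseteq> V" by simp
 then obtain C where C: "\<forall>i. i < j --> cycle_list E (C i) \<and> (\<Union>s<t. U i s) \<subseteq> set (C i) \<and> set (C i) \<subseteq> V"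
  by (elim choice[THEN exE])
 show ?thesis
 proof (rule exI[of _ C], rule conjI)
  show "\<forall>i<j. cycle_list E (C i) \<and> set (C i) \<subseteq> V" using C by simp
  show "V \<subseteq> (\<Union>i<j. set (C i))"
  proof
   fix v assume "v \<in> V"
   then obtain i s where i: "i < j" "s < t" "v \<in> U i s" using U(3) by blast
   have "(\<Union>s<t. U i s) \<subseteq> set (C i)" using C i(1) by simp
   then show "v \<in> (\<Union>i<j. set (C i))" using i by blast
  qed
 qed
qed

text \<open>About \<open>4 * L / \<kappa>\<close> classes and
  \<open>eps = \<kappa> / (16 * L)\<close> make the number of paths fit the reserve: at most
  \<open>n / t\<close> from the initial class, \<open>2 * eps * n\<close> unmatched vertices, and
  \<open>t\<close> from rounding. The Hoeffding exponent has the order of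
  \<open>eps^2 * b / t^2\<close>, that is \<open>n p / L^4\<close>, which is at least of order
  \<open>L^2\<close>.\<close>

lemma cover_many:
 fixes c \<xi> \<gamma> \<alpha> :: real
 assumes "0 < c" "0 < \<xi>" "0 < \<gamma>" "0 < \<alpha>" "2 <= j"
 shows "\<forall>\<^sub>F n in sequentially. \<forall>(V :: 'a set) E p X. good_graph n c \<xi> p V E \<and> V \<noteq> {} \<and> rcard V <= (real j + 1) * \<gamma> * real n \<and>
   X \<subseteq> V \<and> rcard X <= c * \<alpha> / (32 * (\<gamma> + \<alpha>)) * real n \<and> (\<forall>v\<in>V - X. (\<gamma> + \<alpha>) * real n * p <= deg E v) -->
   (cycle_cover j V E)"
proof -
 have ga: "0 < \<gamma> + \<alpha>" using assms by simp
 define \<delta> where "\<delta> = min (1/2) (min (\<alpha> / 4) (\<alpha> / 2 / (\<gamma> + \<alpha>)))"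
 have \<delta>: "0 < \<delta>" "\<delta> <= 1/2" "\<delta> <= \<alpha> / 4" "\<delta> * (\<gamma> + \<alpha>) <= \<alpha> / 2"
 proof -
  have "0 < \<alpha> / 2 / (\<gamma> + \<alpha>)" using assms ga by (intro divide_pos_pos) auto
  then show "0 < \<delta>" using assms unfolding \<delta>_def by (simp only: min_less_iff_conj) auto
  show "\<delta> <= 1/2" unfolding \<delta>_def by (rule min.cobounded1)
  have "\<delta> <= min (\<alpha> / 4) (\<alpha> / 2 / (\<gamma> + \<alpha>))" unfolding \<delta>_def by (rule min.cobounded2)
  then show "\<delta> <= \<alpha> / 4" by (rule order_trans) (rule min.cobounded1)
  have "\<delta> <= \<alpha> / 2 / (\<gamma> + \<alpha>)" by (simp add: \<delta>_def)
  then show "\<delta> * (\<gamma> + \<alpha>) <= \<alpha> / 2" using ga by (simp only: pos_le_divide_eq)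
 qed
 obtain \<kappa> :: real where \<kappa>: "0 < \<kappa>" and ev: "\<forall>\<^sub>F n in sequentially. \<forall>(V :: 'a set) E p. good_graph n c \<xi> p V E \<and> V \<noteq> {} -->
  (\<exists>R1 R2. reserve_pair n \<delta> (\<kappa> * real n / ln (real n)) (5 * ln (real n)) V E R1 R2)"
  using two_reserves[OF assms(1,2) \<delta>(1), where ?'a = 'a] by (elim exE conjE) (rule that; assumption)
 define \<mu> where "\<mu> = min (c / 8) (\<alpha> / 16)"
 have \<mu>: "0 < \<mu>" "\<mu> <= c / 8" "\<mu> <= \<alpha> / 16" using assms by (auto simp: \<mu>_def)
 define \<gamma>0 where "\<gamma>0 = 2 * \<kappa> ^ 4 * \<mu> * c / (16384 * real j ^ 4)"
 have j0: "0 < real j" using assms by simp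
 have \<gamma>0: "0 < \<gamma>0" using \<kappa> \<mu> assms j0 by (simp add: \<gamma>0_def)
 have e1: "\<forall>\<^sub>F n in sequentially. 1 <= ln (real n)" by real_asymp
 have e2: "\<forall>\<^sub>F n in sequentially. 2 <= 4 * ln (real n) / \<kappa>" using \<kappa> by real_asymp
 have e3: "\<forall>\<^sub>F n in sequentially. \<kappa> / (16 * ln (real n)) <= 1/2" using \<kappa> by real_asymp
 have e4: "\<forall>\<^sub>F n in sequentially. 8 * ln (real n) / \<kappa> <= \<kappa> * real n / (2 * ln (real n))" using \<kappa> by real_asymp
 have e5: "\<forall>\<^sub>F n in sequentially. 1 / ln (real n) ^ 3 <= \<mu>" using \<mu> by real_asymp
 have e6: "\<forall>\<^sub>F n in sequentially. real j * (8 * ln (real n) / \<kappa>) * real n * (2 * exp (- \<gamma>0 * (ln (real n))\<^sup>2)) < 1"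
  using \<kappa> \<gamma>0 j0 by real_asymp
 show ?thesis
  using ev e1 e2 e3 e4 e5 e6 eventually_gt_at_top[of 0]
 proof eventually_elim
  case (elim n)
  show ?case
  proof (intro allI impI, elim conjE)
   fix V :: "'a set" and E p X
   assume G: "good_graph n c \<xi> p V E" and Vne: "V \<noteq> {}" and cV: "rcard V <= (real j + 1) * \<gamma> * real n"
    and X: "X \<subseteq> V" "rcard X <= c * \<alpha> / (32 * (\<gamma> + \<alpha>)) * real n"
    and typic: "\<forall>v\<in>V - X. (\<gamma> + \<alpha>) * real n * p <= deg E v"
   note g = good_graphD[OF G]
   define L where "L = ln (real n)"
   note el = elim(2-7)[folded L_def]
   have n0: "0 < real n" using elim(8) by simp
   have L0: "0 < L" "1 <= L" using el(1) by auto
   have np: "0 < real n * p" using n0 g(5) by simp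
   from elim(1)[rule_format, OF conjI[OF G Vne], folded L_def] obtain R1 R2 where R: "reserve_pair n \<delta> (\<kappa> * real n / L) (5 * L) V E R1 R2"
    by (elim exE) (rule that; assumption)
   define t where "t = nat \<lceil>4 * L / \<kappa>\<rceil>"
   define eps where "eps = \<kappa> / (16 * L)"
   define b where "b = \<mu> * (real n * p)"
   define \<beta> where "\<beta> = real n * p / L ^ 3"
   have eps: "0 < eps" "eps <= 1/2" using \<kappa> L0 el(3) by (auto simp: eps_def)
   have tb: "4 * L / \<kappa> <= real t" "real t <= 8 * L / \<kappa>"
   proof -
    show "4 * L / \<kappa> <= real t" unfolding t_def by (rule real_nat_ceiling_ge)
    have "real t <= 4 * L / \<kappa> + 1" using el(2) unfolding t_def by linarith
    moreover have "8 * L / \<kappa> = 4 * L / \<kappa> + 4 * L / \<kappa>" by simp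
    ultimately show "real t <= 8 * L / \<kappa>" using el(2) by linarith
   qed
   have t2: "2 <= t" using tb(1) el(2) by linarith
   have bc: "b <= c / 8 * real n * p" "b <= \<alpha> / 16 * real n * p"
    using mult_right_mono[OF \<mu>(2) less_imp_le[OF np]] mult_right_mono[OF \<mu>(3) less_imp_le[OF np]] by (simp_all add: b_def mult.assoc)
   have "\<beta> <= b" using mult_right_mono[OF el(5) less_imp_le[OF np]] by (simp add: b_def \<beta>_def mult.commute)
   then have \<beta>c: "\<beta> <= c / 8 * real n * p" "\<beta> <= \<alpha> / 16 * real n * p" using bc by linarith+
   have \<beta>0: "0 < \<beta>" using np L0 by (simp add: \<beta>_def)
   have b0: "0 < b" using np \<mu> by (simp add: b_def)
   have Nn: "rcard V <= real n" using g(6) by simp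
   have t0: "0 < real t" using t2 by simp
   have q: "rcard V * (1 / real t + 2 * eps) + real t <= \<kappa> * real n / L"
   proof -
    have "1 / real t <= \<kappa> / (4 * L)" using tb(1) t0 L0 \<kappa> by (simp add: field_simps)
    then have "1 / real t + 2 * eps <= \<kappa> / (4 * L) + \<kappa> / (8 * L)" by (simp add: eps_def)
    also have "... <= \<kappa> / (2 * L)" using \<kappa> L0 by (simp add: field_simps)
    finally have "rcard V * (1 / real t + 2 * eps) <= real n * (\<kappa> / (2 * L))" using Nn eps t0 by (intro mult_mono) auto
    moreover have "real t <= \<kappa> * real n / (2 * L)" using tb(2) el(4) by linarith
    moreover have "real n * (\<kappa> / (2 * L)) + \<kappa> * real n / (2 * L) = \<kappa> * real n / L" using L0 by (simp add: field_simps)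
    ultimately show ?thesis by linarith
   qed
   have sm: "real j * real t * rcard V * (2 * exp (- 2 * eps\<^sup>2 * b / (real j ^ 4 * (real t)\<^sup>2))) < 1"
   proof -
    have h: "\<gamma>0 * L\<^sup>2 <= 2 * eps\<^sup>2 * b / (real j ^ 4 * (real t)\<^sup>2)"
    proof -
     have "\<gamma>0 * L\<^sup>2 = 2 * eps\<^sup>2 * (\<mu> * (c * L ^ 6)) / (real j ^ 4 * (8 * L / \<kappa>)\<^sup>2)"
      using L0 \<kappa> j0 by (simp add: \<gamma>0_def eps_def field_simps power2_eq_square numeral_eq_Suc)
     also have "... <= 2 * eps\<^sup>2 * (\<mu> * (real n * p)) / (real j ^ 4 * (8 * L / \<kappa>)\<^sup>2)"
      using g(7) \<mu> unfolding L_def by (intro divide_right_mono mult_left_mono) auto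
     also have "... <= 2 * eps\<^sup>2 * (\<mu> * (real n * p)) / (real j ^ 4 * (real t)\<^sup>2)"
      using tb(2) t0 j0 \<mu> np by (intro divide_left_mono mult_left_mono power_mono mult_pos_pos) auto
     finally show ?thesis by (simp add: b_def)
    qed
    have "real j * real t * rcard V * (2 * exp (- (2 * eps\<^sup>2 * b / (real j ^ 4 * (real t)\<^sup>2))))
     <= real j * (8 * L / \<kappa>) * real n * (2 * exp (- (\<gamma>0 * L\<^sup>2)))"
     using tb(2) Nn h j0 L0 \<kappa> by (intro mult_mono mult_nonneg_nonneg) auto
    then show ?thesis using el(6) by simp
   qed
   show "cycle_cover j V E"
   proof (rule cover_fixed[OF g(8)[folded L_def, folded \<beta>_def] g(2,3,4,1) Vne assms(5) n0 g(5) \<beta>0 b0 assms(1,3,4) cV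
      _ _ _ _ _ _ _ \<delta>(2,4) X g(9) _ bc \<beta>c _ _ t2 eps q sm])
    have "\<delta> * real n <= \<alpha> / 4 * real n" using \<delta> n0 by (intro mult_right_mono) auto
    then show "rcard R1 <= \<alpha> / 4 * real n" "rcard R2 <= \<alpha> / 4 * real n" using R by linarith+
    show "(\<gamma> + \<alpha>) * real n * p <= deg E v" if "v \<in> V - X" for v using typic that by blast
    show "connector V E R1 (\<kappa> * real n / L) (5 * L)" "connector V E R2 (\<kappa> * real n / L) (5 * L)" using R by simp_all
   qed (use R in simp_all)
  qed
 qed
qed

section \<open>Assembling the cover\<close>

text \<open>Sparseness, applied to one vertex and its neighbourhood of size \<open>d\<close>, gives
  \<open>sqrt d <= 2 * n * p / L ^ 3\<close> when \<open>p <= 1 / 2\<close>; together with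
  \<open>n * p / K <= d\<close> this bounds \<open>n * p\<close> from below. For larger
  \<open>p\<close> the bound is immediate.\<close>

lemma density_bound:
 fixes p K L :: real
 assumes fin: "finite V" "card V = n" and n: "0 < n" and EV: "E \<subseteq> V \<times> V" and K: "1 <= K" and p: "0 < p" and L: "0 < L" "L ^ 6 <= real n / 2"
  and sp: "sparse_rel p (real n * p / L ^ 3) V E" and deg: "!!v. v \<in> V ==> 1 / K * real n * p <= deg E v"
 shows "1 / (4 * K) * L ^ 6 <= real n * p"
proof (cases "p <= 1/2")
 case False
 have "1 / (4 * K) * L ^ 6 <= 1 * L ^ 6" using K L by (intro mult_right_mono) (auto simp: divide_le_eq)
 also have "... <= real n * (1/2)" using L by simp
 also have "... <= real n * p" using False by (intro mult_left_mono) auto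
 finally show ?thesis .
next
 case True
 define N where "N = real n * p"
 have N0: "0 < N" using n p by (simp add: N_def)
 obtain v where v: "v \<in> V" using fin n by fastforce
 define d where "d = deg E v"
 have dN: "N / K <= d" using deg[OF v] by (simp add: d_def N_def)
 then have d0: "0 < d" using N0 K divide_pos_pos[of N K] by linarith
 have sub: "E `` {v} \<subseteq> V" using EV by auto
 have "ecount E {v} (E `` {v}) <= p * rcard {v} * deg E v + N / L ^ 3 * sqrt (rcard {v} * deg E v)"
  using v sub sparse_relD[OF sp, of "{v}" "E `` {v}"] by (simp add: N_def)
 then have "d <= p * d + N / L ^ 3 * sqrt d" by (simp add: ecount_def d_def)
 moreover have "p * d <= 1/2 * d" using True d0 by (intro mult_right_mono) auto
 moreover have sq: "sqrt d * sqrt d = d" using d0 by simp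
 ultimately have "sqrt d * sqrt d <= (2 * (N / L ^ 3)) * sqrt d" by simp
 then have "sqrt d <= 2 * (N / L ^ 3)" by (rule mult_right_le_imp_le) (use d0 in simp)
 then have "sqrt d * sqrt d <= (2 * (N / L ^ 3)) * (2 * (N / L ^ 3))" using d0 N0 L by (intro mult_mono) auto
 then have "N / K <= 4 * N * N / L ^ 6" using dN unfolding sq by (simp add: numeral_eq_Suc mult_ac)
 then have "(1 / K) * N <= (4 * N / L ^ 6) * N" by (simp add: mult_ac)
 then have "1 / K <= 4 * N / L ^ 6" using N0 by (rule mult_right_le_imp_le)
 then show ?thesis using L K by (simp add: N_def field_simps)
qed

lemma relational_cover:
 fixes k :: nat and \<alpha> :: real
 assumes k: "2 <= k" and \<alpha>: "0 < \<alpha>"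
 shows "\<forall>\<^sub>F n in sequentially. \<forall>(V :: 'a set) E p. finite V \<and> card V = n \<and> E \<subseteq> V \<times> V \<and> sym E \<and> irrefl E \<and> 0 < p \<and>
   sparse_rel p (real n * p / ln (real n) ^ 3) V E \<and> (\<forall>v\<in>V. (1 / real k + \<alpha>) * real n * p <= deg E v) -->
   (\<exists>CL. CL \<noteq> [] \<and> length CL <= k - 1 \<and> (\<forall>C\<in>set CL. cycle_list E C) \<and> V \<subseteq> (\<Union>C\<in>set CL. set C))"
proof -
 define K where "K = real k"
 have K: "2 <= K" using k by (simp add: K_def)
 \<comment> \<open>Of the surplus \<alpha> / 2 in the degrees, \<alpha> / 8 goes into the size
   threshold \<gamma> and the rest is \<alpha>'. The constant \<open>\<alpha>1\<close> expresses
   that rest relative to a part with at most \<open>2 * \<gamma> * n\<close> vertices.\<close>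
 define \<gamma> where "\<gamma> = 1 / K + \<alpha> / 8"
 define \<alpha>' where "\<alpha>' = 3 * \<alpha> / 8"
 define \<alpha>1 where "\<alpha>1 = 3 * \<alpha> / 16 / \<gamma>"
 \<comment> \<open>Degrees inside a part are at least \<open>n p / K^2\<close>, and
   \<open>density_bound\<close> gives \<open>L^6 / (4 * K) <= n p\<close>; \<open>c\<close> lies
   below both constants.\<close>
 define c where "c = 1 / (4 * (K * K))"
 have KK: "0 < K" "K <= K * K" "1 <= K * K" using K by (auto intro: mult_mono[of 1 K 1 K, simplified])
 have \<gamma>: "0 < \<gamma>" "1 / K <= \<gamma>" using KK \<alpha> by (auto simp: \<gamma>_def intro: add_pos_pos)
 have \<alpha>'0: "0 < \<alpha>'" "0 < \<alpha>1" using \<alpha> \<gamma> by (simp_all add: \<alpha>'_def \<alpha>1_def)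
 have \<gamma>\<alpha>: "\<gamma> + \<alpha>' = 1 / K + \<alpha> / 2" by (simp add: \<gamma>_def \<alpha>'_def)
 have \<alpha>1: "(1/2 + \<alpha>1) * (2 * \<gamma>) = 1 / K + \<alpha> / 2"
 proof -
  have "(1/2 + \<alpha>1) * (2 * \<gamma>) = \<gamma> + 2 * (\<alpha>1 * \<gamma>)" by (simp add: algebra_simps)
  moreover have "\<alpha>1 * \<gamma> = 3 * \<alpha> / 16" using \<gamma> by (simp add: \<alpha>1_def)
  ultimately show ?thesis by (simp add: \<gamma>_def)
 qed
 have c: "0 < c" "c <= 1 / (4 * K)" "c <= 1 / (K * K)" "c <= 1 / K"
  using KK K by (auto simp: c_def intro!: divide_left_mono)
 define \<tau> where "\<tau> = min (1/40) (min (\<alpha>1 / 40) (c / 160))"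
 have \<tau>: "0 < \<tau>" "\<tau> <= 1/40" "40 * \<tau> <= \<alpha>1" "160 * \<tau> <= c" using c \<alpha>'0 unfolding \<tau>_def by auto
 \<comment> \<open>The fraction of exceptional vertices that \<open>hamilton\<close> and
   \<open>cover_many\<close> both tolerate. \<open>decomposition\<close> bounds this fraction by
   \<open>4 * \<xi> * K / \<alpha>\<close>, which dictates the choice of \<xi>.\<close>
 define \<zeta> where "\<zeta> = min (\<tau> * c) (c * \<alpha>' / (32 * (\<gamma> + \<alpha>')))"
 have \<zeta>: "0 < \<zeta>" "\<zeta> <= \<tau> * c" "\<zeta> <= c * \<alpha>' / (32 * (\<gamma> + \<alpha>'))" using \<tau> c \<alpha>'0 \<gamma> by (auto simp: \<zeta>_def)
 define \<xi> where "\<xi> = min (\<alpha> * c / (64 * K)) (\<alpha> * \<zeta> / (4 * K))"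
 have \<xi>: "0 < \<xi>" "8 * \<xi> * K <= \<alpha> * (c / 8)" "4 * \<xi> * K <= \<alpha> * \<zeta>"
 proof -
  show "0 < \<xi>" using \<alpha> c \<zeta> KK by (simp add: \<xi>_def)
  have "\<xi> <= \<alpha> * c / (64 * K)" "\<xi> <= \<alpha> * \<zeta> / (4 * K)" by (simp_all add: \<xi>_def)
  then show "8 * \<xi> * K <= \<alpha> * (c / 8)" "4 * \<xi> * K <= \<alpha> * \<zeta>" using KK by (simp_all add: le_divide_eq mult_ac)
 qed
 have ham: "\<forall>\<^sub>F n in sequentially. \<forall>(V :: 'a set) E p X. good_graph n c \<xi> p V E \<and> c * real n <= rcard V \<and>
   X \<subseteq> V \<and> rcard X <= \<tau> * c * real n \<and> (\<forall>v\<in>V - X. (1/2 + \<alpha>1) * rcard V * p <= deg E v) -->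
   (hamiltonian V E)"
  by (rule hamilton[OF c(1) \<xi>(1) \<alpha>'0(2) \<tau>])
 have many: "\<forall>\<^sub>F n in sequentially. \<forall>j\<in>{2..k}. \<forall>(V :: 'a set) E p X. good_graph n c \<xi> p V E \<and> V \<noteq> {} \<and> rcard V <= (real j + 1) * \<gamma> * real n \<and>
   X \<subseteq> V \<and> rcard X <= c * \<alpha>' / (32 * (\<gamma> + \<alpha>')) * real n \<and> (\<forall>v\<in>V - X. (\<gamma> + \<alpha>') * real n * p <= deg E v) -->
   (cycle_cover j V E)"
  by (rule eventually_ball_finite, simp, rule ballI, rule cover_many[OF c(1) \<xi>(1) \<gamma>(1) \<alpha>'0(1)], simp)
 have e1: "\<forall>\<^sub>F n in sequentially. 1 <= ln (real n)" by real_asymp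
 have e2: "\<forall>\<^sub>F n in sequentially. ln (real n) ^ 6 <= real n / 2" by real_asymp
 have e3: "\<forall>\<^sub>F n in sequentially. 1 / ln (real n) ^ 3 <= \<alpha> / 4" using \<alpha> by real_asymp
 show ?thesis
  using ham many e1 e2 e3 eventually_ge_at_top[of "2 * k"]
 proof eventually_elim
  case (elim n)
  show ?case
  proof (intro allI impI, elim conjE)
   fix V :: "'a set" and E p
   assume fin: "finite V" "card V = n" and EV: "E \<subseteq> V \<times> V" and symE: "sym E" and irr: "irrefl E" and p: "0 < p"
    and sp: "sparse_rel p (real n * p / ln (real n) ^ 3) V E" and deg: "\<forall>v\<in>V. (1 / real k + \<alpha>) * real n * p <= deg E v"
   have nk: "2 * k <= n" by (rule elim(6))
   have n0: "0 < n" "0 < real n" using nk k by auto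
   have np: "0 < real n * p" using n0 p by simp
   define L where "L = ln (real n)"
   have L0: "0 < L" "1 <= L" using elim(3) by (auto simp: L_def)
   have dens: "1 / (4 * K) * L ^ 6 <= real n * p"
   proof (rule density_bound[OF fin n0(1) EV _ p L0(1) _ sp[folded L_def]])
    show "1 <= K" using K by simp
    show "L ^ 6 <= real n / 2" using elim(4) by (simp add: L_def)
    fix v assume v: "v \<in> V"
    have "1 / K * (real n * p) <= (1 / K + \<alpha>) * (real n * p)" using \<alpha> np by (intro mult_right_mono) auto
    then show "1 / K * real n * p <= deg E v" using deg v by (simp add: K_def mult.assoc) fastforce
   qed
   have cL: "c * L ^ 6 <= real n * p"
   proof -
    have "c * L ^ 6 <= 1 / (4 * K) * L ^ 6" using c L0 by (intro mult_right_mono) auto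
    then show ?thesis using dens by linarith
   qed
   define B where "B = real n * p / L ^ 3"
   have B: "0 <= B" "B <= \<alpha> / 4 * real n * p"
   proof -
    show "0 <= B" using np L0 by (simp add: B_def)
    have "1 / L ^ 3 * (real n * p) <= \<alpha> / 4 * (real n * p)" using elim(5) np unfolding L_def by (intro mult_right_mono) auto
    then show "B <= \<alpha> / 4 * real n * p" by (simp add: B_def)
   qed
   have sp': "sparse_rel p B V E" using sp by (simp add: B_def L_def)
   have \<theta>: "c / 8 <= 1 / (2 * real k)"
   proof -
    have "c / 8 <= c" using c by simp
    also have "... <= 1 / (4 * K)" by (rule c)
    also have "... <= 1 / (2 * K)" using KK by (intro divide_left_mono) auto
    finally show ?thesis by (simp add: K_def)
   qed
   have "\<exists>q \<phi>. 1 <= q \<and> q < k + (if k = 1 then 1 else 0) \<and> (\<forall>v\<in>V. \<phi> v < q) \<and> (\<forall>a<q. \<exists>P. P = {v \<in> V. \<phi> v = a} \<and>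
     (1 / real k + \<alpha> / 2) * real n <= rcard P \<and>
     (\<forall>v\<in>P. (1 / real k + \<alpha>) * real n * p <= real (k * card (E `` {v} \<inter> P))) \<and>
     \<alpha> * real (card {v \<in> P. deg_in E v P < (1 / real k + \<alpha> / 2) * real n * p}) <= 4 * \<xi> * real k * real n \<and>
     (\<forall>S\<subseteq>P. c / 8 * real n <= rcard S --> c / 8 * real n <= rcard (P - S) --> \<xi> * (real n)\<^sup>2 * p <= ecount E S (P - S)))"
    (is "\<exists>q \<phi>. 1 <= q \<and> _ \<and> _ \<and> (\<forall>a<q. ?R q \<phi> a)")
   proof (rule decomposition[OF fin(1,2) nk EV symE irr sp' _ p \<alpha> \<xi>(1) _ \<theta> _ B])
    show "1 <= k" using k by simp
    show "0 < c / 8" using c by simp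
    show "8 * \<xi> * real k <= \<alpha> * (c / 8)" using \<xi>(2) by (simp add: K_def)
    show "(1 / real k + \<alpha>) * real n * p <= deg E v" if "v \<in> V" for v using deg that by blast
   qed
   then obtain q \<phi> where q0: "1 <= q \<and> q < k + (if k = 1 then 1 else 0) \<and> (\<forall>v\<in>V. \<phi> v < q) \<and> (\<forall>a<q. ?R q \<phi> a)"
    by (elim exE) (rule that; assumption)
   have q: "1 <= q" "!!v. v \<in> V ==> \<phi> v < q" using q0 by blast+
   define P where "P a = {v \<in> V. \<phi> v = a}" for a
   have part: "(1 / K + \<alpha> / 2) * real n <= rcard (P a) \<and>
     (\<forall>v\<in>P a. (1 / K + \<alpha>) * real n * p <= K * deg_in E v (P a)) \<and>
     \<alpha> * real (card {v \<in> P a. deg_in E v (P a) < (1 / K + \<alpha> / 2) * real n * p}) <= 4 * \<xi> * K * real n \<and>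
     (\<forall>S\<subseteq>P a. c / 8 * real n <= rcard S --> c / 8 * real n <= rcard (P a - S) --> \<xi> * (real n)\<^sup>2 * p <= ecount E S (P a - S))"
    if a: "a < q" for a
   proof -
    have "\<forall>a<q. ?R q \<phi> a"
     using q0 by (elim conjE)
    from this[rule_format, OF a] show ?thesis unfolding P_def K_def of_nat_mult by (elim exE conjE) (hypsubst, intro conjI; assumption)
   qed
   define Ea where "Ea a = E \<inter> P a \<times> P a" for a
   have PV: "P a \<subseteq> V" "finite (P a)" for a using fin by (auto simp: P_def)
   have Eav: "Ea a `` {v} = E `` {v} \<inter> P a" if "v \<in> P a" for a v using that by (auto simp: Ea_def)
   have good: "good_graph n c \<xi> p (P a) (Ea a)" if a: "a < q" for a
    unfolding good_graph_def
   proof (intro conjI ballI allI impI)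
    show "finite (P a)" "Ea a \<subseteq> P a \<times> P a" "0 < p" using PV p by (auto simp: Ea_def)
    show "sym (Ea a)" "irrefl (Ea a)" using symE irr by (auto simp: Ea_def sym_def irrefl_def)
    show "card (P a) <= n" using card_mono[OF fin(1) PV(1)] fin(2) by simp
    show "c * ln (real n) ^ 6 <= real n * p" using cL by (simp add: L_def)
    show "sparse_rel p (real n * p / ln (real n) ^ 3) (P a) (Ea a)"
     unfolding sparse_rel_def
    proof (intro allI impI)
     fix X Y assume XY: "X \<subseteq> P a" "Y \<subseteq> P a"
     have "finite Y" using XY(2) PV(2) finite_subset by blast
     then have "ecount (Ea a) X Y <= ecount E X Y" unfolding ecount_def by (intro sum_mono) (auto intro!: card_mono simp: Ea_def)
     also have "... <= p * rcard X * rcard Y + real n * p / ln (real n) ^ 3 * sqrt (rcard X * rcard Y)"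
      using XY PV(1)[of a] by (intro sparse_relD[OF sp]) blast+
     finally show "ecount (Ea a) X Y <= p * rcard X * rcard Y + real n * p / ln (real n) ^ 3 * sqrt (rcard X * rcard Y)" .
    qed
    fix v assume v: "v \<in> P a"
    have "(1 / K + \<alpha>) * real n * p <= K * deg_in E v (P a)" using part[OF a] v by blast
    moreover have "1 / K * (real n * p) <= (1 / K + \<alpha>) * (real n * p)" using \<alpha> np by (intro mult_right_mono) auto
    moreover have "K * (c * real n * p) <= 1 / K * (real n * p)"
    proof -
     have "K * c <= K * (1 / (K * K))" using c KK by (intro mult_left_mono) auto
     then have "K * c <= 1 / K" using KK by simp
     then have "K * c * (real n * p) <= 1 / K * (real n * p)" using np by (intro mult_right_mono) auto
     then show ?thesis by (simp add: mult.assoc)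
    qed
    ultimately have "K * (c * real n * p) <= K * deg_in E v (P a)" by (simp only: mult.assoc)
    then show "c * real n * p <= deg (Ea a) v" unfolding Eav[OF v] using KK(1) by (rule mult_left_le_imp_le)
   next
    fix S assume S: "S \<subseteq> P a" "c / 8 * real n <= rcard S" "c / 8 * real n <= rcard (P a - S)"
    have "ecount (Ea a) S (P a - S) = ecount E S (P a - S)"
     unfolding ecount_def using S(1) by (intro sum.cong refl) (auto simp: Ea_def intro!: arg_cong[where f = card])
    then show "\<xi> * (real n)\<^sup>2 * p <= ecount (Ea a) S (P a - S)" using part[OF a] S by simp
   qed
   define m where "m a = rcard (P a)" for a
   have mb: "\<gamma> * real n < m a" "m a <= real n" if a: "a < q" for a
   proof -
    have "\<gamma> * real n < (1 / K + \<alpha> / 2) * real n" using \<alpha> n0 by (intro mult_strict_right_mono) (auto simp: \<gamma>_def)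
    then show "\<gamma> * real n < m a" using part[OF a] unfolding m_def by linarith
    show "m a <= real n" using card_mono[OF fin(1) PV(1)[of a]] fin(2) by (simp add: m_def)
   qed
   define j where "j a = (LEAST j. 1 <= j \<and> m a <= (real j + 1) * \<gamma> * real n)" for a
   have jk: "1 <= k \<and> m a <= (real k + 1) * \<gamma> * real n" if a: "a < q" for a
   proof
    show "1 <= k" using k by simp
    have "1 <= (K + 1) * (1 / K)" using KK by (simp add: field_simps)
    also have "... <= (K + 1) * \<gamma>" using \<gamma> KK by (intro mult_left_mono) auto
    finally have "1 * real n <= (K + 1) * \<gamma> * real n" by (intro mult_right_mono) auto
    then show "m a <= (real k + 1) * \<gamma> * real n" using mb[OF a] by (simp add: K_def)
   qed
   have j: "1 <= j a" "m a <= (real (j a) + 1) * \<gamma> * real n" "j a <= k" if a: "a < q" for a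
    using LeastI[of "\<lambda>j. 1 <= j \<and> m a <= (real j + 1) * \<gamma> * real n", OF jk[OF a]]
     Least_le[of "\<lambda>j. 1 <= j \<and> m a <= (real j + 1) * \<gamma> * real n", OF jk[OF a]] unfolding j_def by auto
   have jm: "real (j a) * \<gamma> * real n < m a" if a: "a < q" for a
   proof (cases "j a = 1")
    case True
    then show ?thesis using mb[OF a] by simp
   next
    case False
    then have "j a - 1 < j a" "1 <= j a - 1" "real (j a - 1) + 1 = real (j a)" using j(1)[OF a] by auto
    then show ?thesis using not_less_Least[of "j a - 1" "\<lambda>j. 1 <= j \<and> m a <= (real j + 1) * \<gamma> * real n"] by (simp add: j_def not_le)
   qed
   have sumj: "(\<Sum>a<q. j a) <= k - 1"
   proof -
    have "(\<Sum>a<q. card (P a)) = card (\<Union>a<q. P a)" using PV(2) by (subst card_UN_disjoint) (auto simp: P_def)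
    also have "(\<Union>a<q. P a) = V" using q(2) by (auto simp: P_def)
    finally have "(\<Sum>a<q. m a) = real n" unfolding m_def using fin(2) by (simp flip: of_nat_sum)
    moreover have "(\<Sum>a<q. real (j a) * \<gamma> * real n) < (\<Sum>a<q. m a)" using jm q(1) by (intro sum_strict_mono) (auto simp: lessThan_empty_iff)
    moreover have "(\<Sum>a<q. real (j a) * \<gamma> * real n) = real (\<Sum>a<q. j a) * \<gamma> * real n" by (simp add: sum_distrib_right)
    ultimately have "(real (\<Sum>a<q. j a) * \<gamma>) * real n < 1 * real n" by simp
    then have "real (\<Sum>a<q. j a) * \<gamma> < 1" using n0(2) by (rule mult_right_less_imp_less[OF _ less_imp_le])
    moreover have "real (\<Sum>a<q. j a) * (1 / K) <= real (\<Sum>a<q. j a) * \<gamma>" using \<gamma> by (intro mult_left_mono) (auto intro: sum_nonneg)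
    ultimately have "real (\<Sum>a<q. j a) / K < 1" by simp
    then have "real (\<Sum>a<q. j a) < K" using KK by (simp add: divide_less_eq)
    then have "(\<Sum>a<q. j a) < k" unfolding K_def by (simp only: of_nat_less_iff)
    then show ?thesis by simp
   qed
   have cyc: "\<exists>CL. length CL = j a \<and> (\<forall>C\<in>set CL. cycle_list E C) \<and> P a \<subseteq> (\<Union>C\<in>set CL. set C)" if a: "a < q" for a
   proof -
    define X where "X = {v \<in> P a. deg_in E v (P a) < (1 / K + \<alpha> / 2) * real n * p}"
    have XP: "X \<subseteq> P a" by (auto simp: X_def)
    have "\<alpha> * rcard X <= 4 * \<xi> * K * real n" using part[OF a] unfolding X_def by blast
    also have "... <= \<alpha> * \<zeta> * real n" using \<xi>(3) by (intro mult_right_mono) auto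
    also have "... = \<alpha> * (\<zeta> * real n)" by simp
    finally have Xc: "rcard X <= \<zeta> * real n" using \<alpha> by (rule mult_left_le_imp_le)
    have typd: "(1 / K + \<alpha> / 2) * real n * p <= deg (Ea a) v" if "v \<in> P a - X" for v
    proof -
     have "v \<in> P a" using that by simp
     then show ?thesis using that unfolding Eav[OF \<open>v \<in> P a\<close>] X_def by auto
    qed
    have chE: "chain E xs" if "chain (Ea a) xs" for xs using that by (rule successively_mono) (auto simp: Ea_def)
    show ?thesis
    proof (cases "j a = 1")
     case True
     have "good_graph n c \<xi> p (P a) (Ea a) \<and> c * real n <= rcard (P a) \<and> X \<subseteq> P a \<and> rcard X <= \<tau> * c * real n \<and>
      (\<forall>v\<in>P a - X. (1/2 + \<alpha>1) * rcard (P a) * p <= deg (Ea a) v)"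
     proof (intro conjI ballI)
      have "c * real n <= \<gamma> * real n" using c(4) \<gamma>(2) by (intro mult_right_mono) auto
      then show "c * real n <= rcard (P a)" using mb(1)[OF a] by (simp add: m_def)
      have "\<zeta> * real n <= \<tau> * c * real n" using \<zeta>(2) by (intro mult_right_mono) auto
      then show "rcard X <= \<tau> * c * real n" using Xc by linarith
      fix v assume v: "v \<in> P a - X"
      have "rcard (P a) <= 2 * \<gamma> * real n" using j(2)[OF a] True by (simp add: m_def)
      then have "(1/2 + \<alpha>1) * rcard (P a) * p <= (1/2 + \<alpha>1) * (2 * \<gamma> * real n) * p"
       using \<alpha>'0 p by (intro mult_right_mono mult_left_mono) auto
      also have "... = ((1/2 + \<alpha>1) * (2 * \<gamma>)) * real n * p" by (simp add: mult_ac)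
      also have "... <= deg (Ea a) v" unfolding \<alpha>1 by (rule typd[OF v])
      finally show "(1/2 + \<alpha>1) * rcard (P a) * p <= deg (Ea a) v" .
     qed (rule good[OF a], rule XP)
     from elim(1)[rule_format, OF this] obtain C where C: "distinct C \<and> set C = P a \<and> 3 <= length C \<and> chain (Ea a) (last C # C)"
      by (elim exE) (rule that; assumption)
     show ?thesis using C True chE by (intro exI[of _ "[C]"]) simp
    next
     case False
     then have j2: "j a \<in> {2..k}" using j(1,3)[OF a] by auto
     have "good_graph n c \<xi> p (P a) (Ea a) \<and> P a \<noteq> {} \<and> rcard (P a) <= (real (j a) + 1) * \<gamma> * real n \<and> X \<subseteq> P a \<and>
      rcard X <= c * \<alpha>' / (32 * (\<gamma> + \<alpha>')) * real n \<and> (\<forall>v\<in>P a - X. (\<gamma> + \<alpha>') * real n * p <= deg (Ea a) v)"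
     proof (intro conjI ballI)
      have "0 < \<gamma> * real n" using \<gamma> n0 by simp
      then have "0 < m a" using mb(1)[OF a] by linarith
      then show "P a \<noteq> {}" by (auto simp: m_def)
      show "rcard (P a) <= (real (j a) + 1) * \<gamma> * real n" using j(2)[OF a] by (simp add: m_def)
      have "\<zeta> * real n <= c * \<alpha>' / (32 * (\<gamma> + \<alpha>')) * real n" using \<zeta>(3) by (intro mult_right_mono) auto
      then show "rcard X <= c * \<alpha>' / (32 * (\<gamma> + \<alpha>')) * real n" using Xc by linarith
      show "(\<gamma> + \<alpha>') * real n * p <= deg (Ea a) v" if "v \<in> P a - X" for v unfolding \<gamma>\<alpha> by (rule typd[OF that])
     qed (rule good[OF a], rule XP)
     from elim(2)[rule_format, OF j2 this] obtain C where C: "(\<forall>i<j a. cycle_list (Ea a) (C i) \<and> set (C i) \<subseteq> P a) \<and> P a \<subseteq> (\<Union>i<j a. set (C i))"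
      by (elim exE) (rule that; assumption)
     show ?thesis
     proof (intro exI[of _ "map C [0..<j a]"] conjI ballI)
      fix D assume "D \<in> set (map C [0..<j a])"
      then obtain i where "i < j a" "D = C i" by auto
      then show "distinct D" "3 <= length D" "chain E (last D # D)" using C chE by auto
     next
      show "P a \<subseteq> (\<Union>C\<in>set (map C [0..<j a]). set C)" using C by (auto simp: lessThan_atLeast0)
     qed simp
    qed
   qed
   then have "\<forall>a. \<exists>CL. a < q --> length CL = j a \<and> (\<forall>C\<in>set CL. cycle_list E C) \<and> P a \<subseteq> (\<Union>C\<in>set CL. set C)" by blast
   then obtain CL where CL: "\<forall>a. a < q --> length (CL a) = j a \<and> (\<forall>C\<in>set (CL a). cycle_list E C) \<and> P a \<subseteq> (\<Union>C\<in>set (CL a). set C)"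
    by (elim choice[THEN exE])
   define CC where "CC = concat (map CL [0..<q])"
   have len: "length CC = (\<Sum>a<q. j a)"
   proof -
    have "length CC = (\<Sum>a<q. length (CL a))" by (simp add: CC_def length_concat comp_def interv_sum_list_conv_sum_set_nat lessThan_atLeast0)
    also have "... = (\<Sum>a<q. j a)" using CL by (intro sum.cong) auto
    finally show ?thesis .
   qed
   show "\<exists>CL. CL \<noteq> [] \<and> length CL <= k - 1 \<and> (\<forall>C\<in>set CL. cycle_list E C) \<and> V \<subseteq> (\<Union>C\<in>set CL. set C)"
   proof (intro exI[of _ CC] conjI)
    have "j 0 <= (\<Sum>a<q. j a)" using q(1) by (intro member_le_sum) auto
    then show "CC \<noteq> []" using len j(1)[of 0] q(1) by auto
    show "length CC <= k - 1" using len sumj by simp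
    show "\<forall>C\<in>set CC. cycle_list E C" using CL by (auto simp: CC_def)
    show "V \<subseteq> (\<Union>C\<in>set CC. set C)"
    proof
     fix v assume v: "v \<in> V"
     have "v \<in> P (\<phi> v)" using v by (simp add: P_def)
     then have "v \<in> (\<Union>C\<in>set (CL (\<phi> v)). set C)" using CL q(2)[OF v] by blast
     then show "v \<in> (\<Union>C\<in>set CC. set C)" using q(2)[OF v] by (auto simp: CC_def)
    qed
   qed
  qed
 qed
qed

section \<open>Transfer to cycles of pair graphs\<close>

lemma pcas_zip: "pcas u (zip (u # xs) (xs @ [w])) w"
 by (induction xs arbitrary: u) auto

lemma pawalk_verts_zip: "pawalk_verts u (zip (u # xs) (xs @ [w])) = u # xs @ [w]"
 by (induction xs arbitrary: u) auto

lemma set_zip_chain: "chain E (u # xs @ [w]) ==> set (zip (u # xs) (xs @ [w])) \<subseteq> E"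
 by (induction xs arbitrary: u) auto

text \<open>Consecutive vertices are zipped into arcs, the last of which returns to
  \<open>u\<close>. The vertex list of this walk begins and ends with \<open>u\<close>, and
  \<open>cycle\<close> asks only for distinctness of its tail.\<close>

lemma graph_cycle_of_list:
 assumes G: "parcs G \<subseteq> pverts G \<times> pverts G" and C: "distinct C" "3 <= length C" "chain (parcs G) (last C # C)"
 shows "\<exists>c. graph_cycle G c \<and> cycle_verts c = set C"
proof -
 obtain u xs where C': "C = u # xs" using C(2) by (cases C) auto
 define c where "c = zip (u # xs) (xs @ [u])"
 have ch: "chain (parcs G) (u # xs)" "(last C, u) \<in> parcs G" using C(3) by (simp_all add: C' split: if_splits)
 have "chain (parcs G) ((u # xs) @ [u])" using ch C' by (subst successively_append_iff) simp
 then have arcs: "set c \<subseteq> parcs G" unfolding c_def by (intro set_zip_chain) simp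
 have "u \<in> pverts G" using ch(2) G by auto
 then have "pre_digraph.awalk (with_proj G) u c u"
  using arcs by (simp add: pre_digraph.awalk_def cas_with_proj_eq c_def pcas_zip del: zip_Cons_Cons)
 moreover have "distinct (tl (pre_digraph.awalk_verts (with_proj G) u c))"
  using C(1) unfolding awalk_verts_with_proj_eq c_def pawalk_verts_zip by (simp add: C')
 moreover have len: "length c = length C" by (simp add: c_def C')
 then have "c \<noteq> []" using C(2) by auto
 ultimately have "graph_cycle G c" using C(2) len unfolding graph_cycle_def pre_digraph.cycle_def by auto
 moreover have "cycle_verts c = set C"
 proof -
  have "map fst c = u # xs" unfolding c_def by (rule map_fst_zip) simp
  then show ?thesis unfolding cycle_verts_def C' by (metis set_map)
 qed
 ultimately show ?thesis by blast
qed

theorem theorem1p3: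
 fixes k :: nat and \<alpha> :: real
 assumes "k \<ge> 2" and "\<alpha> > 0"
 shows "\<exists>\<eta>>0. \<forall>\<^sub>F n :: nat in sequentially.
  \<forall>p \<beta> :: real. \<forall>G :: 'a pair_pre_digraph.
   0 < p \<and> p \<le> 1 \<and> \<beta> \<le> \<eta> * real n * p / ln (real n) ^ 3 \<and>
   pair_graph G \<and> card (pverts G) = n \<and> sparse_graph p \<beta> G \<and>
   real (min_degree G) \<ge> (1 / real k + \<alpha>) * real n * p
   \<longrightarrow> covered_by_cycles G (k - 1)"
\<comment> \<open>\<eta> = 1 suffices: wherever \<beta> is compared with a degree, a factor of order
  at least \<open>ln n\<close> is to spare and absorbs the constants once \<open>n\<close> is
  large.\<close>
proof (intro exI[of _ 1] conjI)
 show "(0 :: real) < 1" by simp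
 show "\<forall>\<^sub>F n :: nat in sequentially.
  \<forall>p \<beta> :: real. \<forall>G :: 'a pair_pre_digraph.
   0 < p \<and> p <= 1 \<and> \<beta> <= 1 * real n * p / ln (real n) ^ 3 \<and>
   pair_graph G \<and> card (pverts G) = n \<and> sparse_graph p \<beta> G \<and>
   real (min_degree G) \<ge> (1 / real k + \<alpha>) * real n * p
   --> covered_by_cycles G (k - 1)"
  using relational_cover[OF assms, where ?'a = 'a]
 proof eventually_elim
  case (elim n)
  show ?case
  proof (intro allI impI, elim conjE)
   fix p \<beta> :: real and G :: "'a pair_pre_digraph"
   assume p: "0 < p" and \<beta>: "\<beta> <= 1 * real n * p / ln (real n) ^ 3" and G: "pair_graph G" and n: "card (pverts G) = n"
    and sp: "sparse_graph p \<beta> G" and deg: "(1 / real k + \<alpha>) * real n * p <= real (min_degree G)"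
   interpret pair_graph G by (rule G)
   have finV: "finite (pverts G)" by (rule pair_finite_verts)
   have "finite (pverts G) \<and> card (pverts G) = n \<and> parcs G \<subseteq> pverts G \<times> pverts G \<and> sym (parcs G) \<and> irrefl (parcs G) \<and> 0 < p \<and>
    sparse_rel p (real n * p / ln (real n) ^ 3) (pverts G) (parcs G) \<and>
    (\<forall>v\<in>pverts G. (1 / real k + \<alpha>) * real n * p <= real (card (parcs G `` {v})))"
   proof (intro conjI ballI)
    show "parcs G \<subseteq> pverts G \<times> pverts G" using in_arcsD1 in_arcsD2 by auto
    show "sym (parcs G)" using pair_sym_arcs by (simp add: symmetric_def)
    show "irrefl (parcs G)" by (auto simp: irrefl_def dest: pair_no_loops)
    show "sparse_rel p (real n * p / ln (real n) ^ 3) (pverts G) (parcs G)"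
     unfolding sparse_rel_def
    proof (intro allI impI)
     fix X Y assume XY: "X \<subseteq> pverts G" "Y \<subseteq> pverts G"
     have "ecount (parcs G) X Y = real (edge_pairs G X Y)"
      unfolding edge_pairs_def using XY finV by (intro ecount_sigma) (auto intro: finite_subset)
     also have "... <= p * real (card X) * real (card Y) + \<beta> * sqrt (real (card X) * real (card Y))"
      using sp XY unfolding sparse_graph_def by blast
     also have "... <= p * real (card X) * real (card Y) + real n * p / ln (real n) ^ 3 * sqrt (real (card X) * real (card Y))"
      using \<beta> by (intro add_left_mono mult_right_mono) auto
     finally show "ecount (parcs G) X Y <= p * real (card X) * real (card Y) + real n * p / ln (real n) ^ 3 * sqrt (real (card X) * real (card Y))" .
    qed
    fix v assume v: "v \<in> pverts G"
    have "min_degree G <= out_degree (with_proj G) v" unfolding min_degree_def using finV v by (intro Min_le) auto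
    also have "out_degree (with_proj G) v = card (parcs G `` {v})"
    proof -
     have "out_arcs (with_proj G) v = Pair v ` (parcs G `` {v})" by (auto simp: out_arcs_def)
     then show ?thesis by (simp add: out_degree_def card_image inj_on_def)
    qed
    finally have "real (min_degree G) <= real (card (parcs G `` {v}))" by simp
    then show "(1 / real k + \<alpha>) * real n * p <= real (card (parcs G `` {v}))" using deg by linarith
   qed (rule finV n p)+
   from elim[rule_format, OF this] obtain CL where CL: "CL \<noteq> []" "length CL <= k - 1"
    "\<forall>C\<in>set CL. cycle_list (parcs G) C" "pverts G \<subseteq> (\<Union>C\<in>set CL. set C)"
    by (elim exE conjE) (rule that; assumption)
   have sub: "parcs G \<subseteq> pverts G \<times> pverts G" using in_arcsD1 in_arcsD2 by auto
   have "\<exists>c. C \<in> set CL --> graph_cycle G c \<and> cycle_verts c = set C" for C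
    using graph_cycle_of_list[OF sub, of C] CL(3) by blast
   then obtain cy where cy: "!!C. C \<in> set CL ==> graph_cycle G (cy C) \<and> cycle_verts (cy C) = set C" by metis
   \<comment> \<open>The indices start at 1, hence \<open>i - 1\<close>; if there are fewer than
     \<open>k - 1\<close> cycles, the head of the list is repeated.\<close>
   define C where "C i = cy (if i <= length CL then CL ! (i - 1) else hd CL)" for i
   show "covered_by_cycles G (k - 1)"
    unfolding covered_by_cycles_def
   proof (intro exI[of _ C] conjI ballI)
    fix i assume i: "i \<in> {1..k - 1}"
    have "(if i <= length CL then CL ! (i - 1) else hd CL) \<in> set CL" using i CL(1) by (auto intro!: nth_mem)
    then show "graph_cycle G (C i)" using cy by (simp add: C_def)
   next
    fix v assume "v \<in> pverts G"
    then obtain D where D: "D \<in> set CL" "v \<in> set D" using CL(4) by blast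
    then obtain i where i: "i < length CL" "CL ! i = D" by (auto simp: in_set_conv_nth)
    show "\<exists>i\<in>{1..k - 1}. v \<in> cycle_verts (C i)"
     using i D CL(2) cy[OF D(1)] by (intro bexI[of _ "Suc i"]) (auto simp: C_def)
   qed
  qed
 qed
qed

end
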